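(* Let $p\ge 5$ be a prime and let $S\in\{R,N\}^5$. Let $n_p(S)$, the curves $C_S^a$, $C_S$, the set $C_S^{a,\circ}(\mathbb F_p)$, the Frobenius traces $a_0,a_1,a_4,a_{12},a_{15}$ (at $p$) and the number $s$ be as defined in the context. Then the curve $C_S$ has genus $17$ and $$n_p(S)=2^{-5}\,|C_S^{a,\circ}(\mathbb F_p)|.$$ Moreover $$n_p(S)=\frac{p}{32}-\frac{A_{S,\,p \bmod 8}}{32}+C_{S,\,p\bmod 24},$$ where $A_{S,\,p\bmod 8}$ and $C_{S,\,p\bmod 24}$ are given by the following two tables. Values of $A_{S,\,p\bmod 8}$ (columns are indexed by the residue of $p$ modulo $8$): $$\begin{array}{l|l|l|l|l} S & 1 & 3 & 5 & 7\\ \hline RRRRR & 4a_0+6a_1+4a_4+a_{12}+sa_{15} & -2a_1+2a_4+a_{12} & 2a_0+2a_1+4a_4+a_{12} & 2a_1+2a_4+a_{12}\\ NRRRR & -2a_1-2a_4-a_{12}-sa_{15} & 2a_1-a_{12} & 2a_0+2a_1-2a_4-a_{12} & -2a_1-a_{12}\\ RNRRR & -2a_1-2a_4-a_{12}-sa_{15} & -2a_1-4a_4-a_{12} & -2a_0-2a_1-2a_4-a_{12} & -2a_1-4a_4-a_{12}\\ NNRRR & -2a_1+a_{12}+sa_{15} & 2a_1+2a_4+a_{12} & 2a_0-2a_1+a_{12} & 2a_1+2a_4+a_{12}\\ RRNRR & -4a_0-2a_1+a_{12}-sa_{15} & 2a_1-2a_4+a_{12} & -2a_0+2a_1+a_{12}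 & -2a_1-2a_4+a_{12}\\ NRNRR & 2a_1-2a_4-a_{12}+sa_{15} & -6a_1-a_{12} & -2a_0-2a_1-2a_4-a_{12} & -2a_1-a_{12}\\ RNNRR & -2a_1+2a_4-a_{12}+sa_{15} & 2a_1-a_{12} & 2a_0-2a_1+2a_4-a_{12} & 2a_1-a_{12}\\ NNNRR & 2a_1+a_{12}-sa_{15} & 2a_1+2a_4+a_{12} & -2a_0+2a_1+a_{12} & 2a_1+2a_4+a_{12}\\ RRRNR & -2a_1-2a_4-a_{12}-sa_{15} & 2a_1-a_{12} & -2a_0-2a_1-2a_4-a_{12} & 2a_1-a_{12}\\ NRRNR & -4a_0+2a_1+a_{12}+sa_{15} & 2a_1-2a_4+a_{12} & -2a_0+2a_1+a_{12} & 2a_1-2a_4+a_{12}\\ RNRNR & -2a_1+a_{12}+sa_{15} & 2a_1+2a_4+a_{12} & -2a_0+2a_1+a_{12} & -2a_1+2a_4+a_{12}\\ NNRNR & 2a_1+2a_4-a_{12}-sa_{15} & -6a_1-a_{12} & 2a_0-2a_1+2a_4-a_{12} & -2a_1-a_{12}\\ RRNNR & -2a_1+2a_4-a_{12}+sa_{15} & -2a_1+4a_4-a_{12} & 2a_0-2a_1+2a_4-a_{12} & -2a_1+4a_4-a_{12}\\ NRNNR & 4a_0-2a_1+a_{12}-sa_{15} & 2a_1-2a_4+a_{12} & 2a_0-2a_1+a_{12} & 2a_1-2a_4+a_{12}\\ RNNNR & 6a_1-4a_4+a_{12}-sa_{15} & -2a_1-2a_4+a_{12} & 2a_0+2a_1-4a_4+a_{12}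 & 2a_1-2a_4+a_{12}\\ NNNNR & -2a_1+2a_4-a_{12}+sa_{15} & 2a_1-a_{12} & -2a_0+2a_1+2a_4-a_{12} & -2a_1-a_{12}\\ RRRRN & -2a_1-2a_4-a_{12}-sa_{15} & 2a_1-a_{12} & 2a_0+2a_1-2a_4-a_{12} & -2a_1-a_{12}\\ NRRRN & -2a_1+a_{12}+sa_{15} & -2a_1-2a_4+a_{12} & -2a_0-6a_1+a_{12} & 2a_1-2a_4+a_{12}\\ RNRRN & -4a_0+2a_1+a_{12}+sa_{15} & -2a_1+2a_4+a_{12} & -2a_0+2a_1+a_{12} & -2a_1+2a_4+a_{12}\\ NNRRN & 2a_1+2a_4-a_{12}-sa_{15} & 2a_1-a_{12} & -2a_0+2a_1+2a_4-a_{12} & 2a_1-a_{12}\\ RRNRN & 2a_1-2a_4-a_{12}+sa_{15} & 2a_1-a_{12} & -2a_0-2a_1-2a_4-a_{12} & 6a_1-a_{12}\\ NRNRN & -2a_1+4a_4+a_{12}-sa_{15} & 2a_1+2a_4+a_{12} & 2a_0+2a_1+4a_4+a_{12} & -2a_1+2a_4+a_{12}\\ RNNRN & 4a_0-2a_1+a_{12}-sa_{15} & -2a_1+2a_4+a_{12} & 2a_0-2a_1+a_{12} & -2a_1+2a_4+a_{12}\\ NNNRN & 2a_1-2a_4-a_{12}+sa_{15} & -2a_1-4a_4-a_{12} & 2a_0+2a_1-2a_4-a_{12} & -2a_1-4a_4-a_{12}\\ RRRNN & -2a_1+a_{12}+sa_{15} & -2a_1-2a_4+a_{12} & 2a_0-2a_1+a_{12}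 & -2a_1-2a_4+a_{12}\\ NRRNN & 2a_1+2a_4-a_{12}-sa_{15} & -2a_1+4a_4-a_{12} & -2a_0+2a_1+2a_4-a_{12} & -2a_1+4a_4-a_{12}\\ RNRNN & 2a_1+2a_4-a_{12}-sa_{15} & 2a_1-a_{12} & 2a_0-2a_1+2a_4-a_{12} & 6a_1-a_{12}\\ NNRNN & 4a_0-2a_1-4a_4+a_{12}+sa_{15} & 2a_1-2a_4+a_{12} & 2a_0+2a_1-4a_4+a_{12} & -2a_1-2a_4+a_{12}\\ RRNNN & 2a_1+a_{12}-sa_{15} & -2a_1-2a_4+a_{12} & -2a_0+2a_1+a_{12} & -2a_1-2a_4+a_{12}\\ NRNNN & 2a_1-2a_4-a_{12}+sa_{15} & 2a_1-a_{12} & 2a_0+2a_1-2a_4-a_{12} & 2a_1-a_{12}\\ RNNNN & -2a_1+2a_4-a_{12}+sa_{15} & 2a_1-a_{12} & -2a_0+2a_1+2a_4-a_{12} & -2a_1-a_{12}\\ NNNNN & -4a_0-2a_1+a_{12}-sa_{15} & -2a_1+2a_4+a_{12} & -2a_0-6a_1+a_{12} & 2a_1+2a_4+a_{12} \end{array}$$ Values of $32\cdot C_{S,\,p\bmod 24}$ (columns are indexed by the residue of $p$ modulo $24$): $$\begin{array}{l|r|r|r|r|r|r|r|r} S & 1 & 5 & 7 & 11 & 13 & 17 & 19 & 23\\ \hline RRRRR & -95 & -15 & -15 & -15 & -15 & -31 & -15 & -31\\ NRRRR & -15 & 1 & 1 & 1 & 1 & -15 & 1 & -31\\ RNRRR &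 -15 & 1 & 1 & 1 & -15 & -15 & 1 & 1\\ NNRRR & 1 & -15 & -15 & 1 & 1 & 1 & 1 & -31\\ RRNRR & -15 & 1 & 1 & -15 & -31 & -15 & -15 & 1\\ NRNRR & 1 & 1 & 1 & -31 & -15 & 1 & 1 & 1\\ RNNRR & 1 & -15 & -15 & 1 & 1 & 1 & 1 & 1\\ NNNRR & 1 & 1 & -15 & 1 & 1 & 1 & 1 & -31\\ RRRNR & -15 & 1 & -15 & 1 & -15 & -15 & 1 & 1\\ NRRNR & 1 & 1 & -15 & -15 & 1 & -31 & -15 & 1\\ RNRNR & 1 & 1 & 1 & 1 & -31 & 1 & 1 & 1\\ NNRNR & 1 & -15 & 1 & -31 & 1 & 1 & 1 & 1\\ RRNNR & 1 & -15 & 1 & 1 & 1 & 1 & -31 & 1\\ NRNNR & 1 & -15 & -15 & -15 & 1 & 1 & -15 & 1\\ RNNNR & 1 & 1 & -15 & 1 & 1 & 1 & 1 & 1\\ NNNNR & 1 & 1 & 1 & 1 & 1 & 1 & 1 & -31\\ RRRRN & -15 & 1 & 1 & 1 & 1 & -15 & 1 & 1\\ NRRRN & 1 & -15 & -15 & 1 & -15 & 1 & 1 & 1\\ RNRRN & 1 & 1 & 1 & -15 & 1 & -31 & -15 & 1\\ NNRRN & 1 & 1 & -15 & 1 & 1 & 1 & 1 & 1\\ RRNRN & 1 & 1 & 1 & 1 & -15 & 1 & 1 & 1\\ NRNRN & 1 & -15 & 1 & 1 & -15 & 1 & 1 & 1\\ RNNRN & 1 & -15 & 1 & -15 & 1 &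 1 & -15 & 1\\ NNNRN & 1 & 1 & 1 & 1 & 1 & 1 & 1 & 1\\ RRRNN & 1 & -15 & 1 & 1 & 1 & 1 & 1 & 1\\ NRRNN & 1 & 1 & 1 & 1 & 1 & 1 & -31 & 1\\ RNRNN & 1 & -15 & 1 & 1 & 1 & 1 & 1 & 1\\ NNRNN & 1 & 1 & 1 & -15 & 1 & 1 & -15 & 1\\ RRNNN & 1 & 1 & 1 & 1 & 1 & 1 & 1 & 1\\ NRNNN & 1 & 1 & -15 & 1 & 1 & 1 & 1 & 1\\ RNNNN & 1 & 1 & 1 & 1 & 1 & 1 & 1 & 1\\ NNNNN & -15 & -15 & -15 & -15 & -15 & -15 & -15 & -31 \end{array}$$
   Context: For an odd prime $p$ and $1\le n\le p-1$ put $w_p(n)=R$ if $\left(\frac{n}{p}\right)=1$ and $w_p(n)=N$ if $\left(\frac{n}{p}\right)=-1$ (Legendre symbol). For a word $S=s_1\cdots s_l\in\{R,N\}^l$ let $$n_p(S)=\#\{1\le x\le p-l:\ (w_p(x),w_p(x+1),\ldots,w_p(x+l-1))=S\}$$ (which is $0$ if $p-l<1$). Here $l=5$. Curves $C_S^a$, $C_S$: fix a quadratic residue $\varepsilon_+$ and a quadratic nonresidue $\varepsilon_-$ in $\mathbb F_p^\times$, and for $S=s_1\cdots s_l$ put $\varepsilon_i=\varepsilon_+$ if $s_i=R$ and $\varepsilon_i=\varepsilon_-$ if $s_i=N$. The affine curve $C_S^a$ is the intersection of $l-1$ quadrics in the affine space with coordinates $x_1,\dots,x_l$, given by $$\varepsilon_{i+1}x_{i+1}^2-\varepsilon_i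 x_i^2=1,\qquad i=1,\dots,l-1.$$ $C_S$ denotes its smooth projective model, and $C_S^{a,\circ}\subset C_S^a$ is the set of points all of whose coordinates $x_1,\ldots,x_l$ are nonzero. Elliptic curves: $E_0,E_1,E_4,E_{12},E_{15}$ are the smooth projective models of the affine curves $$E_0: y^2=x(x+1)(x+2),\quad E_1: y^2=x(x+1)(x+3),\quad E_4: y^2=x(x+1)(x+2)(x+3),$$ $$E_{12}: y^2=x(x+1)(x+3)(x+4),\quad E_{15}: y^2=x^3+2x^2-\tfrac{9}{2}x-9.$$ For $p\ge5$, $a_j=a_j(p)=p+1-|E_j(\mathbb F_p)|$ is the Frobenius trace of the reduction of $E_j$ over $\mathbb F_p$ (points counted on the smooth projective model). The number $s$ is used only for $p\equiv 1\pmod 8$: $s=2\left(\frac{\sqrt2}{p}\right)$, where $\sqrt2$ is a square root of $2$ in $\mathbb F_p$ and $\left(\frac{\cdot}{p}\right)$ is the quadratic character of $\mathbb F_p$; since $-1$ is a square mod $p$ the value does not depend on the choice of the root. *)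

theory Defs
  imports
    "HOL-Number_Theory.Residues"
    "HOL-Library.Poly_Mapping"
    "HOL-Computational_Algebra.Fraction_Field"
    "HOL-Computational_Algebra.Nth_Powers"
    "HOL-Algebra.Embedded_Algebras"
    "HOL-Algebra.Algebraic_Closure_Type"
    "Berlekamp_Zassenhaus.Finite_Field"
begin

section \<open>Words of quadratic residues and nonresidues\<close>

datatype letter = R | N

definition residue_letter :: "nat \<Rightarrow> nat \<Rightarrow> letter" where
  "residue_letter p n = (if Legendre (int n) (int p) = 1 then R else N)"

text \<open>Subtraction on the naturals truncates, so for \<open>p \<le> length S\<close> the range of \<open>x\<close> is empty.\<close>

definition word_count :: "nat \<Rightarrow> letter list \<Rightarrow> nat" where
  "word_count p S =
     card {x \<in> {1..p - length S}. map (\<lambda>i. residue_letter p (x + i)) [0..<length S] = S}"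

section \<open>The affine curves attached to a word\<close>

text \<open>Coordinates are indexed from \<open>0\<close>: position \<open>i\<close> corresponds to the coordinate with
  subscript \<open>i + 1\<close> in the usual numbering.\<close>

definition eps :: "'k \<Rightarrow> 'k \<Rightarrow> letter list \<Rightarrow> nat \<Rightarrow> 'k" where
  "eps ep em S i = (if S ! i = R then ep else em)"

definition affine_points :: "'k::field \<Rightarrow> 'k \<Rightarrow> letter list \<Rightarrow> 'k list set" where
  "affine_points ep em S =
     {x. length x = length S \<and>
         (\<forall>i. Suc i < length S \<longrightarrow>
            eps ep em S (Suc i) * (x ! Suc i)^2 - eps ep em S i * (x ! i)^2 = 1)}"

definition affine_points_nonzero :: "'k::field \<Rightarrow> 'k \<Rightarrow> letter list \<Rightarrow> 'k list set" where
  "affine_points_nonzero ep em S = {x \<in> affine_points ep em S. \<forall>i < length S. x ! i \<noteq> 0}"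

type_synonym 'k mpoly = "(nat \<Rightarrow>\<^sub>0 nat) \<Rightarrow>\<^sub>0 'k"

definition mvar :: "nat \<Rightarrow> 'k::field mpoly" where
  "mvar i = Poly_Mapping.single (Poly_Mapping.single i 1) 1"

definition mconst :: "'k::field \<Rightarrow> 'k mpoly" where
  "mconst c = Poly_Mapping.single 0 c"

definition mpoly_ring :: "nat \<Rightarrow> 'k::field mpoly ring" where
  "mpoly_ring l =
     \<lparr>carrier = {f. \<forall>m \<in> Poly_Mapping.keys f. Poly_Mapping.keys m \<subseteq> {..<l}},
      monoid.mult = (*), one = 1, zero = 0, add = (+)\<rparr>"

definition curve_ideal :: "'k::field \<Rightarrow> 'k \<Rightarrow> letter list \<Rightarrow> 'k mpoly set" where
  "curve_ideal ep em S =
     Idl\<^bsub>mpoly_ring (length S)\<^esub>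
       {mconst (eps ep em S (Suc i)) * (mvar (Suc i))^2 - mconst (eps ep em S i) * (mvar i)^2 - 1 | i.
          Suc i < length S}"

section \<open>Function field and genus\<close>

text \<open>For a prime ideal \<open>I\<close> of \<open>k[x\<^sub>0,\<dots>,x\<^sub>l\<^sub>-\<^sub>1]\<close> the field of rational functions on the affine
  variety of \<open>I\<close>, that is, the fraction field of the coordinate ring \<open>k[x]/I\<close>, is the residue
  field of the localisation of \<open>k[x]\<close> at \<open>I\<close>.\<close>

definition local_ring :: "nat \<Rightarrow> 'k::field mpoly set \<Rightarrow> 'k mpoly fract ring" where
  "local_ring l I =
     \<lparr>carrier = {Fract f g | f g. f \<in> carrier (mpoly_ring l) \<and> g \<in> carrier (mpoly_ring l) - I},
      monoid.mult = (*), one = 1, zero = 0, add = (+)\<rparr>"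

definition local_max_ideal :: "nat \<Rightarrow> 'k::field mpoly set \<Rightarrow> 'k mpoly fract set" where
  "local_max_ideal l I = {Fract f g | f g. f \<in> I \<and> g \<in> carrier (mpoly_ring l) - I}"

definition function_field :: "nat \<Rightarrow> 'k::field mpoly set \<Rightarrow> 'k mpoly fract set ring" where
  "function_field l I = local_ring l I Quot local_max_ideal l I"

definition constants :: "nat \<Rightarrow> 'k::field mpoly set \<Rightarrow> 'k mpoly fract set set" where
  "constants l I =
     range (\<lambda>c. local_max_ideal l I +>\<^bsub>local_ring l I\<^esub> Fract (mconst c) 1)"

text \<open>The points of the smooth projective model of a curve over an algebraically closed field \<open>K\<close>
  are the places of its function field \<open>F\<close>, given here by the normalised discrete valuations of \<open>F\<close>
  that are trivial on \<open>K\<close>. A valuation is stored as a total function with the dummy value \<open>0\<close>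
  at zero and outside \<open>F\<close>.\<close>

definition places :: "'f set \<Rightarrow> ('f, 'b) ring_scheme \<Rightarrow> ('f \<Rightarrow> int) set" where
  "places K F =
     {v. (\<forall>x \<in> carrier F - {\<zero>\<^bsub>F\<^esub>}. \<forall>y \<in> carrier F - {\<zero>\<^bsub>F\<^esub>}. v (x \<otimes>\<^bsub>F\<^esub> y) = v x + v y) \<and>
         (\<forall>x \<in> carrier F - {\<zero>\<^bsub>F\<^esub>}. \<forall>y \<in> carrier F - {\<zero>\<^bsub>F\<^esub>}.
            x \<oplus>\<^bsub>F\<^esub> y \<noteq> \<zero>\<^bsub>F\<^esub> \<longrightarrow> min (v x) (v y) \<le> v (x \<oplus>\<^bsub>F\<^esub> y)) \<and>
         (\<forall>c \<in> K - {\<zero>\<^bsub>F\<^esub>}. v c = 0) \<and>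
         v ` (carrier F - {\<zero>\<^bsub>F\<^esub>}) = UNIV \<and>
         (\<forall>x. x \<notin> carrier F - {\<zero>\<^bsub>F\<^esub>} \<longrightarrow> v x = 0)}"

definition divisors :: "'f set \<Rightarrow> ('f, 'b) ring_scheme \<Rightarrow> (('f \<Rightarrow> int) \<Rightarrow> int) set" where
  "divisors K F = {D. finite {v. D v \<noteq> 0} \<and> {v. D v \<noteq> 0} \<subseteq> places K F}"

text \<open>Over an algebraically closed field of constants every place has degree one.\<close>

definition divisor_degree :: "(('f \<Rightarrow> int) \<Rightarrow> int) \<Rightarrow> int" where
  "divisor_degree D = (\<Sum>v | D v \<noteq> 0. D v)"

definition riemann_roch_space ::
    "'f set \<Rightarrow> ('f, 'b) ring_scheme \<Rightarrow> (('f \<Rightarrow> int) \<Rightarrow> int) \<Rightarrow> 'f set" where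
  "riemann_roch_space K F D =
     {x \<in> carrier F. x = \<zero>\<^bsub>F\<^esub> \<or> (\<forall>v \<in> places K F. 0 \<le> v x + D v)}"

text \<open>The genus of a function field is the maximum of \<open>deg D - l(D) + 1\<close> over all divisors \<open>D\<close>,
  where \<open>l(D)\<close> is the dimension of the Riemann-Roch space of \<open>D\<close>. The predicate states
  that this maximum exists and equals \<open>g\<close>.\<close>

definition has_genus :: "'f set \<Rightarrow> ('f, 'b) ring_scheme \<Rightarrow> nat \<Rightarrow> bool" where
  "has_genus K F g \<longleftrightarrow>
     (\<forall>D \<in> divisors K F. \<exists>n. ring.dimension F n K (riemann_roch_space K F D) \<and>
        divisor_degree D - int n + 1 \<le> int g) \<and>
     (\<exists>D \<in> divisors K F. \<exists>n. ring.dimension F n K (riemann_roch_space K F D) \<and>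
        divisor_degree D - int n + 1 = int g)"

text \<open>The genus of a curve is that of its smooth projective model over an algebraic closure;
  for this the ideal of the affine curve has to be prime there.\<close>

definition smooth_model_has_genus :: "nat \<Rightarrow> 'k::alg_closed_field mpoly set \<Rightarrow> nat \<Rightarrow> bool" where
  "smooth_model_has_genus l I g \<longleftrightarrow>
     primeideal I (mpoly_ring l) \<and> has_genus (constants l I) (function_field l I) g"

section \<open>Elliptic curves and Frobenius traces\<close>

text \<open>For squarefree \<open>f\<close> of degree \<open>3\<close> or \<open>4\<close> over a field of characteristic other than \<open>2\<close>,
  the smooth projective model of \<open>y\<^sup>2 = f(x)\<close> is the curve \<open>y\<^sup>2 = z\<^sup>4 f(x/z)\<close> in the weighted
  projective plane with weights \<open>1, 2, 1\<close> of \<open>x, y, z\<close>. (The plane projective closure is singular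
  at infinity in degree \<open>4\<close>.)\<close>

definition weighted_proportional :: "(('k::field \<times> 'k \<times> 'k) \<times> ('k \<times> 'k \<times> 'k)) set" where
  "weighted_proportional = {((x, y, z), (c * x, c^2 * y, c * z)) | x y z c. c \<noteq> 0}"

definition model_points :: "'k::field poly \<Rightarrow> ('k \<times> 'k \<times> 'k) set set" where
  "model_points f =
     {(x, y, z). (x, z) \<noteq> (0, 0) \<and> y^2 = (\<Sum>i\<le>4. coeff f i * x^i * z^(4 - i))}
       // weighted_proportional"

definition frobenius_trace :: "'k::{field,finite} poly \<Rightarrow> int" where
  "frobenius_trace f = int CARD('k) + 1 - int (card (model_points f))"

definition E0 :: "'k::field poly" where
  "E0 = [:0, 1:] * [:1, 1:] * [:2, 1:]"

definition E1 :: "'k::field poly" where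
  "E1 = [:0, 1:] * [:1, 1:] * [:3, 1:]"

definition E4 :: "'k::field poly" where
  "E4 = [:0, 1:] * [:1, 1:] * [:2, 1:] * [:3, 1:]"

definition E12 :: "'k::field poly" where
  "E12 = [:0, 1:] * [:1, 1:] * [:3, 1:] * [:4, 1:]"

definition E15 :: "'k::field poly" where
  "E15 = [:-9, - 9 / 2, 2, 1:]"

text \<open>Only meaningful for primes congruent to \<open>1\<close> modulo \<open>8\<close>; there \<open>-1\<close> is a square,
  so the choice of the square root of \<open>2\<close> does not matter.\<close>

definition s_sign :: "nat \<Rightarrow> int" where
  "s_sign p = 2 * Legendre (SOME r. [r^2 = 2] (mod int p)) (int p)"

section \<open>The tables\<close>

text \<open>The columns are the residues \<open>1, 3, 5, 7\<close> of \<open>p\<close> modulo \<open>8\<close>.\<close>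

definition A_rows :: "int \<Rightarrow> int \<Rightarrow> int \<Rightarrow> int \<Rightarrow> int \<Rightarrow> int \<Rightarrow> (letter list \<times> int list) list" where
  "A_rows a0 a1 a4 a12 a15 s = [
    ([R,R,R,R,R], [4*a0 + 6*a1 + 4*a4 + a12 + s*a15, -2*a1 + 2*a4 + a12, 2*a0 + 2*a1 + 4*a4 + a12, 2*a1 + 2*a4 + a12]),
    ([N,R,R,R,R], [-2*a1 - 2*a4 - a12 - s*a15, 2*a1 - a12, 2*a0 + 2*a1 - 2*a4 - a12, -2*a1 - a12]),
    ([R,N,R,R,R], [-2*a1 - 2*a4 - a12 - s*a15, -2*a1 - 4*a4 - a12, -2*a0 - 2*a1 - 2*a4 - a12, -2*a1 - 4*a4 - a12]),
    ([N,N,R,R,R], [-2*a1 + a12 + s*a15, 2*a1 + 2*a4 + a12, 2*a0 - 2*a1 + a12, 2*a1 + 2*a4 + a12]),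
    ([R,R,N,R,R], [-4*a0 - 2*a1 + a12 - s*a15, 2*a1 - 2*a4 + a12, -2*a0 + 2*a1 + a12, -2*a1 - 2*a4 + a12]),
    ([N,R,N,R,R], [2*a1 - 2*a4 - a12 + s*a15, -6*a1 - a12, -2*a0 - 2*a1 - 2*a4 - a12, -2*a1 - a12]),
    ([R,N,N,R,R], [-2*a1 + 2*a4 - a12 + s*a15, 2*a1 - a12, 2*a0 - 2*a1 + 2*a4 - a12, 2*a1 - a12]),
    ([N,N,N,R,R], [2*a1 + a12 - s*a15, 2*a1 + 2*a4 + a12, -2*a0 + 2*a1 + a12, 2*a1 + 2*a4 + a12]),
    ([R,R,R,N,R], [-2*a1 - 2*a4 - a12 - s*a15, 2*a1 - a12, -2*a0 - 2*a1 - 2*a4 - a12, 2*a1 - a12]),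
    ([N,R,R,N,R], [-4*a0 + 2*a1 + a12 + s*a15, 2*a1 - 2*a4 + a12, -2*a0 + 2*a1 + a12, 2*a1 - 2*a4 + a12]),
    ([R,N,R,N,R], [-2*a1 + a12 + s*a15, 2*a1 + 2*a4 + a12, -2*a0 + 2*a1 + a12, -2*a1 + 2*a4 + a12]),
    ([N,N,R,N,R], [2*a1 + 2*a4 - a12 - s*a15, -6*a1 - a12, 2*a0 - 2*a1 + 2*a4 - a12, -2*a1 - a12]),
    ([R,R,N,N,R], [-2*a1 + 2*a4 - a12 + s*a15, -2*a1 + 4*a4 - a12, 2*a0 - 2*a1 + 2*a4 - a12, -2*a1 + 4*a4 - a12]),
    ([N,R,N,N,R], [4*a0 - 2*a1 + a12 - s*a15, 2*a1 - 2*a4 + a12, 2*a0 - 2*a1 + a12, 2*a1 - 2*a4 + a12]),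
    ([R,N,N,N,R], [6*a1 - 4*a4 + a12 - s*a15, -2*a1 - 2*a4 + a12, 2*a0 + 2*a1 - 4*a4 + a12, 2*a1 - 2*a4 + a12]),
    ([N,N,N,N,R], [-2*a1 + 2*a4 - a12 + s*a15, 2*a1 - a12, -2*a0 + 2*a1 + 2*a4 - a12, -2*a1 - a12]),
    ([R,R,R,R,N], [-2*a1 - 2*a4 - a12 - s*a15, 2*a1 - a12, 2*a0 + 2*a1 - 2*a4 - a12, -2*a1 - a12]),
    ([N,R,R,R,N], [-2*a1 + a12 + s*a15, -2*a1 - 2*a4 + a12, -2*a0 - 6*a1 + a12, 2*a1 - 2*a4 + a12]),
    ([R,N,R,R,N], [-4*a0 + 2*a1 + a12 + s*a15, -2*a1 + 2*a4 + a12, -2*a0 + 2*a1 + a12, -2*a1 + 2*a4 + a12]),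
    ([N,N,R,R,N], [2*a1 + 2*a4 - a12 - s*a15, 2*a1 - a12, -2*a0 + 2*a1 + 2*a4 - a12, 2*a1 - a12]),
    ([R,R,N,R,N], [2*a1 - 2*a4 - a12 + s*a15, 2*a1 - a12, -2*a0 - 2*a1 - 2*a4 - a12, 6*a1 - a12]),
    ([N,R,N,R,N], [-2*a1 + 4*a4 + a12 - s*a15, 2*a1 + 2*a4 + a12, 2*a0 + 2*a1 + 4*a4 + a12, -2*a1 + 2*a4 + a12]),
    ([R,N,N,R,N], [4*a0 - 2*a1 + a12 - s*a15, -2*a1 + 2*a4 + a12, 2*a0 - 2*a1 + a12, -2*a1 + 2*a4 + a12]),
    ([N,N,N,R,N], [2*a1 - 2*a4 - a12 + s*a15, -2*a1 - 4*a4 - a12, 2*a0 + 2*a1 - 2*a4 - a12, -2*a1 - 4*a4 - a12]),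
    ([R,R,R,N,N], [-2*a1 + a12 + s*a15, -2*a1 - 2*a4 + a12, 2*a0 - 2*a1 + a12, -2*a1 - 2*a4 + a12]),
    ([N,R,R,N,N], [2*a1 + 2*a4 - a12 - s*a15, -2*a1 + 4*a4 - a12, -2*a0 + 2*a1 + 2*a4 - a12, -2*a1 + 4*a4 - a12]),
    ([R,N,R,N,N], [2*a1 + 2*a4 - a12 - s*a15, 2*a1 - a12, 2*a0 - 2*a1 + 2*a4 - a12, 6*a1 - a12]),
    ([N,N,R,N,N], [4*a0 - 2*a1 - 4*a4 + a12 + s*a15, 2*a1 - 2*a4 + a12, 2*a0 + 2*a1 - 4*a4 + a12, -2*a1 - 2*a4 + a12]),
    ([R,R,N,N,N], [2*a1 + a12 - s*a15, -2*a1 - 2*a4 + a12, -2*a0 + 2*a1 + a12, -2*a1 - 2*a4 + a12]),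
    ([N,R,N,N,N], [2*a1 - 2*a4 - a12 + s*a15, 2*a1 - a12, 2*a0 + 2*a1 - 2*a4 - a12, 2*a1 - a12]),
    ([R,N,N,N,N], [-2*a1 + 2*a4 - a12 + s*a15, 2*a1 - a12, -2*a0 + 2*a1 + 2*a4 - a12, -2*a1 - a12]),
    ([N,N,N,N,N], [-4*a0 - 2*a1 + a12 - s*a15, -2*a1 + 2*a4 + a12, -2*a0 - 6*a1 + a12, 2*a1 + 2*a4 + a12])]"

definition A_table :: "letter list \<Rightarrow> nat \<Rightarrow> int \<Rightarrow> int \<Rightarrow> int \<Rightarrow> int \<Rightarrow> int \<Rightarrow> int \<Rightarrow> int" where
  "A_table S r a0 a1 a4 a12 a15 s =
     the (map_of (zip [1, 3, 5, 7] (the (map_of (A_rows a0 a1 a4 a12 a15 s) S))) r)"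

text \<open>The entries are \<open>32 C\<close>; the columns are the residues
  \<open>1, 5, 7, 11, 13, 17, 19, 23\<close> of \<open>p\<close> modulo \<open>24\<close>.\<close>

definition C32_rows :: "(letter list \<times> int list) list" where
  "C32_rows = [
    ([R,R,R,R,R], [-95, -15, -15, -15, -15, -31, -15, -31]),
    ([N,R,R,R,R], [-15, 1, 1, 1, 1, -15, 1, -31]),
    ([R,N,R,R,R], [-15, 1, 1, 1, -15, -15, 1, 1]),
    ([N,N,R,R,R], [1, -15, -15, 1, 1, 1, 1, -31]),
    ([R,R,N,R,R], [-15, 1, 1, -15, -31, -15, -15, 1]),
    ([N,R,N,R,R], [1, 1, 1, -31, -15, 1, 1, 1]),
    ([R,N,N,R,R], [1, -15, -15, 1, 1, 1, 1, 1]),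
    ([N,N,N,R,R], [1, 1, -15, 1, 1, 1, 1, -31]),
    ([R,R,R,N,R], [-15, 1, -15, 1, -15, -15, 1, 1]),
    ([N,R,R,N,R], [1, 1, -15, -15, 1, -31, -15, 1]),
    ([R,N,R,N,R], [1, 1, 1, 1, -31, 1, 1, 1]),
    ([N,N,R,N,R], [1, -15, 1, -31, 1, 1, 1, 1]),
    ([R,R,N,N,R], [1, -15, 1, 1, 1, 1, -31, 1]),
    ([N,R,N,N,R], [1, -15, -15, -15, 1, 1, -15, 1]),
    ([R,N,N,N,R], [1, 1, -15, 1, 1, 1, 1, 1]),
    ([N,N,N,N,R], [1, 1, 1, 1, 1, 1, 1, -31]),
    ([R,R,R,R,N], [-15, 1, 1, 1, 1, -15, 1, 1]),
    ([N,R,R,R,N], [1, -15, -15, 1, -15, 1, 1, 1]),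
    ([R,N,R,R,N], [1, 1, 1, -15, 1, -31, -15, 1]),
    ([N,N,R,R,N], [1, 1, -15, 1, 1, 1, 1, 1]),
    ([R,R,N,R,N], [1, 1, 1, 1, -15, 1, 1, 1]),
    ([N,R,N,R,N], [1, -15, 1, 1, -15, 1, 1, 1]),
    ([R,N,N,R,N], [1, -15, 1, -15, 1, 1, -15, 1]),
    ([N,N,N,R,N], [1, 1, 1, 1, 1, 1, 1, 1]),
    ([R,R,R,N,N], [1, -15, 1, 1, 1, 1, 1, 1]),
    ([N,R,R,N,N], [1, 1, 1, 1, 1, 1, -31, 1]),
    ([R,N,R,N,N], [1, -15, 1, 1, 1, 1, 1, 1]),
    ([N,N,R,N,N], [1, 1, 1, -15, 1, 1, -15, 1]),
    ([R,R,N,N,N], [1, 1, 1, 1, 1, 1, 1, 1]),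
    ([N,R,N,N,N], [1, 1, -15, 1, 1, 1, 1, 1]),
    ([R,N,N,N,N], [1, 1, 1, 1, 1, 1, 1, 1]),
    ([N,N,N,N,N], [-15, -15, -15, -15, -15, -15, -15, -31])]"

definition C_table :: "letter list \<Rightarrow> nat \<Rightarrow> real" where
  "C_table S r =
     of_int (the (map_of (zip [1, 5, 7, 11, 13, 17, 19, 23] (the (map_of C32_rows S))) r)) / 32"

end

(* Over an algebraically closed field the function field of the curve is K(t) with square roots of
   t, t + 1, ..., t + 4 adjoined, where t = e_1 x_1^2. It embeds into Laurent series in a parameter at
   infinity, and the automorphisms changing the signs of the roots produce all 16 places at infinity.
   The coordinate ring is free over K[t] on the square-free monomials in the roots, so the spaces of
   functions with bounded poles at infinity have computable dimension; this gives genus 17, since such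
   divisors dominate all others up to linear equivalence.

   Modulo p, the points of the curve with fixed t are counted by the product over i of
   1 + s_i chi(t + i), which is 32 if t is the start of an occurrence of the word and 0 otherwise,
   unless some t + i vanishes. Expanding the product yields sums of chi over products of up to five
   consecutive linear factors. Affine substitutions and inversions reduce each of them to the trace of one of
   the five elliptic curves; for the product of all five factors, t = w - 2 gives w(w^2 - 1)(w^2 - 4), and
   the involution w -> 2/w leads to the invariant u = w + 2/w and to E_15. *)

theory Submission
  imports Defs "HOL-Computational_Algebra.Formal_Laurent_Series" "HOL-Number_Theory.Quadratic_Reciprocity"
begin

section \<open>Towers of quadratic extensions\<close>

text \<open>The genus is a maximum over all divisors, so all places and their residue fields must be
  known and l(D) bounded for arbitrary D. The intermediate fields are subsets of one Laurent series
  field, where t and its square roots exist concretely; every further embedding into Laurent series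
  gives a place, and its residue field is K. For the upper bound, deg D - l(D) does not decrease
  when D grows, so D is compared with m times infinity plus the divisor of a product of factors t -
  a. A count of fibres (at most 32 zeros against 16 double poles) shows that this divisor has degree
  at most 16 m, while the space has dimension 16 m - 16 for m >= 5; hence 16 + 1 = 17. The
  conditions that 2 and 3 are nonzero make 0, ..., 4 distinct in K. In the count of words, chi(-1)
  and chi(2) depend on p modulo 8 and govern the coefficients of the traces. The character of 3
  occurs only in the correction for the excluded values t = 0, -1, ..., -4, hence the modulus 24 of
  the second table.\<close>

locale subfld =
  fixes S :: "'a::field set"
  assumes one: "1 \<in> S"
    and diff: "x \<in> S \<Longrightarrow> y \<in> S \<Longrightarrow> x - y \<in> S"
    and mult: "x \<in> S \<Longrightarrow> y \<in> S \<Longrightarrow> x * y \<in> S"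
    and inv: "x \<in> S \<Longrightarrow> inverse x \<in> S"
begin

lemma zero: "0 \<in> S"
  using diff[OF one one] by simp

lemma uminus: "x \<in> S \<Longrightarrow> - x \<in> S"
  using diff[OF zero] by fastforce

lemma add: "x \<in> S \<Longrightarrow> y \<in> S \<Longrightarrow> x + y \<in> S"
  using diff[OF _ uminus] by fastforce

lemma div: "x \<in> S \<Longrightarrow> y \<in> S \<Longrightarrow> x / y \<in> S"
  by (simp add: divide_inverse mult inv)

lemma pow: "x \<in> S \<Longrightarrow> x ^ n \<in> S"
  by (induction n) (auto simp: one mult)

lemma of_nat: "of_nat n \<in> S"
  by (induction n) (auto simp: zero one add)

lemma prod: "(\<And>i. i \<in> A \<Longrightarrow> f i \<in> S) \<Longrightarrow> prod f A \<in> S"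
  by (induction A rule: infinite_finite_induct) (auto simp: one mult)

lemma numeral: "numeral n \<in> S"
  using of_nat[of "numeral n"] by simp

lemmas closed = one zero diff uminus add mult inv div pow of_nat prod numeral

end

definition adj :: "'a::field set \<Rightarrow> 'a \<Rightarrow> 'a set" where
  "adj S y = {A + B * y | A B. A \<in> S \<and> B \<in> S}"

lemma adjI: "A \<in> S \<Longrightarrow> B \<in> S \<Longrightarrow> A + B * y \<in> adj S y"
  unfolding adj_def by blast

lemma (in subfld) adj_base: "S \<subseteq> adj S y"
  using adjI[OF _ zero, of _ y] by auto

lemma (in subfld) adj_gen: "y \<in> adj S y"
  using adjI[OF zero one, of y] by auto

lemma (in subfld) adj_unique:
  assumes "y \<notin> S" "A \<in> S" "B \<in> S" "A' \<in> S" "B' \<in> S" "A + B * y = A' + B' * y"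
  shows "A = A'" "B = B'"
proof -
  show "B = B'"
  proof (rule ccontr)
    assume "B \<noteq> B'"
    then have "y = (A' - A) / (B - B')"
      using assms(6) by (simp add: field_simps)
    then show False using assms(1) div[OF diff[OF assms(4,2)] diff[OF assms(3,5)]] by simp
  qed
  then show "A = A'" using assms(6) by simp
qed

text \<open>Inverses come from the conjugate A - B y, whose product with A + B y is the norm A^2 -
  B^2 y^2 in S. Uniqueness of coordinates, which rests on y lying outside S, keeps the conjugate of
  a nonzero element nonzero.\<close>

lemma (in subfld) subfld_adj:
  assumes "y^2 \<in> S" "y \<notin> S"
  shows "subfld (adj S y)"
proof
  show "1 \<in> adj S y" using adj_base one by blast
next
  fix u v assume "u \<in> adj S y" "v \<in> adj S y"
  then obtain A B C D where *: "A \<in> S" "B \<in> S" "C \<in> S" "D \<in> S" "u = A + B * y" "v = C + D * y"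
    unfolding adj_def by blast
  have "u - v = (A - C) + (B - D) * y" using * by (simp add: algebra_simps)
  then show "u - v \<in> adj S y" using adjI[OF diff[OF *(1,3)] diff[OF *(2,4)]] by simp
  have "u * v = (A * C + B * D * y^2) + (A * D + B * C) * y"
    using * by (simp add: algebra_simps power2_eq_square)
  moreover have "A * C + B * D * y^2 \<in> S" "A * D + B * C \<in> S" using *(1-4) assms(1) by (simp_all add: closed)
  ultimately show "u * v \<in> adj S y" by (metis adjI)
next
  fix u assume "u \<in> adj S y"
  then obtain A B where *: "A \<in> S" "B \<in> S" "u = A + B * y" unfolding adj_def by blast
  show "inverse u \<in> adj S y"
  proof (cases "u = 0")
    case False
    have "A - B * y \<noteq> 0"
    proof
      assume "A - B * y = 0"
      then have "A + (- B) * y = 0 + 0 * y" by simp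
      then have "A = 0" "- B = 0" using adj_unique[OF assms(2) *(1) uminus[OF *(2)] zero zero] by blast+
      then show False using False * by simp
    qed
    moreover have "u * (A - B * y) = A^2 - B^2 * y^2"
      using * by (simp add: algebra_simps power2_eq_square)
    ultimately have N: "A^2 - B^2 * y^2 \<noteq> 0" using False by (metis mult_eq_0_iff)
    have "A / (A^2 - B^2 * y^2) + (- B / (A^2 - B^2 * y^2)) * y = (A - B * y) / (A^2 - B^2 * y^2)"
      by (simp add: diff_divide_distrib)
    then have "u * (A / (A^2 - B^2 * y^2) + (- B / (A^2 - B^2 * y^2)) * y) = 1"
      using N \<open>u * (A - B * y) = A^2 - B^2 * y^2\<close> by simp
    then have "inverse u = A / (A^2 - B^2 * y^2) + (- B / (A^2 - B^2 * y^2)) * y"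
      by (rule inverse_unique)
    moreover have "A / (A^2 - B^2 * y^2) \<in> S" "- B / (A^2 - B^2 * y^2) \<in> S"
      using *(1-2) assms(1) by (simp_all add: closed)
    ultimately show ?thesis by (metis adjI)
  qed (use adj_base zero in auto)
qed

text \<open>The conditions concern S only and values elsewhere are arbitrary, so maps can be
  prescribed stage by stage along a tower of subsets. The clause \<open>\<phi> 1 = 1\<close>
  excludes the zero map and makes such a map injective on a subfield.\<close>

definition fhom :: "'a::field set \<Rightarrow> ('a \<Rightarrow> 'b::field) \<Rightarrow> bool" where
  "fhom S \<phi> \<longleftrightarrow> \<phi> 1 = 1 \<and> (\<forall>x\<in>S. \<forall>y\<in>S. \<phi> (x + y) = \<phi> x + \<phi> y \<and> \<phi> (x * y) = \<phi> x * \<phi> y)"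

lemma fhom_add: "fhom S \<phi> \<Longrightarrow> x \<in> S \<Longrightarrow> y \<in> S \<Longrightarrow> \<phi> (x + y) = \<phi> x + \<phi> y"
  and fhom_mult: "fhom S \<phi> \<Longrightarrow> x \<in> S \<Longrightarrow> y \<in> S \<Longrightarrow> \<phi> (x * y) = \<phi> x * \<phi> y"
  and fhom_one: "fhom S \<phi> \<Longrightarrow> \<phi> 1 = 1"
  by (auto simp: fhom_def)

context subfld
begin

lemma fhom_zero: "fhom S \<phi> \<Longrightarrow> \<phi> 0 = 0"
  using fhom_add[of S \<phi> 0 0] zero by (metis add_0 add_cancel_left_left)

lemma fhom_uminus: "fhom S \<phi> \<Longrightarrow> x \<in> S \<Longrightarrow> \<phi> (- x) = - \<phi> x"
  using fhom_add[of S \<phi> x "- x"] uminus[of x] fhom_zero[of \<phi>]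
  by (simp add: eq_neg_iff_add_eq_0) (metis add.commute)

lemma fhom_diff: "fhom S \<phi> \<Longrightarrow> x \<in> S \<Longrightarrow> y \<in> S \<Longrightarrow> \<phi> (x - y) = \<phi> x - \<phi> y"
  using fhom_add[of S \<phi> x "- y"] uminus fhom_uminus by simp

lemma fhom_pow: "fhom S \<phi> \<Longrightarrow> x \<in> S \<Longrightarrow> \<phi> (x ^ n) = \<phi> x ^ n"
  by (induction n) (auto simp: fhom_one fhom_mult pow)

lemma fhom_eq_0_iff: "fhom S \<phi> \<Longrightarrow> x \<in> S \<Longrightarrow> \<phi> x = 0 \<longleftrightarrow> x = 0"
  using fhom_mult[of S \<phi> x "inverse x"] inv[of x] fhom_zero fhom_one[of S \<phi>]
  by (cases "x = 0") auto

lemma fhom_inverse: "fhom S \<phi> \<Longrightarrow> x \<in> S \<Longrightarrow> \<phi> (inverse x) = inverse (\<phi> x)"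
  using fhom_mult[of S \<phi> x "inverse x"] inv[of x] fhom_zero fhom_one[of S \<phi>]
  by (cases "x = 0") (auto simp: inverse_unique)

lemma fhom_div: "fhom S \<phi> \<Longrightarrow> x \<in> S \<Longrightarrow> y \<in> S \<Longrightarrow> \<phi> (x / y) = \<phi> x / \<phi> y"
  by (simp add: divide_inverse fhom_mult fhom_inverse inv)

text \<open>The element A + B y has to go to \<phi> A + \<phi> B z; unique coordinates make this
  well defined and z^2 = \<phi> (y^2) makes it multiplicative. The freedom in the choice of z
  produces both the sign automorphisms and the different places over one point of the
  t-line.\<close>

lemma fhom_extend:
  assumes y: "y \<notin> S" "y^2 \<in> S" and h: "fhom S \<phi>" and z: "z^2 = \<phi> (y^2)"
  shows "\<exists>\<psi>. fhom (adj S y) \<psi> \<and> (\<forall>x\<in>S. \<psi> x = \<phi> x) \<and> \<psi> y = z"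
proof -
  define \<psi> where "\<psi> x = (THE w. \<exists>A\<in>S. \<exists>B\<in>S. x = A + B * y \<and> w = \<phi> A + \<phi> B * z)" for x
  have \<psi>: "\<psi> (A + B * y) = \<phi> A + \<phi> B * z" if "A \<in> S" "B \<in> S" for A B
    unfolding \<psi>_def
  proof (rule the_equality)
    fix w assume "\<exists>A'\<in>S. \<exists>B'\<in>S. A + B * y = A' + B' * y \<and> w = \<phi> A' + \<phi> B' * z"
    then show "w = \<phi> A + \<phi> B * z" using adj_unique[OF y(1) that] by metis
  qed (use that in blast)
  have base: "\<psi> x = \<phi> x" if "x \<in> S" for x
    using \<psi>[OF that zero] fhom_zero[OF h] by simp
  have "fhom (adj S y) \<psi>"
    unfolding fhom_def
  proof (intro conjI ballI)
    show "\<psi> 1 = 1" using base[OF one] fhom_one[OF h] by simp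
  next
    fix u v assume "u \<in> adj S y" "v \<in> adj S y"
    then obtain A B C D where *: "A \<in> S" "B \<in> S" "C \<in> S" "D \<in> S" "u = A + B * y" "v = C + D * y"
      unfolding adj_def by blast
    have "u + v = (A + C) + (B + D) * y" using * by (simp add: algebra_simps)
    then have "\<psi> (u + v) = \<phi> (A + C) + \<phi> (B + D) * z" using \<psi>[OF add[OF *(1,3)] add[OF *(2,4)]] by simp
    then show "\<psi> (u + v) = \<psi> u + \<psi> v" using \<psi> * fhom_add[OF h] by (simp add: algebra_simps)
    have "u * v = (A * C + B * D * y^2) + (A * D + B * C) * y"
      using * by (simp add: algebra_simps power2_eq_square)
    moreover have "\<psi> ((A * C + B * D * y^2) + (A * D + B * C) * y)
        = \<phi> (A * C + B * D * y^2) + \<phi> (A * D + B * C) * z"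
      by (intro \<psi>) (use * closed y in auto)
    ultimately have "\<psi> (u * v) = \<phi> (A * C + B * D * y^2) + \<phi> (A * D + B * C) * z" by simp
    also have "\<dots> = (\<phi> A * \<phi> C + \<phi> B * \<phi> D * z^2) + (\<phi> A * \<phi> D + \<phi> B * \<phi> C) * z"
      using * closed y by (simp add: fhom_add[OF h] fhom_mult[OF h] z)
    also have "\<dots> = \<psi> u * \<psi> v"
      using * \<psi> by (simp add: algebra_simps power2_eq_square)
    finally show "\<psi> (u * v) = \<psi> u * \<psi> v" .
  qed
  moreover have "\<psi> y = z" using \<psi>[OF zero one] fhom_zero[OF h] fhom_one[OF h] by simp
  ultimately show ?thesis using base by blast
qed

end

section \<open>Polynomials and rational functions in a Laurent series t\<close>

definition ev :: "'k::field poly \<Rightarrow> 'k fls \<Rightarrow> 'k fls" where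
  "ev p t = poly (map_poly fls_const p) t"

lemma ev_0 [simp]: "ev 0 t = 0"
  by (simp add: ev_def)

lemma ev_pCons [simp]: "ev (pCons a p) t = fls_const a + t * ev p t"
  by (cases "a = 0 \<and> p = 0") (auto simp: ev_def map_poly_pCons)

lemma ev_1 [simp]: "ev 1 t = 1"
  by (simp add: one_pCons)

lemma ev_add [simp]: "ev (p + q) t = ev p t + ev q t"
  by (induction p q rule: poly_induct2) (auto simp: algebra_simps simp flip: fls_plus_const)

lemma ev_smult [simp]: "ev (smult a p) t = fls_const a * ev p t"
  by (induction p) (auto simp: algebra_simps simp flip: fls_const_mult_const)

lemma ev_minus [simp]: "ev (- p) t = - ev p t"
  using ev_add[of p "- p" t] by (simp add: eq_neg_iff_add_eq_0 add.commute)

lemma ev_diff [simp]: "ev (p - q) t = ev p t - ev q t"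
  using ev_add[of p "- q" t] by simp

lemma ev_mult [simp]: "ev (p * q) t = ev p t * ev q t"
  by (induction p) (auto simp: algebra_simps)

lemma ev_power [simp]: "ev (p ^ n) t = ev p t ^ n"
  by (induction n) auto

lemma ev_prod: "ev (prod f A) t = (\<Prod>i\<in>A. ev (f i) t)"
  by (induction A rule: infinite_finite_induct) auto

definition transc :: "'k::field fls \<Rightarrow> bool" where
  "transc t \<longleftrightarrow> (\<forall>p. ev p t = 0 \<longrightarrow> p = 0)"

text \<open>Denominators are unrestricted: as x / 0 = 0, a vanishing denominator only contributes 0.
  \<open>ratfE\<close> restores a nonvanishing one.\<close>

definition ratf :: "'k::field fls \<Rightarrow> 'k fls set" where
  "ratf t = {ev p t / ev q t | p q. True}"

lemma ratfI: "ev p t / ev q t \<in> ratf t"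
  unfolding ratf_def by blast

lemma ratfE:
  assumes "x \<in> ratf t"
  shows "\<exists>p q. x = ev p t / ev q t \<and> ev q t \<noteq> 0"
proof -
  obtain p q where *: "x = ev p t / ev q t" using assms unfolding ratf_def by blast
  show ?thesis
  proof (cases "ev q t = 0")
    case True
    then have "x = ev 0 t / ev 1 t \<and> ev 1 t \<noteq> 0" using * by simp
    then show ?thesis by blast
  qed (use * in blast)
qed

lemma ev_in_ratf: "ev p t \<in> ratf t"
  using ratfI[of p t 1] by simp

lemma subfld_ratf: "subfld (ratf t)"
proof
  show "1 \<in> ratf t" using ev_in_ratf[of 1] by simp
next
  fix x y assume "x \<in> ratf t" "y \<in> ratf t"
  then obtain p q p' q' where *: "x = ev p t / ev q t" "ev q t \<noteq> 0"
      "y = ev p' t / ev q' t" "ev q' t \<noteq> 0" using ratfE by blast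
  have "x - y = ev (p * q' - p' * q) t / ev (q * q') t"
    using *(2,4) by (simp add: *(1,3) diff_frac_eq)
  then show "x - y \<in> ratf t" using ratfI by metis
  have "x * y = ev (p * p') t / ev (q * q') t"
    by (simp add: *(1,3))
  then show "x * y \<in> ratf t" using ratfI by metis
next
  fix x assume "x \<in> ratf t"
  then obtain p q where *: "x = ev p t / ev q t" using ratfE by blast
  then have "inverse x = ev q t / ev p t" by simp
  then show "inverse x \<in> ratf t" using ratfI by metis
qed

text \<open>Substitution of t' for t in rational functions. Transcendence of t makes the value
  independent of the fraction chosen, and transcendence of t' keeps the new denominators
  nonzero.\<close>

lemma fhom_ratf:
  assumes "transc t" "transc t'"
  shows "\<exists>\<phi>. fhom (ratf t) \<phi> \<and> (\<forall>p. \<phi> (ev p t) = ev p t')"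
proof -
  define \<phi> where "\<phi> x = (THE w. \<exists>p q. q \<noteq> 0 \<and> x = ev p t / ev q t \<and> w = ev p t' / ev q t')" for x
  have nz: "ev q t \<noteq> 0" "ev q t' \<noteq> 0" if "q \<noteq> 0" for q
    using assms that unfolding transc_def by blast+
  have \<phi>: "\<phi> (ev p t / ev q t) = ev p t' / ev q t'" if q: "q \<noteq> 0" for p q
    unfolding \<phi>_def
  proof (rule the_equality)
    fix w assume "\<exists>p' q'. q' \<noteq> 0 \<and> ev p t / ev q t = ev p' t / ev q' t \<and> w = ev p' t' / ev q' t'"
    then obtain p' q' where *: "q' \<noteq> 0" "ev p t / ev q t = ev p' t / ev q' t" "w = ev p' t' / ev q' t'"
      by blast
    then have "ev (p * q' - p' * q) t = 0" using nz q by (simp add: field_simps)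
    then have "p * q' - p' * q = 0" using assms unfolding transc_def by blast
    then have "ev (p * q' - p' * q) t' = 0" by (metis ev_0)
    then have "ev p t' * ev q' t' = ev p' t' * ev q t'" by simp
    then show "w = ev p t' / ev q t'" using *(3) nz(2)[OF q] nz(2)[OF *(1)] by (simp add: frac_eq_eq)
  qed (use q in blast)
  have \<phi>p: "\<phi> (ev p t) = ev p t'" for p using \<phi>[of 1 p] by simp
  have "fhom (ratf t) \<phi>"
    unfolding fhom_def
  proof (intro conjI ballI)
    show "\<phi> 1 = 1" using \<phi>p[of 1] by simp
  next
    fix x y assume "x \<in> ratf t" "y \<in> ratf t"
    then obtain p q p' q' where *: "x = ev p t / ev q t" "ev q t \<noteq> 0"
      "y = ev p' t / ev q' t" "ev q' t \<noteq> 0" using ratfE by blast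
    then have q: "q \<noteq> 0" "q' \<noteq> 0" by auto
    have "x + y = ev (p * q' + p' * q) t / ev (q * q') t"
      using *(2,4) by (simp add: *(1,3) add_frac_eq)
    then show "\<phi> (x + y) = \<phi> x + \<phi> y" using q nz(2)[OF q(1)] nz(2)[OF q(2)] \<phi>[of "q * q'" "p * q' + p' * q"] *(1,3) \<phi>[of q] \<phi>[of q']
      by (simp add: add_frac_eq)
    have "x * y = ev (p * p') t / ev (q * q') t"
      by (simp add: *(1,3))
    then show "\<phi> (x * y) = \<phi> x * \<phi> y" using q \<phi>[of "q * q'" "p * p'"] *(1,3) \<phi>[of q] \<phi>[of q']
      by simp
  qed
  then show ?thesis using \<phi>p by blast
qed

lemma fhom_comp:
  assumes "fhom S \<phi>" "fhom Q \<psi>" "\<phi> ` S \<subseteq> Q"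
  shows "fhom S (\<psi> \<circ> \<phi>)"
  using assms unfolding fhom_def by (auto simp: image_subset_iff)

text \<open>Together with \<open>Tw_least\<close> this reduces an equation between homomorphisms on
  the tower to the generators: the constants, t and the roots y i.\<close>

lemma (in subfld) subfld_equalizer:
  assumes "fhom S \<phi>" "fhom S \<psi>"
  shows "subfld {x \<in> S. \<phi> x = \<psi> x}"
  by standard
    (use assms in \<open>auto simp: closed fhom_one fhom_diff[OF assms(1)] fhom_diff[OF assms(2)]
      fhom_mult[OF assms(1)] fhom_mult[OF assms(2)] fhom_inverse[OF assms(1)] fhom_inverse[OF assms(2)]\<close>)

lemma (in subfld) subfld_vimage:
  assumes "fhom S \<phi>" "subfld Q"
  shows "subfld {x \<in> S. \<phi> x \<in> Q}"
proof -
  interpret Q: subfld Q by fact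
  show ?thesis
    by standard
      (use assms in \<open>auto simp: closed Q.closed fhom_one fhom_diff[OF assms(1)] 
        fhom_mult[OF assms(1)] fhom_inverse[OF assms(1)]\<close>)
qed

lemma (in subfld) fhom_id: "fhom S (\<lambda>x. x)"
  unfolding fhom_def by auto

section \<open>The field K(t) with the square roots of t, t + 1, ..., t + 4\<close>

primrec tower :: "'k::field fls \<Rightarrow> (nat \<Rightarrow> 'k fls) \<Rightarrow> nat \<Rightarrow> 'k fls set" where
  "tower t y 0 = ratf t"
| "tower t y (Suc n) = adj (tower t y n) (y n)"

definition shift :: "nat \<Rightarrow> 'k::field poly" where
  "shift i = [:of_nat i, 1:]"

lemma ev_shift [simp]: "ev (shift i) t = t + of_nat i"
  by (simp add: shift_def fls_of_nat)

locale sqrt_tower =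
  fixes t :: "'k::alg_closed_field fls" and y :: "nat \<Rightarrow> 'k fls"
  assumes two: "(2::'k) \<noteq> 0" and three: "(3::'k) \<noteq> 0"
    and tr: "transc t"
    and y_sq: "i < 5 \<Longrightarrow> y i ^ 2 = t + of_nat i"

text \<open>The differences in question are 1, 2, 3 and 4 = 2 * 2, so nonvanishing of 2 and 3 covers
  them all.\<close>

lemma small_of_nat_inj:
  assumes "(2::'k::field) \<noteq> 0" "(3::'k) \<noteq> 0" "i < 5" "j < 5" "of_nat i = (of_nat j :: 'k)"
  shows "i = j"
proof -
  have *: "i = j" if "i \<le> j" "j < 5" "of_nat i = (of_nat j :: 'k)" for i j
  proof -
    have "of_nat (j - i) = (0::'k)" using that by (simp add: of_nat_diff)
    moreover have "j - i \<in> {0, 1, 2, 3, 4}" using that by auto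
    moreover have "(4::'k) \<noteq> 0" using assms(1) by (metis mult_2 mult_eq_0_iff numeral_Bit0)
    ultimately have "j - i = 0" using assms(1,2) by auto
    then show ?thesis using that by simp
  qed
  show ?thesis using *[of i j] *[of j i] assms(3-5) by (cases "i \<le> j") auto
qed

context sqrt_tower
begin

abbreviation "Tw \<equiv> tower t y"

lemmas inj5 = small_of_nat_inj[OF two three]

lemma two_fls: "(2::'k fls) \<noteq> 0"
  using two by (metis fls_const_nonzero fls_const_numeral)

text \<open>Parity of the order of vanishing at -n: the factors indexed by T vanish at other points,
  so the left side has even order there, while t + n has order 1.\<close>

lemma nonsquare:
  assumes "n < 5" "T \<subseteq> {..<n}" "d \<in> ratf t"
  shows "d^2 * (\<Prod>i\<in>T. t + of_nat i) \<noteq> t + of_nat n"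
proof
  assume eq: "d^2 * (\<Prod>i\<in>T. t + of_nat i) = t + of_nat n"
  obtain p q where pq: "d = ev p t / ev q t" "ev q t \<noteq> 0" using ratfE[OF assms(3)] by blast
  have "ev p t ^ 2 * (\<Prod>i\<in>T. t + of_nat i) = (t + of_nat n) * ev q t ^ 2"
    using eq pq by (simp add: power_divide field_simps)
  then have "ev (p^2 * prod shift T - shift n * q^2) t = 0"
    by (simp add: ev_prod)
  then have eq': "p^2 * prod shift T = shift n * q^2"
    using tr unfolding transc_def by (metis eq_iff_diff_eq_0)
  have q0: "q \<noteq> 0" using pq by auto
  have s0: "shift i \<noteq> (0::'k poly)" for i by (simp add: shift_def)
  have p0: "p \<noteq> 0" using eq' q0 s0 by auto
  have fin: "finite T" using assms(2) finite_subset by blast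
  have t0: "prod shift T \<noteq> (0::'k poly)" using s0 fin by simp
  let ?a = "- of_nat n :: 'k"
  have "poly (prod shift T) ?a \<noteq> 0"
  proof -
    have "poly (shift i) ?a \<noteq> 0" if "i \<in> T" for i
      using inj5[of i n] that assms(1,2) by (auto simp: shift_def)
    then show ?thesis using fin by (simp add: poly_prod)
  qed
  then have "order ?a (prod shift T) = 0" by (rule order_0I)
  moreover have "order ?a (shift n) = 1"
    using order_power_n_n[of ?a 1] by (simp add: shift_def)
  ultimately have "2 * order ?a p = 1 + 2 * order ?a q"
    using arg_cong[OF eq', of "order ?a"] p0 q0 t0 s0[of n]
    by (simp add: order_mult power2_eq_square)
  then show False by presburger
qed

text \<open>Kummer theory in elementary form: elements of a stage whose square lies in K(t) are
  rational functions times products of roots y i. For g = A + B y n the cross term 2 A B of g^2 must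
  vanish, so A = 0 or B = 0 and the claim descends to the previous stage. With
  \<open>nonsquare\<close> it follows that y n is new, which the next stage relies on; hence the
  joint induction.\<close>

lemma tower_props:
  assumes "n \<le> 5"
  shows "subfld (Tw n) \<and> ratf t \<subseteq> Tw n \<and> (n < 5 \<longrightarrow> y n \<notin> Tw n) \<and>
    (\<forall>g\<in>Tw n. g^2 \<in> ratf t \<longrightarrow> (\<exists>d\<in>ratf t. \<exists>T\<subseteq>{..<n}. g = d * prod y T))"
  using assms
proof (induction n)
  have yn: "y n \<notin> Tw n" if n: "n < 5"
    and sq: "\<forall>g\<in>Tw n. g^2 \<in> ratf t \<longrightarrow> (\<exists>d\<in>ratf t. \<exists>T\<subseteq>{..<n}. g = d * prod y T)" for n
  proof
    assume "y n \<in> Tw n"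
    moreover have "y n ^ 2 \<in> ratf t" using y_sq[OF n] ev_in_ratf[of "shift n" t] by simp
    ultimately obtain d T where dT: "d \<in> ratf t" "T \<subseteq> {..<n}" "y n = d * prod y T"
      using sq by blast
    have "y n ^ 2 = d^2 * (\<Prod>i\<in>T. y i ^ 2)" by (simp add: dT(3) power_mult_distrib prod_power_distrib)
    also have "(\<Prod>i\<in>T. y i ^ 2) = (\<Prod>i\<in>T. t + of_nat i)"
      using dT(2) n by (intro prod.cong refl y_sq) auto
    finally show False using nonsquare[OF n dT(2,1)] y_sq[OF n] by simp
  qed
  {
    case 0
    have sq: "\<forall>g\<in>Tw 0. g^2 \<in> ratf t \<longrightarrow> (\<exists>d\<in>ratf t. \<exists>T\<subseteq>{..<0}. g = d * prod y T)"
    proof (intro ballI impI)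
      fix g assume "g \<in> Tw 0"
      then show "\<exists>d\<in>ratf t. \<exists>T\<subseteq>{..<0}. g = d * prod y T" by (intro bexI[of _ g]) auto
    qed
    show ?case using yn[of 0] sq subfld_ratf by auto
  next
    case (Suc n)
    then have n: "n < 5" and S: "subfld (Tw n)" and k0: "ratf t \<subseteq> Tw n" and y: "y n \<notin> Tw n"
      and sq: "\<And>g. g \<in> Tw n \<Longrightarrow> g^2 \<in> ratf t \<Longrightarrow> \<exists>d\<in>ratf t. \<exists>T\<subseteq>{..<n}. g = d * prod y T"
      by auto
    interpret S: subfld "Tw n" by fact
    interpret k: subfld "ratf t" by (rule subfld_ratf)
    have a0: "y n ^ 2 \<in> ratf t" using y_sq[OF n] ev_in_ratf[of "shift n" t] by simp
    have y0: "y n \<noteq> 0" using y S.zero by metis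
    have 1: "subfld (Tw (Suc n))" using S.subfld_adj[OF _ y] a0 k0 by auto
    have 2: "ratf t \<subseteq> Tw (Suc n)" using k0 S.adj_base by auto
    have 3: "\<forall>g\<in>Tw (Suc n). g^2 \<in> ratf t \<longrightarrow> (\<exists>d\<in>ratf t. \<exists>T\<subseteq>{..<Suc n}. g = d * prod y T)"
    proof (intro ballI impI)
      fix g assume g: "g \<in> Tw (Suc n)" "g^2 \<in> ratf t"
      then obtain A B where AB: "A \<in> Tw n" "B \<in> Tw n" "g = A + B * y n" unfolding tower.simps adj_def by blast
      have "(A^2 + B^2 * y n ^ 2) + (2 * A * B) * y n = g^2 + 0 * y n"
        using AB(3) by (simp add: power2_eq_square algebra_simps)
      moreover have "A^2 + B^2 * y n ^ 2 \<in> Tw n" "2 * A * B \<in> Tw n" "g^2 \<in> Tw n"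
        using AB(1,2) subsetD[OF k0 a0] subsetD[OF k0 g(2)] by (simp_all add: S.add S.mult S.pow S.numeral)
      ultimately have c: "A^2 + B^2 * y n ^ 2 = g^2" "2 * A * B = 0"
        using S.adj_unique[OF y] S.zero by blast+
      show "\<exists>d\<in>ratf t. \<exists>T\<subseteq>{..<Suc n}. g = d * prod y T"
      proof (cases "B = 0")
        case True
        then obtain d T where "d \<in> ratf t" "T \<subseteq> {..<n}" "g = d * prod y T"
          using sq[OF AB(1)] g(2) AB(3) by auto
        moreover have "T \<subseteq> {..<Suc n}" using \<open>T \<subseteq> {..<n}\<close> by auto
        ultimately show ?thesis by blast
      next
        case False
        then have A: "A = 0" using c(2) two_fls by simp
        then have "B^2 = g^2 / y n ^ 2" using c(1) y0 by (simp add: field_simps)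
        then have "B^2 \<in> ratf t" using k.div[OF g(2) a0] by simp
        then obtain d T where dT: "d \<in> ratf t" "T \<subseteq> {..<n}" "B = d * prod y T"
          using sq[OF AB(2)] by blast
        have "n \<notin> T" "finite T" using dT(2) finite_subset by auto
        then have "g = d * prod y (insert n T)" using dT(3) AB(3) A by (simp add: mult_ac)
        moreover have "insert n T \<subseteq> {..<Suc n}" using dT(2) by auto
        ultimately show ?thesis using dT(1) by blast
      qed
    qed
    show ?case using 1 2 3 yn[of "Suc n"] by blast
  }
qed

lemma subfld_Tw: "n \<le> 5 \<Longrightarrow> subfld (Tw n)"
  and ratf_Tw: "n \<le> 5 \<Longrightarrow> ratf t \<subseteq> Tw n"
  and y_notin_Tw: "n < 5 \<Longrightarrow> y n \<notin> Tw n"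
  using tower_props[of n] by auto

lemma y_sq_Tw: "n < 5 \<Longrightarrow> y n ^ 2 \<in> Tw n"
  using y_sq[of n] ev_in_ratf[of "shift n" t] ratf_Tw[of n] by auto

lemma ev_Tw: "n \<le> 5 \<Longrightarrow> ev p t \<in> Tw n"
  using ev_in_ratf[of p t] ratf_Tw[of n] by auto

lemma Tw_Suc: "n < 5 \<Longrightarrow> Tw n \<subseteq> Tw (Suc n)"
  using subfld.adj_base[OF subfld_Tw[of n]] by simp

lemma Tw_mono: "m \<le> n \<Longrightarrow> n \<le> 5 \<Longrightarrow> Tw m \<subseteq> Tw n"
proof (induction n)
  case (Suc n)
  then show ?case using Tw_Suc[of n] by (cases "m = Suc n") auto
qed auto

lemma y_Tw: "i < n \<Longrightarrow> n \<le> 5 \<Longrightarrow> y i \<in> Tw n"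
  using subfld.adj_gen[OF subfld_Tw[of i], of "y i"] Tw_mono[of "Suc i" n] by auto

lemma y_nonzero: "i < 5 \<Longrightarrow> y i \<noteq> 0"
  using y_notin_Tw[of i] subfld.zero[OF subfld_Tw[of i]] by auto

lemma ev_const: "ev [:c:] t = fls_const c"
  by simp

lemma const_Tw: "n \<le> 5 \<Longrightarrow> fls_const c \<in> Tw n"
  using ev_Tw[of n "[:c:]"] by simp

lemma t_Tw: "n \<le> 5 \<Longrightarrow> t \<in> Tw n"
  using ev_Tw[of n "[:0, 1:]"] by simp

lemma Tw_least:
  assumes "n \<le> 5" "subfld Q" "\<And>c. fls_const c \<in> Q" "t \<in> Q" "\<And>i. i < n \<Longrightarrow> y i \<in> Q"
  shows "Tw n \<subseteq> Q"
proof -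
  interpret Q: subfld Q by fact
  have "ev p t \<in> Q" for p
    by (induction p) (auto simp: Q.zero assms(3,4) Q.add Q.mult)
  then have 0: "ratf t \<subseteq> Q"
    unfolding ratf_def using Q.div by auto
  show ?thesis
    using assms(1,5)
  proof (induction n)
    case (Suc n)
    then have "Tw n \<subseteq> Q" "y n \<in> Q" by auto
    then show ?case unfolding tower.simps adj_def using Q.add Q.mult by blast
  qed (use 0 in simp)
qed

lemma Tw_hom:
  assumes "n \<le> 5" "transc t'" "\<And>i. i < 5 \<Longrightarrow> z i ^ 2 = t' + of_nat i"
  shows "\<exists>\<phi>. fhom (Tw n) \<phi> \<and> (\<forall>p. \<phi> (ev p t) = ev p t') \<and> (\<forall>i<n. \<phi> (y i) = z i)"
  using assms(1)
proof (induction n)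
  case 0
  then show ?case using fhom_ratf[OF tr assms(2)] by auto
next
  case (Suc n)
  then have n: "n < 5" by simp
  from Suc obtain \<phi> where \<phi>: "fhom (Tw n) \<phi>" "\<And>p. \<phi> (ev p t) = ev p t'" "\<And>i. i < n \<Longrightarrow> \<phi> (y i) = z i"
    by auto
  have "z n ^ 2 = \<phi> (y n ^ 2)"
    using \<phi>(2)[of "shift n"] y_sq[OF n] assms(3)[OF n] by simp
  then obtain \<psi> where \<psi>: "fhom (Tw (Suc n)) \<psi>" "\<And>x. x \<in> Tw n \<Longrightarrow> \<psi> x = \<phi> x" "\<psi> (y n) = z n"
    using subfld.fhom_extend[OF subfld_Tw y_notin_Tw[OF n] y_sq_Tw[OF n] \<phi>(1)] n
    unfolding tower.simps by (meson less_imp_le)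
  have "\<psi> (y i) = z i" if "i < Suc n" for i
    using that \<psi>(2,3) \<phi>(3) y_Tw[of i n] n by (cases "i = n") auto
  then show ?case using \<psi> \<phi>(2) ev_Tw[of n] n by auto
qed

text \<open>The root y j is sent to the other square root of t + j. That the map preserves the
  field, is an involution and fixes \<open>Tw j\<close> is checked on generators and spread by
  \<open>Tw_least\<close>.\<close>

lemma Tw_sign_automorphism:
  assumes j: "j < 5"
  shows "\<exists>\<sigma>. fhom (Tw 5) \<sigma> \<and> (\<forall>x\<in>Tw 5. \<sigma> x \<in> Tw 5 \<and> \<sigma> (\<sigma> x) = x) \<and> (\<forall>p. \<sigma> (ev p t) = ev p t) \<and>
    (\<forall>x\<in>Tw j. \<sigma> x = x) \<and> \<sigma> (y j) = - y j \<and> (\<forall>i<5. i \<noteq> j \<longrightarrow> \<sigma> (y i) = y i)"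
proof -
  interpret F: subfld "Tw 5" using subfld_Tw by simp
  define z where "z = (\<lambda>i. if i = j then - y i else y i)"
  have "z i ^ 2 = t + of_nat i" if "i < 5" for i
    using y_sq[OF that] by (auto simp: z_def)
  then obtain \<sigma> where \<sigma>: "fhom (Tw 5) \<sigma>" "\<And>p. \<sigma> (ev p t) = ev p t" "\<And>i. i < 5 \<Longrightarrow> \<sigma> (y i) = z i"
    using Tw_hom[OF _ tr, of 5 z] by auto
  have c: "\<sigma> (fls_const c) = fls_const c" for c using \<sigma>(2)[of "[:c:]"] by simp
  have tt: "\<sigma> t = t" using \<sigma>(2)[of "[:0,1:]"] by simp
  have zF: "z i \<in> Tw 5" if "i < 5" for i using y_Tw[OF that] F.uminus by (auto simp: z_def)
  have "Tw 5 \<subseteq> {x \<in> Tw 5. \<sigma> x \<in> Tw 5}"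
    by (rule Tw_least[OF _ F.subfld_vimage[OF \<sigma>(1) F.subfld_axioms]])
      (auto simp: c tt \<sigma>(3) zF const_Tw t_Tw y_Tw)
  then have into: "\<And>x. x \<in> Tw 5 \<Longrightarrow> \<sigma> x \<in> Tw 5" by auto
  have "fhom (Tw 5) (\<lambda>x. \<sigma> (\<sigma> x))"
    using fhom_comp[OF \<sigma>(1) \<sigma>(1)] into unfolding o_def by auto
  moreover have "\<sigma> (z i) = y i" if "i < 5" for i
    using \<sigma>(3)[OF that] F.fhom_uminus[OF \<sigma>(1) y_Tw[OF that]] by (auto simp: z_def split: if_splits)
  ultimately have "Tw 5 \<subseteq> {x \<in> Tw 5. \<sigma> (\<sigma> x) = x}"
    by (intro Tw_least F.subfld_equalizer F.fhom_id)
      (auto simp: c tt \<sigma>(3) const_Tw t_Tw y_Tw)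
  then have inv: "\<And>x. x \<in> Tw 5 \<Longrightarrow> \<sigma> (\<sigma> x) = x" by auto
  have "Tw j \<subseteq> {x \<in> Tw 5. \<sigma> x = x}"
    by (intro Tw_least F.subfld_equalizer F.fhom_id \<sigma>(1))
      (use j in \<open>auto simp: c tt \<sigma>(3) const_Tw t_Tw y_Tw z_def\<close>)
  then show ?thesis using \<sigma> into inv j by (intro exI[of _ \<sigma>]) (auto simp: z_def)
qed

end

section \<open>Places\<close>

definition set_ring :: "'a::field set \<Rightarrow> 'a ring" where
  "set_ring F = \<lparr>carrier = F, monoid.mult = (*), one = 1, zero = 0, add = (+)\<rparr>"

lemma set_ring_simps [simp]:
  "carrier (set_ring F) = F" "x \<otimes>\<^bsub>set_ring F\<^esub> y = x * y" "\<one>\<^bsub>set_ring F\<^esub> = 1"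
  "\<zero>\<^bsub>set_ring F\<^esub> = 0" "x \<oplus>\<^bsub>set_ring F\<^esub> y = x + y"
  by (simp_all add: set_ring_def)

locale place = subfld F for F :: "'k::field fls set" +
  fixes v :: "'k fls \<Rightarrow> int"
  assumes place: "v \<in> places (range fls_const) (set_ring F)"
    and const: "fls_const c \<in> F"
begin

lemma v_mult: "x \<in> F \<Longrightarrow> x \<noteq> 0 \<Longrightarrow> y \<in> F \<Longrightarrow> y \<noteq> 0 \<Longrightarrow> v (x * y) = v x + v y"
  and v_add: "x \<in> F \<Longrightarrow> x \<noteq> 0 \<Longrightarrow> y \<in> F \<Longrightarrow> y \<noteq> 0 \<Longrightarrow> x + y \<noteq> 0 \<Longrightarrow> min (v x) (v y) \<le> v (x + y)"
  and v_const: "v (fls_const c) = 0"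
  and v_surj: "\<exists>x\<in>F. x \<noteq> 0 \<and> v x = n"
  and v_dummy: "x = 0 \<or> x \<notin> F \<Longrightarrow> v x = 0"
proof -
  have 1: "\<forall>x \<in> F - {0}. \<forall>y \<in> F - {0}. v (x * y) = v x + v y"
    and 2: "\<forall>x \<in> F - {0}. \<forall>y \<in> F - {0}. x + y \<noteq> 0 \<longrightarrow> min (v x) (v y) \<le> v (x + y)"
    and 3: "\<forall>c \<in> range fls_const - {0}. v c = 0"
    and 4: "v ` (F - {0}) = UNIV"
    and 5: "\<forall>x. x \<notin> F - {0} \<longrightarrow> v x = 0"
    using place unfolding places_def by auto
  show "x \<in> F \<Longrightarrow> x \<noteq> 0 \<Longrightarrow> y \<in> F \<Longrightarrow> y \<noteq> 0 \<Longrightarrow> v (x * y) = v x + v y"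
    using 1 by auto
  show "x \<in> F \<Longrightarrow> x \<noteq> 0 \<Longrightarrow> y \<in> F \<Longrightarrow> y \<noteq> 0 \<Longrightarrow> x + y \<noteq> 0 \<Longrightarrow> min (v x) (v y) \<le> v (x + y)"
    using 2 by auto
  show "v (fls_const c) = 0"
    using 3 5 by (cases "c = 0") auto
  have "n \<in> v ` (F - {0})" using 4 by simp
  then show "\<exists>x\<in>F. x \<noteq> 0 \<and> v x = n" by auto
  show "x = 0 \<or> x \<notin> F \<Longrightarrow> v x = 0" using 5 by auto
qed

lemma v_1: "v 1 = 0"
  using v_const[of 1] by simp

lemma minus_const: "- x = fls_const (- 1) * (x :: 'k fls)"
  by (metis fls_const_1 fls_const_uminus mult_minus1)

lemma v_uminus:
  assumes "x \<in> F"
  shows "v (- x) = v x"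
proof (cases "x = 0")
  case False
  have "v (- x) = v (fls_const (- 1) * x)" by (rule arg_cong[OF minus_const])
  also have "\<dots> = v (fls_const (- 1)) + v x"
    by (rule v_mult[OF const _ assms False]) (simp only: fls_const_eq_0_iff, simp)
  finally show ?thesis by (simp only: v_const add_0)
qed simp

lemma v_inverse:
  assumes "x \<in> F"
  shows "v (inverse x) = - v x"
proof (cases "x = 0")
  case False
  then have "v (x * inverse x) = v x + v (inverse x)" using assms inv v_mult[of x "inverse x"] by auto
  then show ?thesis using False v_1 by simp
qed (simp add: v_dummy)

lemma v_div: "x \<in> F \<Longrightarrow> x \<noteq> 0 \<Longrightarrow> y \<in> F \<Longrightarrow> y \<noteq> 0 \<Longrightarrow> v (x / y) = v x - v y"
  using v_mult[of x "inverse y"] v_inverse[of y] inv[of y] by (simp add: divide_inverse)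

lemma v_pow: "x \<in> F \<Longrightarrow> v (x ^ n) = int n * v x"
proof (cases "x = 0")
  case True
  then show ?thesis using v_1 v_dummy[of 0] by (cases n) auto
next
  case False
  assume "x \<in> F"
  then show ?thesis using False pow by (induction n) (auto simp: v_1 v_mult algebra_simps)
qed

lemma v_prod: "finite A \<Longrightarrow> (\<And>i. i \<in> A \<Longrightarrow> f i \<in> F \<and> f i \<noteq> 0) \<Longrightarrow> v (prod f A) = (\<Sum>i\<in>A. v (f i))"
proof (induction A rule: finite_induct)
  case (insert a A)
  then show ?case using prod[of A f] by (simp add: v_mult)
qed (simp add: v_1)

text \<open>Valuations carry the dummy value 0 at the zero element. This relation treats zero as
  having value infinity instead, so that lower bounds pass through sums and products
  uniformly.\<close>

definition vge :: "int \<Rightarrow> 'k fls \<Rightarrow> bool" where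
  "vge n x \<longleftrightarrow> x = 0 \<or> n \<le> v x"

lemma vge_mono: "vge n x \<Longrightarrow> m \<le> n \<Longrightarrow> vge m x"
  unfolding vge_def by auto

lemma vge_0 [simp]: "vge n 0"
  unfolding vge_def by auto

lemma vge_const [simp]: "vge 0 (fls_const c)"
  unfolding vge_def using v_const by auto

lemma vge_add: "vge n x \<Longrightarrow> vge n y \<Longrightarrow> x \<in> F \<Longrightarrow> y \<in> F \<Longrightarrow> vge n (x + y)"
  unfolding vge_def using v_add[of x y] by (cases "x = 0 \<or> y = 0 \<or> x + y = 0") auto

lemma vge_uminus: "vge n x \<Longrightarrow> x \<in> F \<Longrightarrow> vge n (- x)"
  unfolding vge_def using v_uminus by auto

lemma vge_diff: "vge n x \<Longrightarrow> vge n y \<Longrightarrow> x \<in> F \<Longrightarrow> y \<in> F \<Longrightarrow> vge n (x - y)"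
  using vge_add[of n x "- y"] vge_uminus[of n y] uminus[of y] by simp

lemma vge_mult: "vge m x \<Longrightarrow> vge n y \<Longrightarrow> x \<in> F \<Longrightarrow> y \<in> F \<Longrightarrow> vge (m + n) (x * y)"
  unfolding vge_def using v_mult[of x y] by (cases "x = 0 \<or> y = 0") auto

lemma v_add_eq:
  assumes "x \<in> F" "x \<noteq> 0" "y \<in> F" "vge (v x + 1) y"
  shows "x + y \<noteq> 0" "v (x + y) = v x"
proof -
  show 1: "x + y \<noteq> 0"
  proof
    assume "x + y = 0"
    then have "y = - x" by (simp add: eq_neg_iff_add_eq_0 add.commute)
    then show False using assms v_uminus[of x] unfolding vge_def by auto
  qed
  show "v (x + y) = v x"
  proof (cases "y = 0")
    case False
    then have gt: "v x < v y" using assms unfolding vge_def by auto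
    have "min (v (x + y)) (v (- y)) \<le> v ((x + y) + - y)"
      by (rule v_add) (use assms False 1 add uminus in auto)
    then show ?thesis using gt v_uminus[of y] assms v_add[of x y] 1 False by auto
  qed simp
qed

lemma v_unit:
  assumes "x \<in> F" "vge 1 (x - fls_const c)" "c \<noteq> 0"
  shows "x \<noteq> 0" "v x = 0"
  using v_add_eq[OF const _ diff[OF assms(1) const], of c c] assms v_const[of c] by auto

lemma residue_unique:
  assumes "x \<in> F" "vge 1 (x - fls_const c)" "vge 1 (x - fls_const d)"
  shows "c = d"
proof (rule ccontr)
  assume "c \<noteq> d"
  have "vge 1 ((x - fls_const c) - (x - fls_const d))"
    by (intro vge_diff diff assms const)
  then have "vge 1 (fls_const (d - c))" by (simp flip: fls_minus_const)
  then show False using \<open>c \<noteq> d\<close> v_const[of "d - c"] unfolding vge_def by auto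
qed

end

inductive_set alg :: "'k::field fls set \<Rightarrow> 'k fls set" for W where
  alg_const: "fls_const c \<in> alg W"
| alg_gen: "w \<in> W \<Longrightarrow> w \<in> alg W"
| alg_add: "a \<in> alg W \<Longrightarrow> b \<in> alg W \<Longrightarrow> a + b \<in> alg W"
| alg_mult: "a \<in> alg W \<Longrightarrow> b \<in> alg W \<Longrightarrow> a * b \<in> alg W"

lemma alg_0: "0 \<in> alg W"
  using alg_const[of 0] by simp

lemma alg_1: "1 \<in> alg W"
  using alg_const[of 1] by simp

lemma alg_diff:
  assumes "a \<in> alg W" "b \<in> alg W"
  shows "a - b \<in> alg W"
proof -
  have "a + fls_const (-1) * b \<in> alg W" using assms by (intro alg_add alg_mult alg_const)
  moreover have "fls_const (- 1) = (- 1 :: 'a fls)" by (metis fls_const_1 fls_const_uminus)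
  ultimately show ?thesis by simp
qed

definition quotients :: "'k::field fls set \<Rightarrow> 'k fls set" where
  "quotients A = {a / b | a b. a \<in> A \<and> b \<in> A \<and> b \<noteq> 0}"

lemma quotients_base: "a \<in> A \<Longrightarrow> 1 \<in> A \<Longrightarrow> a \<in> quotients A"
  unfolding quotients_def by (intro CollectI exI[of _ a] exI[of _ 1]) auto

lemma subfld_quotients: "subfld (quotients (alg W))"
proof
  show "1 \<in> quotients (alg W)" by (intro quotients_base alg_1)
next
  fix x y assume "x \<in> quotients (alg W)" "y \<in> quotients (alg W)"
  then obtain a b c d where *: "x = a / b" "y = c / d" "a \<in> alg W" "b \<in> alg W" "c \<in> alg W" "d \<in> alg W"
    "b \<noteq> 0" "d \<noteq> 0" unfolding quotients_def by blast
  have "x - y = (a * d - c * b) / (b * d)" using * by (simp add: diff_frac_eq)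
  moreover have "a * d - c * b \<in> alg W" "b * d \<in> alg W" "b * d \<noteq> 0"
    using * by (auto intro!: alg_diff alg_mult)
  ultimately show "x - y \<in> quotients (alg W)" unfolding quotients_def by blast
  have "x * y = (a * c) / (b * d)" using * by simp
  moreover have "a * c \<in> alg W" using * by (auto intro!: alg_mult)
  ultimately show "x * y \<in> quotients (alg W)" 
    using \<open>b * d \<in> alg W\<close> \<open>b * d \<noteq> 0\<close> unfolding quotients_def by blast
next
  fix x assume "x \<in> quotients (alg W)"
  then obtain a b where *: "x = a / b" "a \<in> alg W" "b \<in> alg W" "b \<noteq> 0" unfolding quotients_def by blast
  show "inverse x \<in> quotients (alg W)"
  proof (cases "a = 0")
    case True
    then show ?thesis using * by (auto intro!: quotients_base alg_0 alg_1)
  next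
    case False
    then have "inverse x = b / a" using * by simp
    then show ?thesis using * False unfolding quotients_def by blast
  qed
qed

text \<open>A smooth point of an affine model lies below at most one place: if the maximal ideal of the
  point becomes principal after inverting functions that do not vanish there, then every
  function is a power of the generator times a unit.\<close>

lemma place_unique:
  assumes v: "place F v" and v': "place F v'"
    and WF: "W \<subseteq> F" and quot: "F \<subseteq> quotients (alg W)"
    and pi: "\<pi> \<in> F" "\<pi> \<noteq> 0" "v \<pi> > 0" "v' \<pi> > 0"
    and W: "\<And>w. w \<in> W \<Longrightarrow> place.vge v 0 w \<and> place.vge v' 0 w \<and>
      (\<exists>c h g. h \<in> alg W \<and> g \<in> alg W \<and> h \<noteq> 0 \<and> v h = 0 \<and> v' h = 0 \<and> h * (w - fls_const c) = \<pi> * g)"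
  shows "v = v' \<and> v \<pi> = 1"
proof -
  interpret v: place F v by fact
  interpret v': place F v' by fact
  \<comment> \<open>Here f is regular at both places and congruent to a constant r modulo \<pi>, up
    to a factor h that is a unit at both. This passes from the generators to sums and
    products.\<close>
  define P where "P f \<longleftrightarrow> f \<in> F \<and> v.vge 0 f \<and> v'.vge 0 f \<and> 
    (\<exists>r h g. h \<in> alg W \<and> g \<in> alg W \<and> h \<noteq> 0 \<and> v h = 0 \<and> v' h = 0 \<and> h * (f - fls_const r) = \<pi> * g)" for f
  have algF: "f \<in> F" if "f \<in> alg W" for f
    using that by induction (use WF in \<open>auto intro: v.closed v.const\<close>)
  have P: "P f" if "f \<in> alg W" for f
    using that
  proof induction
    case (alg_const c)
    show ?case unfolding P_def
      by (intro conjI exI[of _ c] exI[of _ 1] exI[of _ 0])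
        (simp_all add: v.const alg_1 alg_0 v.v_1 v'.v_1)
  next
    case (alg_gen w)
    then show ?case unfolding P_def using W[OF alg_gen] WF by blast
  next
    case (alg_add a b)
    from alg_add.IH(1) obtain r h g where 1: "h \<in> alg W" "g \<in> alg W" "h \<noteq> 0" "v h = 0" "v' h = 0" "h * (a - fls_const r) = \<pi> * g"
      unfolding P_def by blast
    from alg_add.IH(2) obtain r' h' g' where 2: "h' \<in> alg W" "g' \<in> alg W" "h' \<noteq> 0" "v h' = 0" "v' h' = 0" "h' * (b - fls_const r') = \<pi> * g'"
      unfolding P_def by blast
    have "(h * h') * (a + b - fls_const (r + r')) = h' * (h * (a - fls_const r)) + h * (h' * (b - fls_const r'))"
      by (simp add: algebra_simps flip: fls_plus_const)
    also have "\<dots> = \<pi> * (g * h' + g' * h)" unfolding 1 2 by (simp add: algebra_simps)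
    finally have "(h * h') * (a + b - fls_const (r + r')) = \<pi> * (g * h' + g' * h)" .
    moreover have "h * h' \<in> alg W" "g * h' + g' * h \<in> alg W" "h * h' \<noteq> 0" "v (h * h') = 0" "v' (h * h') = 0"
      using 1 2 algF by (auto intro: alg.intros simp: v.v_mult v'.v_mult)
    ultimately have "\<exists>r h g. h \<in> alg W \<and> g \<in> alg W \<and> h \<noteq> 0 \<and> v h = 0 \<and> v' h = 0 \<and> h * (a + b - fls_const r) = \<pi> * g"
      by blast
    then show ?case using alg_add v.vge_add v'.vge_add v.add unfolding P_def by blast
  next
    case (alg_mult a b)
    from alg_mult.IH(1) obtain r h g where 1: "h \<in> alg W" "g \<in> alg W" "h \<noteq> 0" "v h = 0" "v' h = 0" "h * (a - fls_const r) = \<pi> * g"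
      unfolding P_def by blast
    from alg_mult.IH(2) obtain r' h' g' where 2: "h' \<in> alg W" "g' \<in> alg W" "h' \<noteq> 0" "v h' = 0" "v' h' = 0" "h' * (b - fls_const r') = \<pi> * g'"
      unfolding P_def by blast
    have "(h * h') * (a * b - fls_const (r * r')) = h' * fls_const r' * (h * (a - fls_const r)) + h * a * (h' * (b - fls_const r'))"
      by (simp add: algebra_simps flip: fls_const_mult_const)
    also have "\<dots> = \<pi> * (h' * fls_const r' * g + h * a * g')" unfolding 1 2 by (simp add: algebra_simps)
    finally have "(h * h') * (a * b - fls_const (r * r')) = \<pi> * (h' * fls_const r' * g + h * a * g')" .
    moreover have "h * h' \<in> alg W" "h' * fls_const r' * g + h * a * g' \<in> alg W" "h * h' \<noteq> 0" "v (h * h') = 0" "v' (h * h') = 0"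
      using 1 2 algF alg_mult.hyps by (auto intro!: alg.alg_add alg.alg_mult alg.alg_const simp: v.v_mult v'.v_mult)
    ultimately have "\<exists>r h g. h \<in> alg W \<and> g \<in> alg W \<and> h \<noteq> 0 \<and> v h = 0 \<and> v' h = 0 \<and> h * (a * b - fls_const r) = \<pi> * g"
      by blast
    then show ?case using alg_mult v.vge_mult[of 0 a 0 b] v'.vge_mult[of 0 a 0 b] v.mult unfolding P_def by auto
  qed
  \<comment> \<open>Induction on the value of f. If the constant r is nonzero, f is a unit at both
    places; otherwise h f = \<pi> g, and g has smaller value because v \<pi> > 0.\<close>
  have main: "\<exists>n::int. v f = n * v \<pi> \<and> v' f = n * v' \<pi>" if "f \<in> alg W" "f \<noteq> 0" for f
    using that
  proof (induction "nat (v f)" arbitrary: f rule: less_induct)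
    case less
    note f = less.prems
    have fF: "f \<in> F" using algF f by blast
    obtain r h g where 1: "h \<in> alg W" "g \<in> alg W" "h \<noteq> 0" "v h = 0" "v' h = 0" "h * (f - fls_const r) = \<pi> * g"
      using P[OF f(1)] unfolding P_def by blast
    have F: "h \<in> F" "g \<in> F" "f - fls_const r \<in> F" using algF 1 fF v.diff v.const by blast+
    have vg: "v.vge 0 g" "v'.vge 0 g" using P[OF 1(2)] unfolding P_def by auto
    show ?case
    proof (cases "r = 0")
      case False
      have "v.vge 1 (f - fls_const r)"
      proof (cases "f - fls_const r = 0")
        case nz: False
        then have "g \<noteq> 0" using 1 by auto
        then have "v (f - fls_const r) = v \<pi> + v g"
          using v.v_mult[OF F(1) 1(3) F(3) nz] v.v_mult[OF pi(1,2) F(2) \<open>g \<noteq> 0\<close>] 1(4-6) by simp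
        then show ?thesis using pi vg \<open>g \<noteq> 0\<close> unfolding v.vge_def by auto
      qed simp
      moreover have "v'.vge 1 (f - fls_const r)"
      proof (cases "f - fls_const r = 0")
        case nz: False
        then have "g \<noteq> 0" using 1 by auto
        then have "v' (f - fls_const r) = v' \<pi> + v' g"
          using v'.v_mult[OF F(1) 1(3) F(3) nz] v'.v_mult[OF pi(1,2) F(2) \<open>g \<noteq> 0\<close>] 1(4-6) by simp
        then show ?thesis using pi vg \<open>g \<noteq> 0\<close> unfolding v'.vge_def by auto
      qed simp
      ultimately have "v f = 0" "v' f = 0" using v.v_unit(2)[OF fF _ False] v'.v_unit(2)[OF fF _ False] by auto
      then show ?thesis by (intro exI[of _ 0]) auto
    next
      case True
      then have hf: "h * f = \<pi> * g" using 1 by simp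
      then have g0: "g \<noteq> 0" using f 1 by auto
      have e: "v f = v \<pi> + v g" "v' f = v' \<pi> + v' g"
        using v.v_mult[OF F(1) 1(3) fF f(2)] v.v_mult[OF pi(1,2) F(2) g0]
          v'.v_mult[OF F(1) 1(3) fF f(2)] v'.v_mult[OF pi(1,2) F(2) g0] 1(4,5) hf by simp_all
      have "nat (v g) < nat (v f)" using e pi vg g0 unfolding v.vge_def by auto
      then obtain n where "v g = n * v \<pi>" "v' g = n * v' \<pi>" using less.hyps 1 g0 by blast
      then show ?thesis using e by (intro exI[of _ "n + 1"]) (auto simp: algebra_simps)
    qed
  qed
  have mainF: "\<exists>n::int. v x = n * v \<pi> \<and> v' x = n * v' \<pi>" if x: "x \<in> F" "x \<noteq> 0" for x
  proof -
    obtain a b where ab: "x = a / b" "a \<in> alg W" "b \<in> alg W" "b \<noteq> 0"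
      using subsetD[OF quot x(1)] unfolding quotients_def by blast
    then have a0: "a \<noteq> 0" using x by auto
    obtain m n where "v a = m * v \<pi>" "v' a = m * v' \<pi>" "v b = n * v \<pi>" "v' b = n * v' \<pi>"
      using main[OF ab(2) a0] main[OF ab(3,4)] by blast
    then show ?thesis using ab a0 algF
      by (intro exI[of _ "m - n"]) (auto simp: v.v_div v'.v_div algebra_simps)
  qed
  \<comment> \<open>All values are multiples of v \<pi>, and the value 1 occurs since v is
    normalised.\<close>
  have p1: "v \<pi> = 1"
  proof -
    obtain x where "x \<in> F" "x \<noteq> 0" "v x = 1" using v.v_surj by blast
    then obtain n where "1 = n * v \<pi>" using mainF by metis
    then show ?thesis using pi(3) by (metis pos_zmult_eq_1_iff mult.commute)
  qed
  have p2: "v' \<pi> = 1"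
  proof -
    obtain x where "x \<in> F" "x \<noteq> 0" "v' x = 1" using v'.v_surj by blast
    then obtain n where "1 = n * v' \<pi>" using mainF by metis
    then show ?thesis using pi(4) by (metis pos_zmult_eq_1_iff mult.commute)
  qed
  have "v = v'"
  proof
    fix x show "v x = v' x"
    proof (cases "x \<in> F \<and> x \<noteq> 0")
      case True
      then show ?thesis using mainF[of x] p1 p2 by auto
    qed (use v.v_dummy v'.v_dummy in auto)
  qed
  then show ?thesis using p1 by blast
qed

lemma alg_closed_poly_induct [case_names const linear_factor]:
  fixes p :: "'k::alg_closed_field poly"
  assumes const: "\<And>c. P [:c:]" and step: "\<And>r q. P q \<Longrightarrow> P ([:- r, 1:] * q)"
  shows "P p"
proof (induction "degree p" arbitrary: p)
  case 0
  then obtain c where "p = [:c:]" by (metis degree_eq_zeroE)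
  then show ?case using const by simp
next
  case (Suc n)
  then obtain r where "poly p r = 0" using alg_closed_imp_poly_has_root[of p] by auto
  then obtain q where q: "p = [:- r, 1:] * q" by (metis poly_eq_0_iff_dvd dvdE)
  then have "q \<noteq> 0" using Suc(2) by auto
  then have "degree p = Suc (degree q)" unfolding q by (subst degree_mult_eq) auto
  then show ?case using Suc step q by auto
qed

text \<open>Polynomials over K split into linear factors, so a polynomial vanishing at u forces u to
  be one of its roots in K.\<close>

lemma transc_nonconst:
  fixes u :: "'k::alg_closed_field fls"
  assumes "u \<notin> range fls_const"
  shows "transc u"
  unfolding transc_def
proof (intro allI impI)
  fix p show "ev p u = 0 \<Longrightarrow> p = 0"
  proof (induction p rule: alg_closed_poly_induct)
    case (linear_factor r q)
    have "u - fls_const r \<noteq> 0" using assms by auto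
    then have "ev [:- r, 1:] u \<noteq> 0" by simp
    then have "ev q u = 0" using linear_factor(2) by (metis ev_mult mult_eq_0_iff)
    then show ?case using linear_factor(1) by simp
  qed simp
qed

text \<open>Coefficient n of g^2 = f reads 2 c g_n + (products of earlier coefficients) = f_n.
  Solved for g_n, this is the recursion, with starting value c.\<close>

function sqrt_coeff :: "'k::field fps \<Rightarrow> 'k \<Rightarrow> nat \<Rightarrow> 'k" where
  "sqrt_coeff f c n = (if n = 0 then c
     else (fps_nth f n - (\<Sum>i\<in>{1..<n}. sqrt_coeff f c i * sqrt_coeff f c (n - i))) / (2 * c))"
  by auto
termination by (relation "measure (\<lambda>(f, c, n). n)") auto

declare sqrt_coeff.simps [simp del]

lemma sqrt_fps:
  fixes c :: "'k::field"
  assumes "(2::'k) \<noteq> 0" "c \<noteq> 0" "fps_nth f 0 = c^2"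
  shows "\<exists>g. g^2 = f \<and> fps_nth g 0 = c"
proof (intro exI conjI)
  let ?g = "Abs_fps (sqrt_coeff f c)"
  show "fps_nth ?g 0 = c" by (simp add: sqrt_coeff.simps)
  show "?g^2 = f"
  proof (rule fps_ext)
    fix n
    show "fps_nth (?g^2) n = fps_nth f n"
    proof (cases "n = 0")
      case True
      then show ?thesis using assms(3) by (simp add: power2_eq_square fps_mult_nth sqrt_coeff.simps)
    next
      case False
      let ?h = "\<lambda>i. sqrt_coeff f c i * sqrt_coeff f c (n - i)"
      have "{0..n} = insert 0 (insert n {1..<n})" using False by auto
      then have "fps_nth (?g^2) n = ?h 0 + (?h n + sum ?h {1..<n})"
        using False by (simp add: power2_eq_square fps_mult_nth)
      also have "\<dots> = 2 * c * sqrt_coeff f c n + sum ?h {1..<n}"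
        by (simp add: sqrt_coeff.simps[of f c 0])
      also have "\<dots> = fps_nth f n"
        using False assms(1,2) by (subst sqrt_coeff.simps) simp
      finally show ?thesis .
    qed
  qed
qed

text \<open>The order of vanishing of Laurent series is pulled back along \<phi>. The element u of
  order 1 makes the resulting valuation normalised, that is, surjective onto the integers.\<close>

lemma place_of_hom:
  assumes F: "subfld F" and h: "fhom F \<phi>" and c: "\<And>c. fls_const c \<in> F" "\<And>c. \<phi> (fls_const c) = fls_const c"
    and u: "u \<in> F" "fls_subdegree (\<phi> u) = 1"
  shows "place F (\<lambda>x. if x \<in> F \<and> x \<noteq> 0 then fls_subdegree (\<phi> x) else 0)"
proof -
  interpret subfld F by fact
  note nz = fhom_eq_0_iff[OF h]
  let ?v = "\<lambda>x. if x \<in> F \<and> x \<noteq> 0 then fls_subdegree (\<phi> x) else 0"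
  have surj: "n \<in> ?v ` (F - {0})" for n
  proof -
    have u0: "u \<noteq> 0" using u fhom_zero[OF h] by auto
    define x where "x = (if n \<ge> 0 then u ^ nat n else inverse (u ^ nat (- n)))"
    have "x \<in> F" "x \<noteq> 0" using u u0 pow inv by (auto simp: x_def)
    moreover have "fls_subdegree (\<phi> x) = n"
      using u pow by (simp add: x_def fhom_inverse[OF h] fhom_pow[OF h] fls_subdegree_pow)
    ultimately show ?thesis by (intro image_eqI[of _ _ x]) auto
  qed
  show ?thesis
  proof
    show "?v \<in> places (range fls_const) (set_ring F)"
      unfolding places_def set_ring_simps
    proof (intro CollectI conjI ballI impI allI)
      fix x y assume xy: "x \<in> F - {0}" "y \<in> F - {0}"
      then show "?v (x * y) = ?v x + ?v y"
        using mult nz by (auto simp: fhom_mult[OF h])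
      assume "x + y \<noteq> 0"
      then show "min (?v x) (?v y) \<le> ?v (x + y)"
        using xy add nz[of "x + y"] fls_plus_subdegree[of "\<phi> x" "\<phi> y"] by (auto simp: fhom_add[OF h])
    qed (use surj c in auto)
  qed (rule c)
qed

text \<open>With parameter X at infinity, t = X^(-2) and a root of t + i is X^(-1) times a root of 1
  + i X^2 with constant term s i. Replacing X by -X flips all signs at once; s 0 = 1 removes this
  ambiguity and leaves 2^4 sign vectors.\<close>

lemma tower_at_infinity:
  assumes two: "(2 :: 'k::alg_closed_field) \<noteq> 0" and s: "s 0 = 1" "\<And>i. i < 5 \<Longrightarrow> s i = 1 \<or> s i = (- 1 :: 'k)"
  shows "transc (fls_X_inv ^ 2 :: 'k fls)"
    and "\<exists>h. h 0 = 1 \<and> (\<forall>i<5. fps_nth (h i) 0 = s i \<and>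
      (fls_X_inv * fps_to_fls (h i)) ^ 2 = fls_X_inv ^ 2 + of_nat i)"
proof -
  have "fls_X_inv ^ 2 \<notin> range (fls_const :: 'k \<Rightarrow> 'k fls)"
  proof
    assume "fls_X_inv ^ 2 \<in> range (fls_const :: 'k \<Rightarrow> 'k fls)"
    then obtain a :: 'k where "fls_X_inv ^ 2 = fls_const a" by auto
    then have "fls_subdegree (fls_X_inv ^ 2 :: 'k fls) = 0" by simp
    then show False by (simp only: fls_subdegree_fls_X_inv_pow)
  qed
  then show "transc (fls_X_inv ^ 2 :: 'k fls)" by (rule transc_nonconst)
  have "\<exists>h. h^2 = 1 + fps_const (of_nat i) * fps_X ^ 2 \<and> fps_nth h 0 = s i \<and> (i = 0 \<longrightarrow> h = 1)" if "i < 5" for i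
  proof (cases "i = 0")
    case True
    then show ?thesis using s by (intro exI[of _ 1]) auto
  next
    case False
    have si: "s i = 1 \<or> s i = - 1" using s(2) that by auto
    have "\<exists>g. g^2 = 1 + fps_const (of_nat i) * fps_X ^ 2 \<and> fps_nth g 0 = s i"
      by (intro sqrt_fps two) (use si in auto)
    then show ?thesis using False by auto
  qed
  then obtain h where h: "\<And>i. i < 5 \<Longrightarrow> h i ^ 2 = 1 + fps_const (of_nat i) * fps_X ^ 2" 
      "\<And>i. i < 5 \<Longrightarrow> fps_nth (h i) 0 = s i" "h 0 = 1"
    by (metis zero_less_numeral)
  have XX: "fls_X_inv * fls_X = (1 :: 'k fls)"
    by (metis fls_X_subdegree fls_inverse_X fls_zero_subdegree left_inverse zero_neq_one)
  have "(fls_X_inv * fps_to_fls (h i)) ^ 2 = fls_X_inv ^ 2 + of_nat i" if "i < 5" for i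
  proof -
    have "fps_to_fls (h i) ^ 2 = fps_to_fls (h i ^ 2)" by (simp only: fps_to_fls_power)
    also have "\<dots> = 1 + fls_const (of_nat i) * fls_X ^ 2"
      by (simp only: h(1)[OF that] fps_to_fls_plus fls_times_fps_to_fls fps_to_fls_power fps_one_to_fls fps_const_to_fls fps_X_to_fls)
    finally have "fps_to_fls (h i) ^ 2 = 1 + fls_const (of_nat i) * fls_X ^ 2" .
    then have "(fls_X_inv * fps_to_fls (h i)) ^ 2 = fls_X_inv ^ 2 + fls_const (of_nat i) * (fls_X_inv * fls_X) ^ 2"
      by (simp add: power_mult_distrib algebra_simps)
    then show ?thesis by (simp only: XX) (simp add: fls_of_nat)
  qed
  then show "\<exists>h. h 0 = 1 \<and> (\<forall>i<5. fps_nth (h i) 0 = s i \<and>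
      (fls_X_inv * fps_to_fls (h i)) ^ 2 = fls_X_inv ^ 2 + of_nat i)"
    using h by blast
qed

text \<open>The residue field of v is the field of constants. This is the degree-one property that
  lets l(D) grow by at most one when D grows by one at v.\<close>

definition has_residues :: "'k::field fls set \<Rightarrow> ('k fls \<Rightarrow> int) \<Rightarrow> bool" where
  "has_residues F v \<longleftrightarrow> (\<forall>z\<in>F. z \<noteq> 0 \<longrightarrow> v z = 0 \<longrightarrow> (\<exists>c. place.vge v 1 (z - fls_const c)))"

text \<open>The residue is the constant coefficient of the image series.\<close>

lemma has_residues_of_hom:
  assumes F: "subfld F" and h: "fhom F \<phi>" and c: "\<And>c. fls_const c \<in> F" "\<And>c. \<phi> (fls_const c) = fls_const c"
    and pl: "place F (\<lambda>x. if x \<in> F \<and> x \<noteq> 0 then fls_subdegree (\<phi> x) else 0)"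
  shows "has_residues F (\<lambda>x. if x \<in> F \<and> x \<noteq> 0 then fls_subdegree (\<phi> x) else 0)"
  unfolding has_residues_def place.vge_def[OF pl]
proof (intro ballI impI)
  interpret subfld F by fact
  fix z assume z: "z \<in> F" "z \<noteq> 0" "(if z \<in> F \<and> z \<noteq> 0 then fls_subdegree (\<phi> z) else 0) = 0"
  define a where "a = fls_nth (\<phi> z) 0"
  have m: "z - fls_const a \<in> F" using z c diff by blast
  have "1 \<le> fls_subdegree (\<phi> (z - fls_const a))" if "z - fls_const a \<noteq> 0"
  proof (rule fls_subdegree_geI)
    show "\<phi> (z - fls_const a) \<noteq> 0" using fhom_eq_0_iff[OF h m] that by simp
    fix k :: int assume "k < 1"
    then show "fls_nth (\<phi> (z - fls_const a)) k = 0"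
      using z c by (cases "k = 0") (auto simp: fhom_diff[OF h] a_def)
  qed
  then show "\<exists>c. z - fls_const c = 0 \<or> 1 \<le> (if z - fls_const c \<in> F \<and> z - fls_const c \<noteq> 0
      then fls_subdegree (\<phi> (z - fls_const c)) else 0)"
    using m by (intro exI[of _ a]) auto
qed

section \<open>Points of the curve and the places above them\<close>

context sqrt_tower
begin

abbreviation "F \<equiv> Tw 5"

sublocale F: subfld F
  using subfld_Tw by simp

definition Pl :: "('k fls \<Rightarrow> int) set" where
  "Pl = places (range fls_const) (set_ring F)"

lemma PlI: "place F v \<Longrightarrow> v \<in> Pl"
  unfolding Pl_def by (rule place.place)

lemma place_Pl: "v \<in> Pl \<Longrightarrow> place F v"
  unfolding Pl_def by unfold_locales (auto simp: const_Tw)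

lemma y_F: "i < 5 \<Longrightarrow> y i \<in> F"
  and t_F: "t \<in> F"
  and const_F: "fls_const c \<in> F"
  by (simp_all add: y_Tw t_Tw const_Tw)

lemma t_neq_const: "t \<noteq> fls_const a"
proof
  assume "t = fls_const a"
  then have "ev [:- a, 1:] t = 0" by simp
  then show False using tr unfolding transc_def by fastforce
qed

lemma t_nonzero: "t \<noteq> 0"
  using t_neq_const[of 0] by simp

text \<open>The number c i is the value of y i, so t has the value c 0 ^ 2. In
  \<open>infinite_point\<close> the number s i is the value of y i / y 0 instead.\<close>

definition finite_point :: "(nat \<Rightarrow> 'k) \<Rightarrow> bool" where
  "finite_point c \<longleftrightarrow> (\<forall>i<5. c i ^ 2 = c 0 ^ 2 + of_nat i)"

definition infinite_point :: "(nat \<Rightarrow> 'k) \<Rightarrow> bool" where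
  "infinite_point s \<longleftrightarrow> s 0 = 1 \<and> (\<forall>i<5. s i = 1 \<or> s i = - 1)"

definition lies_at :: "('k fls \<Rightarrow> int) \<Rightarrow> (nat \<Rightarrow> 'k) \<Rightarrow> bool" where
  "lies_at v c \<longleftrightarrow> (\<forall>i<5. place.vge v 1 (y i - fls_const (c i)))"

definition lies_at_inf :: "('k fls \<Rightarrow> int) \<Rightarrow> (nat \<Rightarrow> 'k) \<Rightarrow> bool" where
  "lies_at_inf v s \<longleftrightarrow> v (y 0) < 0 \<and> (\<forall>i<5. place.vge v 1 (y i / y 0 - fls_const (s i)))"

lemma finite_point_zero_unique: "finite_point c \<Longrightarrow> i < 5 \<Longrightarrow> j < 5 \<Longrightarrow> c i = 0 \<Longrightarrow> c j = 0 \<Longrightarrow> i = j"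
  using inj5[of i j] unfolding finite_point_def by (metis add_left_cancel)

lemma fps_vge:
  assumes "fps_nth g 0 = c" "fps_to_fls g - fls_const c \<noteq> 0"
  shows "1 \<le> fls_subdegree (fps_to_fls g - fls_const c)"
proof -
  have eq: "fps_to_fls g - fls_const c = fps_to_fls (g - fps_const c)" by simp
  then have "g - fps_const c \<noteq> 0" using assms(2) by (metis fps_zero_to_fls)
  then have "subdegree (g - fps_const c) \<noteq> 0" using assms(1) by (simp add: subdegree_eq_0_iff)
  then show ?thesis unfolding eq fls_subdegree_fls_to_fps by simp
qed

lemma finite_place_exists:
  assumes c: "finite_point c"
  shows "\<exists>v\<in>Pl. lies_at v c \<and> has_residues F v"
proof -
  \<comment> \<open>The embedding will send t to c 0 ^ 2 + X^k. A power series root of c i ^ 2 + X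
    exists when c i is nonzero. Where some c j vanishes, the covering of the t-line is ramified, and
    k = 2 makes X a root of X^2.\<close>
  define k :: nat where "k = (if \<exists>j<5. c j = 0 then 2 else 1)"
  have "\<exists>g. g^2 = fps_const (c i ^ 2) + fps_X ^ k \<and> fps_nth g 0 = c i" if "i < 5" for i
  proof (cases "c i = 0")
    case True
    then have "k = 2" using that by (auto simp: k_def)
    then show ?thesis using True by (intro exI[of _ fps_X]) auto
  next
    case False
    then show ?thesis by (intro sqrt_fps two) (auto simp: k_def)
  qed
  then obtain g where g: "\<And>i. i < 5 \<Longrightarrow> g i ^ 2 = fps_const (c i ^ 2) + fps_X ^ k" 
      "\<And>i. i < 5 \<Longrightarrow> fps_nth (g i) 0 = c i"
    by metis
  define z where "z i = fps_to_fls (g i)" for i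
  define t' :: "'k fls" where "t' = fls_const (c 0 ^ 2) + fls_X ^ k"
  have k: "k > 0" by (simp add: k_def)
  have "t' \<notin> range fls_const"
  proof
    assume "t' \<in> range fls_const"
    then obtain a where "t' = fls_const a" by auto
    then have "fls_X ^ k = fls_const (a - c 0 ^ 2)" by (simp add: t'_def eq_diff_eq add.commute flip: fls_minus_const)
    then have "fls_subdegree (fls_X ^ k :: 'k fls) = fls_subdegree (fls_const (a - c 0 ^ 2))" by (rule arg_cong)
    then show False using k by (simp only: fls_subdegree_fls_X_pow fls_const_subdegree)
  qed
  then have tr': "transc t'" by (rule transc_nonconst)
  have zsq': "z i ^ 2 = fls_const (c i ^ 2) + fls_X ^ k" if "i < 5" for i
  proof -
    have "z i ^ 2 = fps_to_fls (g i ^ 2)" by (simp only: z_def fps_to_fls_power)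
    also have "\<dots> = fls_const (c i ^ 2) + fls_X ^ k"
      by (simp add: g(1)[OF that] fps_to_fls_power)
    finally show ?thesis .
  qed
  have zsq: "z i ^ 2 = t' + of_nat i" if "i < 5" for i
  proof -
    have "c i ^ 2 = c 0 ^ 2 + of_nat i" using c that unfolding finite_point_def by blast
    then have "z i ^ 2 = fls_const (c 0 ^ 2) + fls_const (of_nat i) + fls_X ^ k"
      using zsq'[OF that] by (simp only: fls_plus_const)
    then show ?thesis by (simp only: t'_def fls_of_nat add_ac)
  qed
  obtain \<phi> where \<phi>: "fhom F \<phi>" "\<And>p. \<phi> (ev p t) = ev p t'" "\<And>i. i < 5 \<Longrightarrow> \<phi> (y i) = z i"
    using Tw_hom[OF _ tr', of 5 z] zsq by auto
  have \<phi>c: "\<phi> (fls_const a) = fls_const a" for a using \<phi>(2)[of "[:a:]"] by simp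
  have \<phi>t: "\<phi> t = t'" using \<phi>(2)[of "[:0, 1:]"] by simp
  \<comment> \<open>A local parameter: y j at a ramified point, t - c 0 ^ 2 elsewhere.\<close>
  have "\<exists>u\<in>F. fls_subdegree (\<phi> u) = 1"
  proof (cases "\<exists>j<5. c j = 0")
    case True
    then obtain j where j: "j < 5" "c j = 0" by blast
    then have "z j ^ 2 = fls_X ^ 2" using zsq'[OF j(1)] True by (simp add: k_def)
    then have "2 * fls_subdegree (z j) = 2" by (metis fls_subdegree_fls_X_pow fls_subdegree_pow of_nat_numeral)
    then show ?thesis using \<phi>(3)[OF j(1)] y_F[OF j(1)] by (intro bexI[of _ "y j"]) auto
  next
    case False
    then have "k = 1" unfolding k_def by simp
    then have "\<phi> (t - fls_const (c 0 ^ 2)) = fls_X"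
      using F.fhom_diff[OF \<phi>(1) t_F const_F] \<phi>t \<phi>c by (simp add: t'_def)
    then show ?thesis using F.diff[OF t_F const_F] by (intro bexI[of _ "t - fls_const (c 0 ^ 2)"]) auto
  qed
  then obtain u where u: "u \<in> F" "fls_subdegree (\<phi> u) = 1" by blast
  define v where "v = (\<lambda>x. if x \<in> F \<and> x \<noteq> 0 then fls_subdegree (\<phi> x) else 0)"
  have pl: "place F v" unfolding v_def by (rule place_of_hom[OF _ \<phi>(1) const_F \<phi>c u]) (rule F.subfld_axioms)
  have "lies_at v c" unfolding lies_at_def
  proof (intro allI impI)
    fix i :: nat assume i: "i < 5"
    have "1 \<le> v (y i - fls_const (c i))" if "y i - fls_const (c i) \<noteq> 0"
    proof -
      have m: "y i - fls_const (c i) \<in> F" using i y_F const_F F.diff by blast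
      have e: "\<phi> (y i - fls_const (c i)) = fps_to_fls (g i) - fls_const (c i)"
        using F.fhom_diff[OF \<phi>(1) y_F[OF i] const_F] \<phi>(3)[OF i] \<phi>c by (simp add: z_def)
      moreover have "\<phi> (y i - fls_const (c i)) \<noteq> 0" using F.fhom_eq_0_iff[OF \<phi>(1) m] that by simp
      ultimately show ?thesis using fps_vge[OF g(2)[OF i]] m that by (simp add: v_def)
    qed
    then show "place.vge v 1 (y i - fls_const (c i))" unfolding place.vge_def[OF pl] by blast
  qed
  moreover have "has_residues F v" unfolding v_def
    by (rule has_residues_of_hom[OF F.subfld_axioms \<phi>(1) const_F \<phi>c pl[unfolded v_def]])
  ultimately show ?thesis using PlI[OF pl] by blast
qed

lemma infinite_place_exists:
  assumes s: "infinite_point s"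
  shows "\<exists>v\<in>Pl. lies_at_inf v s \<and> has_residues F v"
proof -
  have s': "s 0 = 1" "\<And>i. i < 5 \<Longrightarrow> s i = 1 \<or> s i = - 1" using s unfolding infinite_point_def by auto
  define t' :: "'k fls" where "t' = fls_X_inv ^ 2"
  obtain h where h: "\<And>i. i < 5 \<Longrightarrow> (fls_X_inv * fps_to_fls (h i)) ^ 2 = t' + of_nat i"
      "\<And>i. i < 5 \<Longrightarrow> fps_nth (h i) 0 = s i" "h 0 = 1"
    using tower_at_infinity(2)[of s, OF two s'] unfolding t'_def by blast
  define z where "z i = fls_X_inv * fps_to_fls (h i)" for i
  have tr': "transc t'" unfolding t'_def by (rule tower_at_infinity(1)[of s, OF two s'])
  have zsq: "z i ^ 2 = t' + of_nat i" if "i < 5" for i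
    unfolding z_def by (rule h(1)[OF that])
  have XX: "fls_X_inv * fls_X = (1 :: 'k fls)"
    by (metis fls_X_subdegree fls_inverse_X fls_zero_subdegree left_inverse zero_neq_one)
  obtain \<phi> where \<phi>: "fhom F \<phi>" "\<And>p. \<phi> (ev p t) = ev p t'" "\<And>i. i < 5 \<Longrightarrow> \<phi> (y i) = z i"
    using Tw_hom[OF _ tr', of 5 z] zsq by auto
  have \<phi>c: "\<phi> (fls_const a) = fls_const a" for a using \<phi>(2)[of "[:a:]"] by simp
  have y0: "\<phi> (y 0) = fls_X_inv" "y 0 \<in> F" "y 0 \<noteq> 0" using \<phi>(3)[of 0] h(3) y_F y_nonzero[of 0] by (auto simp: z_def)
  \<comment> \<open>As y 0 goes to X^(-1), its inverse is a local parameter.\<close>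
  have u: "inverse (y 0) \<in> F" "fls_subdegree (\<phi> (inverse (y 0))) = 1"
    using y0 F.inv F.fhom_inverse[OF \<phi>(1)] by auto
  define v where "v = (\<lambda>x. if x \<in> F \<and> x \<noteq> 0 then fls_subdegree (\<phi> x) else 0)"
  have pl: "place F v" unfolding v_def by (rule place_of_hom[OF _ \<phi>(1) const_F \<phi>c u]) (rule F.subfld_axioms)
  have "lies_at_inf v s" unfolding lies_at_inf_def
  proof (intro conjI allI impI)
    show "v (y 0) < 0" using y0 by (simp add: v_def)
    fix i :: nat assume i: "i < 5"
    have "1 \<le> v (y i / y 0 - fls_const (s i))" if "y i / y 0 - fls_const (s i) \<noteq> 0"
    proof -
      have d: "y i / y 0 \<in> F" using i y_F y0 F.div by blast
      then have m: "y i / y 0 - fls_const (s i) \<in> F" using const_F F.diff by blast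
      have "\<phi> (y i / y 0) = fps_to_fls (h i)"
        using F.fhom_div[OF \<phi>(1) y_F[OF i] y0(2)] \<phi>(3)[OF i] y0(1) XX unfolding z_def
        by (metis mult_zero_left nonzero_mult_div_cancel_left zero_neq_one)
      then have e: "\<phi> (y i / y 0 - fls_const (s i)) = fps_to_fls (h i) - fls_const (s i)"
        using F.fhom_diff[OF \<phi>(1) d const_F] \<phi>c by simp
      moreover have "\<phi> (y i / y 0 - fls_const (s i)) \<noteq> 0" using F.fhom_eq_0_iff[OF \<phi>(1) m] that by simp
      ultimately show ?thesis using fps_vge[OF h(2)[OF i]] m that by (simp add: v_def)
    qed
    then show "place.vge v 1 (y i / y 0 - fls_const (s i))" unfolding place.vge_def[OF pl] by blast
  qed
  moreover have "has_residues F v" unfolding v_def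
    by (rule has_residues_of_hom[OF F.subfld_axioms \<phi>(1) const_F \<phi>c pl[unfolded v_def]])
  ultimately show ?thesis using PlI[OF pl] by blast
qed

end

context sqrt_tower
begin

lemma of_nat_const: "of_nat i = (fls_const (of_nat i) :: 'k fls)"
  by (simp add: fls_of_nat)

lemma F_quotients:
  assumes "\<And>i. i < 5 \<Longrightarrow> y i \<in> quotients (alg W)"
  shows "F \<subseteq> quotients (alg W)"
proof -
  interpret Q: subfld "quotients (alg W)" by (rule subfld_quotients)
  have "y 0 * y 0 \<in> quotients (alg W)" using assms[of 0] Q.mult by simp
  then have "t \<in> quotients (alg W)" using y_sq[of 0] by (simp add: power2_eq_square)
  then show ?thesis
    by (intro Tw_least Q.subfld_axioms assms) (auto intro: quotients_base alg_const alg_1)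
qed

lemma v_ev_t_zero:
  assumes v: "place F v" and "\<And>a. t - fls_const a \<noteq> 0 \<Longrightarrow> v (t - fls_const a) = 0" "p \<noteq> 0"
  shows "v (ev p t) = 0"
proof -
  interpret v: place F v by fact
  show ?thesis using assms(3)
  proof (induction p rule: alg_closed_poly_induct)
    case (const c)
    then show ?case by (simp add: v.v_const)
  next
    case (linear_factor r q)
    have "ev q t \<noteq> 0" "ev [:- r, 1:] t \<noteq> 0" using linear_factor(2) tr unfolding transc_def by fastforce+
    then have "v (ev [:- r, 1:] t * ev q t) = v (ev [:- r, 1:] t) + v (ev q t)"
      by (intro v.v_mult ev_Tw) auto
    moreover have "v (ev [:- r, 1:] t) = 0" using assms(2)[of r] t_neq_const[of r] by simp
    moreover have "q \<noteq> 0" using linear_factor(2) by auto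
    then have "v (ev q t) = 0" by (rule linear_factor(1))
    ultimately show ?case by (simp only: ev_mult add_0)
  qed
qed

text \<open>If no t - a had positive value, all of them, hence all nonzero polynomials in t, would
  have value 0 and v would be trivial on K(t). Triviality climbs the tower because f = A + B y n
  satisfies f^2 = 2 A f - N, where N is a nonzero norm of value 0. This contradicts surjectivity of
  v.\<close>

lemma residue_of_t_exists:
  assumes v: "v \<in> Pl" and t0: "v t \<ge> 0"
  shows "\<exists>a. place.vge v 1 (t - fls_const a)"
proof (rule ccontr)
  assume contra: "\<nexists>a. place.vge v 1 (t - fls_const a)"
  interpret v: place F v by (rule place_Pl[OF v])
  have "v (t - fls_const a) = 0" for a
  proof -
    have "v.vge 0 (t - fls_const a)" using t0 t_F const_F by (intro v.vge_diff) (auto simp: v.vge_def v.v_const)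
    moreover have "\<not> v.vge 1 (t - fls_const a)" using contra by blast
    ultimately show ?thesis unfolding v.vge_def by auto
  qed
  then have p0: "v (ev p t) = 0" if "p \<noteq> 0" for p using v_ev_t_zero[OF v.place_axioms _ that] by blast
  have "\<forall>x\<in>Tw n. x \<noteq> 0 \<longrightarrow> v x = 0" if "n \<le> 5" for n
    using that
  proof (induction n)
    case 0
    show ?case
    proof (intro ballI impI)
      fix x assume x: "x \<in> Tw 0" "x \<noteq> 0"
      then obtain p q where pq: "x = ev p t / ev q t" "ev q t \<noteq> 0" using ratfE[of x t] by auto
      then have "ev p t \<noteq> 0" "p \<noteq> 0" "q \<noteq> 0" using x by auto
      then show "v x = 0" using pq p0 ev_Tw[of 5] by (simp add: v.v_div)
    qed
  next
    case (Suc n)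
    then have n: "n < 5" and IH: "\<And>x. x \<in> Tw n \<Longrightarrow> x \<noteq> 0 \<Longrightarrow> v x = 0" by auto
    interpret S: subfld "Tw n" using subfld_Tw n by simp
    show ?case
    proof (intro ballI impI)
      fix f assume f: "f \<in> Tw (Suc n)" "f \<noteq> 0"
      then obtain A B where AB: "A \<in> Tw n" "B \<in> Tw n" "f = A + B * y n" unfolding tower.simps adj_def by blast
      have TF: "x \<in> F" if "x \<in> Tw n" for x using Tw_mono[of n 5] n that by auto
      have fF: "f \<in> F" using Tw_mono[of "Suc n" 5] n f by auto
      define N where "N = A^2 - B^2 * y n ^ 2"
      have N: "N \<in> Tw n" unfolding N_def using S.diff[OF S.pow[OF AB(1), of 2] S.mult[OF S.pow[OF AB(2), of 2] y_sq_Tw[OF n]]] .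
      have eq: "N = f * (A - B * y n)" using AB(3) by (simp add: N_def algebra_simps power2_eq_square)
      have "A - B * y n \<noteq> 0"
      proof
        assume "A - B * y n = 0"
        then have "A + (- B) * y n = 0 + 0 * y n" by simp
        then have "A = 0" "- B = 0"
          using S.adj_unique[OF y_notin_Tw[OF n] AB(1) S.uminus[OF AB(2)] S.zero S.zero] by blast+
        then show False using f AB by simp
      qed
      then have N0: "N \<noteq> 0" using eq f by simp
      have vN: "v N = 0" using IH N N0 by blast
      have A2: "v.vge 0 (2 * A)" "2 * A \<in> Tw n"
        using IH[of "2 * A"] S.mult[OF S.numeral AB(1)] unfolding v.vge_def by fastforce+
      \<comment> \<open>A positive value of f would force a positive value of N. A negative one
        contradicts f = 2 A - N / f, whose right side is then regular.\<close>
      have q: "N = (2 * A) * f - f * f" using AB(3) eq by (simp add: algebra_simps)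
      show "v f = 0"
      proof (rule ccontr)
        assume "v f \<noteq> 0"
        then consider "v f \<ge> 1" | "v f \<le> -1" by linarith
        then show False
        proof cases
          case 1
          then have f1: "v.vge 1 f" by (simp add: v.vge_def)
          have "v.vge (0 + 1) ((2 * A) * f)" by (intro v.vge_mult A2 f1 TF fF)
          moreover have "v.vge (1 + 1) (f * f)" by (intro v.vge_mult f1 fF)
          ultimately have "v.vge 1 N" unfolding q
            by (intro v.vge_diff F.mult TF A2 fF) (auto intro: v.vge_mono)
          then show False using vN N0 unfolding v.vge_def by auto
        next
          case 2
          have NF: "N / f \<in> F" using N TF fF F.div by blast
          have "v.vge 0 (N / f)" using v.v_div[OF TF[OF N] N0 fF f(2)] vN 2 unfolding v.vge_def by auto
          then have "v.vge 0 (2 * A - N / f)" by (intro v.vge_diff A2 TF NF)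
          moreover have "2 * A - N / f = f" unfolding q using f by (simp add: field_simps)
          ultimately show False using 2 f unfolding v.vge_def by auto
        qed
      qed
    qed
  qed
  then have "v x = 0" if "x \<in> F" "x \<noteq> 0" for x using that by blast
  then show False using v.v_surj[of 1] by force
qed

text \<open>The products (y i - r) (y i + r) = t - a at a finite place and (y i / y 0 - 1) (y i / y
  0 + 1) = i / t at infinity have positive value, hence so has one of the two factors. This fixes
  the value of each root.\<close>

lemma place_finite_or_infinite:
  assumes v: "v \<in> Pl"
  shows "(0 \<le> v t \<and> (\<exists>c. finite_point c \<and> lies_at v c)) \<or> (v t < 0 \<and> (\<exists>s. infinite_point s \<and> lies_at_inf v s))"
proof -
  interpret v: place F v by (rule place_Pl[OF v])
  have split: "v.vge 1 (z - fls_const 1 * w) \<or> v.vge 1 (z + w)" if "v.vge 1 ((z - w) * (z + w))" "z \<in> F" "w \<in> F" for z w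
  proof (cases "(z - w) * (z + w) = 0")
    case False
    then have "v ((z - w) * (z + w)) = v (z - w) + v (z + w)" using that F.diff F.add by (intro v.v_mult) auto
    then have "1 \<le> v (z - w) + v (z + w)" using that False unfolding v.vge_def by simp
    then show ?thesis unfolding v.vge_def by auto
  qed auto
  show ?thesis
  proof (cases "v t \<ge> 0")
    case True
    then obtain a where a: "v.vge 1 (t - fls_const a)" using residue_of_t_exists[OF v] by blast
    have "\<exists>c. c^2 = a + of_nat i \<and> v.vge 1 (y i - fls_const c)" if i: "i < 5" for i
    proof -
      obtain r where r: "r ^ 2 = a + of_nat i" using nth_root_exists[of 2 "a + of_nat i"] by auto
      have "(y i - fls_const r) * (y i + fls_const r) = y i ^ 2 - fls_const (r ^ 2)"
        by (simp add: algebra_simps power2_eq_square flip: fls_const_mult_const)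
      also have "\<dots> = t - fls_const a"
        using y_sq[OF i] by (simp only: r of_nat_const fls_plus_const[symmetric]) simp
      finally have "v.vge 1 ((y i - fls_const r) * (y i + fls_const r))" using a by simp
      from split[OF this y_F[OF i] const_F] show ?thesis
      proof
        assume "v.vge 1 (y i + fls_const r)"
        then show ?thesis using r by (intro exI[of _ "- r"]) auto
      qed (use r in auto)
    qed
    then obtain c where c: "\<And>i. i < 5 \<Longrightarrow> c i ^ 2 = a + of_nat i" "\<And>i. i < 5 \<Longrightarrow> v.vge 1 (y i - fls_const (c i))"
      by metis
    then have "finite_point c" using c(1)[of 0] unfolding finite_point_def by auto
    then show ?thesis using c True unfolding lies_at_def by blast
  next
    case False
    then have vt: "v t < 0" by simp
    have vti: "t + of_nat i \<noteq> 0" "v (t + of_nat i) = v t" for i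
    proof -
      have "v.vge (v t + 1) (of_nat i)" using vt v.v_const unfolding of_nat_const v.vge_def by auto
      then show "t + of_nat i \<noteq> 0" "v (t + of_nat i) = v t"
        using v.v_add_eq[OF t_F t_nonzero F.of_nat] by blast+
    qed
    have y2: "2 * v (y i) = v t" if "i < 5" for i
      using v.v_pow[OF y_F[OF that], of 2] y_sq[OF that] vti by simp
    have y0: "y 0 \<in> F" "y 0 \<noteq> 0" using y_F y_nonzero by auto
    have "\<exists>s. (s = 1 \<or> s = -1) \<and> (i = 0 \<longrightarrow> s = 1) \<and> v.vge 1 (y i / y 0 - fls_const s)" if i: "i < 5" for i
    proof (cases "i = 0")
      case True
      then show ?thesis using y0 by (intro exI[of _ 1]) auto
    next
      case False
      have "(y i / y 0 - 1) * (y i / y 0 + 1) = (y i ^ 2 - y 0 ^ 2) / y 0 ^ 2"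
        using y0 by (simp add: field_simps power2_eq_square)
      also have "\<dots> = of_nat i / t" using y_sq[OF i] y_sq[of 0] by simp
      finally have eq: "(y i / y 0 - 1) * (y i / y 0 + 1) = of_nat i / t" .
      have "v.vge 1 (of_nat i / t)"
        using v.v_div[OF F.of_nat _ t_F t_nonzero, of i] vt v.v_const[of "of_nat i"]
        by (auto simp: v.vge_def simp flip: of_nat_const)
      then have "v.vge 1 ((y i / y 0 - 1) * (y i / y 0 + 1))" using eq by simp
      from split[OF this F.div[OF y_F[OF i] y0(1)] F.one] show ?thesis
      proof
        assume "v.vge 1 (y i / y 0 - fls_const 1 * 1)"
        then show ?thesis using False by (intro exI[of _ 1]) auto
      next
        assume "v.vge 1 (y i / y 0 + 1)"
        then show ?thesis using False by (intro exI[of _ "- 1"]) auto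
      qed
    qed
    then obtain s where s: "\<And>i. i < 5 \<Longrightarrow> s i = 1 \<or> s i = -1" "s 0 = 1"
        "\<And>i. i < 5 \<Longrightarrow> v.vge 1 (y i / y 0 - fls_const (s i))"
      by (metis zero_less_numeral)
    then have "infinite_point s" "lies_at_inf v s"
      using y2[of 0] vt unfolding infinite_point_def lies_at_inf_def by auto
    then show ?thesis using vt by blast
  qed
qed

text \<open>When c i is nonzero, y i + c i has residue 2 (c i) and is a unit, and its product with y
  i - c i is t - c 0 ^ 2. Up to units the maximal ideal of the point is thus generated by y j if c j
  = 0, where t - c 0 ^ 2 = y j ^ 2, and by t - c 0 ^ 2 otherwise, so \<open>place_unique\<close>
  applies.\<close>

lemma finite_place_aux:
  assumes c: "finite_point c" and v: "v \<in> Pl" "lies_at v c" and v': "v' \<in> Pl" "lies_at v' c"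
  shows "v = v' \<and> (\<forall>j<5. c j = 0 \<longrightarrow> v (y j) = 1) \<and> ((\<forall>j<5. c j \<noteq> 0) \<longrightarrow> v (t - fls_const (c 0 ^ 2)) = 1)"
proof -
  have gen: "place.vge v 0 (y i) \<and> place.vge v 1 (t - fls_const (c 0 ^ 2)) \<and>
     (c i \<noteq> 0 \<longrightarrow> v (y i + fls_const (c i)) = 0 \<and> y i + fls_const (c i) \<noteq> 0)" 
    if v: "v \<in> Pl" "lies_at v c" and i: "i < 5" for v i
  proof -
    interpret v: place F v by (rule place_Pl[OF v(1)])
    have l: "v.vge 1 (y i - fls_const (c i))" "v.vge 1 (y 0 - fls_const (c 0))" using v(2) i unfolding lies_at_def by auto
    have ge0: "v.vge 0 (y i)" if "v.vge 1 (y i - fls_const (c i))" "i < 5" for i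
    proof -
      have "v.vge 0 ((y i - fls_const (c i)) + fls_const (c i))"
        using that v.vge_mono[of 1 _ 0] by (intro v.vge_add v.vge_const F.diff y_F const_F) auto
      then show ?thesis by simp
    qed
    have "v.vge (1 + 0) ((y 0 - fls_const (c 0)) * (y 0 + fls_const (c 0)))"
      using ge0[OF l(2)] by (intro v.vge_mult v.vge_add l v.vge_const F.diff F.add y_F const_F) auto
    moreover have "(y 0 - fls_const (c 0)) * (y 0 + fls_const (c 0)) = t - fls_const (c 0 ^ 2)"
      using y_sq[of 0] by (simp add: algebra_simps power2_eq_square flip: fls_const_mult_const)
    ultimately have t1: "v.vge 1 (t - fls_const (c 0 ^ 2))" by simp
    have "v (y i + fls_const (c i)) = 0 \<and> y i + fls_const (c i) \<noteq> 0" if "c i \<noteq> 0"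
    proof -
      have "fls_const (2 * c i) = fls_const (c i) + fls_const (c i)" by (simp only: mult_2 fls_plus_const)
      then have "(y i + fls_const (c i)) - fls_const (2 * c i) = y i - fls_const (c i)" by (simp only: add_diff_cancel_right)
      then have "v.vge 1 ((y i + fls_const (c i)) - fls_const (2 * c i))" using l by (simp only:)
      then show ?thesis using v.v_unit[OF F.add[OF y_F[OF i] const_F], of "c i" "2 * c i"] that two by simp
    qed
    then show ?thesis using ge0[OF l(1) i] t1 by blast
  qed
  have prod: "(y i + fls_const (c i)) * (y i - fls_const (c i)) = t - fls_const (c 0 ^ 2)" if "i < 5" for i
  proof -
    have ci: "c i ^ 2 = c 0 ^ 2 + of_nat i" using c that unfolding finite_point_def by blast
    have "(y i + fls_const (c i)) * (y i - fls_const (c i)) = y i ^ 2 - fls_const (c i ^ 2)"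
      by (simp add: algebra_simps power2_eq_square flip: fls_const_mult_const)
    also have "\<dots> = t - fls_const (c 0 ^ 2)"
      using y_sq[OF that] by (simp only: ci of_nat_const fls_plus_const[symmetric]) simp
    finally show ?thesis .
  qed
  interpret v: place F v by (rule place_Pl[OF v(1)])
  interpret v': place F v' by (rule place_Pl[OF v'(1)])
  define W where "W = y ` {..<5}"
  have WF: "W \<subseteq> F" unfolding W_def using y_F by auto
  have yW: "y i \<in> alg W" if "i < 5" for i using that unfolding W_def by (auto intro: alg_gen)
  have quot: "F \<subseteq> quotients (alg W)" by (intro F_quotients quotients_base yW alg_1)
  show ?thesis
  proof (cases "\<exists>j<5. c j = 0")
    case True
    then obtain j where j: "j < 5" "c j = 0" by blast
    have yj: "v (y j) > 0" "v' (y j) > 0"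
      using v(2) v'(2) j y_nonzero[OF j(1)] unfolding lies_at_def v.vge_def v'.vge_def by force+
    have e: "v = v' \<and> v (y j) = 1"
    proof (rule place_unique[OF v.place_axioms v'.place_axioms WF quot y_F[OF j(1)] y_nonzero[OF j(1)] yj])
      fix w assume "w \<in> W"
      then obtain i where i: "i < 5" "w = y i" unfolding W_def by auto
      have "\<exists>c h g. h \<in> alg W \<and> g \<in> alg W \<and> h \<noteq> 0 \<and> v h = 0 \<and> v' h = 0 \<and> h * (y i - fls_const c) = y j * g"
      proof (cases "c i = 0")
        case True
        then have "i = j" using finite_point_zero_unique[OF c i(1) j(1)] j by blast
        then show ?thesis by (intro exI[of _ 0] exI[of _ 1]) (auto simp: alg_1 v.v_1 v'.v_1)
      next
        case False
        have "(y i + fls_const (c i)) * (y i - fls_const (c i)) = y j * y j"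
          using prod[OF i(1)] prod[OF j(1)] j by simp
        then show ?thesis using gen[OF v i(1)] gen[OF v' i(1)] False yW[OF i(1)] yW[OF j(1)]
          by (intro exI[of _ "c i"] exI[of _ "y i + fls_const (c i)"] exI[of _ "y j"])
            (auto intro: alg_add alg_const)
      qed
      then show "v.vge 0 w \<and> v'.vge 0 w \<and> (\<exists>c h g. h \<in> alg W \<and> g \<in> alg W \<and> h \<noteq> 0 \<and> v h = 0 \<and> v' h = 0 \<and> h * (w - fls_const c) = y j * g)"
        using gen[OF v i(1)] gen[OF v' i(1)] i(2) by blast
    qed
    have "v (y i) = 1" if "i < 5" "c i = 0" for i
      using finite_point_zero_unique[OF c that(1) j(1) that(2) j(2)] e by metis
    then show ?thesis using e j by blast
  next
    case False
    let ?p = "t - fls_const (c 0 ^ 2)"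
    have p0: "?p \<noteq> 0" using t_neq_const by simp
    have p1: "v ?p > 0" "v' ?p > 0" 
      using gen[OF v, of 0] gen[OF v', of 0] p0 unfolding v.vge_def v'.vge_def by auto
    have "v = v' \<and> v ?p = 1"
    proof (rule place_unique[OF v.place_axioms v'.place_axioms WF quot F.diff[OF t_F const_F] p0 p1])
      fix w assume "w \<in> W"
      then obtain i where i: "i < 5" "w = y i" unfolding W_def by auto
      have "\<exists>c h g. h \<in> alg W \<and> g \<in> alg W \<and> h \<noteq> 0 \<and> v h = 0 \<and> v' h = 0 \<and> h * (y i - fls_const c) = ?p * g"
        using gen[OF v i(1)] gen[OF v' i(1)] False yW[OF i(1)] prod[OF i(1)] i(1) alg_1
        by (intro exI[of _ "c i"] exI[of _ "y i + fls_const (c i)"] exI[of _ 1])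
            (auto intro: alg_add alg_const)
      then show "v.vge 0 w \<and> v'.vge 0 w \<and> (\<exists>c h g. h \<in> alg W \<and> g \<in> alg W \<and> h \<noteq> 0 \<and> v h = 0 \<and> v' h = 0 \<and> h * (w - fls_const c) = ?p * g)"
        using gen[OF v i(1)] gen[OF v' i(1)] i(2) by blast
    qed
    then show ?thesis using False by blast
  qed
qed

text \<open>The affine chart at infinity has coordinates 1 / y 0 and y i / y 0, with local parameter
  1 / y 0. The relation is (y i / y 0)^2 - 1 = i / y 0 ^ 2, and y i / y 0 + s i is a unit with
  residue 2 (s i).\<close>

lemma infinite_place_aux:
  assumes s: "infinite_point s" and v: "v \<in> Pl" "lies_at_inf v s" and v': "v' \<in> Pl" "lies_at_inf v' s"
  shows "v = v' \<and> v (y 0) = - 1"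
proof -
  have y0: "y 0 \<in> F" "y 0 \<noteq> 0" using y_F y_nonzero by auto
  define W where "W = insert (inverse (y 0)) ((\<lambda>i. y i / y 0) ` {..<5})"
  have WF: "W \<subseteq> F" unfolding W_def using y_F y0 F.inv F.div by auto
  have iW: "inverse (y 0) \<in> alg W" unfolding W_def by (intro alg_gen) simp
  have zW: "y i / y 0 \<in> alg W" if "i < 5" for i unfolding W_def using that by (intro alg_gen) auto
  interpret Q: subfld "quotients (alg W)" by (rule subfld_quotients)
  have "y 0 \<in> quotients (alg W)" using Q.inv[OF quotients_base[OF iW alg_1]] by simp
  then have "y i \<in> quotients (alg W)" if "i < 5" for i
    using Q.mult[OF quotients_base[OF zW[OF that] alg_1], of "y 0"] y0 by simp
  then have quot: "F \<subseteq> quotients (alg W)" by (rule F_quotients)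
  have gen: "place.vge v 0 (y i / y 0) \<and>
     v (y i / y 0 + fls_const (s i)) = 0 \<and> y i / y 0 + fls_const (s i) \<noteq> 0" 
    if v: "v \<in> Pl" "lies_at_inf v s" and i: "i < 5" for v i
  proof -
    interpret v: place F v by (rule place_Pl[OF v(1)])
    have l: "v.vge 1 (y i / y 0 - fls_const (s i))" using v(2) i unfolding lies_at_inf_def by auto
    have zF: "y i / y 0 \<in> F" using F.div y_F[OF i] y0 by blast
    have "v.vge 0 ((y i / y 0 - fls_const (s i)) + fls_const (s i))"
      using l v.vge_mono[of 1 _ 0] by (intro v.vge_add v.vge_const F.diff zF const_F) auto
    moreover have "fls_const (2 * s i) = fls_const (s i) + fls_const (s i)" by (simp only: mult_2 fls_plus_const)
    then have "(y i / y 0 + fls_const (s i)) - fls_const (2 * s i) = y i / y 0 - fls_const (s i)"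
      by (simp only: add_diff_cancel_right)
    then have "v.vge 1 ((y i / y 0 + fls_const (s i)) - fls_const (2 * s i))" using l by (simp only:)
    moreover have "s i \<noteq> 0" using s i unfolding infinite_point_def by auto
    ultimately show ?thesis using v.v_unit[OF F.add[OF zF const_F], of "s i" "2 * s i"] two by simp
  qed
  interpret v: place F v by (rule place_Pl[OF v(1)])
  interpret v': place F v' by (rule place_Pl[OF v'(1)])
  have pi: "inverse (y 0) \<in> F" "inverse (y 0) \<noteq> 0" "v (inverse (y 0)) > 0" "v' (inverse (y 0)) > 0"
    using y0 F.inv v(2) v'(2) unfolding lies_at_inf_def by (auto simp: v.v_inverse v'.v_inverse)
  have "v = v' \<and> v (inverse (y 0)) = 1"
  proof (rule place_unique[OF v.place_axioms v'.place_axioms WF quot pi])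
    fix w assume "w \<in> W"
    then consider "w = inverse (y 0)" | i where "i < 5" "w = y i / y 0" unfolding W_def by auto
    then show "v.vge 0 w \<and> v'.vge 0 w \<and> (\<exists>c h g. h \<in> alg W \<and> g \<in> alg W \<and> h \<noteq> 0 \<and> v h = 0 \<and> v' h = 0 \<and> h * (w - fls_const c) = inverse (y 0) * g)"
    proof cases
      case 1
      then have "\<exists>c h g. h \<in> alg W \<and> g \<in> alg W \<and> h \<noteq> 0 \<and> v h = 0 \<and> v' h = 0 \<and> h * (w - fls_const c) = inverse (y 0) * g"
        by (intro exI[of _ 0] exI[of _ 1]) (auto simp: alg_1 v.v_1 v'.v_1)
      then show ?thesis using pi(3,4) 1 unfolding v.vge_def v'.vge_def by auto
    next
      case (2 i)
      have "s i ^ 2 = 1" using s 2 unfolding infinite_point_def by (metis power2_eq_1_iff)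
      then have "fls_const (s i) ^ 2 = (1 :: 'k fls)" by (metis fls_const_1 fls_const_mult_const power2_eq_square)
      then have "(y i / y 0 + fls_const (s i)) * (y i / y 0 - fls_const (s i)) = (y i / y 0)^2 - 1"
        by (simp add: algebra_simps power2_eq_square)
      also have "\<dots> = inverse (y 0) * (fls_const (of_nat i) * inverse (y 0))"
      proof -
        have "y i ^ 2 = y 0 ^ 2 + fls_const (of_nat i)" using y_sq[OF 2(1)] y_sq[of 0] of_nat_const by simp
        then show ?thesis using y0 by (simp add: power_divide field_simps power2_eq_square)
      qed
      finally have "\<exists>c h g. h \<in> alg W \<and> g \<in> alg W \<and> h \<noteq> 0 \<and> v h = 0 \<and> v' h = 0 \<and> h * (w - fls_const c) = inverse (y 0) * g"
        using gen[OF v 2(1)] gen[OF v' 2(1)] zW[OF 2(1)] iW 2(2)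
        by (intro exI[of _ "s i"] exI[of _ "y i / y 0 + fls_const (s i)"] exI[of _ "fls_const (of_nat i) * inverse (y 0)"])
           (auto intro: alg_add alg_const alg_mult)
      then show ?thesis using gen[OF v 2(1)] gen[OF v' 2(1)] 2(2) by blast
    qed
  qed
  then show ?thesis using v.v_inverse[OF y0(1)] by linarith
qed

end

section \<open>Fibres over the t-line and divisors of linear factors t - a\<close>

context sqrt_tower
begin

definition fin_places :: "'k \<Rightarrow> ('k fls \<Rightarrow> int) set" where
  "fin_places a = {v \<in> Pl. place.vge v 1 (t - fls_const a)}"

definition inf_places :: "('k fls \<Rightarrow> int) set" where
  "inf_places = {v \<in> Pl. v t < 0}"

lemma lies_at_cong: "(\<And>i. i < 5 \<Longrightarrow> c i = d i) \<Longrightarrow> lies_at v c \<longleftrightarrow> lies_at v d"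
  unfolding lies_at_def by auto

lemma lies_at_residue:
  assumes v: "v \<in> Pl" "lies_at v c"
  shows "place.vge v 1 (t - fls_const (c 0 ^ 2))"
proof -
  interpret v: place F v by (rule place_Pl[OF v(1)])
  have l: "v.vge 1 (y 0 - fls_const (c 0))" using v(2) unfolding lies_at_def by auto
  have "v.vge 0 ((y 0 - fls_const (c 0)) + fls_const (2 * c 0))"
    using l v.vge_mono[of 1 _ 0] by (intro v.vge_add v.vge_const F.diff y_F const_F) auto
  then have "v.vge (1 + 0) ((y 0 - fls_const (c 0)) * ((y 0 - fls_const (c 0)) + fls_const (2 * c 0)))"
    by (intro v.vge_mult l F.diff F.add y_F const_F) auto
  moreover have "(y 0 - fls_const (c 0)) + fls_const (2 * c 0) = y 0 + fls_const (c 0)"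
    by (simp only: mult_2 fls_plus_const[symmetric]) simp
  moreover have "(y 0 - fls_const (c 0)) * (y 0 + fls_const (c 0)) = t - fls_const (c 0 ^ 2)"
    using y_sq[of 0] by (simp add: algebra_simps power2_eq_square flip: fls_const_mult_const)
  ultimately show ?thesis by simp
qed

lemma fin_placesD:
  assumes "v \<in> fin_places a"
  shows "0 \<le> v t"
proof -
  interpret v: place F v using assms place_Pl unfolding fin_places_def by auto
  have "v.vge 0 ((t - fls_const a) + fls_const a)"
    using assms v.vge_mono[of 1 _ 0] unfolding fin_places_def
    by (intro v.vge_add v.vge_const F.diff t_F const_F) auto
  then show ?thesis using t_nonzero by (simp add: v.vge_def)
qed

lemma fin_places_point:
  assumes v: "v \<in> fin_places a"
  shows "\<exists>c. finite_point c \<and> lies_at v c \<and> c 0 ^ 2 = a"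
proof -
  have vP: "v \<in> Pl" and va: "place.vge v 1 (t - fls_const a)" using v unfolding fin_places_def by auto
  interpret v: place F v by (rule place_Pl[OF vP])
  obtain c where c: "finite_point c" "lies_at v c" using place_finite_or_infinite[OF vP] fin_placesD[OF v] by auto
  then show ?thesis using v.residue_unique[OF t_F va lies_at_residue[OF vP c(2)]] by auto
qed

text \<open>A place over a is determined by a choice of square roots of all a + i. If none of these
  vanishes, there are at most 2^5 places, each with value 1. If a + j = 0, at most 2^4 choices
  remain, and t - a = y j ^ 2 has value 2.\<close>

lemma fin_places_degree: "finite (fin_places a) \<and> (\<Sum>v\<in>fin_places a. v (t - fls_const a)) \<le> 32"
proof -
  have "\<exists>r. r ^ 2 = a + of_nat i" for i using nth_root_exists[of 2 "a + of_nat i"] by auto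
  then obtain r where r: "\<And>i. r i ^ 2 = a + of_nat i" by metis
  let ?C = "PiE {..<5::nat} (\<lambda>i. {r i, - r i})"
  have "\<exists>c\<in>?C. finite_point c \<and> lies_at v c \<and> c 0 ^ 2 = a" if v: "v \<in> fin_places a" for v
  proof -
    obtain c where c: "finite_point c" "lies_at v c" "c 0 ^ 2 = a" using fin_places_point[OF v] by blast
    let ?d = "restrict c {..<5}"
    have "c i \<in> {r i, - r i}" if "i < 5" for i
    proof -
      have "c i ^ 2 = r i ^ 2" using c(1,3) that r[of i] unfolding finite_point_def by metis
      then show ?thesis by (simp add: power2_eq_iff)
    qed
    then have "?d \<in> ?C" by auto
    moreover have "lies_at v ?d" using c(2) lies_at_cong[of c ?d] by auto
    moreover have "finite_point ?d" using c(1) unfolding finite_point_def by (metis lessThan_iff restrict_apply' zero_less_numeral)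
    ultimately show ?thesis using c(3) by (intro bexI[of _ ?d]) auto
  qed
  then obtain g where g: "\<And>v. v \<in> fin_places a \<Longrightarrow> g v \<in> ?C \<and> finite_point (g v) \<and> lies_at v (g v) \<and> g v 0 ^ 2 = a" by metis
  have inj: "inj_on g (fin_places a)"
  proof (rule inj_onI)
    fix v w assume vw: "v \<in> fin_places a" "w \<in> fin_places a" "g v = g w"
    then show "v = w" using finite_place_aux[of "g v" v w] g[OF vw(1)] g[OF vw(2)] unfolding fin_places_def by auto
  qed
  have finC: "finite ?C" by (intro finite_PiE) auto
  then have fin: "finite (fin_places a)" using inj g inj_on_finite[of g "fin_places a" ?C] by auto
  have card: "card (fin_places a) \<le> card ?C" using inj g finC by (intro card_inj_on_le[of g]) auto
  have cardC: "card ?C = (\<Prod>i<5. card {r i, - r i})" by (subst card_PiE) auto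
  have "(\<Sum>v\<in>fin_places a. v (t - fls_const a)) \<le> 32"
  proof (cases "\<exists>j<5. r j = 0")
    case True
    then obtain j where j: "j < 5" "r j = 0" by blast
    have "v (t - fls_const a) = 2" if v: "v \<in> fin_places a" for v
    proof -
      have vP: "v \<in> Pl" using v unfolding fin_places_def by auto
      interpret v: place F v by (rule place_Pl[OF vP])
      have "g v j \<in> {r j, - r j}" using g[OF v] j PiE_mem[of "g v" "{..<5}" "\<lambda>i. {r i, - r i}" j] by blast
      then have "g v j = 0" using j by simp
      then have 1: "v (y j) = 1" using finite_place_aux[of "g v" v v] g[OF v] vP j by blast
      have "a + of_nat j = 0" using r[of j] j by simp
      then have "of_nat j = fls_const (- a)" unfolding of_nat_const by (metis add_eq_0_iff)
      then have "t - fls_const a = y j ^ 2" using y_sq[OF j(1)] by simp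
      then show ?thesis using v.v_pow[OF y_F[OF j(1)], of 2] 1 by simp
    qed
    then have "(\<Sum>v\<in>fin_places a. v (t - fls_const a)) = (\<Sum>v\<in>fin_places a. 2)" by (rule sum.cong[OF refl])
    then have "(\<Sum>v\<in>fin_places a. v (t - fls_const a)) = 2 * int (card (fin_places a))" by simp
    moreover have "card ?C \<le> 16"
    proof -
      have "card ?C = card {r j, - r j} * (\<Prod>i\<in>{..<5} - {j}. card {r i, - r i})"
        unfolding cardC using j by (subst prod.remove[of _ j]) auto
      also have "card {r j, - r j} = 1" using j by simp
      also have "(\<Prod>i\<in>{..<5} - {j}. card {r i, - r i}) \<le> (\<Prod>i\<in>{..<5} - {j}. 2)"
        by (intro prod_mono) (auto simp: card_insert_if)
      also have "(\<Prod>i\<in>{..<5} - {j}. 2) = (16::nat)" using j by simp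
      finally show ?thesis by simp
    qed
    ultimately show ?thesis using card by linarith
  next
    case False
    have "v (t - fls_const a) = 1" if v: "v \<in> fin_places a" for v
    proof -
      have vP: "v \<in> Pl" using v unfolding fin_places_def by auto
      have "g v j \<noteq> 0" if "j < 5" for j
        using g[OF v] that False PiE_mem[of "g v" "{..<5}" "\<lambda>i. {r i, - r i}" j] by force
      then show ?thesis using finite_place_aux[of "g v" v v] g[OF v] vP by auto
    qed
    then have "(\<Sum>v\<in>fin_places a. v (t - fls_const a)) = (\<Sum>v\<in>fin_places a. 1)" by (rule sum.cong[OF refl])
    then have "(\<Sum>v\<in>fin_places a. v (t - fls_const a)) = int (card (fin_places a))" by simp
    moreover have "card ?C \<le> (\<Prod>i<5::nat. 2)" unfolding cardC
      by (intro prod_mono) (auto simp: card_insert_if)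
    ultimately show ?thesis using card by simp
  qed
  then show ?thesis using fin by blast
qed

lemma inf_place_values:
  assumes "v \<in> inf_places"
  shows "v (t - fls_const a) = - 2" "v t = - 2" "i < 5 \<Longrightarrow> v (y i) = - 1"
proof -
  have vP: "v \<in> Pl" and neg: "v t < 0" using assms unfolding inf_places_def by auto
  interpret v: place F v by (rule place_Pl[OF vP])
  obtain s where "infinite_point s" "lies_at_inf v s" using place_finite_or_infinite[OF vP] neg by auto
  then have y0: "v (y 0) = - 1" using infinite_place_aux[OF _ vP _ vP] by blast
  then show t2: "v t = - 2" using v.v_pow[OF y_F[of 0], of 2] y_sq[of 0] by simp
  have t3: "v (t + fls_const b) = - 2" for b
  proof -
    have "v.vge (v t + 1) (fls_const b)" using neg v.vge_mono[OF v.vge_const, of "v t + 1" b] by simp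
    then show ?thesis using v.v_add_eq(2)[OF t_F t_nonzero const_F, of b] t2 by simp
  qed
  then show "v (t - fls_const a) = - 2" using t3[of "- a"] by simp
  show "v (y i) = - 1" if "i < 5"
    using v.v_pow[OF y_F[OF that], of 2] y_sq[OF that] t3[of "of_nat i"] of_nat_const[of i] by simp
qed

text \<open>Existence and uniqueness make the places correspond to sign vectors with s 0 = 1. As 2
  is nonzero, 1 and -1 differ, and the count is exactly 2^4.\<close>

lemma inf_places_card: "finite inf_places \<and> card inf_places = 16"
proof -
  let ?A = "\<lambda>i::nat. if i = 0 then {1} else {1, - 1 :: 'k}"
  let ?C = "PiE {..<5::nat} ?A"
  have ne: "(1::'k) \<noteq> - 1" using two by (metis add.right_inverse one_add_one)
  have C_pt: "infinite_point s" if "s \<in> ?C" for s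
    unfolding infinite_point_def
  proof (intro conjI allI impI)
    show "s 0 = 1" using PiE_mem[OF that, of 0] by simp
    show "s i = 1 \<or> s i = - 1" if "i < 5" for i
      using PiE_mem[OF \<open>s \<in> ?C\<close>, of i] that by (cases "i = 0") auto
  qed
  have "\<exists>v\<in>inf_places. lies_at_inf v s" if s: "s \<in> ?C" for s
  proof -
    obtain v where v: "v \<in> Pl" "lies_at_inf v s" using infinite_place_exists[OF C_pt[OF s]] by blast
    interpret v: place F v by (rule place_Pl[OF v(1)])
    have "v t = 2 * v (y 0)" using v.v_pow[OF y_F[of 0], of 2] y_sq[of 0] by simp
    then have "v t < 0" using v(2) unfolding lies_at_inf_def by simp
    then show ?thesis using v unfolding inf_places_def by blast
  qed
  then obtain g where g: "\<And>s. s \<in> ?C \<Longrightarrow> g s \<in> inf_places \<and> lies_at_inf (g s) s" by metis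
  have "inj_on g ?C"
  proof (rule inj_onI)
    fix s s' assume s: "s \<in> ?C" "s' \<in> ?C" "g s = g s'"
    interpret v: place F "g s" using g[OF s(1)] place_Pl unfolding inf_places_def by auto
    have "s i = s' i" if "i < 5" for i
      using v.residue_unique[OF F.div[OF y_F[OF that] y_F[of 0]], of "s i" "s' i"] g[OF s(1)] g[OF s(2)] s(3) that
      unfolding lies_at_inf_def by auto
    then show "s = s'" using s(1,2) by (intro PiE_ext[of s _ _ s']) auto
  qed
  moreover have "g ` ?C = inf_places"
  proof
    show "g ` ?C \<subseteq> inf_places" using g by auto
    show "inf_places \<subseteq> g ` ?C"
    proof
      fix v assume v: "v \<in> inf_places"
      then have vP: "v \<in> Pl" unfolding inf_places_def by auto
      obtain s where s: "infinite_point s" "lies_at_inf v s"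
        using place_finite_or_infinite[OF vP] v unfolding inf_places_def by auto
      let ?s = "restrict s {..<5}"
      have "?s i \<in> ?A i" if "i < 5" for i
        using s(1) that unfolding infinite_point_def by (cases "i = 0") auto
      then have sC: "?s \<in> ?C" by (intro PiE_I) auto
      have "lies_at_inf v ?s" using s(2) unfolding lies_at_inf_def by auto
      then have "v = g ?s" using infinite_place_aux[OF C_pt[OF sC] vP _ _ _, of "g ?s"] g[OF sC] 
        unfolding inf_places_def by auto
      then show "v \<in> g ` ?C" using sC by blast
    qed
  qed
  ultimately have bij: "bij_betw g ?C inf_places" unfolding bij_betw_def by blast
  have "card ?C = (\<Prod>i<5. card (?A i))" by (subst card_PiE) auto
  also have "\<dots> = 16" using ne by (simp add: eval_nat_numeral lessThan_Suc)
  finally have "card ?C = 16" .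
  moreover have "finite ?C" by (intro finite_PiE) auto
  ultimately show ?thesis using bij bij_betw_same_card[OF bij] bij_betw_finite[OF bij] by auto
qed

lemma place_cases:
  assumes "v \<in> Pl"
  obtains "v \<in> inf_places" | a where "v \<in> fin_places a"
  using assms place_finite_or_infinite[OF assms] residue_of_t_exists[OF assms]
  unfolding inf_places_def fin_places_def by (cases "v t < 0") auto

text \<open>The points form a list so that repetition raises the order of vanishing.\<close>

definition lin_prod :: "'k list \<Rightarrow> 'k fls" where
  "lin_prod as = (\<Prod>a\<leftarrow>as. t - fls_const a)"

lemma lin_prod_simps [simp]:
  "lin_prod [] = 1" "lin_prod (a # as) = (t - fls_const a) * lin_prod as"
  by (simp_all add: lin_prod_def)

lemma lin_prod_append: "lin_prod (as @ bs) = lin_prod as * lin_prod bs"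
  by (simp add: lin_prod_def)

lemma lin_prod_F: "lin_prod as \<in> F" "lin_prod as \<noteq> 0"
  by (induction as) (auto intro: F.mult F.diff t_F const_F F.one simp: t_neq_const)

definition divr :: "'k fls \<Rightarrow> ('k fls \<Rightarrow> int) \<Rightarrow> int" where
  "divr q = (\<lambda>v. if v \<in> Pl then v q else 0)"

lemma degree_eq_sum:
  assumes "finite A" "{v. D v \<noteq> 0} \<subseteq> A"
  shows "divisor_degree D = sum D A"
  unfolding divisor_degree_def using assms by (intro sum.mono_neutral_left) auto

text \<open>At most 32 zeros, counted with multiplicity, stand against 16 poles of order 2 at
  infinity.\<close>

lemma divr_linear: "finite {v. divr (t - fls_const a) v \<noteq> 0} \<and> divisor_degree (divr (t - fls_const a)) \<le> 0"
proof -
  let ?f = "t - fls_const a"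
  have sub: "{v. divr ?f v \<noteq> 0} \<subseteq> fin_places a \<union> inf_places"
  proof
    fix v assume "v \<in> {v. divr ?f v \<noteq> 0}"
    then have v: "v \<in> Pl" "v ?f \<noteq> 0" by (auto simp: divr_def split: if_splits)
    interpret v: place F v by (rule place_Pl[OF v(1)])
    show "v \<in> fin_places a \<union> inf_places"
    proof (cases "v t < 0")
      case False
      then have "v.vge 0 ?f" by (intro v.vge_diff t_F const_F) (auto simp: v.vge_def v.v_const)
      then have "v.vge 1 ?f" using v(2) unfolding v.vge_def by auto
      then show ?thesis using v(1) unfolding fin_places_def by auto
    qed (use v in \<open>auto simp: inf_places_def\<close>)
  qed
  have fin: "finite (fin_places a \<union> inf_places)" using fin_places_degree[of a] inf_places_card by auto
  have disj: "fin_places a \<inter> inf_places = {}" using fin_placesD unfolding inf_places_def by force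
  have "divisor_degree (divr ?f) = sum (divr ?f) (fin_places a) + sum (divr ?f) inf_places"
    using degree_eq_sum[OF fin sub] fin disj by (simp add: sum.union_disjoint)
  also have "sum (divr ?f) (fin_places a) = (\<Sum>v\<in>fin_places a. v ?f)"
    by (intro sum.cong) (auto simp: divr_def fin_places_def)
  also have "sum (divr ?f) inf_places = (\<Sum>v\<in>inf_places. - 2)"
  proof (rule sum.cong[OF refl])
    fix v assume "v \<in> inf_places"
    then show "divr ?f v = - 2" using inf_place_values(1)[of v a] by (simp add: divr_def inf_places_def)
  qed
  also have "\<dots> = - 32" using inf_places_card by simp
  finally show ?thesis using fin_places_degree[of a] finite_subset[OF sub fin] by auto
qed

lemma divisor_degree_add:
  assumes "finite {v. D v \<noteq> 0}" "finite {v. E v \<noteq> 0}"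
  shows "divisor_degree (\<lambda>v. D v + E v) = divisor_degree D + divisor_degree E" "finite {v. D v + E v \<noteq> 0}"
proof -
  let ?A = "{v. D v \<noteq> 0} \<union> {v. E v \<noteq> 0}"
  have A: "finite ?A" using assms by auto
  have "divisor_degree (\<lambda>v. D v + E v) = sum (\<lambda>v. D v + E v) ?A" by (rule degree_eq_sum[OF A]) auto
  also have "\<dots> = sum D ?A + sum E ?A" by (rule sum.distrib)
  also have "sum D ?A = divisor_degree D" by (rule degree_eq_sum[OF A, symmetric]) auto
  also have "sum E ?A = divisor_degree E" by (rule degree_eq_sum[OF A, symmetric]) auto
  finally show "divisor_degree (\<lambda>v. D v + E v) = divisor_degree D + divisor_degree E" .
  show "finite {v. D v + E v \<noteq> 0}" by (rule finite_subset[OF _ A]) auto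
qed

lemma divr_mult:
  assumes "p \<in> F" "p \<noteq> 0" "q \<in> F" "q \<noteq> 0"
  shows "divr (p * q) = (\<lambda>v. divr p v + divr q v)"
  using place.v_mult[OF place_Pl _ _ _ _, of _ p q] assms by (auto simp: divr_def)

lemma divr_lin_prod: "finite {v. divr (lin_prod as) v \<noteq> 0} \<and> divisor_degree (divr (lin_prod as)) \<le> 0"
proof (induction as)
  case Nil
  have "divr 1 = (\<lambda>v. 0)" using place.v_1[OF place_Pl] by (auto simp: divr_def)
  then show ?case by (simp add: divisor_degree_def)
next
  case (Cons a as)
  have "divr (lin_prod (a # as)) = (\<lambda>v. divr (t - fls_const a) v + divr (lin_prod as) v)"
    unfolding lin_prod_simps using F.diff[OF t_F const_F] t_neq_const[of a] lin_prod_F by (intro divr_mult) auto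
  then show ?case using divisor_degree_add[of "divr (t - fls_const a)" "divr (lin_prod as)"] Cons divr_linear[of a] by simp
qed

lemma lin_prod_fin_nonneg:
  assumes v: "v \<in> Pl" "0 \<le> v t"
  shows "0 \<le> v (lin_prod as)"
proof -
  interpret v: place F v by (rule place_Pl[OF v(1)])
  have "v.vge 0 (lin_prod as)"
  proof (induction as)
    case (Cons a as)
    have "v.vge 0 (t - fls_const a)" using v(2) by (intro v.vge_diff t_F const_F) (auto simp: v.vge_def v.v_const)
    then have "v.vge (0 + 0) ((t - fls_const a) * lin_prod as)" using Cons by (intro v.vge_mult F.diff t_F const_F lin_prod_F)
    then show ?case by simp
  qed (simp add: v.vge_def v.v_1)
  then show ?thesis using lin_prod_F[of as] by (simp add: v.vge_def)
qed

lemma lin_prod_inf: "v \<in> inf_places \<Longrightarrow> v (lin_prod as) = - 2 * int (length as)"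
proof (induction as)
  case Nil
  then show ?case using place.v_1[OF place_Pl] unfolding inf_places_def by auto
next
  case (Cons a as)
  then interpret v: place F v using place_Pl unfolding inf_places_def by auto
  show ?case using Cons inf_place_values(1)[OF Cons.prems, of a] F.diff[OF t_F const_F] t_neq_const[of a] lin_prod_F
    by (simp add: v.v_mult)
qed

text \<open>Sufficiently many factors t - a, one batch for each place in A, raise the value above D
  there. Factors belonging to other places do no harm, as they are regular at every place with v t
  >= 0.\<close>

lemma lin_prod_dominates:
  assumes "finite A" "A \<subseteq> {v \<in> Pl. 0 \<le> v t}"
  shows "\<exists>as. \<forall>v\<in>A. D v \<le> v (lin_prod as)"
  using assms
proof (induction A rule: finite_induct)
  case (insert w A)
  then obtain as where as: "\<And>v. v \<in> A \<Longrightarrow> D v \<le> v (lin_prod as)" by auto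
  have w: "w \<in> Pl" "0 \<le> w t" using insert by auto
  then obtain a where a: "w \<in> fin_places a" by (cases rule: place_cases[OF w(1)]) (auto simp: inf_places_def)
  define n where "n = nat (D w)"
  define bs where "bs = replicate n a @ as"
  have mult: "v (lin_prod bs) = v (lin_prod (replicate n a)) + v (lin_prod as)" if "v \<in> Pl" for v
    unfolding bs_def lin_prod_append by (rule place.v_mult[OF place_Pl[OF that]]) (auto simp: lin_prod_F)
  have "D v \<le> v (lin_prod bs)" if "v \<in> A" for v
  proof -
    have "v \<in> Pl" "0 \<le> v t" using that insert by auto
    then show ?thesis using mult[of v] as[OF that] lin_prod_fin_nonneg[of v "replicate n a"] by simp
  qed
  moreover have "D w \<le> w (lin_prod bs)"
  proof -
    interpret w: place F w by (rule place_Pl[OF w(1)])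
    have "lin_prod (replicate n a) = (t - fls_const a) ^ n" by (induction n) auto
    then have "w (lin_prod (replicate n a)) = int n * w (t - fls_const a)"
      using w.v_pow[OF F.diff[OF t_F const_F]] by simp
    moreover have "w (t - fls_const a) \<ge> 1" using a t_neq_const[of a] by (auto simp: fin_places_def w.vge_def)
    then have "int n * 1 \<le> int n * w (t - fls_const a)" by (intro mult_left_mono) auto
    moreover have "D w \<le> int n" by (simp add: n_def)
    ultimately show ?thesis using mult[OF w(1)] lin_prod_fin_nonneg[OF w, of as] by linarith
  qed
  ultimately show ?case by (intro exI[of _ bs]) auto
qed simp

end

section \<open>Riemann-Roch spaces\<close>

context sqrt_tower
begin

text \<open>\<open>pole_space n m\<close> is the space of elements of \<open>K[t, y 0, \<dots>, y (n - 1)]\<close> with a pole of order at most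
  \<open>m\<close> at every place at infinity, where \<open>t\<close> has pole order \<open>2\<close> and each \<open>y i\<close> has pole order \<open>1\<close>.\<close>

fun pole_space :: "nat \<Rightarrow> int \<Rightarrow> 'k fls set" where
  "pole_space 0 m = {ev p t | p. p = 0 \<or> 2 * int (degree p) \<le> m}"
| "pole_space (Suc n) m = {A + B * y n | A B. A \<in> pole_space n m \<and> B \<in> pole_space n (m - 1)}"

definition pole_div :: "int \<Rightarrow> ('k fls \<Rightarrow> int) \<Rightarrow> int" where
  "pole_div m = (\<lambda>v. if v \<in> inf_places then m else 0)"

abbreviation RR :: "(('k fls \<Rightarrow> int) \<Rightarrow> int) \<Rightarrow> 'k fls set" where
  "RR D \<equiv> riemann_roch_space (range fls_const) (set_ring F) D"

lemma RR_iff: "x \<in> RR D \<longleftrightarrow> x \<in> F \<and> (\<forall>v\<in>Pl. place.vge v (- D v) x)"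
proof -
  have "place.vge v (- D v) x \<longleftrightarrow> x = 0 \<or> 0 \<le> v x + D v" if "v \<in> Pl" for v
    unfolding place.vge_def[OF place_Pl[OF that]] by auto
  then show ?thesis unfolding riemann_roch_space_def Pl_def[symmetric] by auto
qed

lemma RR_pole_div_iff:
  "x \<in> RR (pole_div m) \<longleftrightarrow> x \<in> F \<and> (\<forall>v\<in>inf_places. place.vge v (- m) x) \<and> (\<forall>a. \<forall>v\<in>fin_places a. place.vge v 0 x)"
proof -
  have fin: "v \<notin> inf_places \<and> v \<in> Pl" if "v \<in> fin_places a" for v a
    using fin_placesD[OF that] that unfolding inf_places_def fin_places_def by auto
  have inf: "v \<in> Pl" if "v \<in> inf_places" for v using that unfolding inf_places_def by simp
  show ?thesis unfolding RR_iff
  proof (intro iffI conjI ballI allI; (elim conjE)?)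
    fix v assume *: "\<forall>v\<in>Pl. place.vge v (- pole_div m v) x" and v: "v \<in> inf_places"
    then show "place.vge v (- m) x" using inf by (force simp: pole_div_def)
  next
    fix v a assume *: "\<forall>v\<in>Pl. place.vge v (- pole_div m v) x" and v: "v \<in> fin_places a"
    then show "place.vge v 0 x" using fin by (force simp: pole_div_def)
  next
    fix v assume *: "\<forall>v\<in>inf_places. place.vge v (- m) x" "\<forall>a. \<forall>v\<in>fin_places a. place.vge v 0 x" "v \<in> Pl"
    from *(3) show "place.vge v (- pole_div m v) x"
      by (cases rule: place_cases) (use * fin in \<open>auto simp: pole_div_def\<close>)
  qed blast+
qed

lemma RR_add:
  assumes "x \<in> RR D" "z \<in> RR D"
  shows "x + z \<in> RR D"
  using assms place.vge_add[OF place_Pl] unfolding RR_iff by (auto intro: F.add)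

lemma RR_const_mult:
  assumes "x \<in> RR D"
  shows "fls_const c * x \<in> RR D"
  unfolding RR_iff
proof (intro conjI ballI)
  show "fls_const c * x \<in> F" using assms unfolding RR_iff by (auto intro: F.mult const_F)
  fix v assume v: "v \<in> Pl"
  interpret v: place F v by (rule place_Pl[OF v])
  have "v.vge (0 + - D v) (fls_const c * x)"
    using assms v const_F unfolding RR_iff by (intro v.vge_mult v.vge_const) auto
  then show "v.vge (- D v) (fls_const c * x)" by simp
qed

lemma RR_diff:
  assumes "x \<in> RR D" "z \<in> RR D"
  shows "x - z \<in> RR D"
  using assms place.vge_diff[OF place_Pl] unfolding RR_iff by (auto intro: F.diff)

lemma pole_space_0: "0 \<in> pole_space n m"
proof (induction n arbitrary: m)
  case 0
  show ?case by (auto intro!: exI[of _ 0])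
next
  case (Suc n)
  show ?case using Suc[of m] Suc[of "m - 1"] by (auto intro!: exI[of _ 0])
qed

lemma pole_space_Tw: "n \<le> 5 \<Longrightarrow> pole_space n m \<subseteq> Tw n"
proof (induction n arbitrary: m)
  case 0
  then show ?case using ev_Tw[of 0] by auto
next
  case (Suc n)
  then have "pole_space n m \<subseteq> Tw n" "pole_space n (m - 1) \<subseteq> Tw n" by auto
  then show ?case unfolding tower.simps adj_def by auto
qed

lemma ev_fin_vge:
  assumes "v \<in> fin_places a"
  shows "place.vge v 0 (ev p t)"
proof -
  have vP: "v \<in> Pl" using assms unfolding fin_places_def by auto
  interpret v: place F v by (rule place_Pl[OF vP])
  have t: "v.vge 0 t" using fin_placesD[OF assms] unfolding v.vge_def by auto
  show ?thesis
  proof (induction p)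
    case (pCons c p)
    have "v.vge (0 + 0) (t * ev p t)" by (intro v.vge_mult t pCons t_F ev_Tw) simp
    then show ?case by (auto intro!: v.vge_add const_F F.mult t_F ev_Tw)
  qed simp
qed

lemma y_fin_vge:
  assumes "v \<in> fin_places a" "i < 5"
  shows "place.vge v 0 (y i)"
proof -
  have vP: "v \<in> Pl" using assms unfolding fin_places_def by auto
  interpret v: place F v by (rule place_Pl[OF vP])
  have "v.vge 0 (t + of_nat i)" using ev_fin_vge[OF assms(1), of "shift i"] by simp
  moreover have "t + of_nat i \<noteq> 0" using y_sq[OF assms(2)] y_nonzero[OF assms(2)] by (metis power_not_zero)
  ultimately have "0 \<le> 2 * v (y i)" using v.v_pow[OF y_F[OF assms(2)], of 2] y_sq[OF assms(2)]
    by (simp add: v.vge_def)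
  then show ?thesis unfolding v.vge_def by auto
qed

lemma ev_inf:
  assumes v: "v \<in> inf_places" and "p \<noteq> 0"
  shows "v (ev p t) = - 2 * int (degree p)"
proof -
  have vP: "v \<in> Pl" using assms unfolding inf_places_def by auto
  interpret v: place F v by (rule place_Pl[OF vP])
  show ?thesis using assms(2)
  proof (induction p rule: alg_closed_poly_induct)
    case (const c)
    then show ?case by (simp add: v.v_const)
  next
    case (linear_factor r q)
    then have q: "q \<noteq> 0" by auto
    have "ev q t \<noteq> 0" "ev [:- r, 1:] t \<noteq> 0" using q tr unfolding transc_def by fastforce+
    then have "v (ev [:- r, 1:] t * ev q t) = v (ev [:- r, 1:] t) + v (ev q t)"
      by (intro v.v_mult ev_Tw) auto
    moreover have "v (ev [:- r, 1:] t) = - 2" using inf_place_values(1)[OF v, of r] by simp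
    moreover have "degree ([:- r, 1:] * q) = Suc (degree q)" using q by (subst degree_mult_eq) auto
    ultimately show ?case using linear_factor(1)[OF q] by (simp only: ev_mult) simp
  qed
qed

lemma pole_space_fin: "n \<le> 5 \<Longrightarrow> f \<in> pole_space n m \<Longrightarrow> v \<in> fin_places a \<Longrightarrow> place.vge v 0 f"
proof (induction n arbitrary: m f)
  case 0
  then show ?case using ev_fin_vge by auto
next
  case (Suc n)
  then have vP: "v \<in> Pl" unfolding fin_places_def by auto
  interpret v: place F v by (rule place_Pl[OF vP])
  obtain A B where AB: "A \<in> pole_space n m" "B \<in> pole_space n (m - 1)" "f = A + B * y n" using Suc.prems by auto
  have F: "A \<in> F" "B \<in> F" using AB pole_space_Tw[of n] Tw_mono[of n 5] Suc.prems(1) by auto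
  have n: "n < 5" using Suc.prems by simp
  have "v.vge (0 + 0) (B * y n)" by (intro v.vge_mult y_fin_vge[OF Suc.prems(3) n] Suc.IH[OF _ AB(2)] y_F F n) (use n Suc.prems in auto)
  then show ?case unfolding AB(3) by (intro v.vge_add F.mult y_F F n Suc.IH[OF _ AB(1)]) (use n Suc.prems in auto)
qed

lemma pole_space_inf: "n \<le> 5 \<Longrightarrow> f \<in> pole_space n m \<Longrightarrow> v \<in> inf_places \<Longrightarrow> place.vge v (- m) f"
proof (induction n arbitrary: m f)
  case 0
  then have vP: "v \<in> Pl" unfolding inf_places_def by auto
  interpret v: place F v by (rule place_Pl[OF vP])
  obtain p where p: "f = ev p t" "p = 0 \<or> 2 * int (degree p) \<le> m" using 0 by auto
  then show ?case using ev_inf[OF 0(3)] by (cases "p = 0") (auto simp: v.vge_def)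
next
  case (Suc n)
  then have vP: "v \<in> Pl" unfolding inf_places_def by auto
  interpret v: place F v by (rule place_Pl[OF vP])
  obtain A B where AB: "A \<in> pole_space n m" "B \<in> pole_space n (m - 1)" "f = A + B * y n" using Suc.prems by auto
  have F: "A \<in> F" "B \<in> F" using AB pole_space_Tw[of n] Tw_mono[of n 5] Suc.prems(1) by auto
  have n: "n < 5" using Suc.prems by simp
  have "v.vge (- 1) (y n)" using inf_place_values(3)[OF Suc.prems(3) n] unfolding v.vge_def by simp
  then have "v.vge (- (m - 1) + - 1) (B * y n)" by (intro v.vge_mult Suc.IH[OF _ AB(2)] y_F F n) (use n Suc.prems in auto)
  then have "v.vge (- m) (B * y n)" by simp
  then show ?case unfolding AB(3) by (intro v.vge_add F.mult y_F F n Suc.IH[OF _ AB(1)]) (use n Suc.prems in auto)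
qed

text \<open>The pull-back of a place along \<sigma> is again a place, and it lies at infinity
  exactly when the original one does, because \<sigma> fixes t. Since \<open>pole_div m\<close> is
  constant on the places at infinity, it is invariant.\<close>

lemma automorphism_RR:
  assumes \<sigma>: "fhom F \<sigma>" "\<And>x. x \<in> F \<Longrightarrow> \<sigma> x \<in> F" "\<And>x. x \<in> F \<Longrightarrow> \<sigma> (\<sigma> x) = x" "\<And>p. \<sigma> (ev p t) = ev p t"
    and x: "x \<in> RR (pole_div m)"
  shows "\<sigma> x \<in> RR (pole_div m)"
  unfolding RR_iff
proof (intro conjI ballI)
  have xF: "x \<in> F" using x unfolding RR_iff by auto
  then show "\<sigma> x \<in> F" using \<sigma> by blast
  fix v assume v: "v \<in> Pl"
  interpret v: place F v by (rule place_Pl[OF v])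
  note nz = F.fhom_eq_0_iff[OF \<sigma>(1)]
  define w where "w x = (if x \<in> F \<and> x \<noteq> 0 then v (\<sigma> x) else 0)" for x
  have "w ` (F - {0}) = UNIV"
  proof -
    have "n \<in> w ` (F - {0})" for n
    proof -
      obtain x where "x \<in> F" "x \<noteq> 0" "v x = n" using v.v_surj by blast
      then show ?thesis using \<sigma>(2,3) nz by (intro image_eqI[of _ _ "\<sigma> x"]) (auto simp: w_def)
    qed
    then show ?thesis by auto
  qed
  moreover have "\<sigma> (fls_const c) = fls_const c" for c using \<sigma>(4)[of "[:c:]"] by simp
  moreover have "min (v (\<sigma> x)) (v (\<sigma> z)) \<le> v (\<sigma> (x + z))" if "x \<in> F" "x \<noteq> 0" "z \<in> F" "z \<noteq> 0" "x + z \<noteq> 0" for x z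
    using v.v_add[of "\<sigma> x" "\<sigma> z"] \<sigma>(2) nz that nz[of "x + z"] F.add[of x z] by (simp add: fhom_add[OF \<sigma>(1)])
  ultimately have "w \<in> places (range fls_const) (set_ring F)"
    unfolding places_def set_ring_simps using nz \<sigma>(2) v.v_mult F.add F.mult
    by (auto simp: w_def fhom_mult[OF \<sigma>(1)] v.v_const)
  then have w: "w \<in> Pl" unfolding Pl_def .
  have wt: "w t = v t" using \<sigma>(4)[of "[:0, 1:]"] t_F t_nonzero by (simp add: w_def)
  have "pole_div m w = pole_div m v" using w v wt unfolding pole_div_def inf_places_def by auto
  moreover have "place.vge w (- pole_div m w) x" using x w unfolding RR_iff by auto
  ultimately show "v.vge (- pole_div m v) (\<sigma> x)"
    unfolding v.vge_def place.vge_def[OF place_Pl[OF w]] using xF nz[OF xF] by (cases "x = 0") (auto simp: w_def)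
qed

text \<open>A pole of r at t = a cannot be cancelled by the roots: at a place over a at most one y j
  vanishes, to order 1, and then t - a has order 2. Hence r is a polynomial in t. A place at
  infinity bounds its degree, each y i with i in U using up one unit of the pole order.\<close>

lemma pole_space_base:
  assumes r: "r \<in> ratf t" and U: "U \<subseteq> {..<5}" and x: "r * prod y U \<in> RR (pole_div m)"
  shows "r \<in> pole_space 0 (m - int (card U))"
proof (cases "r = 0")
  case True
  then show ?thesis using pole_space_0 by metis
next
  case False
  have finU: "finite U" using U finite_subset by blast
  have yU: "prod y U \<in> F" "prod y U \<noteq> 0" using U y_F y_nonzero finU by (auto intro!: F.prod)
  obtain p0 q0 where pq0: "r = ev p0 t / ev q0 t" "ev q0 t \<noteq> 0" using ratfE[OF r] by blast
  have p00: "p0 \<noteq> 0" "q0 \<noteq> 0" using False pq0 by auto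
  have "\<exists>p q. r = ev p t / ev q t \<and> p \<noteq> 0 \<and> q \<noteq> 0 \<and> (\<forall>a. poly p a \<noteq> 0 \<or> poly q a \<noteq> 0)"
    using p00 pq0(1)
  proof (induction "degree q0" arbitrary: p0 q0 rule: less_induct)
    case less
    show ?case
    proof (cases "\<forall>a. poly p0 a \<noteq> 0 \<or> poly q0 a \<noteq> 0")
      case True
      then show ?thesis using less.prems by blast
    next
      case False
      then obtain a where "poly p0 a = 0" "poly q0 a = 0" by blast
      then obtain p1 q1 where pq1: "p0 = [:- a, 1:] * p1" "q0 = [:- a, 1:] * q1" by (metis poly_eq_0_iff_dvd dvdE)
      have "p1 \<noteq> 0" "q1 \<noteq> 0" using less.prems pq1 by auto
      moreover have "degree q1 < degree q0" using \<open>q1 \<noteq> 0\<close> unfolding pq1 by (subst degree_mult_eq) auto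
      moreover have "r = ev p1 t / ev q1 t" unfolding less.prems(3) pq1 using t_neq_const[of a] by (simp only: ev_mult) simp
      ultimately show ?thesis using less.hyps by blast
    qed
  qed
  then obtain p q where pq: "r = ev p t / ev q t" "p \<noteq> 0" "q \<noteq> 0" "\<And>a. poly p a \<noteq> 0 \<or> poly q a \<noteq> 0" by blast
  have ev0: "ev p t \<noteq> 0" "ev q t \<noteq> 0" using pq tr unfolding transc_def by blast+
  have val: "v (r * prod y U) = v (ev p t) - v (ev q t) + (\<Sum>i\<in>U. v (y i))" if v: "v \<in> Pl" for v
  proof -
    interpret v: place F v by (rule place_Pl[OF v])
    have "v (r * prod y U) = v r + v (prod y U)" 
      using False yU ratf_Tw[of 5] r by (intro v.v_mult) auto
    moreover have "v r = v (ev p t) - v (ev q t)" unfolding pq(1) using ev0 ev_Tw by (intro v.v_div) auto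
    moreover have "v (prod y U) = (\<Sum>i\<in>U. v (y i))" using U y_F y_nonzero finU by (intro v.v_prod) auto
    ultimately show ?thesis by simp
  qed
  have x0: "r * prod y U \<noteq> 0" using False yU by simp
  have "degree q = 0"
  proof (rule ccontr)
    assume "degree q \<noteq> 0"
    then obtain a where a: "poly q a = 0" using alg_closed_imp_poly_has_root[of q] by auto
    then have pa: "poly p a \<noteq> 0" using pq(4) by blast
    have "\<exists>c. c ^ 2 = a + of_nat i" for i using nth_root_exists[of 2 "a + of_nat i"] by auto
    then obtain c where c: "\<And>i. c i ^ 2 = a + of_nat i" by metis
    have fp: "finite_point c" using c[of 0] unfolding finite_point_def by (simp add: c)
    obtain v where v: "v \<in> Pl" "lies_at v c" using finite_place_exists[OF fp] by blast
    interpret v: place F v by (rule place_Pl[OF v(1)])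
    have c0: "c 0 ^ 2 = a" using c[of 0] by simp
    have va: "v.vge 1 (t - fls_const a)" using lies_at_residue[OF v] c0 by simp
    then have vfin: "v \<in> fin_places a" using v unfolding fin_places_def by auto
    have red: "v.vge (v (t - fls_const a)) (ev g t - fls_const (poly g a))" for g
    proof -
      obtain h where "g - [:poly g a:] = [:- a, 1:] * h" by (metis poly_eq_0_iff_dvd dvdE poly_diff poly_const_conv diff_self)
      then have "ev (g - [:poly g a:]) t = (t - fls_const a) * ev h t" by (simp only: ev_mult) simp
      then have e: "ev g t - fls_const (poly g a) = (t - fls_const a) * ev h t" by simp
      have "v.vge (v (t - fls_const a) + 0) ((t - fls_const a) * ev h t)"
        by (intro v.vge_mult ev_fin_vge[OF vfin] F.diff t_F const_F ev_Tw) (auto simp: v.vge_def)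
      then show ?thesis unfolding e by simp
    qed
    have ta1: "v (t - fls_const a) \<ge> 1" using va t_neq_const[of a] by (auto simp: v.vge_def)
    have "v (ev p t) = 0"
      using v.v_unit(2)[OF ev_Tw v.vge_mono[OF red ta1] pa] by simp
    moreover have "v (ev q t) \<ge> v (t - fls_const a)" using red[of q] a ev0 by (simp add: v.vge_def)
    \<comment> \<open>Order 1 of y j against order 2 of t - a at a ramified place, 0 against at
      least 1 otherwise.\<close>
    moreover have "(\<Sum>i\<in>U. v (y i)) < v (t - fls_const a)"
    proof (cases "\<exists>j<5. c j = 0")
      case True
      then obtain j where j: "j < 5" "c j = 0" by blast
      then have yj: "v (y j) = 1" using finite_place_aux[OF fp v v] by blast
      have "(\<Sum>i\<in>U. v (y i)) \<le> (\<Sum>i\<in>U. if i = j then 1 else 0)"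
      proof (intro sum_mono)
        fix i assume i: "i \<in> U"
        show "v (y i) \<le> (if i = j then 1 else 0)"
        proof (cases "i = j")
          case False
          then have "c i \<noteq> 0" using finite_point_zero_unique[OF fp, of i j] i j U by auto
          then have "v (y i) = 0" using v.v_unit(2)[OF y_F, of i "c i"] v(2) i U unfolding lies_at_def by auto
          then show ?thesis by simp
        qed (use yj in simp)
      qed
      also have "\<dots> \<le> 1" using finU by (simp add: sum.delta)
      also have "1 < v (t - fls_const a)"
      proof -
        have "a + of_nat j = 0" using c[of j] j by simp
        then have "of_nat j = fls_const (- a)" unfolding of_nat_const by (metis add_eq_0_iff)
        then have "t - fls_const a = y j ^ 2" using y_sq[OF j(1)] by simp
        then show ?thesis using v.v_pow[OF y_F[OF j(1)], of 2] yj by simp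
      qed
      finally show ?thesis .
    next
      case False
      have "v (y i) = 0" if "i \<in> U" for i
        using v.v_unit(2)[OF y_F, of i "c i"] v(2) that U False unfolding lies_at_def by auto
      then have "(\<Sum>i\<in>U. v (y i)) = 0" by (intro sum.neutral) auto
      then show ?thesis using ta1 by simp
    qed
    ultimately have "v (r * prod y U) < 0" using val[OF v(1)] by simp
    moreover have "v.vge 0 (r * prod y U)" using x vfin unfolding RR_pole_div_iff by blast
    ultimately show False using x0 unfolding v.vge_def by auto
  qed
  then obtain d where d: "q = [:d:]" by (metis degree_eq_zeroE)
  then have d0: "d \<noteq> 0" using pq(3) by auto
  have "fls_const d * fls_const (inverse d) = (1 :: 'k fls)" using d0 by (simp only: fls_const_mult_const) simp
  then have "fls_const (inverse d) * ev p t * fls_const d = ev p t" by (metis mult.assoc mult.commute mult_1)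
  moreover have "fls_const d \<noteq> 0" using d0 by simp
  ultimately have "ev p t / fls_const d = fls_const (inverse d) * ev p t" by (metis nonzero_mult_div_cancel_right)
  then have re: "r = ev (smult (inverse d) p) t" by (simp add: pq(1) d)
  obtain v where v: "v \<in> inf_places" using inf_places_card by (metis card.empty ex_in_conv zero_neq_numeral)
  then have vP: "v \<in> Pl" unfolding inf_places_def by auto
  interpret v: place F v by (rule place_Pl[OF vP])
  have "v.vge (- m) (r * prod y U)" using x v unfolding RR_pole_div_iff by blast
  then have "- m \<le> v (r * prod y U)" using x0 unfolding v.vge_def by auto
  also have "\<dots> = - 2 * int (degree p) - int (card U)"
  proof -
    have "(\<Sum>i\<in>U. v (y i)) = (\<Sum>i\<in>U. - 1)" using inf_place_values(3)[OF v] U by (intro sum.cong) auto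
    moreover have "v (ev q t) = 0" using ev_inf[OF v pq(3)] d by simp
    ultimately show ?thesis using val[OF vP] ev_inf[OF v pq(2)] by simp
  qed
  finally have "2 * int (degree (smult (inverse d) p)) \<le> m - int (card U)" using d0 by simp
  then show ?thesis unfolding re pole_space.simps by blast
qed

text \<open>The automorphism changing the sign of y n splits g into the even part A and the odd part
  B y n, both of which stay in the Riemann-Roch space. The set U collects the roots split off so
  far; each of them lowers the pole order left for the coefficient by one.\<close>

lemma RR_pole_space_aux:
  assumes "n \<le> 5" "g \<in> Tw n" "U \<subseteq> {n..<5}" "g * prod y U \<in> RR (pole_div m)"
  shows "g \<in> pole_space n (m - int (card U))"
  using assms
proof (induction n arbitrary: g U)
  case 0
  then show ?case using pole_space_base[of g U m] by (auto simp: atLeast0LessThan)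
next
  case (Suc n)
  have n: "n < 5" using Suc.prems by simp
  obtain A B where AB: "A \<in> Tw n" "B \<in> Tw n" "g = A + B * y n" using Suc.prems unfolding tower.simps adj_def by blast
  obtain \<sigma> where \<sigma>: "fhom F \<sigma>" "\<And>x. x \<in> F \<Longrightarrow> \<sigma> x \<in> F" "\<And>x. x \<in> F \<Longrightarrow> \<sigma> (\<sigma> x) = x" "\<And>p. \<sigma> (ev p t) = ev p t"
    "\<And>x. x \<in> Tw n \<Longrightarrow> \<sigma> x = x" "\<sigma> (y n) = - y n" "\<And>i. i < 5 \<Longrightarrow> i \<noteq> n \<Longrightarrow> \<sigma> (y i) = y i"
    using Tw_sign_automorphism[OF n] by blast
  have finU: "finite U" "n \<notin> U" using Suc.prems(3) finite_subset by auto
  have F: "A \<in> F" "B \<in> F" using AB Tw_mono[of n 5] n by auto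
  have \<sigma>U: "\<sigma> (prod y U) = prod y U \<and> prod y U \<in> F" if "U \<subseteq> {Suc n..<5}" "finite U" for U
    using that(2,1)
  proof (induction U rule: finite_induct)
    case (insert i U)
    then show ?case using \<sigma>(7)[of i] fhom_mult[OF \<sigma>(1), of "y i" "prod y U"] y_F[of i] F.mult by auto
  qed (simp add: fhom_one[OF \<sigma>(1)] F.one)
  note U = \<sigma>U[OF Suc.prems(3) finU(1)]
  have gU: "g * prod y U = A * prod y U + B * prod y (insert n U)" using AB(3) finU by (simp add: algebra_simps)
  have AF: "A * prod y U \<in> F" "B * prod y U \<in> F" using F U F.mult by auto
  have "\<sigma> (g * prod y U) = \<sigma> (A + B * y n) * \<sigma> (prod y U)"
    using F U n y_F F.add F.mult AB(3) by (simp add: fhom_mult[OF \<sigma>(1)])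
  also have "\<dots> = (A - B * y n) * prod y U"
    using F U n y_F F.mult AB \<sigma>(5,6) by (simp add: fhom_mult[OF \<sigma>(1)] fhom_add[OF \<sigma>(1)])
  finally have \<sigma>g: "\<sigma> (g * prod y U) = (A - B * y n) * prod y U" .
  have "\<sigma> (g * prod y U) \<in> RR (pole_div m)" by (rule automorphism_RR[OF \<sigma>(1-4) Suc.prems(4)])
  note s = RR_const_mult[OF RR_add[OF Suc.prems(4) this], of "1 / 2"] and d = RR_const_mult[OF RR_diff[OF Suc.prems(4) this], of "1 / 2"]
  \<comment> \<open>The even and odd parts are recovered by halving sum and difference, as 2 is
    nonzero in K.\<close>
  have half: "fls_const (1 / 2) * (x + x) = (x :: 'k fls)" for x
  proof -
    have "fls_const (1 / 2) * (x + x) = fls_const (1 / 2) * fls_const 2 * x" by (simp only: fls_const_numeral) (simp add: algebra_simps)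
    also have "fls_const (1 / 2) * fls_const 2 = (1 :: 'k fls)" using two by (simp only: fls_const_mult_const) simp
    finally show ?thesis by simp
  qed
  have "g * prod y U + \<sigma> (g * prod y U) = A * prod y U + A * prod y U" by (subst \<sigma>g) (simp add: AB(3) algebra_simps)
  then have A: "A * prod y U \<in> RR (pole_div m)" using s by (simp only: half)
  have "g * prod y U - \<sigma> (g * prod y U) = B * prod y (insert n U) + B * prod y (insert n U)"
    by (subst \<sigma>g) (use finU in \<open>simp add: AB(3) algebra_simps\<close>)
  then have B: "B * prod y (insert n U) \<in> RR (pole_div m)" using d by (simp only: half)
  have "A \<in> pole_space n (m - int (card U))" using Suc.prems(3) n by (intro Suc.IH[OF _ AB(1) _ A]) auto
  moreover have "B \<in> pole_space n (m - int (card (insert n U)))" using Suc.prems(3) n by (intro Suc.IH[OF _ AB(2) _ B]) auto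
  moreover have "m - int (card (insert n U)) = m - int (card U) - 1" using finU by simp
  ultimately show ?case using AB(3) by auto
qed

lemma RR_pole_div: "RR (pole_div m) = pole_space 5 m"
proof
  show "RR (pole_div m) \<subseteq> pole_space 5 m"
  proof
    fix x assume x: "x \<in> RR (pole_div m)"
    then have "x \<in> F" unfolding RR_iff by auto
    then show "x \<in> pole_space 5 m" using RR_pole_space_aux[of 5 x "{}" m] x by simp
  qed
  show "pole_space 5 m \<subseteq> RR (pole_div m)"
    unfolding RR_pole_div_iff subset_iff using pole_space_inf[of 5] pole_space_fin[of 5] pole_space_Tw[of 5 m] by blast
qed

end

lemma field_set_ring:
  assumes "subfld F"
  shows "field (set_ring F)"
proof -
  interpret subfld F by fact
  have "abelian_group (set_ring F)"
    by (rule abelian_groupI) (auto simp: add zero algebra_simps intro!: bexI[of _ "- _"] uminus)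
  moreover have "comm_monoid (set_ring F)"
    by (rule comm_monoidI) (auto simp: mult one algebra_simps)
  ultimately have "cring (set_ring F)"
    by (rule cringI) (auto simp: algebra_simps)
  then show ?thesis
    by (rule cring.cring_fieldI2) (auto intro!: bexI[of _ "inverse _"] inv)
qed

section \<open>Dimensions over the constants and the Riemann inequality\<close>

context sqrt_tower
begin

abbreviation "Kc \<equiv> range (fls_const :: 'k \<Rightarrow> 'k fls)"
abbreviation "FR \<equiv> set_ring F"

sublocale FR: field FR
  by (rule field_set_ring) (rule F.subfld_axioms)

lemma a_inv_R: "x \<in> F \<Longrightarrow> \<ominus>\<^bsub>FR\<^esub> x = - x"
  using FR.sum_zero_eq_neg[of "- x" x] F.uminus by auto

lemma inv_R: "x \<in> F \<Longrightarrow> x \<noteq> 0 \<Longrightarrow> inv\<^bsub>FR\<^esub> x = inverse x"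
  using FR.comm_inv_char[of x "inverse x"] F.inv by auto

lemma subfield_K: "subfield Kc FR"
proof (rule FR.subfieldI')
  show "subring Kc FR"
  proof (rule FR.subringI)
    show "Kc \<subseteq> carrier FR" using const_F by auto
    show "\<one>\<^bsub>FR\<^esub> \<in> Kc" by (auto intro!: image_eqI[of _ _ 1])
  next
    fix h assume "h \<in> Kc"
    then obtain c where c: "h = fls_const c" by auto
    have "- h = fls_const (- c)" by (simp add: c)
    then show "\<ominus>\<^bsub>FR\<^esub> h \<in> Kc" using a_inv_R[of h] const_F c by (metis rangeI)
  qed (auto simp: fls_const_mult_const fls_plus_const)
next
  fix k assume "k \<in> Kc - {\<zero>\<^bsub>FR\<^esub>}"
  then obtain c where c: "k = fls_const c" "c \<noteq> 0" by auto
  have "k * fls_const (inverse c) = 1" unfolding c(1) using c(2) by (simp only: fls_const_mult_const) simp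
  then have "inverse k = fls_const (inverse c)" by (rule inverse_unique)
  then show "inv\<^bsub>FR\<^esub> k \<in> Kc" using inv_R[of k] c const_F by auto
qed

lemma line_extension_iff: "u \<in> FR.line_extension Kc a E \<longleftrightarrow> (\<exists>c. \<exists>w\<in>E. u = fls_const c * a + w)"
  unfolding FR.line_extension_mem_iff by auto

abbreviation "dimK n E \<equiv> FR.dimension n Kc E"

text \<open>The field argument is a variable L with a separate equation, so that rule induction over
  the dimension predicate applies. Multiplication by c turns line extensions into line
  extensions.\<close>

lemma dim_mult_aux:
  assumes "c \<in> F" "c \<noteq> 0"
  shows "FR.dimension n L E \<Longrightarrow> L = Kc \<Longrightarrow> dimK n ((\<lambda>x. x * c) ` E)"
proof (induction rule: FR.dimension.induct)
  case zero_dim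
  have "(\<lambda>x. x * c) ` {\<zero>\<^bsub>FR\<^esub>} = {\<zero>\<^bsub>FR\<^esub>}" by auto
  then show ?case using FR.zero_dim by metis
next
  case (Suc_dim v E n L)
  have "(\<lambda>x. x * c) ` FR.line_extension Kc v E = FR.line_extension Kc (v * c) ((\<lambda>x. x * c) ` E)"
  proof
    show "(\<lambda>x. x * c) ` FR.line_extension Kc v E \<subseteq> FR.line_extension Kc (v * c) ((\<lambda>x. x * c) ` E)"
    proof
      fix u assume "u \<in> (\<lambda>x. x * c) ` FR.line_extension Kc v E"
      then obtain x where x: "x \<in> FR.line_extension Kc v E" "u = x * c" by blast
      then obtain d w where w: "w \<in> E" "u = (fls_const d * v + w) * c" unfolding line_extension_iff by blast
      then have "u = fls_const d * (v * c) + w * c" by (simp add: algebra_simps)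
      then show "u \<in> FR.line_extension Kc (v * c) ((\<lambda>x. x * c) ` E)" using w(1) line_extension_iff by blast
    qed
    show "FR.line_extension Kc (v * c) ((\<lambda>x. x * c) ` E) \<subseteq> (\<lambda>x. x * c) ` FR.line_extension Kc v E"
    proof
      fix u assume "u \<in> FR.line_extension Kc (v * c) ((\<lambda>x. x * c) ` E)"
      then obtain d w where w: "w \<in> E" "u = fls_const d * (v * c) + w * c" unfolding line_extension_iff by blast
      have "u = (fls_const d * v + w) * c" using w by (simp add: algebra_simps)
      moreover have "fls_const d * v + w \<in> FR.line_extension Kc v E" using w by (auto simp: line_extension_iff)
      ultimately show "u \<in> (\<lambda>x. x * c) ` FR.line_extension Kc v E" by blast
    qed
  qed
  moreover have "v * c \<notin> (\<lambda>x. x * c) ` E" using Suc_dim(2) assms(2) by auto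
  moreover have "v * c \<in> carrier FR" using Suc_dim(1) assms(1) F.mult by simp
  ultimately show ?case using FR.Suc_dim[OF _ _ Suc_dim.IH[OF Suc_dim.prems]] Suc_dim.prems by metis
qed

lemma dim_mult: "dimK n E \<Longrightarrow> c \<in> F \<Longrightarrow> c \<noteq> 0 \<Longrightarrow> dimK n ((\<lambda>x. x * c) ` E)"
  by (rule dim_mult_aux[OF _ _ _ refl])

lemma dim_poly: "dimK (Suc k) {ev p t | p. degree p \<le> k}"
proof (induction k)
  case 0
  have "{ev p t | p. degree p \<le> 0} = Kc" (is "?A = Kc")
  proof
    show "?A \<subseteq> Kc"
    proof
      fix x assume "x \<in> ?A"
      then obtain p where p: "x = ev p t" "degree p = 0" by auto
      then obtain c where "p = [:c:]" by (metis degree_eq_zeroE)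
      then show "x \<in> Kc" using p by simp
    qed
    show "Kc \<subseteq> ?A" using ev_const by (metis (mono_tags, lifting) CollectI degree_pCons_0 image_subset_iff le_numeral_extra(3))
  qed
  then show ?case using FR.dimension_one[OF subfield_K] by simp
next
  case (Suc k)
  let ?E = "{ev p t | p. degree p \<le> k}"
  let ?m = "monom 1 (Suc k) :: 'k poly"
  have "{ev p t | p. degree p \<le> Suc k} = FR.line_extension Kc (ev ?m t) ?E"
  proof
    show "{ev p t | p. degree p \<le> Suc k} \<subseteq> FR.line_extension Kc (ev ?m t) ?E"
    proof
      fix x assume "x \<in> {ev p t | p. degree p \<le> Suc k}"
      then obtain p where p: "x = ev p t" "degree p \<le> Suc k" by auto
      define q where "q = p - smult (coeff p (Suc k)) ?m"
      have "degree q \<le> k"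
      proof (rule degree_le, intro allI impI)
        fix i assume "k < i"
        then show "coeff q i = 0" using p(2) by (cases "i = Suc k") (auto simp: q_def coeff_eq_0)
      qed
      moreover have "x = fls_const (coeff p (Suc k)) * ev ?m t + ev q t" using p by (simp add: q_def)
      ultimately show "x \<in> FR.line_extension Kc (ev ?m t) ?E" by (auto simp: line_extension_iff)
    qed
    show "FR.line_extension Kc (ev ?m t) ?E \<subseteq> {ev p t | p. degree p \<le> Suc k}"
    proof
      fix x assume "x \<in> FR.line_extension Kc (ev ?m t) ?E"
      then obtain c q where q: "x = fls_const c * ev ?m t + ev q t" "degree q \<le> k" by (auto simp: line_extension_iff)
      have "x = ev (smult c ?m + q) t" using q by simp
      moreover have "degree (smult c ?m + q) \<le> Suc k" using q(2)
        by (intro degree_add_le) (auto intro: order_trans[OF degree_smult_le] simp: degree_monom_eq)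
      ultimately show "x \<in> {ev p t | p. degree p \<le> Suc k}" by blast
    qed
  qed
  moreover have "ev ?m t \<notin> ?E"
  proof
    assume "ev ?m t \<in> ?E"
    then obtain q where q: "ev ?m t = ev q t" "degree q \<le> k" by auto
    then have "ev (?m - q) t = 0" by simp
    then have "?m = q" using tr unfolding transc_def by (metis eq_iff_diff_eq_0)
    then show False using q(2) by (simp add: degree_monom_eq flip: \<open>?m = q\<close>)
  qed
  ultimately show ?case using FR.Suc_dim[OF _ _ Suc] ev_Tw[of 5] by auto
qed

lemma dim_pole_space_0:
  assumes "0 \<le> m"
  shows "dimK (nat (m div 2 + 1)) (pole_space 0 m)"
proof -
  have "pole_space 0 m = {ev p t | p. degree p \<le> nat (m div 2)}"
  proof -
    have "p = 0 \<or> 2 * int (degree p) \<le> m \<longleftrightarrow> degree p \<le> nat (m div 2)" for p :: "'k poly"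
      using assms by (cases "p = 0") auto
    then show ?thesis by simp
  qed
  moreover have "nat (m div 2 + 1) = Suc (nat (m div 2))" using assms by simp
  ultimately show ?thesis using dim_poly[of "nat (m div 2)"] by (simp only:)
qed

text \<open>The sum of the space and its y n multiple is direct because y n lies outside
  \<open>Tw n\<close>.\<close>

lemma dim_pole_space_Suc:
  assumes "n < 5" "dimK a (pole_space n m)" "dimK b (pole_space n (m - 1))"
  shows "dimK (a + b) (pole_space (Suc n) m)"
proof -
  let ?B = "(\<lambda>x. x * y n) ` pole_space n (m - 1)"
  interpret S: subfld "Tw n" using subfld_Tw assms(1) by simp
  have sub: "pole_space n m \<subseteq> Tw n" "pole_space n (m - 1) \<subseteq> Tw n" using pole_space_Tw assms(1) by auto
  have b: "dimK b ?B" by (rule dim_mult[OF assms(3) y_F[OF assms(1)] y_nonzero[OF assms(1)]])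
  have "pole_space n m \<inter> ?B \<subseteq> {0}"
  proof
    fix x assume "x \<in> pole_space n m \<inter> ?B"
    then obtain B where B: "x \<in> Tw n" "B \<in> Tw n" "x = B * y n" using sub by auto
    then have "x + 0 * y n = 0 + B * y n" by simp
    then have "x = 0" using S.adj_unique[OF y_notin_Tw[OF assms(1)] B(1) S.zero S.zero B(2)] by blast
    then show "x \<in> {0}" by simp
  qed
  then have int: "pole_space n m \<inter> ?B = {\<zero>\<^bsub>FR\<^esub>}" using pole_space_0[of n m] pole_space_0[of n "m - 1"] by force
  have "pole_space (Suc n) m = pole_space n m <+>\<^bsub>FR\<^esub> ?B"
    unfolding set_add_def' by auto
  then show ?thesis using FR.dimension_direct_sum_space[OF subfield_K assms(2) b int] by simp
qed

text \<open>Each stage adds the dimensions for m and for m - 1. From floor(m / 2) + 1 at the bottom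
  this yields m + 1, 2 m + 1, 4 m, 8 m - 4 and 16 m - 16. Five stages lower the pole bound by at
  most 5, so 5 <= m keeps it nonnegative, where the formula at the bottom holds.\<close>

lemma dim_pole_space:
  assumes "5 \<le> m"
  shows "dimK (nat (16 * m - 16)) (pole_space 5 m)"
proof -
  have 1: "dimK (nat (k + 1)) (pole_space 1 k)" if "1 \<le> k" for k
  proof -
    have "dimK (nat (k div 2 + 1) + nat ((k - 1) div 2 + 1)) (pole_space (Suc 0) k)"
      using that by (intro dim_pole_space_Suc dim_pole_space_0) auto
    moreover have "nat (k div 2 + 1) + nat ((k - 1) div 2 + 1) = nat (k + 1)" using that by linarith
    ultimately show ?thesis by simp
  qed
  have 2: "dimK (nat (2 * k + 1)) (pole_space 2 k)" if "2 \<le> k" for k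
  proof -
    have "dimK (nat (k + 1) + nat (k - 1 + 1)) (pole_space (Suc 1) k)"
      using that by (intro dim_pole_space_Suc 1) auto
    moreover have "nat (k + 1) + nat (k - 1 + 1) = nat (2 * k + 1)" using that by linarith
    ultimately show ?thesis by (simp add: numeral_2_eq_2)
  qed
  have 3: "dimK (nat (4 * k)) (pole_space 3 k)" if "3 \<le> k" for k
  proof -
    have "dimK (nat (2 * k + 1) + nat (2 * (k - 1) + 1)) (pole_space (Suc 2) k)"
      using that by (intro dim_pole_space_Suc 2) auto
    moreover have "nat (2 * k + 1) + nat (2 * (k - 1) + 1) = nat (4 * k)" using that by (subst nat_add_distrib[symmetric]) auto
    ultimately show ?thesis by (simp del: pole_space.simps)
  qed
  have 4: "dimK (nat (8 * k - 4)) (pole_space 4 k)" if "4 \<le> k" for k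
  proof -
    have "dimK (nat (4 * k) + nat (4 * (k - 1))) (pole_space (Suc 3) k)"
      using that by (intro dim_pole_space_Suc 3) auto
    moreover have "nat (4 * k) + nat (4 * (k - 1)) = nat (8 * k - 4)" using that by (subst nat_add_distrib[symmetric]) auto
    ultimately show ?thesis by (simp del: pole_space.simps)
  qed
  have "dimK (nat (8 * m - 4) + nat (8 * (m - 1) - 4)) (pole_space (Suc 4) m)"
    using assms by (intro dim_pole_space_Suc 4) auto
  moreover have "nat (8 * m - 4) + nat (8 * (m - 1) - 4) = nat (16 * m - 16)" using assms by (subst nat_add_distrib[symmetric]) auto
  ultimately show ?thesis by (simp del: pole_space.simps)
qed

text \<open>Every place lies at a point, and by uniqueness it coincides with the place built there
  from a Laurent series embedding.\<close>

lemma Pl_has_residues: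
  assumes v: "v \<in> Pl"
  shows "has_residues F v"
  using place_finite_or_infinite[OF v]
proof (elim disjE conjE exE)
  fix c assume c: "finite_point c" "lies_at v c"
  obtain w where w: "w \<in> Pl" "lies_at w c" "has_residues F w" using finite_place_exists[OF c(1)] by blast
  then show ?thesis using finite_place_aux[OF c(1) v c(2) w(1,2)] by simp
next
  fix s assume s: "infinite_point s" "lies_at_inf v s"
  obtain w where w: "w \<in> Pl" "lies_at_inf w s" "has_residues F w" using infinite_place_exists[OF s(1)] by blast
  then show ?thesis using infinite_place_aux[OF s(1) v s(2) w(1,2)] by simp
qed

lemma residue_quotient:
  assumes v: "v \<in> Pl" and x: "x \<in> F" "x \<noteq> 0" and u: "u \<in> F" "u \<noteq> 0" and eq: "v x = v u"
  shows "\<exists>c. place.vge v (v u + 1) (x - fls_const c * u)"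
proof -
  interpret v: place F v by (rule place_Pl[OF v])
  have z: "x / u \<in> F" "x / u \<noteq> 0" "v (x / u) = 0" using x u eq F.div by (auto simp: v.v_div)
  then obtain c where c: "v.vge 1 (x / u - fls_const c)" using Pl_has_residues[OF v] unfolding has_residues_def by blast
  have "v.vge (1 + v u) ((x / u - fls_const c) * u)"
    by (intro v.vge_mult c F.diff z const_F u) (simp add: v.vge_def)
  moreover have "(x / u - fls_const c) * u = x - fls_const c * u" using u by (simp add: field_simps)
  ultimately show ?thesis by (auto simp: add.commute)
qed

text \<open>Two functions with the extremal pole order at v become congruent after scaling one of
  them by a constant, because the residue field is K. So one new function u generates the larger
  space over the smaller one.\<close>

lemma RR_step:
  assumes v: "v \<in> Pl"
  shows "RR (D(v := D v + 1)) = RR D \<or> (\<exists>u\<in>F. u \<notin> RR D \<and> RR (D(v := D v + 1)) = FR.line_extension Kc u (RR D))"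
proof -
  interpret v: place F v by (rule place_Pl[OF v])
  let ?D = "D(v := D v + 1)"
  have split: "x \<in> RR ?D \<longleftrightarrow> x \<in> F \<and> v.vge (- D v - 1) x \<and> (\<forall>w\<in>Pl - {v}. place.vge w (- D w) x)" for x
    using v unfolding RR_iff by auto
  have split0: "x \<in> RR D \<longleftrightarrow> x \<in> F \<and> v.vge (- D v) x \<and> (\<forall>w\<in>Pl - {v}. place.vge w (- D w) x)" for x
    using v unfolding RR_iff by auto
  have sub: "RR D \<subseteq> RR ?D" using split split0 v.vge_mono by auto
  show ?thesis
  proof (cases "RR ?D \<subseteq> RR D")
    case False
    then obtain u where u: "u \<in> RR ?D" "u \<notin> RR D" by blast
    then have uF: "u \<in> F" using split by blast
    have vu: "u \<noteq> 0" "v u = - D v - 1" using u split split0 unfolding v.vge_def by auto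
    have "RR ?D = FR.line_extension Kc u (RR D)"
    proof
      show "FR.line_extension Kc u (RR D) \<subseteq> RR ?D"
        using sub u(1) by (auto simp: line_extension_iff intro!: RR_add RR_const_mult)
      show "RR ?D \<subseteq> FR.line_extension Kc u (RR D)"
      proof
        fix x assume x: "x \<in> RR ?D"
        then have xF: "x \<in> F" using split by blast
        show "x \<in> FR.line_extension Kc u (RR D)"
        proof (cases "v.vge (- D v) x")
          case True
          then have "x \<in> RR D" using x split split0 by blast
          then show ?thesis unfolding line_extension_iff by (intro exI[of _ 0] bexI[of _ x]) auto
        next
          case False
          then have "x \<noteq> 0" "v x = v u" using x split vu unfolding v.vge_def by auto
          then obtain c where c: "v.vge (v u + 1) (x - fls_const c * u)" using residue_quotient[OF v xF _ uF vu(1)] by blast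
          have "x - fls_const c * u \<in> RR ?D" by (intro RR_diff RR_const_mult x u)
          then have "x - fls_const c * u \<in> RR D" using c vu(2) split split0 by simp
          then show ?thesis unfolding line_extension_iff by (intro exI[of _ c] bexI[of _ "x - fls_const c * u"]) auto
        qed
      qed
    qed
    then show ?thesis using u(2) uF by blast
  qed (use sub in blast)
qed

text \<open>Iterating \<open>RR_step\<close> gives l(E) - l(D) <= deg E - deg D for D <= E. This
  degree difference is the measure of the induction.\<close>

lemma RR_raise:
  assumes "finite A" "A \<subseteq> Pl" "\<And>v. v \<notin> A \<Longrightarrow> D v = E v" "\<And>v. D v \<le> E v" "dimK n (RR D)"
  shows "\<exists>m. dimK m (RR E) \<and> int m \<le> int n + (\<Sum>v\<in>A. E v - D v)"
  using assms(3-5)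
proof (induction "nat (\<Sum>v\<in>A. E v - D v)" arbitrary: D n rule: less_induct)
  case less
  show ?case
  proof (cases "D = E")
    case True
    then show ?thesis using less.prems by auto
  next
    case False
    then obtain v where "D v \<noteq> E v" by auto
    then have v: "v \<in> A" "D v < E v" using less.prems(1)[of v] less.prems(2)[of v] by fastforce+
    let ?D = "D(v := D v + 1)"
    have vP: "v \<in> Pl" using v assms(2) by auto
    have sum: "(\<Sum>v\<in>A. E v - ?D v) = (\<Sum>v\<in>A. E v - D v) - 1"
      using assms(1) v(1) by (simp add: sum.remove[of A v])
    have "(\<Sum>w\<in>A. E w - D w) \<ge> (\<Sum>w\<in>{v}. E w - D w)"
      using assms(1) v(1) less.prems(2) by (intro sum_mono2) auto
    then have pos: "(\<Sum>v\<in>A. E v - D v) \<ge> 1" using v(2) by simp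
    obtain k where k: "dimK k (RR ?D)" "k \<le> Suc n"
    proof -
      from RR_step[OF vP, of D] show ?thesis
      proof (elim disjE bexE conjE)
        assume "RR ?D = RR D"
        then show ?thesis using less.prems(3) that[of n] by simp
      next
        fix u assume u: "u \<in> F" "u \<notin> RR D" "RR ?D = FR.line_extension Kc u (RR D)"
        then show ?thesis using FR.Suc_dim[OF _ u(2) less.prems(3)] that[of "Suc n"] by simp
      qed
    qed
    have "nat (\<Sum>v\<in>A. E v - ?D v) < nat (\<Sum>v\<in>A. E v - D v)" using sum pos by simp
    moreover have "?D w = E w" if "w \<notin> A" for w using that v(1) less.prems(1) by auto
    moreover have "?D w \<le> E w" for w using v(2) less.prems(2) by auto
    ultimately obtain m where m: "dimK m (RR E)" "int m \<le> int k + (\<Sum>v\<in>A. E v - ?D v)"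
      using less.hyps[of ?D k] k(1) by blast
    then show ?thesis using k(2) sum by (intro exI[of _ m]) auto
  qed
qed

lemma subalgebra_RR: "subalgebra Kc (RR D) FR"
proof -
  have zero: "0 \<in> RR D" unfolding RR_iff using F.zero place.vge_0[OF place_Pl] by auto
  have "subgroup (RR D) (add_monoid FR)"
  proof (rule FR.add.subgroupI)
    show "RR D \<subseteq> carrier FR"
      using RR_iff[of _ D] by (simp add: subset_iff)
    show "RR D \<noteq> {}" using zero by blast
  next
    fix a assume a: "a \<in> RR D"
    have "fls_const (- 1) * a \<in> RR D" using a by (rule RR_const_mult)
    moreover have "a \<in> F" using a RR_iff by blast
    ultimately show "\<ominus>\<^bsub>FR\<^esub> a \<in> RR D" by (simp add: a_inv_R)
  next
    fix a b assume "a \<in> RR D" "b \<in> RR D"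
    then have "a + b \<in> RR D" by (rule RR_add)
    then show "a \<oplus>\<^bsub>FR\<^esub> b \<in> RR D" by simp
  qed
  then show ?thesis
    by (intro subalgebra.intro) (auto simp: subalgebra_axioms_def intro: RR_const_mult)
qed

lemma divisors_iff: "D \<in> divisors Kc FR \<longleftrightarrow> finite {v. D v \<noteq> 0} \<and> {v. D v \<noteq> 0} \<subseteq> Pl"
  unfolding divisors_def Pl_def by simp

lemma pole_div_degree: "finite {v. pole_div m v \<noteq> 0} \<and> divisor_degree (pole_div m) = 16 * m"
proof -
  have sub: "{v. pole_div m v \<noteq> 0} \<subseteq> inf_places" unfolding pole_div_def by auto
  have "divisor_degree (pole_div m) = sum (pole_div m) inf_places"
    using degree_eq_sum[OF _ sub] inf_places_card by blast
  also have "\<dots> = (\<Sum>v\<in>inf_places. m)" by (intro sum.cong) (auto simp: pole_div_def)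
  finally show ?thesis using inf_places_card finite_subset[OF sub] by auto
qed

text \<open>Linear equivalence: division by q turns the bounds prescribed by D into those prescribed
  by D plus the divisor of q.\<close>

lemma RR_twist:
  assumes q: "q \<in> F" "q \<noteq> 0"
  shows "RR (\<lambda>v. D v + divr q v) = (\<lambda>x. x * inverse q) ` RR D"
proof -
  have "x \<in> RR (\<lambda>v. D v + divr q v) \<longleftrightarrow> x * q \<in> RR D" if x: "x \<in> F" for x
  proof -
    have "place.vge v (- (D v + divr q v)) x \<longleftrightarrow> place.vge v (- D v) (x * q)" if v: "v \<in> Pl" for v
    proof -
      interpret v: place F v by (rule place_Pl[OF v])
      show ?thesis using v v.v_mult[OF x _ q] q unfolding v.vge_def divr_def by (cases "x = 0") auto
    qed
    then show ?thesis using x q F.mult unfolding RR_iff by auto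
  qed
  note iff = this
  show ?thesis
  proof
    show "RR (\<lambda>v. D v + divr q v) \<subseteq> (\<lambda>x. x * inverse q) ` RR D"
    proof
      fix x assume x: "x \<in> RR (\<lambda>v. D v + divr q v)"
      then have "x \<in> F" unfolding RR_iff by auto
      then have "x * q \<in> RR D" using iff x by blast
      moreover have "x = x * q * inverse q" using q by simp
      ultimately show "x \<in> (\<lambda>x. x * inverse q) ` RR D" by blast
    qed
    show "(\<lambda>x. x * inverse q) ` RR D \<subseteq> RR (\<lambda>v. D v + divr q v)"
    proof
      fix x assume "x \<in> (\<lambda>x. x * inverse q) ` RR D"
      then obtain z where z: "z \<in> RR D" "x = z * inverse q" by blast
      then have "x \<in> F" "x * q = z" using q F.mult F.inv unfolding RR_iff by auto
      then show "x \<in> RR (\<lambda>v. D v + divr q v)" using iff z by blast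
    qed
  qed
qed

text \<open>D lies below E, which is m times infinity plus the divisor of q, and l(E) = 16 m - 16
  and deg E <= 16 m are known. By \<open>RR_raise\<close>, deg D - l(D) <= deg E - l(E) <=
  16.\<close>

lemma riemann_inequality:
  assumes D: "D \<in> divisors Kc FR"
  shows "\<exists>n. dimK n (RR D) \<and> divisor_degree D - int n + 1 \<le> 17"
proof -
  let ?S = "{v. D v \<noteq> 0}"
  have S: "finite ?S" "?S \<subseteq> Pl" using D unfolding divisors_iff by auto
  obtain as where as: "\<And>v. v \<in> ?S \<Longrightarrow> 0 \<le> v t \<Longrightarrow> D v \<le> v (lin_prod as)"
    using lin_prod_dominates[of "{v \<in> ?S. 0 \<le> v t}" D] S by auto
  define q where "q = lin_prod as"
  \<comment> \<open>The 5 makes the dimension formula valid, twice the length offsets the poles of q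
    at infinity, and the sum of absolute values dominates D there.\<close>
  define m where "m = 5 + 2 * int (length as) + (\<Sum>v\<in>?S. \<bar>D v\<bar>)"
  define E where "E = (\<lambda>v. pole_div m v + divr q v)"
  have q: "q \<in> F" "q \<noteq> 0" unfolding q_def by (rule lin_prod_F)+
  have m: "5 \<le> m" unfolding m_def by (simp add: sum_nonneg)
  have dimE: "dimK (nat (16 * m - 16)) (RR E)"
    unfolding E_def RR_twist[OF q] RR_pole_div
    by (intro dim_mult dim_pole_space m F.inv q) (use q in auto)
  have degE: "finite {v. E v \<noteq> 0}" "divisor_degree E \<le> 16 * m"
    using divisor_degree_add[of "pole_div m" "divr q"] pole_div_degree[of m] divr_lin_prod[of as] unfolding E_def q_def by auto
  have DE: "D v \<le> E v" for v
  proof (cases "v \<in> Pl")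
    case False
    then have "D v = 0" "E v = 0" using S(2) by (auto simp: E_def pole_div_def inf_places_def divr_def)
    then show ?thesis by simp
  next
    case True
    show ?thesis
    proof (cases "0 \<le> v t")
      case fin: True
      have "D v \<le> v q"
      proof (cases "D v = 0")
        case True
        then show ?thesis using lin_prod_fin_nonneg[OF \<open>v \<in> Pl\<close> fin] by (simp add: q_def)
      next
        case False
        then show ?thesis using as[of v] fin by (simp add: q_def)
      qed
      moreover have "v \<notin> inf_places" using fin unfolding inf_places_def by simp
      ultimately show ?thesis using True by (simp add: E_def pole_div_def divr_def)
    next
      case False
      then have vi: "v \<in> inf_places" using True unfolding inf_places_def by simp
      have "D v \<le> (\<Sum>v\<in>?S. \<bar>D v\<bar>)"
      proof (cases "D v = 0")
        case True
        then show ?thesis by (simp add: sum_nonneg)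
      next
        case False
        then have "\<bar>D v\<bar> \<le> (\<Sum>v\<in>?S. \<bar>D v\<bar>)" using S(1) by (intro member_le_sum) auto
        then show ?thesis by linarith
      qed
      then show ?thesis using vi True lin_prod_inf[OF vi, of as] by (simp add: E_def pole_div_def divr_def q_def m_def)
    qed
  qed
  have "RR D \<subseteq> RR E"
  proof
    fix x assume x: "x \<in> RR D"
    have "place.vge v (- E v) x" if v: "v \<in> Pl" for v
      using place.vge_mono[OF place_Pl[OF v], of "- D v" x "- E v"] DE[of v] x v unfolding RR_iff by auto
    then show "x \<in> RR E" using x unfolding RR_iff by auto
  qed
  \<comment> \<open>\<open>RR_raise\<close> starts from a given dimension of the smaller space; its
    finiteness comes from the inclusion in the space of E.\<close>
  then have "FR.finite_dimension Kc (RR D)"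
    using FR.subalbegra_incl_imp_finite_dimension[OF subfield_K FR.finite_dimensionI[OF dimE] subalgebra_RR] by blast
  then obtain n where n: "dimK n (RR D)" unfolding FR.finite_dimension_def by blast
  let ?A = "?S \<union> {v. E v \<noteq> 0}"
  have A: "finite ?A" "?A \<subseteq> Pl" using S degE(1)
    by (auto simp: E_def pole_div_def inf_places_def divr_def split: if_splits)
  obtain k where k: "dimK k (RR E)" "int k \<le> int n + (\<Sum>v\<in>?A. E v - D v)"
    using RR_raise[OF A, of D E n] DE n by auto
  have "k = nat (16 * m - 16)" using FR.dimension_is_inj[OF subfield_K k(1) dimE] .
  moreover have "(\<Sum>v\<in>?A. E v - D v) = divisor_degree E - divisor_degree D"
    unfolding sum_subtractf using degree_eq_sum[OF A(1), of E] degree_eq_sum[OF A(1), of D] by auto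
  ultimately have "divisor_degree D - int n + 1 \<le> 17" using k(2) degE(2) m by auto
  then show ?thesis using n by blast
qed

theorem has_genus_17: "has_genus Kc FR 17"
  unfolding has_genus_def
proof (intro conjI ballI)
  show "\<exists>n. dimK n (RR D) \<and> divisor_degree D - int n + 1 \<le> int 17" if "D \<in> divisors Kc FR" for D
    using riemann_inequality[OF that] by simp
  \<comment> \<open>An instance of the range m >= 5 in which the bound is attained: 16 * 6 - 80 + 1
    = 17.\<close>
  have "pole_div 6 \<in> divisors Kc FR"
    unfolding divisors_iff using pole_div_degree[of 6] by (auto simp: pole_div_def inf_places_def split: if_splits)
  moreover have "dimK 80 (RR (pole_div 6))" using dim_pole_space[of 6] unfolding RR_pole_div by simp
  moreover have "divisor_degree (pole_div 6) - int 80 + 1 = int 17" using pole_div_degree[of 6] by simp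
  ultimately show "\<exists>D\<in>divisors Kc FR. \<exists>n. dimK n (RR D) \<and> divisor_degree D - int n + 1 = int 17" by blast
qed

end

section \<open>The coordinate ring\<close>

definition mono_eval :: "(nat \<Rightarrow> 'a::comm_monoid_mult) \<Rightarrow> (nat \<Rightarrow>\<^sub>0 nat) \<Rightarrow> 'a" where
  "mono_eval w m = (\<Prod>i\<in>Poly_Mapping.keys m. w i ^ Poly_Mapping.lookup m i)"

definition mpoly_eval :: "(nat \<Rightarrow> 'k fls) \<Rightarrow> 'k::field mpoly \<Rightarrow> 'k fls" where
  "mpoly_eval w f = (\<Sum>m\<in>Poly_Mapping.keys f. fls_const (Poly_Mapping.lookup f m) * mono_eval w m)"

lemma mono_eval_superset:
  assumes "finite A" "Poly_Mapping.keys m \<subseteq> A"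
  shows "mono_eval w m = (\<Prod>i\<in>A. w i ^ Poly_Mapping.lookup m i)"
  unfolding mono_eval_def using assms
  by (intro prod.mono_neutral_left) (auto simp: in_keys_iff)

lemma mono_eval_add: "mono_eval w (m + n) = mono_eval w m * mono_eval w n"
proof -
  let ?A = "Poly_Mapping.keys m \<union> Poly_Mapping.keys n"
  have "mono_eval w (m + n) = (\<Prod>i\<in>?A. w i ^ Poly_Mapping.lookup (m + n) i)"
    by (intro mono_eval_superset) (use Poly_Mapping.keys_add[of m n] in auto)
  also have "\<dots> = (\<Prod>i\<in>?A. w i ^ Poly_Mapping.lookup m i) * (\<Prod>i\<in>?A. w i ^ Poly_Mapping.lookup n i)"
    by (simp add: lookup_add power_add prod.distrib)
  also have "\<dots> = mono_eval w m * mono_eval w n"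
    using mono_eval_superset[of ?A m w] mono_eval_superset[of ?A n w] by simp
  finally show ?thesis .
qed

lemma mpoly_eval_superset:
  assumes "finite A" "Poly_Mapping.keys f \<subseteq> A"
  shows "mpoly_eval w f = (\<Sum>m\<in>A. fls_const (Poly_Mapping.lookup f m) * mono_eval w m)"
  unfolding mpoly_eval_def using assms
  by (intro sum.mono_neutral_left) (auto simp: in_keys_iff)

lemma mpoly_eval_add: "mpoly_eval w (f + g) = mpoly_eval w f + mpoly_eval w g"
proof -
  let ?A = "Poly_Mapping.keys f \<union> Poly_Mapping.keys g"
  have "mpoly_eval w (f + g) = (\<Sum>m\<in>?A. fls_const (Poly_Mapping.lookup (f + g) m) * mono_eval w m)"
    by (intro mpoly_eval_superset) (use Poly_Mapping.keys_add[of f g] in auto)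
  also have "\<dots> = (\<Sum>m\<in>?A. fls_const (Poly_Mapping.lookup f m) * mono_eval w m)
      + (\<Sum>m\<in>?A. fls_const (Poly_Mapping.lookup g m) * mono_eval w m)"
    by (simp only: lookup_add fls_plus_const[symmetric] distrib_right sum.distrib)
  also have "\<dots> = mpoly_eval w f + mpoly_eval w g"
    using mpoly_eval_superset[of ?A f w] mpoly_eval_superset[of ?A g w] by simp
  finally show ?thesis .
qed

lemma mpoly_eval_0: "mpoly_eval w 0 = 0"
  by (simp add: mpoly_eval_def)

lemma mpoly_eval_single: "mpoly_eval w (Poly_Mapping.single m c) = fls_const c * mono_eval w m"
  by (simp add: mpoly_eval_def)

lemma poly_mapping_plus_induct [case_names zero plus]:
  assumes "P 0" and plus: "\<And>f a b. a \<notin> Poly_Mapping.keys f \<Longrightarrow> b \<noteq> 0 \<Longrightarrow> P f \<Longrightarrow> P (f + Poly_Mapping.single a b)"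
  shows "P (f :: 'a \<Rightarrow>\<^sub>0 'b::comm_monoid_add)"
proof (induction f rule: update_induct)
  case (update f a b)
  have "Poly_Mapping.update a b f = f + Poly_Mapping.single a b"
    using update(1) by (intro poly_mapping_eqI) (auto simp: lookup_update lookup_add lookup_single when_def in_keys_iff)
  then show ?case using plus[OF update] by simp
qed (rule assms(1))

lemma mpoly_induct [case_names single add]:
  assumes "\<And>m c. P (Poly_Mapping.single m c)" "\<And>f g. P f \<Longrightarrow> P g \<Longrightarrow> P (f + g)"
  shows "P (f :: 'a \<Rightarrow>\<^sub>0 'b::comm_monoid_add)"
proof (induction f rule: poly_mapping_plus_induct)
  case zero
  then show ?case using assms(1)[of undefined 0] by simp
next
  case (plus f a b)
  then show ?case by (intro assms)
qed

lemma mpoly_eval_mult: "mpoly_eval w (f * g) = mpoly_eval w f * mpoly_eval w g"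
proof (induction f rule: mpoly_induct)
  case (single m c)
  show ?case
  proof (induction g rule: mpoly_induct)
    case (single n d)
    then show ?case by (simp add: mult_single mpoly_eval_single mono_eval_add mult_ac flip: fls_const_mult_const)
  qed (simp add: algebra_simps mpoly_eval_add)
qed (simp add: algebra_simps mpoly_eval_add)

lemma mpoly_eval_const [simp]: "mpoly_eval w (mconst c) = fls_const c"
  by (simp add: mconst_def mpoly_eval_single mono_eval_def)

lemma mpoly_eval_var [simp]: "mpoly_eval w (mvar i) = w i"
  by (simp add: mvar_def mpoly_eval_single mono_eval_def)

lemma mpoly_eval_1 [simp]: "mpoly_eval w 1 = 1"
  using mpoly_eval_const[of w 1] by (simp add: mconst_def)

lemma mpoly_eval_diff: "mpoly_eval w (f - g) = mpoly_eval w f - mpoly_eval w g"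
  using mpoly_eval_add[of w "f - g" g] by simp

lemma mpoly_eval_power: "mpoly_eval w (f ^ n) = mpoly_eval w f ^ n"
  by (induction n) (simp_all add: mpoly_eval_mult)

abbreviation mcar :: "nat \<Rightarrow> 'k::field mpoly set" where
  "mcar l \<equiv> carrier (mpoly_ring l)"

lemma mcar_iff: "f \<in> mcar l \<longleftrightarrow> (\<forall>m\<in>Poly_Mapping.keys f. Poly_Mapping.keys m \<subseteq> {..<l})"
  by (simp add: mpoly_ring_def)

lemma mpoly_ring_simps [simp]:
  "x \<otimes>\<^bsub>mpoly_ring l\<^esub> y = x * y" "\<one>\<^bsub>mpoly_ring l\<^esub> = 1"
  "\<zero>\<^bsub>mpoly_ring l\<^esub> = 0" "x \<oplus>\<^bsub>mpoly_ring l\<^esub> y = x + y"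
  by (simp_all add: mpoly_ring_def)

lemma mcar_single: "Poly_Mapping.keys m \<subseteq> {..<l} \<Longrightarrow> Poly_Mapping.single m c \<in> mcar l"
  by (simp add: mcar_iff)

lemma mcar_const: "mconst c \<in> mcar l"
  unfolding mconst_def by (rule mcar_single) simp

lemma mcar_var: "i < l \<Longrightarrow> mvar i \<in> mcar l"
  unfolding mvar_def by (rule mcar_single) simp

lemma mcar_0: "0 \<in> mcar l"
  by (simp add: mcar_iff)

lemma mcar_1: "1 \<in> mcar l"
  by (simp add: mcar_iff)

lemma mcar_add: "f \<in> mcar l \<Longrightarrow> g \<in> mcar l \<Longrightarrow> f + g \<in> mcar l"
  using Poly_Mapping.keys_add[of f g] unfolding mcar_iff by blast

lemma mcar_uminus: "f \<in> mcar l \<Longrightarrow> - f \<in> mcar l"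
  unfolding mcar_iff by (simp add: in_keys_iff)

lemma mcar_diff: "f \<in> mcar l \<Longrightarrow> g \<in> mcar l \<Longrightarrow> f - g \<in> mcar l"
  using mcar_add[of f l "- g"] mcar_uminus[of g l] by simp

lemma mcar_mult:
  assumes "f \<in> mcar l" "g \<in> mcar l"
  shows "f * g \<in> mcar l"
  unfolding mcar_iff
proof
  fix m assume "m \<in> Poly_Mapping.keys (f * g)"
  then obtain a b where ab: "m = a + b" "a \<in> Poly_Mapping.keys f" "b \<in> Poly_Mapping.keys g"
    using Poly_Mapping.keys_mult[of f g] by blast
  then show "Poly_Mapping.keys m \<subseteq> {..<l}"
    using assms Poly_Mapping.keys_add[of a b] unfolding mcar_iff by blast
qed

lemma mcar_power: "f \<in> mcar l \<Longrightarrow> f ^ n \<in> mcar l"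
  by (induction n) (auto intro: mcar_mult mcar_1)

lemma cring_mpoly_ring: "cring (mpoly_ring l :: 'k::field mpoly ring)"
proof (rule cringI)
  show "abelian_group (mpoly_ring l :: 'k mpoly ring)"
    by (rule abelian_groupI)
      (auto simp: mcar_add mcar_0 algebra_simps intro!: bexI[of _ "- _"] mcar_uminus)
  show "comm_monoid (mpoly_ring l :: 'k mpoly ring)"
    by (rule comm_monoidI) (auto simp: mcar_mult mcar_1 algebra_simps)
qed (auto simp: algebra_simps)

text \<open>Serves as an induction principle: values of polynomials lie in F, and polynomials reduce
  to normal forms, because this holds for constants and variables.\<close>

lemma mcar_generated:
  assumes const: "\<And>c. mconst c \<in> Q" and var: "\<And>i. i < l \<Longrightarrow> mvar i \<in> Q"
    and add: "\<And>f g. f \<in> Q \<Longrightarrow> g \<in> Q \<Longrightarrow> f + g \<in> Q"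
    and mult: "\<And>f g. f \<in> Q \<Longrightarrow> g \<in> Q \<Longrightarrow> f * g \<in> Q"
  shows "mcar l \<subseteq> Q"
proof
  have mono: "Poly_Mapping.single m 1 \<in> Q" if "Poly_Mapping.keys m \<subseteq> {..<l}" for m
    using that
  proof (induction m rule: poly_mapping_plus_induct)
    case zero
    then show ?case using const[of 1] by (simp add: mconst_def)
  next
    case (plus f i n)
    have keys: "Poly_Mapping.keys (f + Poly_Mapping.single i n) = insert i (Poly_Mapping.keys f)"
      using plus(1,2) by (auto simp: in_keys_iff lookup_add lookup_single when_def split: if_splits)
    then have i: "i < l" and f: "Poly_Mapping.keys f \<subseteq> {..<l}" using plus(4) by auto
    have "Poly_Mapping.single (Poly_Mapping.single i n) 1 \<in> Q"
    proof (induction n)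
      case 0
      then show ?case using const[of 1] by (simp add: mconst_def)
    next
      case (Suc n)
      have "Poly_Mapping.single (Poly_Mapping.single i (Suc n)) 1
          = mvar i * (Poly_Mapping.single (Poly_Mapping.single i n) 1 :: 'a mpoly)"
        by (simp add: mvar_def mult_single flip: single_add)
      then show ?case using mult[OF var[OF i] Suc] by simp
    qed
    then have "Poly_Mapping.single f 1 * Poly_Mapping.single (Poly_Mapping.single i n) 1 \<in> Q"
      using plus(3)[OF f] by (intro mult)
    then show ?case by (simp add: mult_single)
  qed
  fix f :: "'a mpoly" assume "f \<in> mcar l"
  then show "f \<in> Q"
  proof (induction "card (Poly_Mapping.keys f)" arbitrary: f)
    case 0
    then have "f = 0" by simp
    then show ?case using const[of 0] by (simp add: mconst_def)
  next
    case (Suc n)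
    then obtain m where m: "m \<in> Poly_Mapping.keys f" by (metis card.empty ex_in_conv old.nat.distinct(2))
    define c where "c = Poly_Mapping.lookup f m"
    define g where "g = f - Poly_Mapping.single m c"
    have keys: "Poly_Mapping.keys g = Poly_Mapping.keys f - {m}"
      by (auto simp: g_def c_def in_keys_iff lookup_minus lookup_single when_def split: if_splits)
    then have "card (Poly_Mapping.keys g) = n" using Suc(2) m by simp
    moreover have "g \<in> mcar l" using Suc(3) keys unfolding mcar_iff by auto
    ultimately have "g \<in> Q" using Suc(1) by blast
    moreover have "mconst c * Poly_Mapping.single m 1 \<in> Q"
      using Suc(3) m unfolding mcar_iff by (intro mult const mono) auto
    moreover have "f = g + mconst c * Poly_Mapping.single m 1"
      by (simp add: g_def mconst_def mult_single)
    ultimately show ?case using add by metis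
  qed
qed

locale curve_tower = sqrt_tower t y for t :: "'k::alg_closed_field fls" and y +
  fixes S :: "letter list" and ep em :: 'k
  assumes len: "length S = 5" and ep: "ep \<noteq> 0" and em: "em \<noteq> 0"
begin

abbreviation "e \<equiv> eps ep em S"

definition root_e :: "nat \<Rightarrow> 'k" where
  "root_e i = (SOME r. r ^ 2 = e i)"

lemma e_nonzero: "e i \<noteq> 0"
  using ep em by (simp add: eps_def)

lemma root_e: "root_e i ^ 2 = e i"
  unfolding root_e_def by (rule someI_ex) (use nth_root_exists[of 2 "e i"] in auto)

lemma root_e_nonzero: "root_e i \<noteq> 0"
  using root_e[of i] e_nonzero[of i] by auto

text \<open>The coordinate function on the curve: y i divided by a square root of e i, so that e i
  times its square is t + i.\<close>

definition w :: "nat \<Rightarrow> 'k fls" where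
  "w i = fls_const (inverse (root_e i)) * y i"

lemma w_y: "fls_const (root_e i) * w i = y i"
proof -
  have "fls_const (root_e i) * fls_const (inverse (root_e i)) = (1 :: 'k fls)"
    using root_e_nonzero[of i] by (simp only: fls_const_mult_const) simp
  then show ?thesis unfolding w_def by (metis mult.assoc mult_1)
qed

lemma w_sq:
  assumes "i < 5"
  shows "fls_const (e i) * w i ^ 2 = t + of_nat i"
proof -
  have "t + of_nat i = (fls_const (root_e i) * w i) ^ 2" unfolding w_y using y_sq[OF assms] by simp
  also have "\<dots> = fls_const (root_e i) ^ 2 * w i ^ 2" by (rule power_mult_distrib)
  also have "fls_const (root_e i) ^ 2 = fls_const (e i)"
    unfolding power2_eq_square fls_const_mult_const using root_e[of i] by (simp add: power2_eq_square)
  finally show ?thesis by simp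
qed

lemma w_Tw: "i < n \<Longrightarrow> n \<le> 5 \<Longrightarrow> w i \<in> Tw n"
  unfolding w_def using subfld.mult[OF subfld_Tw] const_Tw y_Tw by auto

abbreviation "mev \<equiv> mpoly_eval w"
abbreviation "I \<equiv> curve_ideal ep em S"

definition ker :: "'k mpoly set" where
  "ker = {f \<in> mcar 5. mev f = 0}"

sublocale M: cring "mpoly_ring 5 :: 'k mpoly ring"
  by (rule cring_mpoly_ring)

lemma mev_F: "f \<in> mcar 5 \<Longrightarrow> mev f \<in> F"
proof -
  have "mcar 5 \<subseteq> {f. mev f \<in> F}"
    by (rule mcar_generated)
      (auto simp: mpoly_eval_add mpoly_eval_mult const_F w_Tw F.add F.mult)
  then show "f \<in> mcar 5 \<Longrightarrow> mev f \<in> F" by blast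
qed

lemma ring_hom_mev: "ring_hom_ring (mpoly_ring 5) FR mev"
  by (rule ring_hom_ringI2[OF M.ring_axioms FR.ring_axioms], rule ring_hom_memI)
    (auto simp: mev_F mpoly_eval_add mpoly_eval_mult)

lemma ideal_ker: "ideal ker (mpoly_ring 5)"
proof -
  have "ker = a_kernel (mpoly_ring 5) FR mev" unfolding ker_def a_kernel_def' by simp
  then show ?thesis using ring_hom_ring.kernel_is_ideal[OF ring_hom_mev] by simp
qed

lemma primeideal_ker: "primeideal ker (mpoly_ring 5)"
proof (rule primeidealI[OF ideal_ker M.is_cring])
  have "1 \<notin> ker" unfolding ker_def by simp
  then show "mcar 5 \<noteq> ker" using mcar_1 by blast
  fix a b assume "a \<in> mcar 5" "b \<in> mcar 5" "a \<otimes>\<^bsub>mpoly_ring 5\<^esub> b \<in> ker"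
  then show "a \<in> ker \<or> b \<in> ker" unfolding ker_def by (auto simp: mpoly_eval_mult)
qed

definition gens :: "'k mpoly set" where
  "gens = {mconst (e (Suc i)) * (mvar (Suc i))^2 - mconst (e i) * (mvar i)^2 - 1 | i. Suc i < 5}"

lemma I_gens: "I = Idl\<^bsub>mpoly_ring 5\<^esub> gens"
  unfolding curve_ideal_def gens_def len ..

lemma gens_car: "gens \<subseteq> mcar 5"
  unfolding gens_def by (auto intro!: mcar_diff mcar_mult mcar_const mcar_power mcar_var mcar_1)

lemma ideal_I: "ideal I (mpoly_ring 5)"
  unfolding I_gens by (rule M.genideal_ideal[OF gens_car])

lemma I_ker: "I \<subseteq> ker"
  unfolding I_gens
proof (rule M.genideal_minimal[OF ideal_ker], rule subsetI)
  fix f assume f: "f \<in> gens"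
  then obtain i where i: "Suc i < 5" "f = mconst (e (Suc i)) * (mvar (Suc i))^2 - mconst (e i) * (mvar i)^2 - 1"
    unfolding gens_def by blast
  have "mev f = fls_const (e (Suc i)) * w (Suc i) ^ 2 - fls_const (e i) * w i ^ 2 - 1"
    unfolding i(2) by (simp only: mpoly_eval_diff mpoly_eval_mult mpoly_eval_const mpoly_eval_var mpoly_eval_power mpoly_eval_1)
  also have "\<dots> = 0" using w_sq[OF i(1)] w_sq[of i] i(1) by simp
  finally show "f \<in> ker" using f gens_car unfolding ker_def by blast
qed

lemma I_car: "f \<in> I \<Longrightarrow> f \<in> mcar 5"
  using I_ker unfolding ker_def by blast

lemma I_add: "f \<in> I \<Longrightarrow> g \<in> I \<Longrightarrow> f + g \<in> I"
  using additive_subgroup.a_closed[OF ideal.axioms(1)[OF ideal_I], of f g] by simp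

lemma I_mult: "f \<in> I \<Longrightarrow> g \<in> mcar 5 \<Longrightarrow> g * f \<in> I"
  using ideal.I_l_closed[OF ideal_I, of f g] by simp

lemma I_zero: "0 \<in> I"
  using additive_subgroup.zero_closed[OF ideal.axioms(1)[OF ideal_I]] by simp

section \<open>Normal forms in the coordinate ring and primality of the ideal\<close>

definition T :: "'k mpoly" where
  "T = mconst (e 0) * (mvar 0)^2"

lemma T_car: "T \<in> mcar 5"
  unfolding T_def by (intro mcar_mult mcar_const mcar_power mcar_var) simp

lemma mconst_simps: "mconst (a + b) = mconst a + mconst b" "mconst (a * b) = mconst a * mconst b" "mconst 0 = 0" "mconst 1 = 1"
  by (simp_all add: mconst_def single_add mult_single)

lemma of_nat_mconst: "of_nat n = (mconst (of_nat n) :: 'k mpoly)"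
  by (simp add: mconst_def)

text \<open>Consecutive generators telescope down to T, the polynomial that stands for t.\<close>

lemma rel_in_I:
  assumes "n < 5"
  shows "mconst (e n) * (mvar n)^2 - (T + of_nat n) \<in> I"
  using assms
proof (induction n)
  case 0
  then show ?case by (simp add: T_def I_zero)
next
  case (Suc n)
  have "mconst (e (Suc n)) * (mvar (Suc n))^2 - mconst (e n) * (mvar n)^2 - 1 \<in> I"
    unfolding I_gens using Suc(2) by (intro subsetD[OF M.genideal_self[OF gens_car]]) (auto simp: gens_def)
  then have "(mconst (e (Suc n)) * (mvar (Suc n))^2 - mconst (e n) * (mvar n)^2 - 1) + (mconst (e n) * (mvar n)^2 - (T + of_nat n)) \<in> I"
    using Suc by (intro I_add) auto
  then show ?case by (simp add: algebra_simps)
qed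

definition pev :: "'k poly \<Rightarrow> 'k mpoly" where
  "pev p = poly (map_poly mconst p) T"

lemma pev_0: "pev 0 = 0"
  by (simp add: pev_def)

lemma pev_pCons: "pev (pCons a p) = mconst a + T * pev p"
  by (cases "a = 0 \<and> p = 0") (auto simp: pev_def map_poly_pCons mconst_simps)

lemma pev_add: "pev (p + q) = pev p + pev q"
  by (induction p q rule: poly_induct2) (simp_all add: pev_0 pev_pCons algebra_simps mconst_simps)

lemma pev_smult: "pev (smult a p) = mconst a * pev p"
  by (induction p) (simp_all add: pev_0 pev_pCons algebra_simps mconst_simps)

lemma pev_mult: "pev (p * q) = pev p * pev q"
  by (induction p) (simp_all add: pev_0 pev_pCons pev_add pev_smult algebra_simps mconst_simps)

lemma pev_car: "pev p \<in> mcar 5"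
  by (induction p) (simp_all add: pev_0 pev_pCons mcar_0 mcar_add mcar_mult mcar_const T_car)

lemma mev_pev: "mev (pev p) = ev p t"
proof (induction p)
  case 0
  then show ?case by (simp add: pev_0 mpoly_eval_0)
next
  case (pCons a p)
  have "mev T = t" unfolding T_def using w_sq[of 0] by (simp add: mpoly_eval_mult mpoly_eval_power)
  then show ?case using pCons by (simp add: pev_pCons mpoly_eval_add mpoly_eval_mult)
qed

text \<open>Normal forms of polynomials modulo the ideal of the curve: linear in each coordinate, with
  coefficients that are polynomials in \<open>T\<close>.\<close>

primrec nf :: "nat \<Rightarrow> 'k mpoly set" where
  "nf 0 = range pev"
| "nf (Suc n) = {A + B * mvar n | A B. A \<in> nf n \<and> B \<in> nf n}"

lemma nf_SucI: "A \<in> nf n \<Longrightarrow> B \<in> nf n \<Longrightarrow> A + B * mvar n \<in> nf (Suc n)"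
  by auto

lemma nf_car: "n \<le> 5 \<Longrightarrow> f \<in> nf n \<Longrightarrow> f \<in> mcar 5"
proof (induction n arbitrary: f)
  case (Suc n)
  then show ?case by (auto intro!: mcar_add mcar_mult mcar_var)
qed (auto simp: pev_car)

lemma nf_add: "f \<in> nf n \<Longrightarrow> g \<in> nf n \<Longrightarrow> f + g \<in> nf n"
proof (induction n arbitrary: f g)
  case 0
  then obtain p q where "f = pev p" "g = pev q" by auto
  then have "f + g = pev (p + q)" by (simp only: pev_add)
  then show ?case by (simp only: nf.simps rangeI)
next
  case (Suc n)
  then obtain A B C D where *: "A \<in> nf n" "B \<in> nf n" "C \<in> nf n" "D \<in> nf n" "f = A + B * mvar n" "g = C + D * mvar n"
    by auto
  have "f + g = (A + C) + (B + D) * mvar n" using * by (simp add: algebra_simps)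
  moreover have "A + C \<in> nf n" "B + D \<in> nf n" using Suc.IH * by auto
  ultimately show ?case by auto
qed

lemma nf_pev: "pev p \<in> nf n"
proof (induction n)
  case (Suc n)
  have "pev 0 \<in> nf n" by (induction n) (auto simp: pev_0 intro!: exI[of _ 0] image_eqI[of _ _ 0])
  then show ?case using nf_SucI[OF Suc, of "pev 0"] by (simp add: pev_0 del: nf.simps)
qed simp

definition red :: "nat \<Rightarrow> 'k mpoly set" where
  "red n = {f \<in> mcar 5. \<exists>g\<in>nf n. f - g \<in> I}"

lemma redI: "g \<in> nf n \<Longrightarrow> i \<in> I \<Longrightarrow> n \<le> 5 \<Longrightarrow> g + i \<in> red n"
  unfolding red_def using nf_car[of n g] I_car[of i] mcar_add[of g 5 i] by (auto intro!: bexI[of _ g])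

lemma redE:
  assumes "f \<in> red n"
  shows "\<exists>g i. g \<in> nf n \<and> i \<in> I \<and> f = g + i"
proof -
  obtain g where "g \<in> nf n" "f - g \<in> I" using assms unfolding red_def by auto
  then show ?thesis by (intro exI[of _ g] exI[of _ "f - g"]) auto
qed

lemma red_add:
  assumes "n \<le> 5" "f \<in> red n" "g \<in> red n"
  shows "f + g \<in> red n"
proof -
  obtain a i where 1: "a \<in> nf n" "i \<in> I" "f = a + i" using redE[OF assms(2)] by blast
  obtain b j where 2: "b \<in> nf n" "j \<in> I" "g = b + j" using redE[OF assms(3)] by blast
  have "f + g = (a + b) + (i + j)" using 1 2 by simp
  then show ?thesis using redI[OF nf_add[OF 1(1) 2(1)] I_add[OF 1(2) 2(2)] assms(1)] by simp
qed

lemma nf_red: "n \<le> 5 \<Longrightarrow> f \<in> nf n \<Longrightarrow> f \<in> red n"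
  using redI[of f n 0] I_zero by simp

text \<open>A square (mvar n)^2 arising in a product is replaced by (T + n) / e n modulo I, which
  leaves only coefficients of the previous stage. The induction runs over normal forms; remainders
  in I are absorbed because I is an ideal.\<close>

lemma red_mult:
  assumes "n \<le> 5" "f \<in> red n" "g \<in> red n"
  shows "f * g \<in> red n"
proof -
  have nf_mult: "f * g \<in> red n" if "f \<in> nf n" "g \<in> nf n" for f g
    using assms(1) that
  proof (induction n arbitrary: f g)
    case 0
    then obtain p q where "f = pev p" "g = pev q" by auto
    then have "f * g = pev (p * q)" by (simp add: pev_mult)
    then show ?case using nf_red[of 0] by auto
  next
    case (Suc n)
    then have n: "n < 5" by simp
    have redm: "f * g \<in> red n" if "f \<in> red n" "g \<in> red n" for f g
    proof -
      obtain a i where 1: "a \<in> nf n" "i \<in> I" "f = a + i" using redE[OF \<open>f \<in> red n\<close>] by blast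
      obtain b j where 2: "b \<in> nf n" "j \<in> I" "g = b + j" using redE[OF \<open>g \<in> red n\<close>] by blast
      have "a * b \<in> red n" using Suc.IH[OF _ 1(1) 2(1)] n by simp
      then obtain c k where 3: "c \<in> nf n" "k \<in> I" "a * b = c + k" using redE by blast
      have "f * g = c + (k + (a * j + g * i))" using 1 2 3 by (simp add: algebra_simps)
      moreover have "g \<in> mcar 5" using that(2) unfolding red_def by auto
      then have "k + (a * j + g * i) \<in> I" using 1 2 3 nf_car[of n a] n by (intro I_add I_mult) auto
      ultimately show ?thesis using redI[OF 3(1)] n by simp
    qed
    obtain A B C D where *: "A \<in> nf n" "B \<in> nf n" "C \<in> nf n" "D \<in> nf n" "f = A + B * mvar n" "g = C + D * mvar n"
      using Suc.prems by auto
    have r: "A \<in> red n" "B \<in> red n" "C \<in> red n" "D \<in> red n" using * nf_red n by auto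
    define s where "s = pev (smult (inverse (e n)) (shift n))"
    have s: "s = mconst (inverse (e n)) * (T + of_nat n)"
      unfolding s_def pev_smult by (simp add: shift_def pev_pCons pev_0 mconst_simps of_nat_mconst add.commute)
    have sred: "s \<in> red n" unfolding s_def using nf_pev nf_red n by simp
    have x2: "(mvar n)^2 - s \<in> I"
    proof -
      have "mconst (inverse (e n)) * (mconst (e n) * (mvar n)^2 - (T + of_nat n)) \<in> I"
        by (intro I_mult rel_in_I n mcar_const)
      moreover have "mconst (inverse (e n)) * mconst (e n) = 1"
        unfolding mconst_simps(2)[symmetric] using e_nonzero[of n] by (simp add: mconst_simps)
      ultimately show ?thesis unfolding s right_diff_distrib mult.assoc[symmetric] by simp
    qed
    have P: "A * C + B * D * s \<in> red n" "A * D + B * C \<in> red n"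
      using r sred n by (auto intro!: red_add redm)
    obtain a i where 1: "a \<in> nf n" "i \<in> I" "A * C + B * D * s = a + i" using redE[OF P(1)] by blast
    obtain b j where 2: "b \<in> nf n" "j \<in> I" "A * D + B * C = b + j" using redE[OF P(2)] by blast
    have "f * g = (A * C + B * D * s) + (A * D + B * C) * mvar n + B * D * ((mvar n)^2 - s)"
      using * by (simp add: algebra_simps power2_eq_square)
    also have "\<dots> = (a + b * mvar n) + (i + (mvar n * j + B * D * ((mvar n)^2 - s)))"
      unfolding 1 2 by (simp add: algebra_simps)
    finally have eq: "f * g = (a + b * mvar n) + (i + (mvar n * j + B * D * ((mvar n)^2 - s)))" .
    have "a + b * mvar n \<in> nf (Suc n)" using 1 2 by auto
    moreover have "i + (mvar n * j + B * D * ((mvar n)^2 - s)) \<in> I"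
      using 1 2 x2 n nf_car[of n] * by (intro I_add I_mult mcar_var mcar_mult) auto
    ultimately show ?case unfolding eq using n by (intro redI) auto
  qed
  obtain a i where 1: "a \<in> nf n" "i \<in> I" "f = a + i" using redE[OF assms(2)] by blast
  obtain b j where 2: "b \<in> nf n" "j \<in> I" "g = b + j" using redE[OF assms(3)] by blast
  obtain c k where 3: "c \<in> nf n" "k \<in> I" "a * b = c + k" using redE[OF nf_mult[OF 1(1) 2(1)]] by blast
  have "f * g = c + (k + (a * j + g * i))" using 1 2 3 by (simp add: algebra_simps)
  moreover have "g \<in> mcar 5" using assms(3) unfolding red_def by auto
  then have "k + (a * j + g * i) \<in> I" using 1 2 3 nf_car[of n a] assms(1) by (intro I_add I_mult) auto
  ultimately show ?thesis using redI[OF 3(1) _ assms(1)] by simp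
qed

lemma nf_mono: "m \<le> n \<Longrightarrow> nf m \<subseteq> nf n"
proof (induction n)
  case (Suc n)
  have "nf n \<subseteq> nf (Suc n)"
  proof
    fix f assume f: "f \<in> nf n"
    show "f \<in> nf (Suc n)" using nf_SucI[OF f nf_pev[of 0 n]] by (simp add: pev_0 del: nf.simps)
  qed
  then show ?case using Suc by (cases "m = Suc n") auto
qed simp

lemma mcar_red: "mcar 5 \<subseteq> red 5"
proof (rule mcar_generated)
  fix c :: 'k
  have "mconst c = pev [:c:]" by (simp add: pev_pCons pev_0)
  then show "mconst c \<in> red 5" using nf_pev nf_red[of 5] by simp
next
  fix i :: nat assume i: "i < 5"
  have "mvar i \<in> nf (Suc i)" using nf_SucI[OF nf_pev[of 0 i] nf_pev[of 1 i]]
    by (simp add: pev_0 one_pCons pev_pCons mconst_simps del: nf.simps)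
  then show "mvar i \<in> red 5" using nf_mono[of "Suc i" 5] i nf_red[of 5] by auto
qed (auto intro: red_add red_mult)

text \<open>Since t is transcendental and 1, y n are independent over \<open>Tw n\<close>, a normal
  form with value zero has all coefficients zero.\<close>

lemma nf_eval:
  assumes "n \<le> 5" "f \<in> nf n"
  shows "mev f \<in> Tw n \<and> (mev f = 0 \<longrightarrow> f = 0)"
  using assms
proof (induction n arbitrary: f)
  case 0
  then obtain p where p: "f = pev p" by auto
  then show ?case using tr ev_in_ratf[of p t] unfolding transc_def by (auto simp: mev_pev pev_0)
next
  case (Suc n)
  then have n: "n < 5" by simp
  interpret S: subfld "Tw n" using subfld_Tw n by simp
  obtain A B where AB: "A \<in> nf n" "B \<in> nf n" "f = A + B * mvar n" using Suc.prems by auto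
  have IH: "mev A \<in> Tw n" "mev B \<in> Tw n" "mev A = 0 \<Longrightarrow> A = 0" "mev B = 0 \<Longrightarrow> B = 0"
    using Suc.IH[OF _ AB(1)] Suc.IH[OF _ AB(2)] n by auto
  define c where "c = mev B * fls_const (inverse (root_e n))"
  have cT: "c \<in> Tw n" unfolding c_def using IH const_Tw n by (intro S.mult) auto
  have eq: "mev f = mev A + c * y n"
    unfolding AB(3) by (simp add: mpoly_eval_add mpoly_eval_mult c_def w_def mult.assoc)
  have "f = 0" if z: "mev f = 0"
  proof -
    have "mev A + c * y n = 0 + 0 * y n" using eq z by simp
    then have "mev A = 0" "c = 0" using S.adj_unique[OF y_notin_Tw[OF n] IH(1) cT S.zero S.zero] by blast+
    moreover have "fls_const (inverse (root_e n)) \<noteq> (0 :: 'k fls)" using root_e_nonzero[of n] by simp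
    ultimately have "mev B = 0" unfolding c_def by (metis mult_eq_0_iff)
    then show ?thesis using IH \<open>mev A = 0\<close> AB by simp
  qed
  moreover have "mev f \<in> Tw (Suc n)" unfolding eq using IH(1) cT by (auto intro: adjI)
  ultimately show ?case by blast
qed

text \<open>Modulo I every polynomial is a normal form, and a normal form in the kernel is 0. Being
  the kernel of a map into a field, I is prime.\<close>

lemma I_eq_ker: "I = ker"
proof
  show "ker \<subseteq> I"
  proof
    fix f assume f: "f \<in> ker"
    then have "f \<in> red 5" using mcar_red unfolding ker_def by blast
    then obtain g i where gi: "g \<in> nf 5" "i \<in> I" "f = g + i" using redE by blast
    have "mev i = 0" using gi(2) I_ker unfolding ker_def by blast
    then have "mev g = 0" using f gi(3) unfolding ker_def by (simp add: mpoly_eval_add)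
    then have "g = 0" using nf_eval[OF _ gi(1)] by simp
    then show "f \<in> I" using gi by simp
  qed
qed (rule I_ker)

end

section \<open>Transport of the genus along isomorphisms\<close>

text \<open>The value 0 outside B is the dummy value that \<open>places\<close> prescribes; it makes
  transport along \<psi> and along its inverse exact inverses of each other on places.\<close>

definition transport :: "('b \<Rightarrow> 'a) \<Rightarrow> 'b set \<Rightarrow> ('a \<Rightarrow> int) \<Rightarrow> 'b \<Rightarrow> int" where
  "transport \<psi> B v = (\<lambda>x. if x \<in> B then v (\<psi> x) else 0)"

lemma transport_place:
  assumes bij: "bij_betw \<psi> (carrier S) (carrier RA)"
    and zero: "\<And>x. x \<in> carrier S \<Longrightarrow> \<psi> x = \<zero>\<^bsub>RA\<^esub> \<longleftrightarrow> x = \<zero>\<^bsub>S\<^esub>"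
    and mult: "\<And>x y. x \<in> carrier S \<Longrightarrow> y \<in> carrier S \<Longrightarrow> \<psi> (x \<otimes>\<^bsub>S\<^esub> y) = \<psi> x \<otimes>\<^bsub>RA\<^esub> \<psi> y"
    and add: "\<And>x y. x \<in> carrier S \<Longrightarrow> y \<in> carrier S \<Longrightarrow> \<psi> (x \<oplus>\<^bsub>S\<^esub> y) = \<psi> x \<oplus>\<^bsub>RA\<^esub> \<psi> y"
    and closed: "\<And>x y. x \<in> carrier S \<Longrightarrow> y \<in> carrier S \<Longrightarrow> x \<otimes>\<^bsub>S\<^esub> y \<in> carrier S \<and> x \<oplus>\<^bsub>S\<^esub> y \<in> carrier S"
    and L: "L \<subseteq> carrier S" "\<psi> ` L \<subseteq> K"
    and v: "v \<in> places K RA"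
  shows "transport \<psi> (carrier S) v \<in> places L S"
proof -
  have 1: "\<forall>x \<in> carrier RA - {\<zero>\<^bsub>RA\<^esub>}. \<forall>y \<in> carrier RA - {\<zero>\<^bsub>RA\<^esub>}. v (x \<otimes>\<^bsub>RA\<^esub> y) = v x + v y"
    and 2: "\<forall>x \<in> carrier RA - {\<zero>\<^bsub>RA\<^esub>}. \<forall>y \<in> carrier RA - {\<zero>\<^bsub>RA\<^esub>}.
            x \<oplus>\<^bsub>RA\<^esub> y \<noteq> \<zero>\<^bsub>RA\<^esub> \<longrightarrow> min (v x) (v y) \<le> v (x \<oplus>\<^bsub>RA\<^esub> y)"
    and 3: "\<forall>c \<in> K - {\<zero>\<^bsub>RA\<^esub>}. v c = 0"
    and 4: "v ` (carrier RA - {\<zero>\<^bsub>RA\<^esub>}) = UNIV"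
    and 5: "\<forall>x. x \<notin> carrier RA - {\<zero>\<^bsub>RA\<^esub>} \<longrightarrow> v x = 0"
    using v unfolding places_def by auto
  have mem: "\<psi> x \<in> carrier RA - {\<zero>\<^bsub>RA\<^esub>}" if "x \<in> carrier S - {\<zero>\<^bsub>S\<^esub>}" for x
    using that bij_betwE[OF bij] zero by auto
  show ?thesis
    unfolding places_def
  proof (intro CollectI conjI ballI impI allI)
    fix x y assume xy: "x \<in> carrier S - {\<zero>\<^bsub>S\<^esub>}" "y \<in> carrier S - {\<zero>\<^bsub>S\<^esub>}"
    then show "transport \<psi> (carrier S) v (x \<otimes>\<^bsub>S\<^esub> y) = transport \<psi> (carrier S) v x + transport \<psi> (carrier S) v y"
      using 1 mem[OF xy(1)] mem[OF xy(2)] mult closed by (simp add: transport_def)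
    assume "x \<oplus>\<^bsub>S\<^esub> y \<noteq> \<zero>\<^bsub>S\<^esub>"
    then have "\<psi> x \<oplus>\<^bsub>RA\<^esub> \<psi> y \<noteq> \<zero>\<^bsub>RA\<^esub>" using xy zero[of "x \<oplus>\<^bsub>S\<^esub> y"] closed[of x y] add[of x y] by auto
    then show "min (transport \<psi> (carrier S) v x) (transport \<psi> (carrier S) v y) \<le> transport \<psi> (carrier S) v (x \<oplus>\<^bsub>S\<^esub> y)"
      using 2 mem[OF xy(1)] mem[OF xy(2)] xy add closed by (simp add: transport_def)
  next
    fix c assume c: "c \<in> L - {\<zero>\<^bsub>S\<^esub>}"
    then have "\<psi> c \<in> K - {\<zero>\<^bsub>RA\<^esub>}" using L zero[of c] by auto
    then show "transport \<psi> (carrier S) v c = 0" using 3 c L by (auto simp: transport_def)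
  next
    have "n \<in> transport \<psi> (carrier S) v ` (carrier S - {\<zero>\<^bsub>S\<^esub>})" for n
    proof -
      obtain x where x: "x \<in> carrier RA - {\<zero>\<^bsub>RA\<^esub>}" "n = v x" using 4 by (metis UNIV_I image_iff)
      then obtain z where z: "z \<in> carrier S" "x = \<psi> z" using bij unfolding bij_betw_def by auto
      then have "z \<in> carrier S - {\<zero>\<^bsub>S\<^esub>}" using x zero[of z] by auto
      then show ?thesis using x z by (intro image_eqI[of _ _ z]) (auto simp: transport_def)
    qed
    then show "transport \<psi> (carrier S) v ` (carrier S - {\<zero>\<^bsub>S\<^esub>}) = UNIV" by auto
  next
    fix x assume "x \<notin> carrier S - {\<zero>\<^bsub>S\<^esub>}"
    then have "x \<notin> carrier S \<or> \<psi> x = \<zero>\<^bsub>RA\<^esub>" using zero by auto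
    then show "transport \<psi> (carrier S) v x = 0" using 5 by (auto simp: transport_def)
  qed
qed

text \<open>The function field consists of cosets of fractions, whereas the genus is computed in a
  field of Laurent series. Places are carried over by composing valuations with the isomorphism or
  its inverse, and divisors and Riemann-Roch spaces follow.\<close>

lemma has_genus_transport:
  assumes RA: "ring RA" and S: "ring S" and iso: "\<phi> \<in> ring_iso RA S"
    and K: "subfield K RA" and nontriv: "\<one>\<^bsub>S\<^esub> \<noteq> \<zero>\<^bsub>S\<^esub>" and genus: "has_genus K RA g"
  shows "has_genus (\<phi> ` K) S g"
proof -
  interpret RA: ring RA by fact
  interpret S: ring S by fact
  interpret h: ring_hom_ring RA S \<phi>
    using iso by (intro ring_hom_ringI2 RA S) (auto simp: ring_iso_def)
  let ?A = "carrier RA" and ?B = "carrier S"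
  define \<psi> where "\<psi> = inv_into ?A \<phi>"
  have bij: "bij_betw \<phi> ?A ?B" using iso by (simp add: ring_iso_def)
  have bij': "bij_betw \<psi> ?B ?A" unfolding \<psi>_def by (rule bij_betw_inv_into[OF bij])
  have \<psi>\<phi>: "\<psi> (\<phi> x) = x" if "x \<in> ?A" for x
    unfolding \<psi>_def using bij that by (simp add: bij_betw_def)
  have \<phi>\<psi>: "\<phi> (\<psi> x) = x" and \<psi>B: "\<psi> x \<in> ?A" if "x \<in> ?B" for x
    using bij that bij_betwE[OF bij'] unfolding \<psi>_def by (auto simp: bij_betw_def f_inv_into_f)
  have KA: "K \<subseteq> ?A" by (rule subfieldE(3)[OF K])
  have \<psi>eq: "\<psi> u = x" if "u = \<phi> x" "x \<in> ?A" for u x using that \<psi>\<phi> by simp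
  have zero: "\<phi> x = \<zero>\<^bsub>S\<^esub> \<longleftrightarrow> x = \<zero>\<^bsub>RA\<^esub>" if "x \<in> ?A" for x
    using that \<psi>\<phi>[of x] \<psi>\<phi>[of "\<zero>\<^bsub>RA\<^esub>"] h.hom_zero by auto
  have zero': "\<psi> x = \<zero>\<^bsub>RA\<^esub> \<longleftrightarrow> x = \<zero>\<^bsub>S\<^esub>" if "x \<in> ?B" for x
    using zero[OF \<psi>B[OF that]] \<phi>\<psi>[OF that] by simp
  define push where "push = transport \<psi> ?B"
  define pull where "pull = transport \<phi> ?A"
  have push: "push v \<in> places (\<phi> ` K) S" if "v \<in> places K RA" for v
    unfolding push_def
  proof (rule transport_place[OF bij' zero' _ _ _ _ _ that])
    fix x y assume "x \<in> ?B" "y \<in> ?B"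
    then show "\<psi> (x \<otimes>\<^bsub>S\<^esub> y) = \<psi> x \<otimes>\<^bsub>RA\<^esub> \<psi> y" "\<psi> (x \<oplus>\<^bsub>S\<^esub> y) = \<psi> x \<oplus>\<^bsub>RA\<^esub> \<psi> y"
      using \<phi>\<psi> \<psi>B by (auto intro!: \<psi>eq)
  qed (use KA \<psi>\<phi> in auto)
  have pull: "pull w \<in> places K RA" if "w \<in> places (\<phi> ` K) S" for w
    unfolding pull_def
    by (rule transport_place[OF bij zero _ _ _ _ _ that]) (use KA in auto)
  have pull_push: "pull (push v) = v" if "v \<in> places K RA" for v
    using that \<psi>\<phi> unfolding pull_def push_def transport_def places_def by (auto simp: fun_eq_iff)
  have push_pull: "push (pull w) = w" if "w \<in> places (\<phi> ` K) S" for w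
    using that \<phi>\<psi> \<psi>B unfolding pull_def push_def transport_def places_def by (auto simp: fun_eq_iff)
  define pb where "pb D' = (\<lambda>v. if v \<in> places K RA then D' (push v) else 0)" for D' :: "_ \<Rightarrow> int"
  have supp: "{v. pb D' v \<noteq> 0} = pull ` {w. D' w \<noteq> 0}" if D': "D' \<in> divisors (\<phi> ` K) S" for D'
  proof -
    have s: "{w. D' w \<noteq> 0} \<subseteq> places (\<phi> ` K) S" using D' unfolding divisors_def by auto
    show ?thesis
    proof
      show "{v. pb D' v \<noteq> 0} \<subseteq> pull ` {w. D' w \<noteq> 0}"
      proof
        fix v assume "v \<in> {v. pb D' v \<noteq> 0}"
        then have "v \<in> places K RA" "D' (push v) \<noteq> 0" by (auto simp: pb_def split: if_splits)
        then show "v \<in> pull ` {w. D' w \<noteq> 0}" using pull_push[of v] by (intro image_eqI[of _ _ "push v"]) auto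
      qed
      show "pull ` {w. D' w \<noteq> 0} \<subseteq> {v. pb D' v \<noteq> 0}"
      proof
        fix v assume "v \<in> pull ` {w. D' w \<noteq> 0}"
        then obtain w where w: "v = pull w" "D' w \<noteq> 0" by auto
        then have "w \<in> places (\<phi> ` K) S" using s by auto
        then show "v \<in> {v. pb D' v \<noteq> 0}" using w pull[of w] push_pull[of w] by (simp add: pb_def)
      qed
    qed
  qed
  have back_div: "pb D' \<in> divisors K RA" if D': "D' \<in> divisors (\<phi> ` K) S" for D'
    using D' supp[OF D'] unfolding divisors_def by (auto simp: pb_def split: if_splits)
  have back_deg: "divisor_degree (pb D') = divisor_degree D'" if D': "D' \<in> divisors (\<phi> ` K) S" for D'
  proof -
    have s: "{w. D' w \<noteq> 0} \<subseteq> places (\<phi> ` K) S" using D' unfolding divisors_def by auto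
    have "inj_on pull {w. D' w \<noteq> 0}" by (rule inj_on_inverseI[of _ push]) (use push_pull s in auto)
    then have "divisor_degree (pb D') = (\<Sum>w\<in>{w. D' w \<noteq> 0}. pb D' (pull w))"
      unfolding divisor_degree_def supp[OF D'] by (simp add: sum.reindex)
    also have "\<dots> = (\<Sum>w\<in>{w. D' w \<noteq> 0}. D' w)"
    proof (rule sum.cong[OF refl])
      fix w assume "w \<in> {w. D' w \<noteq> 0}"
      then have "w \<in> places (\<phi> ` K) S" using s by blast
      then show "pb D' (pull w) = D' w" using pull[of w] push_pull[of w] by (simp add: pb_def)
    qed
    finally show ?thesis unfolding divisor_degree_def .
  qed
  have back_RR: "riemann_roch_space (\<phi> ` K) S D' = \<phi> ` riemann_roch_space K RA (pb D')" for D'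
  proof
    show "\<phi> ` riemann_roch_space K RA (pb D') \<subseteq> riemann_roch_space (\<phi> ` K) S D'"
    proof
      fix u assume "u \<in> \<phi> ` riemann_roch_space K RA (pb D')"
      then obtain x where x: "u = \<phi> x" "x \<in> ?A" "x = \<zero>\<^bsub>RA\<^esub> \<or> (\<forall>v\<in>places K RA. 0 \<le> v x + pb D' v)"
        unfolding riemann_roch_space_def by auto
      have "0 \<le> w u + D' w" if w: "w \<in> places (\<phi> ` K) S" and "x \<noteq> \<zero>\<^bsub>RA\<^esub>" for w
      proof -
        have "0 \<le> pull w x + pb D' (pull w)" using x that pull[OF w] by blast
        then show ?thesis using x(1,2) pull[OF w] push_pull[OF w] by (simp add: pb_def pull_def transport_def)
      qed
      then show "u \<in> riemann_roch_space (\<phi> ` K) S D'"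
        unfolding riemann_roch_space_def using x(1,2) zero[OF x(2)] by auto
    qed
    show "riemann_roch_space (\<phi> ` K) S D' \<subseteq> \<phi> ` riemann_roch_space K RA (pb D')"
    proof
      fix u assume u: "u \<in> riemann_roch_space (\<phi> ` K) S D'"
      then have uB: "u \<in> ?B" unfolding riemann_roch_space_def by auto
      have "0 \<le> v (\<psi> u) + pb D' v" if v: "v \<in> places K RA" and "\<psi> u \<noteq> \<zero>\<^bsub>RA\<^esub>" for v
      proof -
        have "u \<noteq> \<zero>\<^bsub>S\<^esub>" using that zero'[OF uB] by simp
        then have "0 \<le> push v u + D' (push v)" using u push[OF v] unfolding riemann_roch_space_def by auto
        then show ?thesis using uB v by (simp add: pb_def push_def transport_def)
      qed
      then have "\<psi> u \<in> riemann_roch_space K RA (pb D')"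
        unfolding riemann_roch_space_def using \<psi>B[OF uB] by auto
      then show "u \<in> \<phi> ` riemann_roch_space K RA (pb D')" using \<phi>\<psi>[OF uB] by (metis image_eqI)
    qed
  qed
  have dim: "ring.dimension S n (\<phi> ` K) (riemann_roch_space (\<phi> ` K) S D')"
    if "ring.dimension RA n K (riemann_roch_space K RA (pb D'))" for n D'
    unfolding back_RR
  proof (rule h.inj_hom_dimension[OF K nontriv _ that])
    show "inj_on \<phi> (riemann_roch_space K RA (pb D'))"
      using bij unfolding bij_betw_def riemann_roch_space_def by (auto intro: inj_on_subset)
  qed
  show ?thesis
    unfolding has_genus_def
  proof (intro conjI ballI)
    fix D' assume D': "D' \<in> divisors (\<phi> ` K) S"
    obtain n where "ring.dimension RA n K (riemann_roch_space K RA (pb D'))" "divisor_degree (pb D') - int n + 1 \<le> int g"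
      using genus back_div[OF D'] unfolding has_genus_def by blast
    then show "\<exists>n. ring.dimension S n (\<phi> ` K) (riemann_roch_space (\<phi> ` K) S D') \<and> divisor_degree D' - int n + 1 \<le> int g"
      using dim back_deg[OF D'] by auto
  next
    obtain D n where D: "D \<in> divisors K RA" "ring.dimension RA n K (riemann_roch_space K RA D)" "divisor_degree D - int n + 1 = int g"
      using genus unfolding has_genus_def by blast
    define D' where "D' = (\<lambda>w. if w \<in> places (\<phi> ` K) S then D (pull w) else 0)"
    have sD: "{v. D v \<noteq> 0} \<subseteq> places K RA" "finite {v. D v \<noteq> 0}" using D(1) unfolding divisors_def by auto
    have "{w. D' w \<noteq> 0} \<subseteq> push ` {v. D v \<noteq> 0}"
    proof
      fix w assume "w \<in> {w. D' w \<noteq> 0}"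
      then have "w \<in> places (\<phi> ` K) S" "D (pull w) \<noteq> 0" by (auto simp: D'_def split: if_splits)
      then show "w \<in> push ` {v. D v \<noteq> 0}" using push_pull[of w] by (intro image_eqI[of _ _ "pull w"]) auto
    qed
    then have D': "D' \<in> divisors (\<phi> ` K) S"
      unfolding divisors_def using sD(2) finite_surj by (auto simp: D'_def split: if_splits)
    have "pb D' = D"
    proof
      fix v
      show "pb D' v = D v"
        using sD(1) push[of v] pull_push[of v] by (cases "v \<in> places K RA") (auto simp: pb_def D'_def)
    qed
    then show "\<exists>D'\<in>divisors (\<phi> ` K) S. \<exists>n. ring.dimension S n (\<phi> ` K) (riemann_roch_space (\<phi> ` K) S D') \<and>
        divisor_degree D' - int n + 1 = int g"
      using D' D dim[of n D'] back_deg[OF D'] by auto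
  qed
qed

section \<open>The function field of the curve\<close>

context curve_tower
begin

abbreviation "LR \<equiv> local_ring 5 I"

lemma LR_simps [simp]:
  "x \<otimes>\<^bsub>LR\<^esub> z = x * z" "\<one>\<^bsub>LR\<^esub> = 1" "\<zero>\<^bsub>LR\<^esub> = 0" "x \<oplus>\<^bsub>LR\<^esub> z = x + z"
  by (simp_all add: local_ring_def)

lemma LR_iff: "z \<in> carrier LR \<longleftrightarrow> (\<exists>f g. f \<in> mcar 5 \<and> g \<in> mcar 5 \<and> g \<notin> I \<and> z = Fract f g)"
  unfolding local_ring_def by auto

lemma LR_I: "f \<in> mcar 5 \<Longrightarrow> g \<in> mcar 5 \<Longrightarrow> g \<notin> I \<Longrightarrow> Fract f g \<in> carrier LR"
  unfolding LR_iff by blast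

lemma not_I:
  assumes "g \<in> mcar 5" "g \<notin> I"
  shows "mev g \<noteq> 0" "g \<noteq> 0"
  using assms I_zero unfolding I_eq_ker ker_def by auto

lemma not_I_mult:
  assumes "g \<in> mcar 5" "g \<notin> I" "h \<in> mcar 5" "h \<notin> I"
  shows "g * h \<notin> I"
  using not_I(1)[OF assms(1,2)] not_I(1)[OF assms(3,4)] unfolding I_eq_ker ker_def
  by (simp add: mpoly_eval_mult)

lemma one_not_I: "1 \<notin> I"
  unfolding I_eq_ker ker_def by simp

lemma LR_add: "x \<in> carrier LR \<Longrightarrow> z \<in> carrier LR \<Longrightarrow> x + z \<in> carrier LR"
  and LR_mult: "x \<in> carrier LR \<Longrightarrow> z \<in> carrier LR \<Longrightarrow> x * z \<in> carrier LR"
proof -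
  assume "x \<in> carrier LR" "z \<in> carrier LR"
  then obtain f g f' g' where *: "f \<in> mcar 5" "g \<in> mcar 5" "g \<notin> I" "x = Fract f g"
    "f' \<in> mcar 5" "g' \<in> mcar 5" "g' \<notin> I" "z = Fract f' g'" unfolding LR_iff by blast
  have nz: "g \<noteq> 0" "g' \<noteq> 0" using not_I * by blast+
  have "x + z = Fract (f * g' + f' * g) (g * g')" using * nz by simp
  then show "x + z \<in> carrier LR"
    using * not_I_mult[of g g'] by (auto intro!: LR_I mcar_add mcar_mult)
  have "x * z = Fract (f * f') (g * g')" using * by simp
  then show "x * z \<in> carrier LR"
    using * not_I_mult[of g g'] by (auto intro!: LR_I mcar_mult)
qed

lemma LR_uminus: "x \<in> carrier LR \<Longrightarrow> - x \<in> carrier LR"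
  unfolding LR_iff using mcar_uminus by (metis minus_fract)

lemma LR_one: "1 \<in> carrier LR"
  using LR_I[OF mcar_1 mcar_1 one_not_I] by (simp add: One_fract_def)

lemma LR_zero: "0 \<in> carrier LR"
  using LR_I[OF mcar_0 mcar_1 one_not_I] by (simp add: Zero_fract_def)

lemma cring_LR: "cring LR"
proof (rule cringI)
  show "abelian_group LR"
    by (rule abelian_groupI)
      (auto simp: LR_add LR_zero algebra_simps intro!: bexI[of _ "- _"] LR_uminus)
  show "comm_monoid LR"
    by (rule comm_monoidI) (auto simp: LR_mult LR_one algebra_simps)
qed (auto simp: algebra_simps)

text \<open>Evaluation of a fraction on the curve. The description is unambiguous because equal
  fractions have equal values and denominators outside I do not evaluate to 0.\<close>

definition fev :: "'k mpoly fract \<Rightarrow> 'k fls" where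
  "fev z = (THE u. \<exists>f g. f \<in> mcar 5 \<and> g \<in> mcar 5 \<and> g \<notin> I \<and> z = Fract f g \<and> u = mev f / mev g)"

lemma fev_Fract:
  assumes "f \<in> mcar 5" "g \<in> mcar 5" "g \<notin> I"
  shows "fev (Fract f g) = mev f / mev g"
  unfolding fev_def
proof (rule the_equality)
  show "\<exists>f' g'. f' \<in> mcar 5 \<and> g' \<in> mcar 5 \<and> g' \<notin> I \<and> Fract f g = Fract f' g' \<and> mev f / mev g = mev f' / mev g'"
    using assms by blast
  fix u assume "\<exists>f' g'. f' \<in> mcar 5 \<and> g' \<in> mcar 5 \<and> g' \<notin> I \<and> Fract f g = Fract f' g' \<and> u = mev f' / mev g'"
  then obtain f' g' where *: "f' \<in> mcar 5" "g' \<in> mcar 5" "g' \<notin> I" "Fract f g = Fract f' g'" "u = mev f' / mev g'" by blast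
  then have "f * g' = f' * g" using not_I assms by (simp add: eq_fract)
  then have "mev f * mev g' = mev f' * mev g" by (metis mpoly_eval_mult)
  then show "u = mev f / mev g" using not_I(1) assms * by (simp add: frac_eq_eq)
qed

lemma fev_hom: "ring_hom_ring LR FR fev"
proof (rule ring_hom_ringI2[OF cring.axioms(1)[OF cring_LR] FR.ring_axioms], rule ring_hom_memI)
  fix x assume "x \<in> carrier LR"
  then obtain f g where "f \<in> mcar 5" "g \<in> mcar 5" "g \<notin> I" "x = Fract f g" unfolding LR_iff by blast
  then show "fev x \<in> carrier FR" using mev_F F.div by (simp add: fev_Fract)
next
  fix x y assume "x \<in> carrier LR" "y \<in> carrier LR"
  then obtain f g f' g' where *: "f \<in> mcar 5" "g \<in> mcar 5" "g \<notin> I" "x = Fract f g"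
    "f' \<in> mcar 5" "g' \<in> mcar 5" "g' \<notin> I" "y = Fract f' g'" unfolding LR_iff by blast
  have nz: "g \<noteq> 0" "g' \<noteq> 0" "mev g \<noteq> 0" "mev g' \<noteq> 0" using not_I * by blast+
  have p: "g * g' \<in> mcar 5" "g * g' \<notin> I" "f * f' \<in> mcar 5" "f * g' + f' * g \<in> mcar 5"
    using * not_I_mult[of g g'] by (auto intro!: mcar_add mcar_mult)
  have "x + y = Fract (f * g' + f' * g) (g * g')" using * nz by simp
  then have "fev (x + y) = mev (f * g' + f' * g) / mev (g * g')" using fev_Fract p by simp
  then show "fev (x \<oplus>\<^bsub>LR\<^esub> y) = fev x \<oplus>\<^bsub>FR\<^esub> fev y"
    using * nz by (simp add: fev_Fract mpoly_eval_add mpoly_eval_mult add_frac_eq)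
  have "x * y = Fract (f * f') (g * g')" using * by simp
  then have "fev (x * y) = mev (f * f') / mev (g * g')" using fev_Fract p by simp
  then show "fev (x \<otimes>\<^bsub>LR\<^esub> y) = fev x \<otimes>\<^bsub>FR\<^esub> fev y"
    using * by (simp add: fev_Fract mpoly_eval_mult)
next
  show "fev \<one>\<^bsub>LR\<^esub> = \<one>\<^bsub>FR\<^esub>"
    using fev_Fract[OF mcar_1 mcar_1 one_not_I] by (simp add: One_fract_def)
qed

lemma fev_kernel: "a_kernel LR FR fev = local_max_ideal 5 I"
proof -
  have "x \<in> carrier LR \<and> fev x = 0 \<longleftrightarrow> x \<in> local_max_ideal 5 I" for x
  proof
    assume x: "x \<in> carrier LR \<and> fev x = 0"
    then obtain f g where *: "f \<in> mcar 5" "g \<in> mcar 5" "g \<notin> I" "x = Fract f g" unfolding LR_iff by blast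
    then have "mev f = 0" using x not_I by (simp add: fev_Fract)
    then have "f \<in> I" unfolding I_eq_ker ker_def using * by simp
    then show "x \<in> local_max_ideal 5 I" unfolding local_max_ideal_def using * by blast
  next
    assume "x \<in> local_max_ideal 5 I"
    then obtain f g where *: "f \<in> I" "g \<in> mcar 5" "g \<notin> I" "x = Fract f g" unfolding local_max_ideal_def by blast
    then have "mev f = 0" "f \<in> mcar 5" unfolding I_eq_ker ker_def by auto
    then show "x \<in> carrier LR \<and> fev x = 0" using * LR_I by (simp add: fev_Fract)
  qed
  then show ?thesis unfolding a_kernel_def' by auto
qed

lemma fev_const: "fev (Fract (mconst c) 1) = fls_const c"
  using fev_Fract[OF mcar_const mcar_1 one_not_I] by simp

text \<open>The image is a field that contains the constants, t and all roots y i, so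
  \<open>Tw_least\<close> puts F inside it.\<close>

lemma fev_surj: "fev ` carrier LR = F"
proof
  show "fev ` carrier LR \<subseteq> F"
    using ring_hom_closed[OF ring_hom_ring.homh[OF fev_hom]] by auto
  have E: "fev ` carrier LR = {mev f / mev g | f g. f \<in> mcar 5 \<and> g \<in> mcar 5 \<and> g \<notin> I}" (is "_ = ?E")
  proof
    show "fev ` carrier LR \<subseteq> ?E" unfolding LR_iff image_subset_iff Ball_def using fev_Fract by blast
    show "?E \<subseteq> fev ` carrier LR"
    proof
      fix x assume "x \<in> ?E"
      then obtain f g where "f \<in> mcar 5" "g \<in> mcar 5" "g \<notin> I" "x = mev f / mev g" by blast
      then show "x \<in> fev ` carrier LR" using fev_Fract[of f g] LR_I[of f g] by (intro image_eqI[of _ _ "Fract f g"]) auto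
    qed
  qed
  have EI: "mev f / mev g \<in> ?E" if "f \<in> mcar 5" "g \<in> mcar 5" "g \<notin> I" for f g using that by blast
  have EI1: "mev f \<in> ?E" if "f \<in> mcar 5" for f using EI[OF that mcar_1 one_not_I] by simp
  have sub: "subfld ?E"
  proof
    show "1 \<in> ?E" using EI1[OF mcar_1] by simp
  next
    fix x y assume "x \<in> ?E" "y \<in> ?E"
    then obtain f g f' g' where *: "f \<in> mcar 5" "g \<in> mcar 5" "g \<notin> I" "x = mev f / mev g"
      "f' \<in> mcar 5" "g' \<in> mcar 5" "g' \<notin> I" "y = mev f' / mev g'" by blast
    have nz: "mev g \<noteq> 0" "mev g' \<noteq> 0" using not_I * by blast+
    have "x - y = mev (f * g' - f' * g) / mev (g * g')" using * nz by (simp add: diff_frac_eq mpoly_eval_diff mpoly_eval_mult)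
    then show "x - y \<in> ?E" using EI[of "f * g' - f' * g" "g * g'"] * not_I_mult[of g g'] by (simp add: mcar_diff mcar_mult)
    have "x * y = mev (f * f') / mev (g * g')" using * by (simp add: mpoly_eval_mult)
    then show "x * y \<in> ?E" using EI[of "f * f'" "g * g'"] * not_I_mult[of g g'] by (simp add: mcar_mult)
  next
    fix x assume "x \<in> ?E"
    then obtain f g where *: "f \<in> mcar 5" "g \<in> mcar 5" "g \<notin> I" "x = mev f / mev g" by blast
    show "inverse x \<in> ?E"
    proof (cases "f \<in> I")
      case True
      then have "inverse x = mev 0" using * unfolding I_eq_ker ker_def by (simp add: mpoly_eval_0)
      then show ?thesis using EI1[OF mcar_0] by simp
    next
      case False
      then show ?thesis using EI[of g f] * by simp
    qed
  qed
  have yE: "y i \<in> ?E" if "i < 5" for i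
    using EI1[of "mconst (root_e i) * mvar i"] that w_y[of i] by (simp add: mpoly_eval_mult mcar_mult mcar_const mcar_var)
  have "t = y 0 * y 0" using y_sq[of 0] by (simp add: power2_eq_square)
  then have tE: "t \<in> ?E" using subfld.mult[OF sub yE yE, of 0 0] by simp
  have cE: "fls_const c \<in> ?E" for c using EI1[OF mcar_const, of c] by simp
  show "F \<subseteq> fev ` carrier LR" unfolding E by (rule Tw_least[OF _ sub cE tE yE]) simp_all
qed

text \<open>The local maximal ideal is the kernel of \<open>fev\<close>, so the homomorphism theorem
  identifies the residue field with F. The genus is carried back along the inverse isomorphism,
  under which the constant series become the cosets of constant polynomials.\<close>

theorem smooth_model_genus: "smooth_model_has_genus (length S) I 17"
proof -
  interpret h: ring_hom_ring LR FR fev by (rule fev_hom)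
  let ?Q = "function_field 5 I"
  let ?\<theta> = "\<lambda>Z. the_elem (fev ` Z)"
  have Q: "?Q = LR Quot (a_kernel LR FR fev)" unfolding function_field_def fev_kernel ..
  have ringQ: "ring ?Q" unfolding Q by (rule ideal.quotient_is_ring[OF h.kernel_is_ideal])
  have iso: "?\<theta> \<in> ring_iso ?Q FR" unfolding Q by (rule h.FactRing_iso_set) (simp add: fev_surj)
  let ?\<phi> = "inv_into (carrier ?Q) ?\<theta>"
  have iso': "?\<phi> \<in> ring_iso FR ?Q" by (rule ring_iso_set_sym[OF ringQ iso])
  have bij: "bij_betw ?\<theta> (carrier ?Q) F" using iso by (simp add: ring_iso_def)
  have "\<one>\<^bsub>?Q\<^esub> \<noteq> \<zero>\<^bsub>?Q\<^esub>"
  proof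
    assume "\<one>\<^bsub>?Q\<^esub> = \<zero>\<^bsub>?Q\<^esub>"
    then have "?\<theta> \<one>\<^bsub>?Q\<^esub> = ?\<theta> \<zero>\<^bsub>?Q\<^esub>" by simp
    moreover have hom: "?\<theta> \<in> Ring.ring_hom ?Q FR" using iso by (simp add: ring_iso_def)
    ultimately show False using ring_hom_one[OF hom] ring_hom_zero[OF hom ringQ FR.ring_axioms] by simp
  qed
  then have "has_genus (?\<phi> ` Kc) ?Q 17"
    by (rule has_genus_transport[OF FR.ring_axioms ringQ iso' subfield_K _ has_genus_17])
  moreover have "?\<phi> ` Kc = constants 5 I"
  proof -
    define coset where "coset c = local_max_ideal 5 I +>\<^bsub>LR\<^esub> Fract (mconst c) 1" for c
    have c: "coset c \<in> carrier ?Q \<and> ?\<theta> (coset c) = fls_const c" for c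
    proof -
      have L: "Fract (mconst c) 1 \<in> carrier LR" by (rule LR_I[OF mcar_const mcar_1 one_not_I])
      have "coset c \<in> carrier ?Q"
        unfolding Q coset_def FactRing_def fev_kernel using L by (auto simp: A_RCOSETS_def')
      moreover have "?\<theta> (coset c) = fev (Fract (mconst c) 1)"
        unfolding coset_def fev_kernel[symmetric] by (rule h.the_elem_simp[OF L])
      ultimately show ?thesis using fev_const by simp
    qed
    have "?\<phi> (fls_const c) = coset c" for c
      using c[of c] bij inv_into_f_f[of ?\<theta> "carrier ?Q" "coset c"] unfolding bij_betw_def by auto
    then show ?thesis unfolding constants_def coset_def[symmetric] image_image by simp
  qed
  moreover have "primeideal I (mpoly_ring 5)" unfolding I_eq_ker by (rule primeideal_ker)
  ultimately show ?thesis unfolding smooth_model_has_genus_def len by simp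
qed

end

text \<open>The abstract tower is realised by the expansion at infinity with t = X^(-2) and all
  signs equal to 1.\<close>

theorem curve_genus:
  fixes ep em :: "'k::alg_closed_field"
  assumes two: "(2::'k) \<noteq> 0" and three: "(3::'k) \<noteq> 0" and "length S = 5" "ep \<noteq> 0" "em \<noteq> 0"
  shows "smooth_model_has_genus (length S) (curve_ideal ep em S) 17"
proof -
  let ?t = "fls_X_inv ^ 2 :: 'k fls"
  obtain h where h: "\<And>i. i < 5 \<Longrightarrow> (fls_X_inv * fps_to_fls (h i)) ^ 2 = ?t + of_nat i"
    using tower_at_infinity(2)[of "\<lambda>_. 1", OF two] by auto
  interpret curve_tower ?t "\<lambda>i. fls_X_inv * fps_to_fls (h i)" S ep em
    using assms h tower_at_infinity(1)[of "\<lambda>_. 1", OF two] by unfold_locales auto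
  show ?thesis by (rule smooth_model_genus)
qed

section \<open>Sums of the quadratic character\<close>

definition chi :: "'a::field \<Rightarrow> int" where
  "chi x = (if x = 0 then 0 else if is_square x then 1 else - 1)"

lemma is_square_iff: "is_square x \<longleftrightarrow> (\<exists>z. x = z ^ 2)"
  by (auto simp: is_nth_power_def)

lemma chi_0 [simp]: "chi 0 = 0"
  by (simp add: chi_def)

lemma chi_square: "x \<noteq> 0 \<Longrightarrow> chi (x ^ 2) = 1"
  by (auto simp: chi_def is_square_iff)

lemma chi_1 [simp]: "chi 1 = 1"
  using chi_square[of 1] by simp

lemma chi_cases: "x \<noteq> 0 \<Longrightarrow> chi x = 1 \<or> chi x = - 1"
  by (auto simp: chi_def)

lemma sum_affine:
  fixes f :: "'a::{field,finite} \<Rightarrow> int"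
  assumes "a \<noteq> 0"
  shows "(\<Sum>x\<in>UNIV. f (a * x + b)) = (\<Sum>x\<in>UNIV. f x)"
  by (rule sum.reindex_bij_witness[of _ "\<lambda>x. (x - b) / a" "\<lambda>x. a * x + b"]) (use assms in auto)

lemma sum_inverse:
  fixes f :: "'a::{field,finite} \<Rightarrow> int"
  shows "(\<Sum>x\<in>UNIV. f (inverse x)) = (\<Sum>x\<in>UNIV. f x)"
  by (rule sum.reindex_bij_witness[of _ inverse inverse]) auto

context
  assumes two: "(2 :: 'a::{field,finite}) \<noteq> 0"
begin

lemma card_sqrt: "int (card {z::'a. z ^ 2 = c}) = 1 + chi c"
proof (cases "c = 0")
  case True
  then have "{z::'a. z ^ 2 = c} = {0}" by auto
  then show ?thesis using True by simp
next
  case False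
  show ?thesis
  proof (cases "is_square c")
    case True
    then obtain r where r: "c = r ^ 2" by (auto simp: is_square_iff)
    then have "r \<noteq> 0" using False by auto
    then have "r \<noteq> - r" using two by (metis add.right_inverse mult_2 mult_eq_0_iff)
    moreover have "{z. z ^ 2 = c} = {r, - r}" using r by (auto simp: power2_eq_iff)
    ultimately show ?thesis using True False by (simp add: chi_def)
  next
    case ns: False
    then have "{z. z ^ 2 = c} = {}" by (auto simp: is_square_iff)
    then show ?thesis using False ns by (simp add: chi_def)
  qed
qed

text \<open>The pairs (x, z) with z^2 = x are counted in two ways.\<close>

lemma sum_chi: "(\<Sum>x\<in>UNIV. chi (x :: 'a)) = 0"
proof -
  have "(\<Sum>x\<in>UNIV. 1 + chi (x :: 'a)) = (\<Sum>x\<in>UNIV. \<Sum>z\<in>UNIV. of_bool ((z::'a) ^ 2 = x))"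
    unfolding card_sqrt[symmetric] by (simp add: of_bool_def sum.If_cases)
  also have "\<dots> = (\<Sum>z\<in>UNIV. \<Sum>x\<in>UNIV. of_bool ((z::'a) ^ 2 = x))"
    by (rule sum.swap)
  also have "\<dots> = int CARD('a)" by (simp add: of_bool_def)
  finally show ?thesis by (simp add: sum.distrib)
qed

lemma chi_mult: "chi (x * y) = chi x * chi (y :: 'a)"
proof -
  have sq: "chi (x * y) = chi y" if s: "is_square x" "x \<noteq> 0" for x y :: 'a
  proof -
    obtain r where r: "x = r ^ 2" using s by (auto simp: is_square_iff)
    have "is_square (x * y) \<longleftrightarrow> is_square y"
    proof
      assume "is_square (x * y)"
      then obtain z where "x * y = z ^ 2" by (auto simp: is_square_iff)
      then have "y = (z / r) ^ 2" using r s by (simp add: power_divide field_simps)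
      then show "is_square y" by (auto simp: is_square_iff)
    next
      assume "is_square y"
      then obtain z where "y = z ^ 2" by (auto simp: is_square_iff)
      then have "x * y = (r * z) ^ 2" using r by (simp add: power_mult_distrib)
      then show "is_square (x * y)" unfolding is_square_iff by blast
    qed
    then show ?thesis using s by (simp add: chi_def)
  qed
  \<comment> \<open>For a nonsquare a the terms -(chi (a x) + chi x) are nonnegative and sum to
    zero, so each of them vanishes. This settles nonsquare times nonsquare by counting
    alone.\<close>
  have ns: "chi (a * x) = - chi x" if a: "a \<noteq> 0" "\<not> is_square a" for a x :: 'a
  proof -
    have chia: "chi a = - 1" using a by (simp add: chi_def)
    have "(\<Sum>x\<in>UNIV. - (chi (a * x) + chi x)) = 0"
      using sum_affine[OF a(1), of chi 0] sum_chi by (simp add: sum.distrib sum_negf sum_subtractf)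
    moreover have "0 \<le> - (chi (a * x) + chi x)" for x
    proof (cases "x = 0 \<or> \<not> is_square x")
      case True
      then show ?thesis by (auto simp: chi_def)
    next
      case False
      then have "chi (a * x) = chi a" using sq[of x a] by (simp add: mult.commute)
      then show ?thesis using chia False by (simp add: chi_def)
    qed
    ultimately have "- (chi (a * x) + chi x) = 0"
      by (subst (asm) sum_nonneg_eq_0_iff) auto
    then show ?thesis by simp
  qed
  consider "x = 0" | "x \<noteq> 0" "is_square x" | "x \<noteq> 0" "\<not> is_square x" by blast
  then show ?thesis
    by cases (auto simp: sq ns, simp_all add: chi_def)
qed

lemma chi_mult_square: "y \<noteq> 0 \<Longrightarrow> chi (x * y ^ 2) = chi (x :: 'a)"
  using chi_square[of y] by (simp add: chi_mult)

lemma chi_self: "x \<noteq> 0 \<Longrightarrow> chi x * chi (x :: 'a) = 1"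
  using chi_cases[of x] by auto

lemma chi_4: "chi (4 :: 'a) = 1"
  using chi_square[OF two] by simp

lemma chi_div: "y \<noteq> 0 \<Longrightarrow> chi (x / y) = chi x * chi (y :: 'a)"
proof -
  assume y: "y \<noteq> 0"
  then have "chi (x / y * y) * chi y = chi (x / y) * (chi y * chi y)" by (simp only: chi_mult mult.assoc)
  then show ?thesis using y chi_self[OF y] by simp
qed

lemma chi_minus: "chi (- x) = chi (- 1 :: 'a) * chi (x :: 'a)"
  using chi_mult[of "- 1" x] by simp

text \<open>For nonzero x, x (x + d) = (d / x + 1) x^2, which gives a complete sum over 1 / x. The
  term x = 0, where inverse 0 = 0 yields chi 1 = 1, has to be taken off.\<close>

lemma sum_chi2:
  assumes "d \<noteq> 0"
  shows "(\<Sum>x\<in>UNIV. chi x * chi (x + d :: 'a)) = - 1"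
proof -
  have "(\<Sum>x\<in>UNIV. chi x * chi (x + d)) = (\<Sum>x\<in>UNIV. chi (d * inverse x + 1) - of_bool (x = 0))"
  proof (rule sum.cong[OF refl])
    fix x :: 'a
    show "chi x * chi (x + d) = chi (d * inverse x + 1) - of_bool (x = 0)"
    proof (cases "x = 0")
      case False
      then have "x * (x + d) = (d * inverse x + 1) * x ^ 2" by (simp add: field_simps power2_eq_square)
      then have "chi (x * (x + d)) = chi (d * inverse x + 1)" using chi_mult_square[OF False] by simp
      then show ?thesis using False by (simp add: chi_mult)
    qed simp
  qed
  also have "\<dots> = (\<Sum>x\<in>UNIV. chi (d * inverse x + 1)) - 1" by (simp add: sum_subtractf of_bool_def)
  also have "(\<Sum>x\<in>UNIV. chi (d * inverse x + 1)) = 0"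
    using sum_inverse[of "\<lambda>x. chi (d * x + 1)"] sum_affine[OF assms, of chi 1] sum_chi by simp
  finally show ?thesis by simp
qed

text \<open>The substitution 1 / x moves the root 0 to infinity: the four factors x pulled out form
  a square, and three linear factors remain. The -1 is again the term x = 0.\<close>

lemma sum_chi4:
  "(\<Sum>x\<in>UNIV. chi x * chi (x + a) * chi (x + b) * chi (x + c :: 'a))
    = (\<Sum>x\<in>UNIV. chi (1 + a * x) * chi (1 + b * x) * chi (1 + c * x)) - 1"
proof -
  have "(\<Sum>x\<in>UNIV. chi x * chi (x + a) * chi (x + b) * chi (x + c))
      = (\<Sum>x\<in>UNIV. chi (1 + a * inverse x) * chi (1 + b * inverse x) * chi (1 + c * inverse x) - of_bool (x = 0))"
  proof (rule sum.cong[OF refl])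
    fix x :: 'a
    show "chi x * chi (x + a) * chi (x + b) * chi (x + c)
      = chi (1 + a * inverse x) * chi (1 + b * inverse x) * chi (1 + c * inverse x) - of_bool (x = 0)"
    proof (cases "x = 0")
      case False
      have e: "chi (x + d) = chi x * chi (1 + d * inverse x)" for d
      proof -
        have "x + d = x * (1 + d * inverse x)" using False by (simp add: field_simps)
        then show ?thesis by (simp only: chi_mult)
      qed
      show ?thesis unfolding e[of a] e[of b] e[of c] using chi_cases[OF False] False by auto
    qed simp
  qed
  also have "\<dots> = (\<Sum>x\<in>UNIV. chi (1 + a * inverse x) * chi (1 + b * inverse x) * chi (1 + c * inverse x)) - 1"
    by (simp add: sum_subtractf of_bool_def)
  also have "(\<Sum>x\<in>UNIV. chi (1 + a * inverse x) * chi (1 + b * inverse x) * chi (1 + c * inverse x))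
      = (\<Sum>x\<in>UNIV. chi (1 + a * x) * chi (1 + b * x) * chi (1 + c * x))"
    by (rule sum_inverse[of "\<lambda>x. chi (1 + a * x) * chi (1 + b * x) * chi (1 + c * x)"])
  finally show ?thesis .
qed

abbreviation c :: "nat \<Rightarrow> 'a \<Rightarrow> int" where
  "c i x \<equiv> chi (x + of_nat i)"

lemma sum_shift: "(\<Sum>x\<in>UNIV. f (x + b)) = (\<Sum>x\<in>UNIV. f (x :: 'a) :: int)"
  using sum_affine[of 1 f b] by simp

lemma sum_reflect: "(\<Sum>x\<in>UNIV. f (b - x)) = (\<Sum>x\<in>UNIV. f (x :: 'a) :: int)"
  using sum_affine[of "- 1" f b] by simp

lemma chi_neg_1: "chi (- 1 :: 'a) = 1 \<or> chi (- 1 :: 'a) = - 1"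
  by (rule chi_cases) simp

lemma c_neg:
  assumes "of_nat i + of_nat j = (b :: 'a)"
  shows "c i (- b - x) = chi (- 1 :: 'a) * c j x"
proof -
  have "- b - x + of_nat i = - (x + of_nat j)" unfolding assms[symmetric] by simp
  then show ?thesis by (simp only: chi_minus[of "x + of_nat j"])
qed

lemma sum_c1: "(\<Sum>x\<in>UNIV. c i x) = 0"
  using sum_shift[of chi] sum_chi by simp

lemma sum_c2: "of_nat i \<noteq> (of_nat j :: 'a) \<Longrightarrow> (\<Sum>x\<in>UNIV. c i x * c j x) = - 1"
  using sum_shift[of "\<lambda>x. chi x * chi (x + (of_nat j - of_nat i))" "of_nat i"] sum_chi2[of "of_nat j - of_nat i"]
  by (simp add: add.assoc)

lemma sum_012: "(\<Sum>x\<in>UNIV. c 1 x * c 2 x * c 3 x) = (\<Sum>x\<in>UNIV. c 0 x * c 1 x * c 2 x)"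
   "(\<Sum>x\<in>UNIV. c 2 x * c 3 x * c 4 x) = (\<Sum>x\<in>UNIV. c 0 x * c 1 x * c 2 x)"
  using sum_shift[of "\<lambda>x. c 0 x * c 1 x * c 2 x" 1] sum_shift[of "\<lambda>x. c 0 x * c 1 x * c 2 x" 2]
  by (simp_all add: add.assoc)

lemma sum_124: "(\<Sum>x\<in>UNIV. c 1 x * c 2 x * c 4 x) = (\<Sum>x\<in>UNIV. c 0 x * c 1 x * c 3 x)"
  using sum_shift[of "\<lambda>x. c 0 x * c 1 x * c 3 x" 1] by (simp add: add.assoc)

text \<open>The reflection x -> -3 - x permutes the points 0, -1, -2, -3, and three factors
  contribute chi(-1)^3 = chi(-1).\<close>

lemma sum_023: "(\<Sum>x\<in>UNIV. c 0 x * c 2 x * c 3 x) = chi (- 1 :: 'a) * (\<Sum>x\<in>UNIV. c 0 x * c 1 x * c 3 x)"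
proof -
  have "(\<Sum>x\<in>UNIV. c 0 x * c 2 x * c 3 x) = (\<Sum>x\<in>UNIV. c 0 (- 3 - x) * c 2 (- 3 - x) * c 3 (- 3 - x))"
    using sum_reflect[of "\<lambda>x. c 0 x * c 2 x * c 3 x" "- 3"] by simp
  also have "\<dots> = (\<Sum>x\<in>UNIV. chi (- 1 :: 'a) * (c 0 x * c 1 x * c 3 x))"
  proof (rule sum.cong[OF refl])
    fix x :: 'a
    have e0: "c 0 (- 3 - x) = chi (- 1 :: 'a) * c 3 x" by (rule c_neg) simp
    have e2: "c 2 (- 3 - x) = chi (- 1 :: 'a) * c 1 x" by (rule c_neg) simp
    have e3: "c 3 (- 3 - x) = chi (- 1 :: 'a) * c 0 x" by (rule c_neg) simp
    show "c 0 (- 3 - x) * c 2 (- 3 - x) * c 3 (- 3 - x) = chi (- 1 :: 'a) * (c 0 x * c 1 x * c 3 x)"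
      unfolding e0 e2 e3 using chi_neg_1 by (elim disjE) (simp_all add: mult_ac)
  qed
  finally show ?thesis by (simp add: sum_distrib_left)
qed

lemma sum_134: "(\<Sum>x\<in>UNIV. c 1 x * c 3 x * c 4 x) = chi (- 1 :: 'a) * (\<Sum>x\<in>UNIV. c 0 x * c 1 x * c 3 x)"
  using sum_shift[of "\<lambda>x. c 0 x * c 2 x * c 3 x" 1] sum_023 by (simp add: add.assoc)

lemma sum_034: "(\<Sum>x\<in>UNIV. c 0 x * c 3 x * c 4 x) = chi (- 1 :: 'a) * (\<Sum>x\<in>UNIV. c 0 x * c 1 x * c 4 x)"
proof -
  have "(\<Sum>x\<in>UNIV. c 0 x * c 3 x * c 4 x) = (\<Sum>x\<in>UNIV. c 0 (- 4 - x) * c 3 (- 4 - x) * c 4 (- 4 - x))"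
    using sum_reflect[of "\<lambda>x. c 0 x * c 3 x * c 4 x" "- 4"] by simp
  also have "\<dots> = (\<Sum>x\<in>UNIV. chi (- 1 :: 'a) * (c 0 x * c 1 x * c 4 x))"
  proof (rule sum.cong[OF refl])
    fix x :: 'a
    have e0: "c 0 (- 4 - x) = chi (- 1 :: 'a) * c 4 x" by (rule c_neg) simp
    have e3: "c 3 (- 4 - x) = chi (- 1 :: 'a) * c 1 x" by (rule c_neg) simp
    have e4: "c 4 (- 4 - x) = chi (- 1 :: 'a) * c 0 x" by (rule c_neg) simp
    show "c 0 (- 4 - x) * c 3 (- 4 - x) * c 4 (- 4 - x) = chi (- 1 :: 'a) * (c 0 x * c 1 x * c 4 x)"
      unfolding e0 e3 e4 using chi_neg_1 by (elim disjE) (simp_all add: mult_ac)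
  qed
  finally show ?thesis by (simp add: sum_distrib_left)
qed

text \<open>Replacing x by 2 x takes chi 2 out of each of the three factors.\<close>

lemma sum_024: "(\<Sum>x\<in>UNIV. c 0 x * c 2 x * c 4 x) = chi (2 :: 'a) * (\<Sum>x\<in>UNIV. c 0 x * c 1 x * c 2 x)"
proof -
  have "(\<Sum>x\<in>UNIV. c 0 x * c 2 x * c 4 x) = (\<Sum>x\<in>UNIV. c 0 (2 * x) * c 2 (2 * x) * c 4 (2 * x))"
    using sum_affine[OF two, of "\<lambda>x. c 0 x * c 2 x * c 4 x" 0] by simp
  also have "\<dots> = (\<Sum>x\<in>UNIV. chi (2 :: 'a) * (c 0 x * c 1 x * c 2 x))"
  proof (rule sum.cong[OF refl])
    fix x :: 'a
    have "2 * x + 2 = 2 * (x + 1)" "2 * x + 4 = 2 * (x + 2)" by auto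
    then show "c 0 (2 * x) * c 2 (2 * x) * c 4 (2 * x) = chi (2 :: 'a) * (c 0 x * c 1 x * c 2 x)"
      using chi_mult[of 2 "x + 1"] chi_mult[of 2 "x + 2"] chi_mult[of 2 x] chi_self[OF two]
      by (simp add: mult_ac)
  qed
  finally show ?thesis by (simp add: sum_distrib_left)
qed

lemma sum_1234: "(\<Sum>x\<in>UNIV. c 1 x * c 2 x * c 3 x * c 4 x) = (\<Sum>x\<in>UNIV. c 0 x * c 1 x * c 2 x * c 3 x)"
  using sum_shift[of "\<lambda>x. c 0 x * c 1 x * c 2 x * c 3 x" 1] by (simp add: add.assoc)

lemma sum_0234: "(\<Sum>x\<in>UNIV. c 0 x * c 2 x * c 3 x * c 4 x) = (\<Sum>x\<in>UNIV. c 0 x * c 1 x * c 2 x * c 4 x)"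
proof -
  have "(\<Sum>x\<in>UNIV. c 0 x * c 2 x * c 3 x * c 4 x) = (\<Sum>x\<in>UNIV. c 0 (- 4 - x) * c 2 (- 4 - x) * c 3 (- 4 - x) * c 4 (- 4 - x))"
    using sum_reflect[of "\<lambda>x. c 0 x * c 2 x * c 3 x * c 4 x" "- 4"] by simp
  also have "\<dots> = (\<Sum>x\<in>UNIV. c 0 x * c 1 x * c 2 x * c 4 x)"
  proof (rule sum.cong[OF refl])
    fix x :: 'a
    have e0: "c 0 (- 4 - x) = chi (- 1 :: 'a) * c 4 x" by (rule c_neg) simp
    have e2: "c 2 (- 4 - x) = chi (- 1 :: 'a) * c 2 x" by (rule c_neg) simp
    have e3: "c 3 (- 4 - x) = chi (- 1 :: 'a) * c 1 x" by (rule c_neg) simp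
    have e4: "c 4 (- 4 - x) = chi (- 1 :: 'a) * c 0 x" by (rule c_neg) simp
    show "c 0 (- 4 - x) * c 2 (- 4 - x) * c 3 (- 4 - x) * c 4 (- 4 - x) = c 0 x * c 1 x * c 2 x * c 4 x"
      unfolding e0 e2 e3 e4 using chi_neg_1 by (elim disjE) (simp_all add: mult_ac)
  qed
  finally show ?thesis .
qed

text \<open>After the inversion, x -> x / 4 turns the factors into (x + 4) / 4, (x + 2) / 2 and x +
  1. The denominators contribute chi 4 chi 2 = chi 2, and a shift by 1 leads to the cubic of
  E1.\<close>

lemma sum_0124: "(\<Sum>x\<in>UNIV. c 0 x * c 1 x * c 2 x * c 4 x) = chi (2 :: 'a) * (\<Sum>x\<in>UNIV. c 0 x * c 1 x * c 3 x) - 1"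
proof -
  have four: "(4 :: 'a) \<noteq> 0" using two by (metis mult_2 mult_eq_0_iff numeral_Bit0)
  have "(\<Sum>x\<in>UNIV. c 0 x * c 1 x * c 2 x * c 4 x) = (\<Sum>x\<in>UNIV. chi (1 + x) * chi (1 + 2 * x) * chi (1 + 4 * x :: 'a)) - 1"
    using sum_chi4[of 1 2 4] by simp
  also have "(\<Sum>x\<in>UNIV. chi (1 + x) * chi (1 + 2 * x) * chi (1 + 4 * x :: 'a))
     = (\<Sum>x\<in>UNIV. chi (1 + 1 / 4 * x) * chi (1 + 2 * (1 / 4 * x)) * chi (1 + 4 * (1 / 4 * x) :: 'a))"
    using sum_affine[of "1 / 4" "\<lambda>x. chi (1 + x) * chi (1 + 2 * x) * chi (1 + 4 * x :: 'a)" 0] four by simp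
  also have "\<dots> = (\<Sum>x\<in>UNIV. chi (2 :: 'a) * (c 1 x * c 2 x * c 4 x))"
  proof (rule sum.cong[OF refl])
    fix x :: 'a
    have "1 + 1 / 4 * x = (x + 4) / 4" using four by (simp add: field_simps)
    moreover have "1 + 2 * (1 / 4 * x) = (x + 2) / 2"
    proof -
      have "(1 + 2 * (1 / 4 * x)) * 4 = (x + 2) / 2 * 4" using four two by (simp add: field_simps)
      then show ?thesis using four by (simp only: mult_cancel_right) simp
    qed
    moreover have "1 + 4 * (1 / 4 * x) = x + 1" using four by simp
    ultimately show "chi (1 + 1 / 4 * x) * chi (1 + 2 * (1 / 4 * x)) * chi (1 + 4 * (1 / 4 * x)) = chi (2 :: 'a) * (c 1 x * c 2 x * c 4 x)"
      using two four chi_4 by (simp only: chi_div[OF two] chi_div[OF four]) (simp add: mult_ac)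
  qed
  also have "\<dots> = chi (2 :: 'a) * (\<Sum>x\<in>UNIV. c 0 x * c 1 x * c 3 x)"
    by (simp only: sum_distrib_left[symmetric] sum_124)
  finally show ?thesis .
qed

text \<open>After the inversion, x -> x / 6 - 1 / 3 turns 1 + x, 1 + 2 x, 1 + 3 x into (x + 4) / 6,
  (x + 1) / 3, x / 2, and chi 6 chi 3 chi 2 = 1. Thus the trace of E4 also serves the cubic with
  roots 0, -1, -4.\<close>

lemma sum_0123:
  assumes three: "(3 :: 'a) \<noteq> 0"
  shows "(\<Sum>x\<in>UNIV. c 0 x * c 1 x * c 2 x * c 3 x) = (\<Sum>x\<in>UNIV. c 0 x * c 1 x * c 4 x) - 1"
proof -
  have six: "(6 :: 'a) = 2 * 3" by simp
  have six0: "(6 :: 'a) \<noteq> 0" unfolding six using two three by (metis mult_eq_0_iff)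
  have chi6: "chi (6 :: 'a) = chi (2 :: 'a) * chi (3 :: 'a)" unfolding six by (rule chi_mult)
  have "(\<Sum>x\<in>UNIV. c 0 x * c 1 x * c 2 x * c 3 x) = (\<Sum>x\<in>UNIV. chi (1 + x) * chi (1 + 2 * x) * chi (1 + 3 * x :: 'a)) - 1"
    using sum_chi4[of 1 2 3] by simp
  also have "(\<Sum>x\<in>UNIV. chi (1 + x) * chi (1 + 2 * x) * chi (1 + 3 * x :: 'a))
     = (\<Sum>x\<in>UNIV. chi (1 + (1 / 6 * x + - (1 / 3))) * chi (1 + 2 * (1 / 6 * x + - (1 / 3))) * chi (1 + 3 * (1 / 6 * x + - (1 / 3)) :: 'a))"
    using sum_affine[of "1 / 6" "\<lambda>x. chi (1 + x) * chi (1 + 2 * x) * chi (1 + 3 * x :: 'a)" "- (1 / 3)"] six0 by simp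
  also have "\<dots> = (\<Sum>x\<in>UNIV. c 0 x * c 1 x * c 4 x)"
  proof (rule sum.cong[OF refl])
    fix x :: 'a
    define z where "z = 1 / 6 * x + - (1 / 3)"
    have "z * 6 = 1 / 6 * x * 6 - 1 / 3 * 6"
      by (simp only: z_def distrib_right mult_minus_left diff_conv_add_uminus)
    moreover have "1 / 6 * x * 6 = x" using six0 by simp
    moreover have "1 / 3 * 6 = (2::'a)" unfolding six using three by simp
    ultimately have z: "z * 6 = x - 2" by simp
    have "(1 + z) * 6 = x + 4" using z by (simp add: algebra_simps)
    then have 1: "1 + z = (x + 4) / 6" using six0 by (metis nonzero_mult_div_cancel_right)
    have "(1 + 2 * z) * 3 = x + 1" using z by (simp add: algebra_simps)
    then have 2: "1 + 2 * z = (x + 1) / 3" using three by (metis nonzero_mult_div_cancel_right)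
    have "(1 + 3 * z) * 2 = x" using z by (simp add: algebra_simps)
    then have 3: "1 + 3 * z = x / 2" using two by (metis nonzero_mult_div_cancel_right)
    show "chi (1 + (1 / 6 * x + - (1 / 3))) * chi (1 + 2 * (1 / 6 * x + - (1 / 3))) * chi (1 + 3 * (1 / 6 * x + - (1 / 3))) = c 0 x * c 1 x * c 4 x"
      unfolding z_def[symmetric] 1 2 3 chi_div[OF two] chi_div[OF three] chi_div[OF six0] chi6
      using chi_cases[OF two] chi_cases[OF three] by auto
  qed
  finally show ?thesis .
qed

end

section \<open>The product of five consecutive factors, and Frobenius traces as character
  sums\<close>

context
  assumes two: "(2 :: 'a::{field,finite}) \<noteq> 0"
begin

abbreviation d :: "nat \<Rightarrow> 'a \<Rightarrow> int" where
  "d i x \<equiv> chi (x + of_nat i)"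

definition sum5 :: int where
  "sum5 = (\<Sum>x\<in>UNIV. d 0 x * d 1 x * d 2 x * d 3 x * d 4 x)"

text \<open>Under x -> -4 - x the odd number of factors leaves chi(-1). The sum therefore vanishes
  when -1 is a nonsquare.\<close>

lemma sum5_reflect: "sum5 = chi (- 1 :: 'a) * sum5"
proof -
  have "sum5 = (\<Sum>x\<in>UNIV. d 0 (- 4 - x) * d 1 (- 4 - x) * d 2 (- 4 - x) * d 3 (- 4 - x) * d 4 (- 4 - x))"
    unfolding sum5_def by (rule sum_reflect[OF two, of "\<lambda>x. d 0 x * d 1 x * d 2 x * d 3 x * d 4 x" "- 4", symmetric])
  also have "\<dots> = (\<Sum>x\<in>UNIV. chi (- 1 :: 'a) * (d 0 x * d 1 x * d 2 x * d 3 x * d 4 x))"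
  proof (rule sum.cong[OF refl])
    fix x :: 'a
    have e: "d 0 (- 4 - x) = chi (- 1 :: 'a) * d 4 x" "d 1 (- 4 - x) = chi (- 1 :: 'a) * d 3 x"
      "d 2 (- 4 - x) = chi (- 1 :: 'a) * d 2 x" "d 3 (- 4 - x) = chi (- 1 :: 'a) * d 1 x"
      "d 4 (- 4 - x) = chi (- 1 :: 'a) * d 0 x"
      by (rule c_neg[OF two], simp)+
    show "d 0 (- 4 - x) * d 1 (- 4 - x) * d 2 (- 4 - x) * d 3 (- 4 - x) * d 4 (- 4 - x)
        = chi (- 1 :: 'a) * (d 0 x * d 1 x * d 2 x * d 3 x * d 4 x)"
      unfolding e using chi_neg_1[OF two] by (elim disjE) (simp_all add: mult_ac)
  qed
  also have "\<dots> = chi (- 1 :: 'a) * sum5" unfolding sum5_def by (simp only: sum_distrib_left)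
  finally show ?thesis .
qed

definition h5 :: "'a \<Rightarrow> int" where
  "h5 w = chi (w * ((w^2 - 1) * (w^2 - 4)))"

lemma sum5_h5: "sum5 = (\<Sum>w\<in>UNIV. h5 w)"
proof -
  have "d 0 x * d 1 x * d 2 x * d 3 x * d 4 x = h5 (1 * x + 2)" for x
  proof -
    have "(1 * x + 2) * (((1 * x + 2)^2 - 1) * ((1 * x + 2)^2 - 4)) = x * (x + 1) * (x + 2) * (x + 3) * (x + 4)"
      by (simp add: algebra_simps power2_eq_square)
    then show ?thesis unfolding h5_def by (simp only: chi_mult[OF two]) simp
  qed
  then show ?thesis unfolding sum5_def using sum_affine[of 1 h5 2] by simp
qed

text \<open>The involution w -> 2 / w exchanges the roots 1 and 2, and -1 and -2. It multiplies the
  polynomial by 2 times the square of 2 / w^3, so the sum vanishes when 2 is a nonsquare.\<close>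

lemma sum5_invert: "sum5 = chi (2 :: 'a) * sum5"
proof -
  have e: "h5 (2 * inverse w) = chi (2 :: 'a) * h5 w" for w
  proof (cases "w = 0")
    case False
    have "2 * inverse w * (((2 * inverse w)^2 - 1) * ((2 * inverse w)^2 - 4))
        = 2 * (w * ((w^2 - 1) * (w^2 - 4))) * (2 * inverse w ^ 3) ^ 2" (is "?l = ?r")
    proof -
      define v where "v = inverse w"
      have vw: "v * w = 1" using False by (simp add: v_def)
      have "2 * (w * ((w^2 - 1) * (w^2 - 4))) * (2 * v ^ 3) ^ 2
         = 2 * (v * w) * v * (((v * w)^2 - v^2) * ((2 * (v * w))^2 - (4 * v)^2))"
        by (simp add: algebra_simps power2_eq_square power3_eq_cube)
      also have "\<dots> = 2 * v * (((2 * v)^2 - 1) * ((2 * v)^2 - 4))"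
        unfolding vw by (simp add: algebra_simps power2_eq_square)
      finally show ?thesis unfolding v_def by simp
    qed
    moreover have nz: "2 * inverse w ^ 3 \<noteq> 0" using False two by simp
    ultimately show ?thesis unfolding h5_def
      using chi_mult_square[OF two nz, of "2 * (w * ((w^2 - 1) * (w^2 - 4)))"]
        chi_mult[OF two, of 2 "w * ((w^2 - 1) * (w^2 - 4))"] by (simp only:)
  qed (simp add: h5_def)
  have "sum5 = (\<Sum>w\<in>UNIV. h5 (2 * w))" unfolding sum5_h5 using sum_affine[OF two, of h5 0] by simp
  also have "\<dots> = (\<Sum>w\<in>UNIV. h5 (2 * inverse w))" by (rule sum_inverse[symmetric])
  also have "\<dots> = chi (2 :: 'a) * sum5" unfolding e sum5_h5 by (simp only: sum_distrib_left)
  finally show ?thesis .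
qed

text \<open>A root satisfies w + 2 / w = u, hence (u + 2 r) w = (w + r)^2 and (u - 2 r) w = (w -
  r)^2. As the product of the roots is the square r^2, in the generic case both roots have the
  character of u + 2 r and of u - 2 r. Without roots the discriminant (u + 2 r) (u - 2 r) is a
  nonsquare and the two characters cancel.\<close>

lemma chi_roots_sum:
  assumes r: "r ^ 2 = (2 :: 'a)"
  shows "(\<Sum>w | w^2 - u * w + 2 = 0. chi w) = chi (u + 2 * r) + chi (u - 2 * r)"
proof (cases "\<exists>w. w^2 - u * w + 2 = 0")
  case True
  then obtain w where w: "w^2 - u * w + 2 = 0" by blast
  then have w0: "w \<noteq> 0" using two by auto
  have r0: "r \<noteq> 0" using r two by auto
  have four: "(4 :: 'a) \<noteq> 0" using two by (metis mult_2 mult_eq_0_iff numeral_Bit0)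
  have uw: "u * w = w^2 + 2" using w by (simp add: algebra_simps)
  have roots: "{z. z^2 - u * z + 2 = 0} = {w, u - w}"
  proof -
    have "z^2 - u * z + 2 = (z - w) * (z - (u - w))" for z
      using uw by (simp add: algebra_simps power2_eq_square)
    then show ?thesis by auto
  qed
  have ww: "(u - w) * w = 2" using uw by (simp add: algebra_simps power2_eq_square)
  have "(u + 2 * r) * w = w^2 + 2 + 2 * r * w" using uw by (simp add: algebra_simps)
  also have "\<dots> = (w + r)^2" using r by (simp add: power2_sum algebra_simps)
  finally have p: "(u + 2 * r) * w = (w + r)^2" .
  have "(u - 2 * r) * w = w^2 + 2 - 2 * r * w" using uw by (simp add: algebra_simps)
  also have "\<dots> = (w - r)^2" using r by (simp add: power2_diff algebra_simps)
  finally have m: "(u - 2 * r) * w = (w - r)^2" .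
  show ?thesis
  proof (cases "w = r \<or> w = - r")
    case False
    then have nz: "w + r \<noteq> 0" "w - r \<noteq> 0" by (auto simp: eq_neg_iff_add_eq_0)
    have "chi (u + 2 * r) * chi w = 1" "chi (u - 2 * r) * chi w = 1"
      using chi_square[OF nz(1)] chi_square[OF nz(2)] unfolding p[symmetric] m[symmetric] chi_mult[OF two] by simp_all
    then have pm: "chi (u + 2 * r) = chi w" "chi (u - 2 * r) = chi w" using chi_cases[OF w0] by auto
    have "chi (u - w) * chi w = 1" using chi_square[OF r0] r ww chi_mult[OF two, of "u - w" w] by simp
    then have o: "chi (u - w) = chi w" using chi_cases[OF w0] by auto
    have "w \<noteq> u - w"
    proof
      assume "w = u - w"
      then have "w^2 = r^2" using ww r by (metis power2_eq_square)
      then show False using False by (simp add: power2_eq_iff)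
    qed
    then show ?thesis unfolding roots pm by (simp add: o)
  next
    \<comment> \<open>The double root w = r or w = -r: one of u + 2 r and u - 2 r is 0, the other is
      4 w.\<close>
    case True
    have "u = 2 * w"
    proof -
      have "w^2 = 2" using True r by auto
      then have "u * w = (2 * w) * w" using uw by (simp add: power2_eq_square mult.assoc)
      then show ?thesis using w0 by simp
    qed
    moreover have "chi (4 * w) = chi w" using chi_mult[OF two, of 4 w] chi_4[OF two] by simp
    ultimately show ?thesis unfolding roots using True by auto
  qed
next
  case False
  have "\<not> is_square ((u + 2 * r) * (u - 2 * r))"
  proof
    assume "is_square ((u + 2 * r) * (u - 2 * r))"
    then obtain z where z: "(u + 2 * r) * (u - 2 * r) = z^2" by (auto simp: is_square_iff)
    have four: "(4 :: 'a) \<noteq> 0" using two by (metis mult_2 mult_eq_0_iff numeral_Bit0)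
    define w where "w = (u + z) / 2"
    have w2: "2 * w = u + z" using two by (simp add: w_def)
    have "4 * (w^2 - u * w + 2) = (2 * w)^2 - 2 * u * (2 * w) + 8" by (simp add: algebra_simps power2_eq_square)
    also have "\<dots> = z^2 - u^2 + 4 * r^2" unfolding w2 r by (simp add: algebra_simps power2_eq_square)
    also have "\<dots> = 0" unfolding z[symmetric] by (simp add: algebra_simps power2_eq_square)
    finally show False using False four by (metis mult_eq_0_iff)
  qed
  then have "chi ((u + 2 * r) * (u - 2 * r)) = - 1" by (metis chi_def is_square_iff zero_power2)
  then have "chi (u + 2 * r) * chi (u - 2 * r) = - 1" by (simp only: chi_mult[OF two])
  then have "chi (u + 2 * r) + chi (u - 2 * r) = 0"
    using chi_cases[of "u + 2 * r"] chi_cases[of "u - 2 * r"] by (cases "u + 2 * r = 0"; cases "u - 2 * r = 0") auto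
  then show ?thesis using False by simp
qed

text \<open>The polynomial equals w (u^2 - 9) w^2 with u = w + 2 / w, so sorting by u leaves the
  inner sums of \<open>chi_roots_sum\<close>. The two resulting sums agree under u -> -u since -1 is
  a square. The scaling u = r v removes the irrational coefficient: it takes out chi r and leaves (v
  + 2) (v^2 - 9 / 2), the cubic of E15.\<close>

lemma sum5_sqrt2:
  assumes r: "r ^ 2 = (2 :: 'a)" and m1: "chi (- 1 :: 'a) = 1"
  shows "sum5 = 2 * chi r * (\<Sum>v\<in>UNIV. chi (v^3 + 2 * v^2 - 9 / 2 * v - 9 :: 'a))"
proof -
  have r0: "r \<noteq> 0" using r two by auto
  have chi2: "chi (2 :: 'a) = 1" using chi_square[OF r0] r by simp
  have h: "h5 w = (\<Sum>u\<in>UNIV. if w^2 - u * w + 2 = 0 then chi w * chi (u^2 - 9) else 0)" for w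
  proof (cases "w = 0")
    case True
    then show ?thesis using two by (simp add: h5_def)
  next
    case False
    define u0 where "u0 = w + 2 * inverse w"
    have u0: "u0 * w = w^2 + 2" using False by (simp add: u0_def field_simps power2_eq_square)
    have eq: "w^2 - u * w + 2 = 0 \<longleftrightarrow> u = u0" for u
    proof -
      have "w^2 - u * w + 2 = 0 \<longleftrightarrow> u * w = u0 * w" unfolding u0 by (auto simp: algebra_simps)
      then show ?thesis using False by simp
    qed
    have "(w * ((w^2 - 1) * (w^2 - 4))) = w * ((w^2 + 2)^2 - 9 * w^2)" by (simp add: algebra_simps power2_eq_square)
    also have "\<dots> = w * (u0^2 - 9) * w^2" unfolding u0[symmetric] by (simp add: algebra_simps power2_eq_square)
    finally have "h5 w = chi w * chi (u0^2 - 9)" unfolding h5_def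
      using chi_mult_square[OF two False, of "w * (u0^2 - 9)"] chi_mult[OF two, of w "u0^2 - 9"] by (simp only:)
    then show ?thesis unfolding eq by simp
  qed
  have "sum5 = (\<Sum>u\<in>UNIV. \<Sum>w\<in>UNIV. if (w::'a)^2 - u * w + 2 = 0 then chi w * chi (u^2 - 9) else 0)"
    unfolding sum5_h5 h by (rule sum.swap)
  also have "\<dots> = (\<Sum>u\<in>UNIV. (\<Sum>w | w^2 - u * w + 2 = 0. chi w) * chi (u^2 - 9 :: 'a))"
    by (simp add: sum.If_cases sum_distrib_right)
  also have "\<dots> = (\<Sum>u\<in>UNIV. chi (u + 2 * r) * chi (u^2 - 9)) + (\<Sum>u\<in>UNIV. chi (u - 2 * r) * chi (u^2 - 9))"
    unfolding chi_roots_sum[OF r] distrib_right by (rule sum.distrib)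
  also have "(\<Sum>u\<in>UNIV. chi (u - 2 * r) * chi (u^2 - 9)) = (\<Sum>u\<in>UNIV. chi (u + 2 * r) * chi (u^2 - 9))"
  proof -
    have "chi (- u - 2 * r) = chi (u + 2 * r)" for u
      using chi_minus[OF two, of "u + 2 * r"] m1 by simp
    then show ?thesis using sum_affine[of "- 1" "\<lambda>u. chi (u - 2 * r) * chi (u^2 - 9)" 0] by simp
  qed
  also have "(\<Sum>u\<in>UNIV. chi (u + 2 * r) * chi (u^2 - 9)) = (\<Sum>v\<in>UNIV. chi (r * v + 2 * r) * chi ((r * v)^2 - 9))"
    using sum_affine[OF r0, of "\<lambda>u. chi (u + 2 * r) * chi (u^2 - 9)" 0] by simp
  also have "\<dots> = (\<Sum>v\<in>UNIV. chi r * chi (v^3 + 2 * v^2 - 9 / 2 * v - 9 :: 'a))"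
  proof (rule sum.cong[OF refl])
    fix v :: 'a
    have "(r * v)^2 - 9 = 2 * (v^2 - 9 / 2)" using two r by (simp add: power_mult_distrib algebra_simps)
    then have 1: "chi ((r * v)^2 - 9) = chi (v^2 - 9 / 2)" using chi2 chi_mult[OF two, of 2 "v^2 - 9 / 2"] by (simp only: mult_1)
    have "r * v + 2 * r = r * (v + 2)" by (simp add: algebra_simps)
    then have 2: "chi (r * v + 2 * r) = chi r * chi (v + 2)" by (simp only: chi_mult[OF two])
    have "(v + 2) * (v^2 - 9 / 2) = v^3 + 2 * v^2 - 9 / 2 * v - 9"
      using two by (simp add: algebra_simps power2_eq_square power3_eq_cube)
    then have 3: "chi (v + 2) * chi (v^2 - 9 / 2) = chi (v^3 + 2 * v^2 - 9 / 2 * v - 9)"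
      by (simp only: chi_mult[OF two, symmetric])
    show "chi (r * v + 2 * r) * chi ((r * v)^2 - 9) = chi r * chi (v^3 + 2 * v^2 - 9 / 2 * v - 9)"
      unfolding 1 2 3[symmetric] by simp
  qed
  also have "\<dots> = chi r * (\<Sum>v\<in>UNIV. chi (v^3 + 2 * v^2 - 9 / 2 * v - 9 :: 'a))" by (simp only: sum_distrib_left)
  finally show ?thesis by simp
qed

text \<open>Every point of the model is equivalent to exactly one point with \<open>z = 1\<close> or with \<open>z = 0\<close> and \<open>x = 1\<close>.\<close>

lemma frobenius_trace_eq:
  fixes f :: "'a poly"
  assumes deg: "degree f \<le> 4"
  shows "frobenius_trace f = - (\<Sum>x\<in>UNIV. chi (poly f x)) - chi (coeff f 4)"
proof -
  let ?r = "weighted_proportional :: (('a \<times> 'a \<times> 'a) \<times> ('a \<times> 'a \<times> 'a)) set"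
  let ?F = "\<lambda>x z. \<Sum>i\<le>4. coeff f i * x^i * z^(4 - i)"
  define P where "P = {(x, y, z). (x, z) \<noteq> (0, 0) \<and> y^2 = ?F x z}"
  \<comment> \<open>The points at infinity correspond to the square roots of the coefficient of x^4:
    a single one if this coefficient is 0, otherwise two or none. This is the source of the last
    term.\<close>
  define N where "N = (\<lambda>(x, y). (x, y, 1 :: 'a)) ` {(x, y). y^2 = poly f x} \<union> (\<lambda>y. (1, y, 0 :: 'a)) ` {y. y^2 = coeff f 4}"
  have F1: "?F x 1 = poly f x" for x
    unfolding poly_altdef using deg by (intro sum.mono_neutral_cong_right) (auto simp: coeff_eq_0)
  have F0: "?F x 0 = coeff f 4 * x^4" for x
  proof -
    have "?F x 0 = (\<Sum>i\<le>4. if i = 4 then coeff f i * x^i else 0)" by (intro sum.cong) auto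
    then show ?thesis by simp
  qed
  have Fc: "?F (k * x) (k * z) = k^4 * ?F x z" for k x z
    unfolding sum_distrib_left
  proof (rule sum.cong[OF refl])
    fix i :: nat assume "i \<in> {..4}"
    then have "k^4 = k^i * k^(4 - i)" by (simp flip: power_add)
    then show "coeff f i * (k * x)^i * (k * z)^(4 - i) = k^4 * (coeff f i * x^i * z^(4 - i))"
      by (simp add: power_mult_distrib mult_ac)
  qed
  have img: "?r `` {(x, y, z)} = {(k * x, k^2 * y, k * z) | k. k \<noteq> 0}" for x y z
    unfolding weighted_proportional_def by auto
  have cls: "?r `` {(k * x, k^2 * y, k * z)} = ?r `` {(x, y, z)}" if k: "k \<noteq> 0" for k x y z
    unfolding img
  proof (intro equalityI subsetI)
    fix p assume "p \<in> {(l * (k * x), l^2 * (k^2 * y), l * (k * z)) | l. l \<noteq> 0}"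
    then obtain l where "l \<noteq> 0" "p = (l * (k * x), l^2 * (k^2 * y), l * (k * z))" by blast
    then show "p \<in> {(k * x, k^2 * y, k * z) | k. k \<noteq> 0}"
      using k by (intro CollectI exI[of _ "l * k"]) (simp add: power_mult_distrib)
  next
    fix p assume "p \<in> {(k * x, k^2 * y, k * z) | k. k \<noteq> 0}"
    then obtain l where "l \<noteq> 0" "p = (l * x, l^2 * y, l * z)" by blast
    then show "p \<in> {(l * (k * x), l^2 * (k^2 * y), l * (k * z)) | l. l \<noteq> 0}"
      using k by (intro CollectI exI[of _ "l / k"]) (simp add: power_divide)
  qed
  have NP: "N \<subseteq> P" 
  proof -
    have "?F 1 0 = coeff f 4" using F0[of 1] by simp
    then show ?thesis unfolding N_def P_def using F1 by auto
  qed
  have inj: "inj_on (\<lambda>n. ?r `` {n}) N"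
  proof (rule inj_onI)
    fix m n assume mn: "m \<in> N" "n \<in> N" "?r `` {m} = ?r `` {n}"
    obtain x y z where m: "m = (x, y, z)" by (cases m) auto
    obtain x' y' z' where n: "n = (x', y', z')" by (cases n) auto
    have "m \<in> ?r `` {m}" unfolding m img by (intro CollectI exI[of _ 1]) simp
    then have "m \<in> ?r `` {n}" using mn by simp
    then obtain k where k: "k \<noteq> 0" "x = k * x'" "y = k^2 * y'" "z = k * z'" unfolding m n img by auto
    \<comment> \<open>Equivalent representatives both have z = 1, or both have z = 0 and x = 1,
      because k is nonzero.\<close>
    have "k = 1" using mn(1,2) k unfolding m n N_def by auto
    then show "m = n" using k m n by simp
  qed
  have surj: "(\<lambda>n. ?r `` {n}) ` N = P // ?r"
  proof
    show "(\<lambda>n. ?r `` {n}) ` N \<subseteq> P // ?r" using NP by (auto intro: quotientI)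
    show "P // ?r \<subseteq> (\<lambda>n. ?r `` {n}) ` N"
    proof
      fix c assume "c \<in> P // ?r"
      then obtain x y z where p: "(x, y, z) \<in> P" "c = ?r `` {(x, y, z)}" unfolding quotient_def by auto
      show "c \<in> (\<lambda>n. ?r `` {n}) ` N"
      proof (cases "z = 0")
        case False
        let ?k = "inverse z"
        have "(?k^2 * y)^2 = ?k^4 * ?F x z" using p(1) unfolding P_def by (simp add: power_mult_distrib)
        also have "\<dots> = ?F (?k * x) (?k * z)" by (rule Fc[symmetric])
        also have "\<dots> = poly f (?k * x)" using False F1 by simp
        finally have "(?k * x, ?k^2 * y, 1) \<in> N" unfolding N_def by auto
        moreover have "c = ?r `` {(?k * x, ?k^2 * y, 1)}"
          using cls[of ?k x y z] False p(2) by simp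
        ultimately show ?thesis by blast
      next
        case True
        then have x: "x \<noteq> 0" using p(1) unfolding P_def by auto
        let ?k = "inverse x"
        have "(?k^2 * y)^2 = ?k^4 * ?F x 0" using p(1) True unfolding P_def by (simp add: power_mult_distrib)
        also have "\<dots> = ?F (?k * x) (?k * 0)" by (rule Fc[symmetric])
        also have "\<dots> = coeff f 4" using x F0[of 1] by simp
        finally have "(1, ?k^2 * y, 0) \<in> N" unfolding N_def by auto
        moreover have "c = ?r `` {(1, ?k^2 * y, 0)}"
          using cls[of ?k x y z] x p(2) True by simp
        ultimately show ?thesis by blast
      qed
    qed
  qed
  have "card (model_points f) = card N"
    unfolding model_points_def P_def[symmetric] surj[symmetric] by (rule card_image[OF inj])
  also have "card N = card {(x, y). y^2 = poly f x} + card {y. y^2 = coeff f 4}"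
    unfolding N_def by (subst card_Un_disjoint) (auto simp: card_image inj_on_def)
  also have "{(x, y). y^2 = poly f x} = (SIGMA x:UNIV. {y. y^2 = poly f x})" by auto
  also have "card \<dots> = (\<Sum>x\<in>UNIV. card {y. y^2 = poly f x})" by (rule card_SigmaI) auto
  finally have "int (card (model_points f)) = (\<Sum>x\<in>UNIV. 1 + chi (poly f x)) + (1 + chi (coeff f 4))"
    using card_sqrt[OF two] by simp
  also have "\<dots> = int CARD('a) + (\<Sum>x\<in>UNIV. chi (poly f x)) + 1 + chi (coeff f 4)" by (simp add: sum.distrib)
  finally show ?thesis unfolding frobenius_trace_def by simp
qed

text \<open>E4 and E12 are quartics with leading coefficient 1 and have two points at infinity,
  hence the additional -1; the cubics have one.\<close>

lemma trace_E0: "frobenius_trace (E0 :: 'a poly) = - (\<Sum>x\<in>UNIV. d 0 x * d 1 x * d 2 x)"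
  and trace_E1: "frobenius_trace (E1 :: 'a poly) = - (\<Sum>x\<in>UNIV. d 0 x * d 1 x * d 3 x)"
  and trace_E4: "frobenius_trace (E4 :: 'a poly) = - (\<Sum>x\<in>UNIV. d 0 x * d 1 x * d 2 x * d 3 x) - 1"
  and trace_E12: "frobenius_trace (E12 :: 'a poly) = - (\<Sum>x\<in>UNIV. d 0 x * d 1 x * d 3 x * d 4 x) - 1"
  and trace_E15: "frobenius_trace (E15 :: 'a poly) = - (\<Sum>v\<in>UNIV. chi (v^3 + 2 * v^2 - 9 / 2 * v - 9 :: 'a))"
proof -
  have p3: "degree ([:0, 1:] * [:a, 1:] * [:b, 1:] :: 'a poly) \<le> 4" "coeff ([:0, 1:] * [:a, 1:] * [:b, 1:] :: 'a poly) 4 = 0" for a b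
    by (simp_all add: eval_nat_numeral)
  have p4: "degree ([:0, 1:] * [:a, 1:] * [:b, 1:] * [:e, 1:] :: 'a poly) \<le> 4" "coeff ([:0, 1:] * [:a, 1:] * [:b, 1:] * [:e, 1:] :: 'a poly) 4 = 1" for a b e
    by (simp_all add: eval_nat_numeral)
  have e3: "poly ([:0, 1:] * [:a, 1:] * [:b, 1:]) x = x * (x + a) * (x + b)" for a b x :: 'a
    by (simp add: algebra_simps)
  have e4: "poly ([:0, 1:] * [:a, 1:] * [:b, 1:] * [:e, 1:]) x = x * (x + a) * (x + b) * (x + e)" for a b e x :: 'a
    by (simp only: poly_mult) (simp add: add.commute)
  show "frobenius_trace (E0 :: 'a poly) = - (\<Sum>x\<in>UNIV. d 0 x * d 1 x * d 2 x)"
    unfolding E0_def frobenius_trace_eq[OF p3(1)] p3(2) e3 chi_mult[OF two] by simp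
  show "frobenius_trace (E1 :: 'a poly) = - (\<Sum>x\<in>UNIV. d 0 x * d 1 x * d 3 x)"
    unfolding E1_def frobenius_trace_eq[OF p3(1)] p3(2) e3 chi_mult[OF two] by simp
  show "frobenius_trace (E4 :: 'a poly) = - (\<Sum>x\<in>UNIV. d 0 x * d 1 x * d 2 x * d 3 x) - 1"
    unfolding E4_def frobenius_trace_eq[OF p4(1)] p4(2) e4 chi_mult[OF two] by simp
  show "frobenius_trace (E12 :: 'a poly) = - (\<Sum>x\<in>UNIV. d 0 x * d 1 x * d 3 x * d 4 x) - 1"
    unfolding E12_def frobenius_trace_eq[OF p4(1)] p4(2) e4 chi_mult[OF two] by simp
  have "degree (E15 :: 'a poly) \<le> 4" "coeff (E15 :: 'a poly) 4 = 0" by (simp_all add: E15_def eval_nat_numeral)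
  moreover have "poly E15 v = v^3 + 2 * v^2 - 9 / 2 * v - 9" for v :: 'a
    by (simp add: E15_def algebra_simps power2_eq_square power3_eq_cube)
  ultimately show "frobenius_trace (E15 :: 'a poly) = - (\<Sum>v\<in>UNIV. chi (v^3 + 2 * v^2 - 9 / 2 * v - 9 :: 'a))"
    using frobenius_trace_eq[of E15] by simp
qed

end

section \<open>Counting points and words\<close>

definition letter_sign :: "letter \<Rightarrow> int" where
  "letter_sign u = (if u = R then 1 else - 1)"

lemma letter_sign_simps [simp]: "letter_sign R = 1" "letter_sign N = - 1"
  by (simp_all add: letter_sign_def)

text \<open>For nonzero scaling constants of the right quadratic character this is the number of
  nonzero z whose scaled square is x + i, as \<open>card_scaled_sqrt\<close> shows. The case x + i =
  0 yields 0, whereas the character formula alone would yield 1.\<close>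

definition letter_weight :: "letter list \<Rightarrow> nat \<Rightarrow> 'a::field \<Rightarrow> int" where
  "letter_weight S i x = (if x + of_nat i = 0 then 0 else 1 + letter_sign (S ! i) * chi (x + of_nat i))"

text \<open>The first five terms come from the nontrivial sums of products of three, four or five characters, the
  next two from the sums equal to \<open>-1\<close>, and the last one removes the elements \<open>0, -1, \<dots>, -4\<close>.
  The parameters \<open>m\<close>, \<open>b\<close> and \<open>t\<close> are the characters of \<open>-1\<close>, \<open>2\<close> and \<open>3\<close>.\<close>

definition count_correction ::
    "int \<Rightarrow> int \<Rightarrow> int \<Rightarrow> int \<Rightarrow> int \<Rightarrow> int \<Rightarrow> int \<Rightarrow> int \<Rightarrow> int \<Rightarrow> int \<Rightarrow> int \<Rightarrow> int \<Rightarrow> int \<Rightarrow> int" where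
  "count_correction s0 s1 s2 s3 s4 m b t a0 a1 a4 a12 q =
     - a0 * (s0 * s1 * s2 + s1 * s2 * s3 + s2 * s3 * s4 + b * (s0 * s2 * s4))
     - a1 * (s0 * s1 * s3 + s1 * s2 * s4 + m * (s0 * s2 * s3 + s1 * s3 * s4)
         + b * (s0 * s1 * s2 * s4 + s0 * s2 * s3 * s4))
     - a4 * (s0 * s1 * s4 + m * (s0 * s3 * s4) + (s0 * s1 * s2 * s3 + s1 * s2 * s3 * s4))
     - a12 * (s0 * s1 * s3 * s4)
     + q * (s0 * s1 * s2 * s3 * s4)
     - (s0 * s1 + s0 * s2 + s0 * s3 + s0 * s4 + s1 * s2 + s1 * s3 + s1 * s4 + s2 * s3 + s2 * s4 + s3 * s4)
     - (s0 * s1 * s2 * s3 + s1 * s2 * s3 * s4 + (s0 * s1 * s2 * s4 + s0 * s2 * s3 * s4) + s0 * s1 * s3 * s4)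
     - ((1 + s1) * (1 + s2 * b) * (1 + s3 * t) * (1 + s4)
       + (1 + s0 * m) * (1 + s2) * (1 + s3 * b) * (1 + s4 * t)
       + (1 + s0 * (m * b)) * (1 + s1 * m) * (1 + s3) * (1 + s4 * b)
       + (1 + s0 * (m * t)) * (1 + s1 * (m * b)) * (1 + s2 * m) * (1 + s4)
       + (1 + s0 * m) * (1 + s1 * (m * t)) * (1 + s2 * (m * b)) * (1 + s3 * m))"

lemma card_lists_nth:
  assumes "\<And>i. i < n \<Longrightarrow> finite (B i)"
  shows "finite {x. length x = n \<and> (\<forall>i<n. x ! i \<in> B i)} \<and>
    card {x. length x = n \<and> (\<forall>i<n. x ! i \<in> B i)} = (\<Prod>i<n. card (B i))"
  using assms
proof (induction n)
  case 0
  then show ?case by simp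
next
  case (Suc n)
  let ?L = "{x. length x = n \<and> (\<forall>i<n. x ! i \<in> B i)}"
  have eq: "{x. length x = Suc n \<and> (\<forall>i<Suc n. x ! i \<in> B i)} = (\<lambda>(x, z). x @ [z]) ` (?L \<times> B n)"
  proof (intro equalityI subsetI)
    fix x assume x: "x \<in> {x. length x = Suc n \<and> (\<forall>i<Suc n. x ! i \<in> B i)}"
    then have "x = butlast x @ [last x]" by (cases x rule: rev_cases) auto
    then obtain w z where w: "x = w @ [z]" by blast
    have "w ! i \<in> B i" if "i < n" for i
      using x that unfolding w by (auto simp: nth_append dest!: spec[of _ i])
    moreover have "z \<in> B n" using x unfolding w by (auto dest!: spec[of _ n])
    ultimately show "x \<in> (\<lambda>(x, z). x @ [z]) ` (?L \<times> B n)" using x unfolding w by auto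
  next
    fix x assume "x \<in> (\<lambda>(x, z). x @ [z]) ` (?L \<times> B n)"
    then show "x \<in> {x. length x = Suc n \<and> (\<forall>i<Suc n. x ! i \<in> B i)}" by (auto simp: nth_append less_Suc_eq)
  qed
  have "inj_on (\<lambda>(x, z). x @ [z]) (?L \<times> B n)" by (auto simp: inj_on_def)
  then show ?case using Suc unfolding eq by (simp add: card_image card_cartesian_product)
qed

context
  assumes two: "(2 :: 'a::{field,finite}) \<noteq> 0"
begin

lemma card_scaled_sqrt:
  assumes "ep \<noteq> 0" "is_square ep" "em \<noteq> 0" "\<not> is_square (em :: 'a)"
  shows "int (card {z. z \<noteq> 0 \<and> eps ep em S i * z^2 = x + of_nat i}) = letter_weight S i x"
proof (cases "x + of_nat i = 0")
  case True
  then have "{z. z \<noteq> 0 \<and> eps ep em S i * z^2 = x + of_nat i} = {}" using assms by (auto simp: eps_def)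
  then show ?thesis using True by (simp add: letter_weight_def)
next
  case False
  let ?e = "eps ep em S i"
  have e: "?e \<noteq> 0" "chi ?e = letter_sign (S ! i)" using assms by (auto simp: eps_def chi_def letter_sign_def)
  have "{z. z \<noteq> 0 \<and> ?e * z^2 = x + of_nat i} = {z. z^2 = (x + of_nat i) / ?e}"
    using False e(1) by (auto simp: field_simps)
  then show ?thesis using False e card_sqrt[OF two, of "(x + of_nat i) / ?e"] chi_div[OF two e(1)]
    by (simp add: letter_weight_def)
qed

text \<open>Along a point of the curve the products \<open>\<epsilon>\<^sub>i x\<^sub>i\<^sup>2\<close> are consecutive elements of the field.\<close>

lemma card_affine_points_nonzero:
  assumes "length S = 5" "ep \<noteq> 0" "is_square ep" "em \<noteq> 0" "\<not> is_square (em :: 'a)"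
  shows "int (card (affine_points_nonzero ep em S)) = (\<Sum>x\<in>UNIV. \<Prod>i<5. letter_weight S i (x :: 'a))"
proof -
  define B where "B x i = {z. z \<noteq> 0 \<and> eps ep em S i * z^2 = x + of_nat i}" for x i
  define L where "L x = {z. length z = 5 \<and> (\<forall>i<5. z ! i \<in> B x i)}" for x
  have L: "finite (L x)" "int (card (L x)) = (\<Prod>i<5. letter_weight S i x)" for x
    using card_lists_nth[of 5 "B x"] card_scaled_sqrt[OF assms(2-5), of S _ x]
    unfolding L_def B_def by simp_all
  have "affine_points_nonzero ep em S = (\<Union>x. L x)"
  proof (intro equalityI subsetI)
    fix z assume z: "z \<in> affine_points_nonzero ep em S"
    define e where "e i = eps ep em S i * (z ! i)^2" for i
    have e: "e i = e 0 + of_nat i" if "i < 5" for i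
      using that
    proof (induction i)
      case (Suc i)
      have "e (Suc i) - e i = 1"
        using z Suc.prems assms(1) unfolding affine_points_nonzero_def affine_points_def e_def by auto
      then show ?case using Suc by (simp add: algebra_simps)
    qed simp
    have "length z = 5" "\<forall>i<5. z ! i \<noteq> 0"
      using z assms(1) unfolding affine_points_nonzero_def affine_points_def by auto
    moreover have "eps ep em S i * (z ! i)^2 = e 0 + of_nat i" if "i < 5" for i
      using e[OF that] unfolding e_def[of i] .
    ultimately have "z \<in> L (e 0)" unfolding L_def B_def by blast
    then show "z \<in> (\<Union>x. L x)" by blast
  next
    fix z assume "z \<in> (\<Union>x. L x)"
    then obtain x where z: "z \<in> L x" by blast
    then have "eps ep em S (Suc i) * (z ! Suc i)^2 - eps ep em S i * (z ! i)^2 = 1" if "Suc i < 5" for i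
      using that by (auto simp: L_def B_def)
    then show "z \<in> affine_points_nonzero ep em S"
      using z assms(1) unfolding affine_points_nonzero_def affine_points_def L_def B_def by auto
  qed
  \<comment> \<open>The coordinate with index 0 determines x as its scaled square.\<close>
  moreover have "L x \<inter> L w = {}" if "x \<noteq> w" for x w
    using that unfolding L_def B_def by (auto dest!: spec[of _ 0])
  ultimately have "card (affine_points_nonzero ep em S) = (\<Sum>x\<in>UNIV. card (L x))"
    using L(1) by (subst card_UN_disjoint[symmetric]) auto
  then show ?thesis using L(2) by simp
qed

text \<open>A factor is 2 where the letter matches and 0 otherwise, also at x + i = 0, where chi
  takes the value 0 of no letter. Five matches give 2^5 = 32.\<close>

lemma prod_letter_weight:
  assumes "length S = 5"
  shows "(\<Prod>i<5. letter_weight S i (x :: 'a)) = (if \<forall>i<5. chi (x + of_nat i) = letter_sign (S ! i) then 32 else 0)"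
proof (cases "\<forall>i<5. chi (x + of_nat i) = letter_sign (S ! i)")
  case True
  then have "letter_weight S i x = 2" if "i < 5" for i
    using that by (auto simp: letter_weight_def letter_sign_def split: if_splits)
  then show ?thesis using True by simp
next
  case False
  then obtain i where i: "i < 5" "chi (x + of_nat i) \<noteq> letter_sign (S ! i)" by blast
  then have "letter_weight S i x = 0"
    using chi_cases[of "x + of_nat i"] by (auto simp: letter_weight_def letter_sign_def)
  then have "(\<Prod>i<5. letter_weight S i x) = 0" using i(1) by (intro prod_zero) auto
  then show ?thesis by (simp only: False if_False)
qed

lemma sum_prod_letter_weight:
  assumes three: "(3 :: 'a) \<noteq> 0"
  shows "(\<Sum>x\<in>UNIV. \<Prod>i<5. letter_weight S i (x :: 'a)) =
    int CARD('a) + count_correction (letter_sign (S ! 0)) (letter_sign (S ! 1)) (letter_sign (S ! 2)) (letter_sign (S ! 3)) (letter_sign (S ! 4))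
      (chi (- 1 :: 'a)) (chi (2 :: 'a)) (chi (3 :: 'a))
      (frobenius_trace (E0 :: 'a poly)) (frobenius_trace (E1 :: 'a poly)) (frobenius_trace (E4 :: 'a poly))
      (frobenius_trace (E12 :: 'a poly)) (sum5 TYPE('a))"
proof -
  define s m b t where s_def: "s = (\<lambda>i. letter_sign (S ! i))"
    and m_def: "m = chi (- 1 :: 'a)" and b_def: "b = chi (2 :: 'a)" and t_def: "t = chi (3 :: 'a)"
  have si: "letter_sign (S ! i) = s i" for i unfolding s_def ..
  note ne = small_of_nat_inj[OF two three]
  \<comment> \<open>\<open>G\<close> keeps the value 1 for a factor with x + i = 0, so that it
    expands into complete character sums. Its values at the five exceptional points are subtracted
    afterwards.\<close>
  define G where "G x = (\<Prod>i<5. 1 + s i * chi (x + of_nat i))" for x :: 'a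
  have lt5: "{..<5::nat} = {0, 1, 2, 3, 4}" by auto
  define Z where "Z = (\<lambda>j::nat. - of_nat j :: 'a) ` {..<5}"
  have inj: "inj_on (\<lambda>j::nat. - of_nat j :: 'a) {..<5}" by (intro inj_onI ne) auto
  have "(\<Prod>i<5. letter_weight S i x) = (if x \<in> Z then 0 else G x)" for x :: 'a
  proof (cases "x \<in> Z")
    case True
    then obtain j where "j < 5" "x + of_nat j = 0" by (auto simp: Z_def)
    then have "(\<Prod>i<5. letter_weight S i x) = 0" by (intro prod_zero bexI[of _ j]) (auto simp: letter_weight_def)
    then show ?thesis using True by simp
  next
    case False
    then have "x + of_nat i \<noteq> 0" if "i < 5" for i
      using that by (auto simp: Z_def add_eq_0_iff2)
    then show ?thesis using False by (simp add: G_def letter_weight_def s_def)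
  qed
  then have "(\<Sum>x\<in>UNIV. \<Prod>i<5. letter_weight S i (x :: 'a)) = (\<Sum>x\<in>UNIV. G x) - (\<Sum>x\<in>Z. G x)"
    by (simp add: sum.If_cases flip: sum.Int_Diff[of UNIV G Z])
      (simp add: sum_diff Compl_eq_Diff_UNIV)
  also have "(\<Sum>x\<in>Z. G x) = (\<Sum>j<5. G (- of_nat j))" unfolding Z_def by (simp add: sum.reindex[OF inj])
  also have "\<dots> = G 0 + G (- 1) + G (- 2) + G (- 3) + G (- 4)" unfolding lt5 by simp
  finally have 1: "(\<Sum>x\<in>UNIV. \<Prod>i<5. letter_weight S i (x :: 'a))
      = (\<Sum>x\<in>UNIV. G x) - (G 0 + G (- 1) + G (- 2) + G (- 3) + G (- 4))" .
  have Gexp: "G x = (1 + s 0 * chi x) * (1 + s 1 * chi (x + 1)) * (1 + s 2 * chi (x + 2)) * (1 + s 3 * chi (x + 3))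
      * (1 + s 4 * chi (x + 4))" for x
    unfolding G_def lt5 by (simp add: mult_ac)
  have neg: "chi (- 1 :: 'a) = m" "chi (- 2 :: 'a) = m * b" "chi (- 3 :: 'a) = m * t" "chi (- 4 :: 'a) = m"
    using chi_minus[OF two, of 2] chi_minus[OF two, of 3] chi_minus[OF two, of 4] chi_4[OF two]
    by (simp_all add: m_def b_def t_def)
  note pos = b_def[symmetric] t_def[symmetric] chi_4[OF two]
  have Gv: "G 0 = (1 + s 1) * (1 + s 2 * b) * (1 + s 3 * t) * (1 + s 4)"
      "G (- 1) = (1 + s 0 * m) * (1 + s 2) * (1 + s 3 * b) * (1 + s 4 * t)"
      "G (- 2) = (1 + s 0 * (m * b)) * (1 + s 1 * m) * (1 + s 3) * (1 + s 4 * b)"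
      "G (- 3) = (1 + s 0 * (m * t)) * (1 + s 1 * (m * b)) * (1 + s 2 * m) * (1 + s 4)"
      "G (- 4) = (1 + s 0 * m) * (1 + s 1 * (m * t)) * (1 + s 2 * (m * b)) * (1 + s 3 * m)"
    unfolding Gexp by (simp_all add: neg pos)
  have sums: "(\<Sum>x\<in>UNIV. G x) = int CARD('a)
     - (s 0 * s 1 + s 0 * s 2 + s 0 * s 3 + s 0 * s 4 + s 1 * s 2 + s 1 * s 3 + s 1 * s 4 + s 2 * s 3 + s 2 * s 4 + s 3 * s 4)
     + (\<Sum>x\<in>UNIV. d 0 (x :: 'a) * d 1 x * d 2 x) * (s 0 * s 1 * s 2 + s 1 * s 2 * s 3 + s 2 * s 3 * s 4 + b * (s 0 * s 2 * s 4))
     + (\<Sum>x\<in>UNIV. d 0 (x :: 'a) * d 1 x * d 3 x) * (s 0 * s 1 * s 3 + s 1 * s 2 * s 4 + m * (s 0 * s 2 * s 3 + s 1 * s 3 * s 4))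
     + (\<Sum>x\<in>UNIV. d 0 (x :: 'a) * d 1 x * d 4 x) * (s 0 * s 1 * s 4 + m * (s 0 * s 3 * s 4))
     + (\<Sum>x\<in>UNIV. d 0 (x :: 'a) * d 1 x * d 2 x * d 3 x) * (s 0 * s 1 * s 2 * s 3 + s 1 * s 2 * s 3 * s 4)
     + (\<Sum>x\<in>UNIV. d 0 (x :: 'a) * d 1 x * d 2 x * d 4 x) * (s 0 * s 1 * s 2 * s 4 + s 0 * s 2 * s 3 * s 4)
     + (\<Sum>x\<in>UNIV. d 0 (x :: 'a) * d 1 x * d 3 x * d 4 x) * (s 0 * s 1 * s 3 * s 4)
     + sum5 TYPE('a) * (s 0 * s 1 * s 2 * s 3 * s 4)"
  proof -
    \<comment> \<open>An opaque name keeps the expansion formal: signs and characters are separated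
      by a ring identity in ten variables before any sum is evaluated.\<close>
    define D where "D i x = d i x" for i and x :: 'a
    have exp: "(1 + z0 * y0) * (1 + z1 * y1) * (1 + z2 * y2) * (1 + z3 * y3) * (1 + z4 * y4) =
        1 + (z0 * y0 + z1 * y1 + z2 * y2 + z3 * y3 + z4 * y4)
        + ((z0 * z1) * (y0 * y1) + (z0 * z2) * (y0 * y2) + (z0 * z3) * (y0 * y3) + (z0 * z4) * (y0 * y4) + (z1 * z2) * (y1 * y2)
          + (z1 * z3) * (y1 * y3) + (z1 * z4) * (y1 * y4) + (z2 * z3) * (y2 * y3) + (z2 * z4) * (y2 * y4) + (z3 * z4) * (y3 * y4))
        + ((z0 * z1 * z2) * (y0 * y1 * y2) + (z1 * z2 * z3) * (y1 * y2 * y3) + (z2 * z3 * z4) * (y2 * y3 * y4)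
          + (z0 * z2 * z4) * (y0 * y2 * y4) + (z0 * z1 * z3) * (y0 * y1 * y3) + (z1 * z2 * z4) * (y1 * y2 * y4)
          + (z0 * z2 * z3) * (y0 * y2 * y3) + (z1 * z3 * z4) * (y1 * y3 * y4) + (z0 * z1 * z4) * (y0 * y1 * y4)
          + (z0 * z3 * z4) * (y0 * y3 * y4))
        + ((z0 * z1 * z2 * z3) * (y0 * y1 * y2 * y3) + (z1 * z2 * z3 * z4) * (y1 * y2 * y3 * y4)
          + (z0 * z1 * z2 * z4) * (y0 * y1 * y2 * y4) + (z0 * z2 * z3 * z4) * (y0 * y2 * y3 * y4)
          + (z0 * z1 * z3 * z4) * (y0 * y1 * y3 * y4))
        + (z0 * z1 * z2 * z3 * z4) * (y0 * y1 * y2 * y3 * y4)" for y0 y1 y2 y3 y4 z0 z1 z2 z3 z4 :: int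
      by (simp add: algebra_simps)
    have GD: "G x = (1 + s 0 * D 0 x) * (1 + s 1 * D 1 x) * (1 + s 2 * D 2 x) * (1 + s 3 * D 3 x) * (1 + s 4 * D 4 x)" for x
      unfolding Gexp D_def by simp
    have 1: "(\<Sum>x\<in>UNIV. D i x) = 0" for i unfolding D_def by (rule sum_c1[OF two])
    have 2: "(\<Sum>x\<in>UNIV. D i x * D j x) = - 1" if "i < 5" "j < 5" "i \<noteq> j" for i j
      unfolding D_def by (rule sum_c2[OF two]) (use ne that in blast)
    note 3 = sum_012[OF two] sum_124[OF two] sum_023[OF two] sum_134[OF two] sum_034[OF two] sum_024[OF two]
      sum_1234[OF two] sum_0234[OF two]
    note 3 = 3[folded D_def m_def b_def]
    have 2: "(\<Sum>x\<in>UNIV. D 0 x * D 1 x) = - 1" "(\<Sum>x\<in>UNIV. D 0 x * D 2 x) = - 1" "(\<Sum>x\<in>UNIV. D 0 x * D 3 x) = - 1"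
      "(\<Sum>x\<in>UNIV. D 0 x * D 4 x) = - 1" "(\<Sum>x\<in>UNIV. D 1 x * D 2 x) = - 1" "(\<Sum>x\<in>UNIV. D 1 x * D 3 x) = - 1"
      "(\<Sum>x\<in>UNIV. D 1 x * D 4 x) = - 1" "(\<Sum>x\<in>UNIV. D 2 x * D 3 x) = - 1" "(\<Sum>x\<in>UNIV. D 2 x * D 4 x) = - 1"
      "(\<Sum>x\<in>UNIV. D 3 x * D 4 x) = - 1"
      by (rule 2; simp)+
    have const: "(\<Sum>x\<in>(UNIV :: 'a set). 1) = int CARD('a)" by simp
    define L0 L1 L14 L4 L24 L12 L5 where L: "L0 = (\<Sum>x\<in>UNIV. D 0 x * D 1 x * D 2 x)"
      "L1 = (\<Sum>x\<in>UNIV. D 0 x * D 1 x * D 3 x)" "L14 = (\<Sum>x\<in>UNIV. D 0 x * D 1 x * D 4 x)"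
      "L4 = (\<Sum>x\<in>UNIV. D 0 x * D 1 x * D 2 x * D 3 x)" "L24 = (\<Sum>x\<in>UNIV. D 0 x * D 1 x * D 2 x * D 4 x)"
      "L12 = (\<Sum>x\<in>UNIV. D 0 x * D 1 x * D 3 x * D 4 x)" "L5 = (\<Sum>x\<in>UNIV. D 0 x * D 1 x * D 2 x * D 3 x * D 4 x)"
    note 3 = 3[folded L]
    have 5: "sum5 TYPE('a) = L5" unfolding L D_def by (rule sum5_def[OF two])
    show ?thesis
      unfolding GD exp sum.distrib sum_distrib_left[symmetric] D_def[symmetric] 1 2 5 const 3 L[symmetric]
      by (simp add: algebra_simps)
  qed
  have "frobenius_trace (E0 :: 'a poly) = - (\<Sum>x\<in>UNIV. d 0 (x :: 'a) * d 1 x * d 2 x)"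
    "frobenius_trace (E1 :: 'a poly) = - (\<Sum>x\<in>UNIV. d 0 (x :: 'a) * d 1 x * d 3 x)"
    "frobenius_trace (E4 :: 'a poly) = - (\<Sum>x\<in>UNIV. d 0 (x :: 'a) * d 1 x * d 2 x * d 3 x) - 1"
    "frobenius_trace (E12 :: 'a poly) = - (\<Sum>x\<in>UNIV. d 0 (x :: 'a) * d 1 x * d 3 x * d 4 x) - 1"
    using trace_E0[OF two] trace_E1[OF two] trace_E4[OF two] trace_E12[OF two] .
  then have tr: "(\<Sum>x\<in>UNIV. d 0 (x :: 'a) * d 1 x * d 2 x) = - frobenius_trace (E0 :: 'a poly)"
    "(\<Sum>x\<in>UNIV. d 0 (x :: 'a) * d 1 x * d 3 x) = - frobenius_trace (E1 :: 'a poly)"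
    "(\<Sum>x\<in>UNIV. d 0 (x :: 'a) * d 1 x * d 2 x * d 3 x) = - frobenius_trace (E4 :: 'a poly) - 1"
    "(\<Sum>x\<in>UNIV. d 0 (x :: 'a) * d 1 x * d 3 x * d 4 x) = - frobenius_trace (E12 :: 'a poly) - 1"
    "(\<Sum>x\<in>UNIV. d 0 (x :: 'a) * d 1 x * d 4 x) = - frobenius_trace (E4 :: 'a poly)"
    "(\<Sum>x\<in>UNIV. d 0 (x :: 'a) * d 1 x * d 2 x * d 4 x) = - b * frobenius_trace (E1 :: 'a poly) - 1"
    using sum_0124[OF two] sum_0123[OF two three] by (simp_all add: b_def)
  \<comment> \<open>Ring identity that regroups the evaluated sums into the shape of
    \<open>count_correction\<close>; g stands for the values at the five exceptional points.\<close>
  have fin: "P - Q + - e0 * k0 + - e1 * k1 + - e4 * k14 + (- e4 - 1) * k4 + (- b * e1 - 1) * k24 + (- e12 - 1) * k34 + T * k5 - g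
      = P + (- e0 * k0 - e1 * (k1 + b * k24) - e4 * (k14 + k4) - e12 * k34 + T * k5 - Q - (k4 + k24 + k34) - g)"
    for P Q e0 e1 e4 e12 k0 k1 k14 k4 k24 k34 k5 g T :: int
    by (simp add: algebra_simps)
  show ?thesis unfolding count_correction_def si m_def[symmetric] b_def[symmetric] t_def[symmetric] 1 sums tr Gv
    by (rule fin)
qed

end

section \<open>Legendre symbols and occurrences of words\<close>

lemma chi_of_int: "chi (of_int a :: 'p::prime_card mod_ring) = Legendre a (int CARD('p))"
proof -
  have eq: "of_int x = (of_int y :: 'p mod_ring) \<longleftrightarrow> [x = y] (mod int CARD('p))" for x y
    by (simp add: of_int_eq_iff_cong_CHAR)
  have "is_square (of_int a :: 'p mod_ring) \<longleftrightarrow> QuadRes (int CARD('p)) a"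
  proof
    assume "is_square (of_int a :: 'p mod_ring)"
    then obtain z :: "'p mod_ring" where z: "of_int a = z^2" by (auto simp: is_square_iff)
    obtain i where "z = of_nat i" using surj_of_nat_mod_ring[of z] by blast
    then have "of_int (int i ^ 2) = (of_int a :: 'p mod_ring)" using z by simp
    then show "QuadRes (int CARD('p)) a" unfolding eq QuadRes_def by blast
  next
    assume "QuadRes (int CARD('p)) a"
    then obtain y where "of_int (y ^ 2) = (of_int a :: 'p mod_ring)" unfolding eq QuadRes_def by blast
    then show "is_square (of_int a :: 'p mod_ring)" unfolding is_square_iff by (metis of_int_power)
  qed
  then show ?thesis using eq[of a 0] by (simp add: chi_def Legendre_def)
qed

lemma word_count_eq:
  assumes two: "(2 :: 'p::prime_card mod_ring) \<noteq> 0" and len: "length S = 5"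
  shows "32 * int (word_count CARD('p) S) = (\<Sum>x\<in>UNIV. \<Prod>i<5. letter_weight S i (x :: 'p mod_ring))"
proof -
  let ?p = "CARD('p)"
  define A where "A = {x \<in> {1..?p - length S}. map (\<lambda>i. residue_letter ?p (x + i)) [0..<length S] = S}"
  define B where "B = {x :: 'p mod_ring. \<forall>i<5. chi (x + of_nat i) = letter_sign (S ! i)}"
  have letter: "residue_letter ?p n = u \<longleftrightarrow> chi (of_nat n :: 'p mod_ring) = letter_sign u"
    if "0 < n" "n < ?p" for n u
  proof -
    have "of_nat n \<noteq> (0 :: 'p mod_ring)" using of_nat_0_mod_ring_dvd that nat_dvd_not_less by blast
    then show ?thesis
      using chi_of_int[of "int n", where 'p = 'p] chi_cases[of "of_nat n :: 'p mod_ring"]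
      by (cases u) (auto simp: residue_letter_def)
  qed
  have A: "x \<in> A \<longleftrightarrow> 0 < x \<and> x + 5 \<le> ?p \<and> (\<forall>i<5. chi (of_nat (x + i) :: 'p mod_ring) = letter_sign (S ! i))" for x
  proof -
    have "map (\<lambda>i. residue_letter ?p (x + i)) [0..<length S] = S \<longleftrightarrow> (\<forall>i<5. residue_letter ?p (x + i) = S ! i)"
      using len by (auto simp: list_eq_iff_nth_eq)
    moreover have "x \<in> {1..?p - length S} \<longleftrightarrow> 0 < x \<and> x + 5 \<le> ?p" using len by auto
    moreover have "residue_letter ?p (x + i) = S ! i \<longleftrightarrow> chi (of_nat (x + i) :: 'p mod_ring) = letter_sign (S ! i)"
      if "0 < x" "x + 5 \<le> ?p" "i < 5" for i
      by (rule letter) (use that in auto)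
    ultimately show ?thesis unfolding A_def by blast
  qed
  have inj: "inj_on (of_nat :: nat \<Rightarrow> 'p mod_ring) {..<?p}"
    by (intro inj_onI) (auto simp: of_nat_eq_iff_cong_CHAR cong_def)
  have "bij_betw of_nat A B"
    unfolding bij_betw_def
  proof
    show "inj_on (of_nat :: nat \<Rightarrow> 'p mod_ring) A" by (rule inj_on_subset[OF inj]) (auto simp: A)
    show "of_nat ` A = B"
    proof (intro equalityI subsetI)
      fix x :: "'p mod_ring" assume "x \<in> of_nat ` A"
      then show "x \<in> B" by (auto simp: A B_def)
    next
      fix x :: "'p mod_ring" assume x: "x \<in> B"
      obtain n where n: "n < ?p" "x = of_nat n" using surj_of_nat_mod_ring[of x] by blast
      have ne: "x + of_nat i \<noteq> 0" if "i < 5" for i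
      proof -
        have "chi (x + of_nat i) = letter_sign (S ! i)" using x that by (simp add: B_def)
        then show ?thesis by (auto simp: letter_sign_def split: if_splits)
      qed
      have "n \<noteq> 0" using ne[of 0] n by (intro notI) simp
      \<comment> \<open>If the window of length 5 reached p, one of its entries would be 0 in the
        field, and the character value 0 is the sign of no letter. This matches the range of
        starting points in \<open>word_count\<close>.\<close>
      moreover have "n + 5 \<le> ?p"
      proof (rule ccontr)
        assume "\<not> n + 5 \<le> ?p"
        then have "?p - n < 5" and "n + (?p - n) = ?p" using n by auto
        have "x + of_nat (?p - n) = of_nat (n + (?p - n))" unfolding n(2) by (rule of_nat_add[symmetric])
        also have "\<dots> = 0" using \<open>n + (?p - n) = ?p\<close> by simp
        finally show False using ne[OF \<open>?p - n < 5\<close>] by simp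
      qed
      ultimately have "n \<in> A" using x n by (simp add: A B_def)
      then show "x \<in> of_nat ` A" using n by blast
    qed
  qed
  then have "card A = card B" by (rule bij_betw_same_card)
  then have "32 * int (word_count ?p S) = 32 * int (card B)" unfolding word_count_def A_def by simp
  also have "\<dots> = (\<Sum>x\<in>UNIV. if x \<in> B then 32 else 0)" by (simp add: sum.If_cases)
  finally show ?thesis unfolding prod_letter_weight[OF two len] B_def by simp
qed

text \<open>Euler's criterion gives the congruence modulo p. Both sides have absolute value at most
  1, so they differ by at most 2 < p.\<close>

lemma Legendre_minus_1:
  fixes p :: nat
  assumes "prime p" "2 < p"
  shows "Legendre (- 1) p = (- 1) ^ ((p - 1) div 2)"
proof -
  have "[Legendre (- 1) p = (- 1) ^ ((p - 1) div 2)] (mod p)" by (rule euler_criterion[OF assms])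
  then have "int p dvd Legendre (- 1) p - (- 1) ^ ((p - 1) div 2)" by (simp add: cong_iff_dvd_diff)
  moreover have "\<bar>Legendre (- 1) p - (- 1) ^ ((p - 1) div 2)\<bar> \<le> 2"
    by (cases "even ((p - 1) div 2)") (auto simp: Legendre_def)
  ultimately show ?thesis using assms(2) zdvd_not_zless[of "\<bar>Legendre (- 1) p - (- 1) ^ ((p - 1) div 2)\<bar>" "int p"] by auto
qed

text \<open>Gauss's lemma with multiplier 2: for h = (p - 1) / 2 the numbers 2, 4, ..., 2 h are
  already reduced modulo p, and those exceeding h come from h div 2 < x <= h.\<close>

lemma Legendre_2:
  fixes p :: nat
  assumes "prime p" "2 < p"
  shows "Legendre 2 p = (- 1) ^ ((p + 1) div 4)"
proof -
  interpret GAUSS p 2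
  proof
    show "[2 \<noteq> 0] (mod int p)" using assms(2) by (auto simp: cong_def)
  qed (use assms in auto)
  define h where "h = (int p - 1) div 2"
  have "E = (\<lambda>x. x * 2) ` {h div 2 <.. h}"
  proof (intro equalityI subsetI)
    fix y assume "y \<in> E"
    then obtain x where x: "0 < x" "x \<le> h" "y = (x * 2) mod p" "h < y"
      unfolding E_def C_def B_def A_def h_def by auto
    then have "y = x * 2" by (simp add: h_def)
    then show "y \<in> (\<lambda>x. x * 2) ` {h div 2 <.. h}" using x by auto
  next
    fix y assume "y \<in> (\<lambda>x. x * 2) ` {h div 2 <.. h}"
    then obtain x where x: "h div 2 < x" "x \<le> h" "y = x * 2" by auto
    have h0: "0 \<le> h" using assms(2) by (simp add: h_def)
    then have "x \<in> A" unfolding A_def h_def[symmetric] using x by auto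
    moreover have "y = (x * 2) mod p" using x h0 by (simp add: h_def)
    ultimately have "y \<in> C" unfolding C_def B_def image_image by blast
    moreover have "h < y" using x by auto
    ultimately show "y \<in> E" unfolding E_def h_def by simp
  qed
  then have "card E = nat (h - h div 2)" by (simp add: card_image inj_on_def)
  also have "odd p" using assms by (simp add: prime_odd_nat)
  then obtain k where k: "p = 2 * k + 1" by (elim oddE)
  have "int k - int k div 2 = int ((k + 1) div 2)" by (cases "even k") (auto elim!: evenE oddE)
  then have "nat (h - h div 2) = (k + 1) div 2" unfolding h_def k by simp
  also have "\<dots> = (p + 1) div 4" unfolding k by simp
  finally show ?thesis using gauss_lemma by simp
qed

text \<open>Reciprocity exchanges 3 and p, and 1 is the only nonzero square modulo 3.\<close>

lemma Legendre_3:
  fixes p :: nat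
  assumes "prime p" "3 < p"
  shows "Legendre 3 p = (- 1) ^ ((p - 1) div 2) * (if p mod 3 = 1 then 1 else - 1)"
proof -
  have 3: "prime (3 :: nat)" by simp
  have "\<not> 3 dvd p" using primes_dvd_imp_eq[OF 3 assms(1)] assms(2) by auto
  then have p: "p mod 3 = 1 \<or> p mod 3 = 2" by presburger
  have L: "Legendre p 3 = (if p mod 3 = 1 then 1 else - 1)"
  proof (cases "p mod 3 = 1")
    case True
    then have "int p mod 3 = 1" by presburger
    then have "[1 ^ 2 = int p] (mod 3)" "\<not> [int p = 0] (mod 3)" by (simp_all add: cong_def)
    then have "QuadRes 3 (int p)" unfolding QuadRes_def by blast
    then show ?thesis using True \<open>\<not> [int p = 0] (mod 3)\<close> by (simp add: Legendre_def)
  next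
    case False
    then have p2: "int p mod 3 = 2" using p by presburger
    have "\<not> [y ^ 2 = int p] (mod 3)" for y
    proof -
      have "y mod 3 = 0 \<or> y mod 3 = 1 \<or> y mod 3 = 2" by presburger
      then have "(y mod 3) ^ 2 mod 3 \<noteq> 2" by auto
      then show ?thesis unfolding cong_def p2 by (simp add: power_mod)
    qed
    then show ?thesis using False p2 by (simp add: Legendre_def QuadRes_def cong_def)
  qed
  have "Legendre (int 3) p * Legendre p (int 3) = (- 1) ^ ((3 - 1) div 2 * ((p - 1) div 2))"
    by (rule Quadratic_Reciprocity[OF 3 _ assms(1)]) (use assms(2) in auto)
  then show ?thesis using L by (cases "p mod 3 = 1") simp_all
qed

lemma card_mod_ring_gt_3:
  assumes "(2 :: 'p::prime_card mod_ring) \<noteq> 0" "(3 :: 'p mod_ring) \<noteq> 0"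
  shows "3 < CARD('p)"
proof -
  have "of_nat CARD('p) = (0 :: 'p mod_ring)" by simp
  moreover have "CARD('p) > 1" using prime_card prime_gt_1_nat by blast
  ultimately have "CARD('p) \<noteq> 2" "CARD('p) \<noteq> 3" using assms by (metis of_nat_numeral)+
  then show ?thesis using \<open>CARD('p) > 1\<close> by simp
qed

text \<open>When p grows by 24, the exponents (p - 1) div 2 and (p + 1) div 4 grow by the even
  numbers 12 and 6, and p mod 3 is unchanged. So all three characters can be read off from the
  residue r.\<close>

lemma chi_small_values:
  assumes "(2 :: 'p::prime_card mod_ring) \<noteq> 0" "(3 :: 'p mod_ring) \<noteq> 0"
  shows "(CARD('p) mod 24, chi (- 1 :: 'p mod_ring), chi (2 :: 'p mod_ring), chi (3 :: 'p mod_ring)) \<in>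
    {(1, 1, 1, 1), (5, 1, -1, -1), (7, -1, 1, -1), (11, -1, -1, 1),
     (13, 1, -1, 1), (17, 1, 1, -1), (19, -1, -1, -1), (23, -1, 1, 1)}"
proof -
  let ?p = "CARD('p)"
  have p: "prime ?p" "3 < ?p" using prime_card card_mod_ring_gt_3[OF assms] by auto
  have "\<not> 2 dvd ?p" "\<not> 3 dvd ?p"
    using primes_dvd_imp_eq[OF _ p(1), of 2] primes_dvd_imp_eq[OF _ p(1), of 3] p(2) by auto
  then have "?p mod 24 \<in> {1, 5, 7, 11, 13, 17, 19, 23}" by (simp; presburger)
  moreover obtain k where "?p = 24 * k + ?p mod 24" by (metis div_mult_mod_eq mult.commute)
  ultimately obtain r where r: "r \<in> {1, 5, 7, 11, 13, 17, 19, 23}" "?p mod 24 = r" "?p = 24 * k + r" by blast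
  have "chi (of_int (- 1) :: 'p mod_ring) = (- 1) ^ ((?p - 1) div 2)"
    unfolding chi_of_int by (rule Legendre_minus_1) (use p in auto)
  moreover have "(?p - 1) div 2 = 12 * k + (r - 1) div 2" "(?p + 1) div 4 = 6 * k + (r + 1) div 4"
    using r(1) unfolding r(3) by auto
  then have "(- 1 :: int) ^ ((?p - 1) div 2) = (- 1) ^ ((r - 1) div 2)" "(- 1 :: int) ^ ((?p + 1) div 4) = (- 1) ^ ((r + 1) div 4)"
    by (simp_all add: power_add)
  moreover have "chi (of_int 2 :: 'p mod_ring) = (- 1) ^ ((?p + 1) div 4)"
    unfolding chi_of_int by (rule Legendre_2) (use p in auto)
  moreover have "chi (of_int 3 :: 'p mod_ring) = (- 1) ^ ((?p - 1) div 2) * (if ?p mod 3 = 1 then 1 else - 1)"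
    unfolding chi_of_int by (rule Legendre_3) (use p in auto)
  moreover have "?p mod 3 = r mod 3" unfolding r(2)[symmetric] by (simp add: mod_mod_cancel)
  ultimately have "chi (- 1 :: 'p mod_ring) = (- 1) ^ ((r - 1) div 2)" "chi (2 :: 'p mod_ring) = (- 1) ^ ((r + 1) div 4)"
    "chi (3 :: 'p mod_ring) = (- 1) ^ ((r - 1) div 2) * (if r mod 3 = 1 then 1 else - 1)" by simp_all
  then show ?thesis using r(1) unfolding r(2) by (elim insertE emptyE) simp_all
qed

text \<open>For p = 1 modulo 8, both -1 and 2 are squares and \<open>sum5_sqrt2\<close> applies. In
  every other class one of the two involutions gives sum5 = - sum5.\<close>

lemma sum5_eq:
  assumes "(2 :: 'p::prime_card mod_ring) \<noteq> 0" "(3 :: 'p mod_ring) \<noteq> 0"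
  shows "sum5 TYPE('p mod_ring) =
    (if CARD('p) mod 8 = 1 then - s_sign CARD('p) * frobenius_trace (E15 :: 'p mod_ring poly) else 0)"
proof -
  let ?p = "CARD('p)"
  have "?p mod 8 = (?p mod 24) mod 8" by (simp add: mod_mod_cancel)
  then have iff: "?p mod 8 = 1 \<longleftrightarrow> chi (- 1 :: 'p mod_ring) = 1 \<and> chi (2 :: 'p mod_ring) = 1"
    using chi_small_values[OF assms] by auto
  show ?thesis
  proof (cases "?p mod 8 = 1")
    case False
    then have "chi (- 1 :: 'p mod_ring) = - 1 \<or> chi (2 :: 'p mod_ring) = - 1"
      using chi_cases[of "- 1 :: 'p mod_ring"] chi_cases[OF assms(1)] iff by auto
    then have "sum5 TYPE('p mod_ring) = - sum5 TYPE('p mod_ring)"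
      using sum5_reflect[OF assms(1)] sum5_invert[OF assms(1)] by auto
    then show ?thesis using False by simp
  next
    case True
    \<comment> \<open>This is the very root selected inside \<open>s_sign\<close>, so the two
      characters of it agree literally.\<close>
    define r :: int where "r = (SOME r. [r^2 = 2] (mod int ?p))"
    have "chi (of_int 2 :: 'p mod_ring) = 1" using True iff by simp
    then have "QuadRes (int ?p) 2" unfolding chi_of_int by (auto simp: Legendre_def split: if_splits)
    then have "\<exists>r. [r^2 = 2] (mod int ?p)" by (simp add: QuadRes_def)
    then have "[r^2 = 2] (mod int ?p)" unfolding r_def by (rule someI_ex)
    then have "of_int (r^2) = (of_int 2 :: 'p mod_ring)" by (subst of_int_eq_iff_cong_CHAR) simp
    then have "(of_int r)^2 = (2 :: 'p mod_ring)" by simp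
    from sum5_sqrt2[OF assms(1) this] have "sum5 TYPE('p mod_ring)
        = 2 * chi (of_int r :: 'p mod_ring) * - frobenius_trace (E15 :: 'p mod_ring poly)"
      using True iff trace_E15[OF assms(1)] by simp
    then show ?thesis using True unfolding chi_of_int s_sign_def r_def by simp
  qed
qed

text \<open>E0 is its own quadratic twist by -1: the reflection x -> -2 - x permutes the three
  factors and produces chi(-1)^3 = -1.\<close>

lemma trace_E0_eq_0:
  assumes two: "(2 :: 'a::{field,finite}) \<noteq> 0" and "chi (- 1 :: 'a) = - 1"
  shows "frobenius_trace (E0 :: 'a poly) = 0"
proof -
  let ?f = "\<lambda>x :: 'a. chi (x + of_nat 0) * chi (x + of_nat 1) * chi (x + of_nat 2)"
  have "?f (- 2 - x) = - ?f x" for x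
  proof -
    have e: "chi (- 2 - x + of_nat 0) = chi (- 1 :: 'a) * chi (x + of_nat 2)" "chi (- 2 - x + of_nat 1) = chi (- 1 :: 'a) * chi (x + of_nat 1)"
      "chi (- 2 - x + of_nat 2) = chi (- 1 :: 'a) * chi (x + of_nat 0)"
      by (rule c_neg[OF two], simp)+
    show ?thesis unfolding e assms(2) by (simp add: mult_ac)
  qed
  then have "(\<Sum>x\<in>UNIV. ?f x) = (\<Sum>x\<in>UNIV. - ?f x)"
    using sum_reflect[OF two, of ?f "- 2"] by simp
  then have "(\<Sum>x\<in>UNIV. ?f x) = 0" by (simp only: sum_negf)
  then show ?thesis unfolding trace_E0[OF two] by simp
qed

text \<open>Each tuple consists of a residue of p modulo 24 and the characters of -1, 2 and 3 that
  belong to it.\<close>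

abbreviation chi_values :: "(nat \<times> int \<times> int \<times> int) set" where
  "chi_values \<equiv> {(1, 1, 1, 1), (5, 1, -1, -1), (7, -1, 1, -1), (11, -1, -1, 1),
     (13, 1, -1, 1), (17, 1, 1, -1), (19, -1, -1, -1), (23, -1, 1, 1)}"

text \<open>For \<open>p \<equiv> 3\<close> modulo \<open>4\<close> the trace \<open>a\<^sub>0\<close> vanishes, and the table omits it.\<close>

definition row_correct ::
    "int \<Rightarrow> int \<Rightarrow> int \<Rightarrow> int \<Rightarrow> int \<Rightarrow> int \<Rightarrow> letter list \<times> int list \<Rightarrow> letter list \<times> int list \<Rightarrow> bool" where
  "row_correct a0 a1 a4 a12 a15 sg = (\<lambda>(S, T) (S', U). S' = S \<and>
    (\<forall>(r, m, b, t) \<in> chi_values. (m = - 1 \<longrightarrow> a0 = 0) \<longrightarrow>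
      count_correction (letter_sign (S ! 0)) (letter_sign (S ! 1)) (letter_sign (S ! 2)) (letter_sign (S ! 3)) (letter_sign (S ! 4))
        m b t a0 a1 a4 a12 (if r mod 8 = 1 then - sg * a15 else 0)
      = - the (map_of (zip [1, 3, 5, 7] T) (r mod 8)) + the (map_of (zip [1, 5, 7, 11, 13, 17, 19, 23] U) r)))"

text \<open>Within one row and one residue class all signs are numbers, so both sides are explicit
  integer polynomials in the traces and s. The tables thus reduce to 32 times 8 identities for
  arbitrary integers, with a0 = 0 where chi(-1) = -1.\<close>

lemma rows_correct: "list_all2 (row_correct a0 a1 a4 a12 a15 sg) (A_rows a0 a1 a4 a12 a15 sg) C32_rows"
  unfolding A_rows_def C32_rows_def list_all2_Cons
  by (intro conjI; simp add: row_correct_def; simp add: count_correction_def)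

text \<open>Both tables list the same 32 distinct words in the same order, so an index found in one
  serves the other.\<close>

lemma rows_lookup:
  assumes "length S = 5"
  obtains T U where "map_of (A_rows a0 a1 a4 a12 a15 sg) S = Some T" "map_of C32_rows S = Some U"
    "row_correct a0 a1 a4 a12 a15 sg (S, T) (S, U)"
proof -
  let ?A = "A_rows a0 a1 a4 a12 a15 sg"
  have keys: "map fst ?A = map fst C32_rows"
    by (simp add: A_rows_def C32_rows_def)
  have dist: "distinct (map fst C32_rows)"
    by (simp add: C32_rows_def)
  obtain x0 x1 x2 x3 x4 where S: "S = [x0, x1, x2, x3, x4]"
    using assms by (auto simp: length_Suc_conv eval_nat_numeral)
  have "S \<in> set (map fst C32_rows)"
    unfolding S C32_rows_def by (cases x0; cases x1; cases x2; cases x3; cases x4; simp)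
  then obtain i where i: "i < length C32_rows" "fst (C32_rows ! i) = S"
    by (auto simp: in_set_conv_nth)
  have len: "length ?A = length C32_rows" using keys by (metis length_map)
  then have "fst (?A ! i) = S" using i keys by (metis nth_map)
  then obtain T U where TU: "?A ! i = (S, T)" "C32_rows ! i = (S, U)" using i(2) by (metis prod.collapse)
  show thesis
  proof (rule that)
    show "map_of ?A S = Some T"
      by (rule map_of_is_SomeI) (use TU i len keys dist in \<open>auto simp: in_set_conv_nth\<close>)
    show "map_of C32_rows S = Some U"
      by (rule map_of_is_SomeI) (use TU i dist in \<open>auto simp: in_set_conv_nth\<close>)
    show "row_correct a0 a1 a4 a12 a15 sg (S, T) (S, U)"
      using list_all2_nthD2[OF rows_correct[of a0 a1 a4 a12 a15 sg] i(1)] unfolding TU .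
  qed
qed

lemma table_identity:
  fixes a0 a1 a4 a12 a15 sg :: int
  assumes "length S = 5" and V: "(r, m, b, t) \<in> chi_values" and "m = - 1 \<Longrightarrow> a0 = 0"
  shows "real_of_int (count_correction (letter_sign (S ! 0)) (letter_sign (S ! 1)) (letter_sign (S ! 2)) (letter_sign (S ! 3)) (letter_sign (S ! 4))
        m b t a0 a1 a4 a12
      (if r mod 8 = 1 then - sg * a15 else 0))
    = - real_of_int (A_table S (r mod 8) a0 a1 a4 a12 a15 sg) + 32 * C_table S r"
proof -
  obtain T U where TU: "map_of (A_rows a0 a1 a4 a12 a15 sg) S = Some T" "map_of C32_rows S = Some U"
    "row_correct a0 a1 a4 a12 a15 sg (S, T) (S, U)"
    using rows_lookup[OF assms(1)] by blast
  have imp: "m = - 1 \<longrightarrow> a0 = 0" using assms(3) by blast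
  note TU(3)[unfolded row_correct_def prod.case, THEN conjunct2, THEN bspec, OF V, unfolded prod.case, THEN mp, OF imp]
  then show ?thesis unfolding A_table_def C_table_def TU(1,2) option.sel by simp
qed

theorem theorem2:
  fixes p :: nat and S :: "letter list" and ep em :: "'p::prime_card mod_ring"
  assumes "p = CARD('p)" and "prime p" and "p \<ge> 5"
    and "length S = 5"
    and "ep \<noteq> 0" and "is_square ep"
    and "em \<noteq> 0" and "\<not> is_square em"
  shows "smooth_model_has_genus (length S) (curve_ideal (to_ac ep) (to_ac em) S) 17
    \<and> real (word_count p S) = real (card (affine_points_nonzero ep em S)) / 2 ^ 5
    \<and> real (word_count p S) =
           real p / 32
           - of_int (A_table S (p mod 8)
               (frobenius_trace (E0 :: 'p mod_ring poly))
               (frobenius_trace (E1 :: 'p mod_ring poly))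
               (frobenius_trace (E4 :: 'p mod_ring poly))
               (frobenius_trace (E12 :: 'p mod_ring poly))
               (frobenius_trace (E15 :: 'p mod_ring poly))
               (s_sign p)) / 32
           + C_table S (p mod 24)"
proof -
  have small: "of_nat n \<noteq> (0 :: 'p mod_ring)" if "0 < n" "n < p" for n
    using of_nat_0_mod_ring_dvd[of n] that assms(1) nat_dvd_not_less by blast
  have two: "(2 :: 'p mod_ring) \<noteq> 0" and three: "(3 :: 'p mod_ring) \<noteq> 0"
    using small[of 2] small[of 3] assms(3) by simp_all
  have genus: "smooth_model_has_genus (length S) (curve_ideal (to_ac ep) (to_ac em) S) 17"
  proof (rule curve_genus)
    show "(2 :: 'p mod_ring alg_closure) \<noteq> 0" "(3 :: 'p mod_ring alg_closure) \<noteq> 0"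
      using two three by (metis to_ac_numeral to_ac_eq_0_iff)+
  qed (use assms in auto)
  have words: "32 * int (word_count p S) = (\<Sum>x\<in>UNIV. \<Prod>i<5. letter_weight S i (x :: 'p mod_ring))"
    using word_count_eq[OF two assms(4)] assms(1) by simp
  have "32 * int (word_count p S) = int (card (affine_points_nonzero ep em S))"
    using words card_affine_points_nonzero[OF two assms(4-8)] by simp
  then have points: "real (word_count p S) = real (card (affine_points_nonzero ep em S)) / 2 ^ 5"
    by simp
  have p8: "p mod 24 mod 8 = p mod 8" by (simp add: mod_mod_cancel)
  have "32 * real (word_count p S) = real_of_int (32 * int (word_count p S))" by simp
  also have "\<dots> = real p - of_int (A_table S (p mod 8)
               (frobenius_trace (E0 :: 'p mod_ring poly))
               (frobenius_trace (E1 :: 'p mod_ring poly))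
               (frobenius_trace (E4 :: 'p mod_ring poly))
               (frobenius_trace (E12 :: 'p mod_ring poly))
               (frobenius_trace (E15 :: 'p mod_ring poly))
               (s_sign p)) + 32 * C_table S (p mod 24)"
    unfolding words sum_prod_letter_weight[OF two three] sum5_eq[OF two three]
    using table_identity[OF assms(4) chi_small_values[OF two three] trace_E0_eq_0[OF two],
        of "frobenius_trace (E1 :: 'p mod_ring poly)" "frobenius_trace (E4 :: 'p mod_ring poly)"
        "frobenius_trace (E12 :: 'p mod_ring poly)" "s_sign p" "frobenius_trace (E15 :: 'p mod_ring poly)"]
    unfolding assms(1)[symmetric] p8 by (simp flip: assms(1))
  finally show ?thesis using genus points by simp
qed

end
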